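(* In the setting and under the standing assumptions given in the context, assume that $\sup_{t\in T}\mathrm{E}(X_t^4)<\infty$, that $J_n=o(n)$, and that either $T=\bigcup_{J\ge1}T_J$, or $\bigcup_{J\ge1}T_J$ is dense in $T$ and $R$ is continuous on $T\times T$. Assume also that, for some $k_\infty\le J_\infty$, $$\lim_{k\to k_\infty}\limsup_{J\to J_\infty}\operatorname{tr}\big((\mathbf{R}_J^{-}-\mathbf{R}_{J,k}^{-})\mathbf{K}_J\big)=0,$$ and that $$\liminf_{J\to J_\infty}\frac{\rho_m(\mathbf{R}_J)}{J}>0\qquad\text{for all } m\in\{k_1,k_2,\dots\},$$ where $k_1,k_2,\dots$ are positive integers with $k_\ell\to k_\infty$. Then for each $j$ (with $1\le j\le p$), $$\|\widehat\xi_{n,k_\ell,j}-\xi_j\|_{L_X^2}\xrightarrow{p}0\qquad\text{as } n\to\infty\text{ and then }\ell\to\infty.$$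
   Context: Setting. On a probability space $(\Omega,\mathcal{A},P)$, $\{X_t,t\in T\}$ is a real-valued, zero-mean, second-order process indexed by a separable metric space $T$, with covariance function $R(s,t)=\mathrm{E}(X_sX_t)$; $Y$ is a random element; $L_X^2$ is the closed linear span of $\{X_t\}$ in $L^2(\Omega,\mathcal{A},P)$. For a covariance kernel $C$, $\mathcal{H}_C$ denotes the reproducing kernel Hilbert space with kernel $C$. $\Psi_X:L_X^2\to\mathcal{H}_R$ is the isometric isomorphism with $\Psi_X(X_t)=R(\cdot,t)$. $\xi_1,\dots,\xi_p\in L_X^2$ are fixed. $Z_t=\mathrm{E}(X_t\mid Y)$ has covariance function $K$. $\mathcal{H}_{X,e}=\operatorname{span}\{\Psi_X(\xi_1),\dots,\Psi_X(\xi_p)\}$. Standing assumptions. (i) $Y$ and $X$ are conditionally independent given $\xi_1,\dots,\xi_p$. (ii) For any $\xi\in L_X^2$, $\mathrm{E}(\xi\mid\xi_1,\dots,\xi_p)\in\operatorname{span}\{\xi_1,\dots,\xi_p\}$ a.s. (iii) Either $T$ is countable, or $R$ is continuous on $T\times T$ and the sample paths of $Z_t$ are continuous on $T$ a.s. (Under these assumptions the paths of $Z$ lie in $\mathcal{H}_{X,e}$ a.s.) (iv) $I_1,\dots,I_S$ is a partition of the range of $Y$ with $p_s=\mathrm{P}(Y\in I_s)>0$ for each $s$; $\mathcal{G}$ is the $\sigma$-field generated by the events $\{Y\in I_s\}$; $K^{\mathcal{G}}$ is the covariance function of $Z_t^{\mathcal{G}}=\mathrm{E}(Z_t\mid\mathcal{G})$;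 and $\mathcal{H}_{K^{\mathcal{G}}}=\mathcal{H}_{X,e}$. (v) Let $h_s(t)=\mathrm{E}(X_t\mid Y\in I_s)$ and $L^{\mathcal{G}}=\sum_{s=1}^S p_s\,h_s\otimes_{\mathcal{H}_R}h_s$, where $(g\otimes_{\mathcal{H}_R}h)f=\langle g,f\rangle_{\mathcal{H}_R}h$. The $p$ nonzero eigenvalues of $L^{\mathcal{G}}$ are distinct, $f_j$ is the unit-norm eigenfunction for the $j$th largest eigenvalue, $1\le j\le p$, and $\xi_j=\Psi_X^{-1}(f_j)$. Data. $(Y_i,X_{i,t})$, $1\le i\le n$, are i.i.d. copies of $(Y,X_t)$. There is a sequence $t_1,t_2,\dots$ in $T$, $T_J=\{t_1,\dots,t_J\}$, and the observations at stage $n$ are $Y_i$ and $\mathbf{X}_i=(X_{i,t_1},\dots,X_{i,t_{J_n}})^T$, $1\le i\le n$, where $J_n$ is a nondecreasing sequence of positive integers tending to $J_\infty\le\infty$ ($J_\infty=\infty$ in the infinite-dimensional case). Matrices. $\lambda_j(\mathbf{A})$ is the $j$th largest eigenvalue of a symmetric nonnegative definite matrix $\mathbf{A}$. If $\mathbf{A}=\sum_j\lambda_j(\mathbf{A})\mathbf{u}_j\mathbf{u}_j^T$ is its eigendecomposition, $\mathbf{A}^\alpha=\sum_{\lambda_j(\mathbf{A})>0}\lambda_j^\alpha(\mathbf{A})\mathbf{u}_j\mathbf{u}_j^T$ for $\alpha\in\mathbb{R}$, and $\mathbf{A}^-=\mathbf{A}^{-1}$ is the Moore–Penrose inverse. $\mathbf{R}_J=\{R(t_i,t_j)\}_{i,j=1}^J$,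 $\mathbf{K}_J=\{K(t_i,t_j)\}_{i,j=1}^J$, and $$\rho_m(\mathbf{R}_J)=\min\{|\lambda_j(\mathbf{R}_J)-\lambda_m(\mathbf{R}_J)|:\lambda_j(\mathbf{R}_J)\ne\lambda_m(\mathbf{R}_J)\}.$$ $\widehat p_s=\frac1n\sum_{i=1}^n I(Y_i\in I_s)$, $\widehat{\mathbf{h}}_s=\sum_{i=1}^n\mathbf{X}_iI(Y_i\in I_s)/\sum_{i=1}^nI(Y_i\in I_s)$, $\widehat{\mathbf{R}}_{n,J_n}=\frac1n\sum_{i=1}^n\mathbf{X}_i\mathbf{X}_i^T$. For $k\le J$, $\mathbf{P}_{J,k}$ and $\widehat{\mathbf{P}}_{n,J_n,k}$ are the projection matrices onto the eigenspaces of the first $k$ eigenvalues of $\mathbf{R}_J$ and $\widehat{\mathbf{R}}_{n,J_n}$ respectively; $\mathbf{R}_{J,k}=\mathbf{P}_{J,k}\mathbf{R}_J\mathbf{P}_{J,k}$ and $\widehat{\mathbf{R}}_{n,J_n,k}=\widehat{\mathbf{P}}_{n,J_n,k}\widehat{\mathbf{R}}_{n,J_n}\widehat{\mathbf{P}}_{n,J_n,k}$. Estimator. $\widehat\xi_{n,k,j}=(X_{t_1},\dots,X_{t_{J_n}})\widehat{\mathbf{R}}_{n,J_n,k}^{-1/2}\mathbf{v}_j$, where $\mathbf{v}_j$ is the unit eigenvector for the $j$th largest eigenvalue of $\widehat{\mathbf{M}}_{n,k}=\widehat{\mathbf{R}}_{n,J_n,k}^{-1/2}\big(\sum_{s=1}^S\widehat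 p_s\widehat{\mathbf{h}}_s\widehat{\mathbf{h}}_s^T\big)\widehat{\mathbf{R}}_{n,J_n,k}^{-1/2}$ in $\mathbb{R}^{J_n}$, with its sign chosen so that $\langle\widehat\xi_{n,k,j},\xi_j\rangle_{L_X^2}\ge0$. Here $X$ is a generic process: in computing the $L_X^2$ norm (and inner product), the data-dependent coefficients $\widehat{\mathbf{R}}_{n,J_n,k}^{-1/2}\mathbf{v}_j$ are treated as fixed, so that the norm is a random variable depending on the data. Convergence. "$A_{n,\ell}\xrightarrow{p}0$ as $n\to\infty$ and then $\ell\to\infty$" means $\lim_{\ell\to\infty}\limsup_{n\to\infty}\mathrm{P}(|A_{n,\ell}|>\varepsilon)=0$ for every $\varepsilon>0$.
   Formalization: If J_∞ is finite, every X_t is assumed to lie a.s. in the span of X at t_1,…,t_{J_∞}; all k_ℓ ≤ J_∞; where R_J has tied k-th and (k+1)-st eigenvalues, the trace condition is required for every choice of P_{J,k}. Without the span and tie assumptions the claim can fail. *)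

theory Defs
  imports
    "HOL-Probability.Probability"
    "HOL-Library.Landau_Symbols"
    "HOL-Library.Extended_Nat"
    "Jordan_Normal_Form.Char_Poly"
begin

unbundle no vec_syntax
unbundle no inner_syntax

text \<open>Elements of $L^2$ are represented by functions; equality in $L^2$ is equality almost
  everywhere.\<close>

definition L2 :: "'w measure \<Rightarrow> ('w \<Rightarrow> real) set" where
  "L2 M = {f \<in> borel_measurable M. integrable M (\<lambda>w. (f w)\<^sup>2)}"

definition l2_inner :: "'w measure \<Rightarrow> ('w \<Rightarrow> real) \<Rightarrow> ('w \<Rightarrow> real) \<Rightarrow> real" where
  "l2_inner M f g = (\<integral>w. f w * g w \<partial>M)"

definition l2_norm :: "'w measure \<Rightarrow> ('w \<Rightarrow> real) \<Rightarrow> real" where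
  "l2_norm M f = sqrt (l2_inner M f f)"

definition fun_span :: "('x \<Rightarrow> real) set \<Rightarrow> ('x \<Rightarrow> real) set" where
  "fun_span B = {(\<lambda>x. \<Sum>f\<in>F. c f * f x) | F c. finite F \<and> F \<subseteq> B}"

definition closed_span :: "'w measure \<Rightarrow> ('t \<Rightarrow> 'w \<Rightarrow> real) \<Rightarrow> ('w \<Rightarrow> real) set" where
  "closed_span M X =
     {f \<in> L2 M. \<forall>e>0. \<exists>g\<in>fun_span (range X). l2_norm M (\<lambda>w. f w - g w) < e}"

text \<open>Only used for zero-mean processes.\<close>

definition cov_fun :: "'w measure \<Rightarrow> ('t \<Rightarrow> 'w \<Rightarrow> real) \<Rightarrow> 't \<Rightarrow> 't \<Rightarrow> real" where
  "cov_fun M X s t = (\<integral>w. X s w * X t w \<partial>M)"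

definition sigma_rv :: "'w measure \<Rightarrow> 'y measure \<Rightarrow> ('w \<Rightarrow> 'y) \<Rightarrow> 'w measure" where
  "sigma_rv M N Y = vimage_algebra (space M) Y N"

definition sigma_fam :: "'w measure \<Rightarrow> 'i set \<Rightarrow> ('i \<Rightarrow> 'w \<Rightarrow> real) \<Rightarrow> 'w measure" where
  "sigma_fam M I X = sigma_rv M (\<Pi>\<^sub>M i\<in>I. borel) (\<lambda>w. \<lambda>i\<in>I. X i w)"

text \<open>Conditional independence of the \<sigma>-algebras \<open>F\<close> and \<open>G\<close> given \<open>H\<close>.\<close>

definition cond_indep :: "'w measure \<Rightarrow> 'w measure \<Rightarrow> 'w measure \<Rightarrow> 'w measure \<Rightarrow> bool" where
  "cond_indep M F G H \<longleftrightarrow>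
     (\<forall>A\<in>sets F. \<forall>B\<in>sets G. AE w in M.
        real_cond_exp M H (indicator (A \<inter> B)) w =
        real_cond_exp M H (indicator A) w * real_cond_exp M H (indicator B) w)"

text \<open>\<open>E(Z | A)\<close> for an event \<open>A\<close> of positive probability.\<close>

definition exp_given :: "'w measure \<Rightarrow> 'w set \<Rightarrow> ('w \<Rightarrow> real) \<Rightarrow> real" where
  "exp_given M A Z = (LINT w:A|M. Z w) / measure M A"

text \<open>\<open>H\<close> with inner product \<open>ip\<close> is the Hilbert space of functions with reproducing
  kernel \<open>C\<close>. Such a pair exists for every covariance kernel, and \<open>H\<close> and \<open>ip\<close> on \<open>H\<close> are then
  determined by \<open>C\<close>.\<close>

definition is_rkhs ::
    "('t \<Rightarrow> 't \<Rightarrow> real) \<Rightarrow> ('t \<Rightarrow> real) set \<Rightarrow> (('t \<Rightarrow> real) \<Rightarrow> ('t \<Rightarrow> real) \<Rightarrow> real) \<Rightarrow> bool" where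
  "is_rkhs C H ip \<longleftrightarrow>
     (\<lambda>_. 0) \<in> H \<and>
     (\<forall>f\<in>H. \<forall>g\<in>H. \<forall>a b. (\<lambda>t. a * f t + b * g t) \<in> H) \<and>
     (\<forall>f\<in>H. \<forall>g\<in>H. \<forall>h\<in>H. \<forall>a b. ip (\<lambda>t. a * f t + b * g t) h = a * ip f h + b * ip g h) \<and>
     (\<forall>f\<in>H. \<forall>g\<in>H. ip f g = ip g f) \<and>
     (\<forall>f\<in>H. ip f f \<ge> 0 \<and> (ip f f = 0 \<longrightarrow> f = (\<lambda>_. 0))) \<and>
     (\<forall>F. (\<forall>n. F n \<in> H) \<and>
          (\<forall>e>0. \<exists>n0. \<forall>m\<ge>n0. \<forall>n\<ge>n0. sqrt (ip (\<lambda>t. F m t - F n t) (\<lambda>t. F m t - F n t)) < e) \<longrightarrow>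
          (\<exists>f\<in>H. (\<lambda>n. sqrt (ip (\<lambda>t. F n t - f t) (\<lambda>t. F n t - f t))) \<longlonglongrightarrow> (0::real))) \<and>
     (\<forall>t. (\<lambda>s. C s t) \<in> H \<and> (\<forall>f\<in>H. ip f (\<lambda>s. C s t) = f t))"

text \<open>The isometric isomorphism \<open>\<Psi>\<close> from the closed linear span of \<open>X\<close> onto the RKHS of its
  covariance function. Injectivity (up to almost everywhere equality) follows from isometry.\<close>

definition loeve_isometry ::
    "'w measure \<Rightarrow> ('t \<Rightarrow> 'w \<Rightarrow> real) \<Rightarrow> ('t \<Rightarrow> real) set \<Rightarrow>
     (('t \<Rightarrow> real) \<Rightarrow> ('t \<Rightarrow> real) \<Rightarrow> real) \<Rightarrow> (('w \<Rightarrow> real) \<Rightarrow> 't \<Rightarrow> real) \<Rightarrow> bool" where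
  "loeve_isometry M X H ip \<Psi> \<longleftrightarrow>
     \<Psi> ` closed_span M X = H \<and>
     (\<forall>\<xi>\<in>closed_span M X. \<forall>\<eta>\<in>closed_span M X. \<forall>a b.
        \<Psi> (\<lambda>w. a * \<xi> w + b * \<eta> w) = (\<lambda>t. a * \<Psi> \<xi> t + b * \<Psi> \<eta> t)) \<and>
     (\<forall>\<xi>\<in>closed_span M X. \<forall>\<eta>\<in>closed_span M X. ip (\<Psi> \<xi>) (\<Psi> \<eta>) = l2_inner M \<xi> \<eta>) \<and>
     (\<forall>t. \<Psi> (X t) = (\<lambda>s. cov_fun M X s t))"

definition tensor_op ::
    "(('t \<Rightarrow> real) \<Rightarrow> ('t \<Rightarrow> real) \<Rightarrow> real) \<Rightarrow>
     ('t \<Rightarrow> real) \<Rightarrow> ('t \<Rightarrow> real) \<Rightarrow> ('t \<Rightarrow> real) \<Rightarrow> 't \<Rightarrow> real" where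
  "tensor_op ip g h f = (\<lambda>t. ip g f * h t)"

definition op_eigenspace ::
    "('t \<Rightarrow> real) set \<Rightarrow> (('t \<Rightarrow> real) \<Rightarrow> 't \<Rightarrow> real) \<Rightarrow> real \<Rightarrow> ('t \<Rightarrow> real) set" where
  "op_eigenspace H L l = {f \<in> H. L f = (\<lambda>t. l * f t)}"

text \<open>The nonzero eigenvalues of \<open>L\<close>, counted with multiplicity, are the distinct numbers
  \<open>lam 1 > \<dots> > lam p\<close>, and \<open>f j\<close> is a unit-norm eigenfunction for \<open>lam j\<close>.\<close>

definition simple_eigensystem ::
    "('t \<Rightarrow> real) set \<Rightarrow> (('t \<Rightarrow> real) \<Rightarrow> ('t \<Rightarrow> real) \<Rightarrow> real) \<Rightarrow> (('t \<Rightarrow> real) \<Rightarrow> 't \<Rightarrow> real) \<Rightarrow>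
     nat \<Rightarrow> (nat \<Rightarrow> real) \<Rightarrow> (nat \<Rightarrow> 't \<Rightarrow> real) \<Rightarrow> bool" where
  "simple_eigensystem H ip L p lam f \<longleftrightarrow>
     lam ` {1..p} = {l. l \<noteq> 0 \<and> (\<exists>g\<in>op_eigenspace H L l. g \<noteq> (\<lambda>_. 0))} \<and>
     (\<forall>i\<in>{1..p}. \<forall>j\<in>{1..p}. i < j \<longrightarrow> lam j < lam i) \<and>
     (\<forall>j\<in>{1..p}. f j \<in> op_eigenspace H L (lam j) \<and> ip (f j) (f j) = 1 \<and>
        op_eigenspace H L (lam j) \<subseteq> fun_span {f j})"

text \<open>Eigenvalues, counted with multiplicity, in decreasing order; the first index is 1.
  Meaningful for symmetric \<open>A\<close> and \<open>1 \<le> j \<le> dim_row A\<close>.\<close>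

definition eigval :: "real mat \<Rightarrow> nat \<Rightarrow> real" where
  "eigval A j = rev (sorted_list_of_multiset (proots (char_poly A))) ! (j - 1)"

text \<open>An eigendecomposition of \<open>A\<close>: the sum of \<open>eigval A j\<close> times \<open>u j (u j)\<^sup>T\<close>.\<close>

definition eigenbasis :: "real mat \<Rightarrow> (nat \<Rightarrow> real vec) \<Rightarrow> bool" where
  "eigenbasis A u \<longleftrightarrow> (let J = dim_row A in
     A \<in> carrier_mat J J \<and>
     (\<forall>i\<in>{1..J}. u i \<in> carrier_vec J) \<and>
     (\<forall>i\<in>{1..J}. \<forall>j\<in>{1..J}. u i \<bullet> u j = (if i = j then 1 else 0)) \<and>
     A = Matrix.mat J J (\<lambda>(a, b). \<Sum>j\<in>{1..J}. eigval A j * u j $ a * u j $ b))"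

text \<open>The result does not depend on the eigenbasis that is selected.\<close>

definition mat_power :: "real mat \<Rightarrow> real \<Rightarrow> real mat" where
  "mat_power A \<alpha> = (let J = dim_row A; u = (SOME u. eigenbasis A u) in
     Matrix.mat J J
       (\<lambda>(a, b). \<Sum>j | j \<in> {1..J} \<and> eigval A j > 0. eigval A j powr \<alpha> * u j $ a * u j $ b))"

definition pinv :: "real mat \<Rightarrow> real mat" where
  "pinv A = mat_power A (- 1)"

definition mat_trace :: "real mat \<Rightarrow> real" where
  "mat_trace A = (\<Sum>i<dim_row A. A $$ (i, i))"

text \<open>Projections onto the span of the first \<open>k\<close> eigenvectors. This is a singleton unless the
  \<open>k\<close>-th and the \<open>(k+1)\<close>-st eigenvalue coincide; in that case it contains one projection for
  each choice of eigenvectors.\<close>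

definition top_projs :: "real mat \<Rightarrow> nat \<Rightarrow> real mat set" where
  "top_projs A k = {Matrix.mat (dim_row A) (dim_row A) (\<lambda>(a, b). \<Sum>j\<in>{1..k}. u j $ a * u j $ b)
                    | u. eigenbasis A u}"

text \<open>The minimum over the empty set is \<open>\<infinity>\<close>.\<close>

definition eigengap :: "nat \<Rightarrow> real mat \<Rightarrow> ereal" where
  "eigengap m A = (INF j\<in>{j\<in>{1..dim_row A}. eigval A j \<noteq> eigval A m}.
                     ereal \<bar>eigval A j - eigval A m\<bar>)"

definition kernel_mat :: "('t \<Rightarrow> 't \<Rightarrow> real) \<Rightarrow> (nat \<Rightarrow> 't) \<Rightarrow> nat \<Rightarrow> real mat" where
  "kernel_mat C \<tau> J = Matrix.mat J J (\<lambda>(a, b). C (\<tau> (Suc a)) (\<tau> (Suc b)))"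

text \<open>\<open>Yd i\<close> and \<open>Xd i\<close> are the data, \<open>i \<in> {1..n}\<close>; \<open>\<tau> 1, \<tau> 2, \<dots>\<close> are the sampling points.
  Coordinate \<open>a < J\<close> of a vector belongs to \<open>\<tau> (Suc a)\<close>.\<close>

definition samp_p :: "(nat \<Rightarrow> 'v \<Rightarrow> 'y) \<Rightarrow> nat \<Rightarrow> 'y set \<Rightarrow> 'v \<Rightarrow> real" where
  "samp_p Yd n A \<omega> = (\<Sum>i\<in>{1..n}. indicator A (Yd i \<omega>)) / real n"

definition samp_h ::
    "(nat \<Rightarrow> 'v \<Rightarrow> 'y) \<Rightarrow> (nat \<Rightarrow> 't \<Rightarrow> 'v \<Rightarrow> real) \<Rightarrow> (nat \<Rightarrow> 't) \<Rightarrow> nat \<Rightarrow> nat \<Rightarrow> 'y set \<Rightarrow> 'v \<Rightarrow> real vec"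
  where
  "samp_h Yd Xd \<tau> n J A \<omega> =
     Matrix.vec J (\<lambda>a. (\<Sum>i\<in>{1..n}. Xd i (\<tau> (Suc a)) \<omega> * indicator A (Yd i \<omega>)) /
                       (\<Sum>i\<in>{1..n}. indicator A (Yd i \<omega>)))"

definition samp_cov ::
    "(nat \<Rightarrow> 't \<Rightarrow> 'v \<Rightarrow> real) \<Rightarrow> (nat \<Rightarrow> 't) \<Rightarrow> nat \<Rightarrow> nat \<Rightarrow> 'v \<Rightarrow> real mat" where
  "samp_cov Xd \<tau> n J \<omega> =
     Matrix.mat J J (\<lambda>(a, b). (\<Sum>i\<in>{1..n}. Xd i (\<tau> (Suc a)) \<omega> * Xd i (\<tau> (Suc b)) \<omega>) / real n)"

definition samp_slice ::
    "(nat \<Rightarrow> 'v \<Rightarrow> 'y) \<Rightarrow> (nat \<Rightarrow> 't \<Rightarrow> 'v \<Rightarrow> real) \<Rightarrow> (nat \<Rightarrow> 't) \<Rightarrow> (nat \<Rightarrow> 'y set) \<Rightarrow> nat \<Rightarrow>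
     nat \<Rightarrow> nat \<Rightarrow> 'v \<Rightarrow> real mat" where
  "samp_slice Yd Xd \<tau> I S n J \<omega> =
     Matrix.mat J J (\<lambda>(a, b). \<Sum>s\<in>{1..S}.
       samp_p Yd n (I s) \<omega> * samp_h Yd Xd \<tau> n J (I s) \<omega> $ a * samp_h Yd Xd \<tau> n J (I s) \<omega> $ b)"

text \<open>In the following two definitions \<open>P\<close> is the projection used to truncate the sample
  covariance matrix.\<close>

definition samp_isqrt ::
    "(nat \<Rightarrow> 't \<Rightarrow> 'v \<Rightarrow> real) \<Rightarrow> (nat \<Rightarrow> 't) \<Rightarrow> nat \<Rightarrow> nat \<Rightarrow> real mat \<Rightarrow> 'v \<Rightarrow> real mat" where
  "samp_isqrt Xd \<tau> n J P \<omega> = mat_power (P * samp_cov Xd \<tau> n J \<omega> * P) (- (1 / 2))"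

definition samp_M ::
    "(nat \<Rightarrow> 'v \<Rightarrow> 'y) \<Rightarrow> (nat \<Rightarrow> 't \<Rightarrow> 'v \<Rightarrow> real) \<Rightarrow> (nat \<Rightarrow> 't) \<Rightarrow> (nat \<Rightarrow> 'y set) \<Rightarrow> nat \<Rightarrow>
     nat \<Rightarrow> nat \<Rightarrow> real mat \<Rightarrow> 'v \<Rightarrow> real mat" where
  "samp_M Yd Xd \<tau> I S n J P \<omega> =
     samp_isqrt Xd \<tau> n J P \<omega> * samp_slice Yd Xd \<tau> I S n J \<omega> * samp_isqrt Xd \<tau> n J P \<omega>"

text \<open>The linear combination of \<open>X (\<tau> 1), X (\<tau> 2), \<dots>\<close> with coefficient vector \<open>b\<close>. The argument
  \<open>w\<close> is a sample point of the generic process, which is kept apart from the data.\<close>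

definition lin_comb :: "('t \<Rightarrow> 'w \<Rightarrow> real) \<Rightarrow> (nat \<Rightarrow> 't) \<Rightarrow> real vec \<Rightarrow> 'w \<Rightarrow> real" where
  "lin_comb X \<tau> b = (\<lambda>w. \<Sum>a<dim_vec b. X (\<tau> (Suc a)) w * b $ a)"

text \<open>The filter of natural numbers tending to \<open>N \<le> \<infinity>\<close>. For finite \<open>N\<close> it is the limit in
  the discrete space of natural numbers, that is, the value at \<open>N\<close>.\<close>

definition towards :: "enat \<Rightarrow> nat filter" where
  "towards N = (case N of enat m \<Rightarrow> principal {m} | \<infinity> \<Rightarrow> sequentially)"

text \<open>Convergence to 0 in probability as \<open>n \<rightarrow> \<infinity>\<close> and then \<open>l \<rightarrow> \<infinity>\<close>.\<close>

definition iterated_tendsto_prob :: "'v measure \<Rightarrow> (nat \<Rightarrow> nat \<Rightarrow> 'v \<Rightarrow> real) \<Rightarrow> bool" where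
  "iterated_tendsto_prob D A \<longleftrightarrow>
     (\<forall>\<epsilon>>0. (\<lambda>l. limsup (\<lambda>n. ereal (measure D {\<omega>\<in>space D. \<bar>A n l \<omega>\<bar> > \<epsilon>}))) \<longlonglongrightarrow> 0)"

end

theory Submission
  imports Defs
begin

text \<open>The estimator depends continuously on finitely many objects that converge. For
  each slice \<open>s\<close> the slice mean \<open>h s\<close> has a representer \<open>\<eta> s\<close> in the closed span of the
  process, with \<open>h s t = E (\<eta> s * X t)\<close>. The operator \<open>LG\<close> has finite rank, and
  the span of its eigenfunctions for nonzero eigenvalues contains the slice means; moreover
  \<open>\<xi> j\<close> is the combination of the \<open>\<eta> s\<close> with coefficients
  \<open>q s * E (\<eta> s * \<xi> j) / lam j\<close> (\<open>eigen_relation\<close>), and the Gram matrix of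
  the \<open>\<eta> s\<close> has the eigenvalue structure of \<open>LG\<close> (\<open>eta_gram_in_eigenspaces\<close>). On the
  sample side, the estimator is the combination with the corresponding sample coefficients of
  estimated representers, whose coefficient vectors are a truncated inverse of the sample
  covariance matrix applied to the sample slice means (\<open>estimator_representation\<close>). If the
  estimated representers, their Gram matrix and the slice frequencies are close to their
  population values, the leading eigenvectors are close up to sign, because the eigenvalues
  are simple, and the sign convention removes the ambiguity (\<open>eigenvector_perturbation\<close>).

  The estimated representers are close for two reasons. First, the population truncation loses
  little. The distance from \<open>\<eta> s\<close> to the sampled span tends to 0 by density
  (\<open>sampled_span_dense\<close>), and the projection of \<open>\<eta> s\<close> onto the sampled span loses, by
  truncation at \<open>k\<close>, the quantity \<open>defect\<close>. Since
  \<open>q s * (h s \<bullet> b)\<^sup>2 \<le> b \<bullet> K b\<close> by the Cauchy-Schwarz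
  inequality, the trace in the hypothesis dominates \<open>q s\<close> times this defect
  (\<open>trace_lower_bound\<close>), for every choice of eigenvectors.

  Second, for a fixed truncation index, replacing population by sample quantities costs
  little. With respect to the eigenbases \<open>v\<close> of \<open>B\<close> and \<open>u\<close> of \<open>A\<close>, the difference
  \<open>f B - f A\<close> of spectral functions has the entries
  \<open>(f (l' i) - f (l j)) * (v i \<bullet> u j)\<close>; so a Lipschitz bound for \<open>f\<close> on
  the relevant pairs of eigenvalues bounds the Frobenius norm of the difference
  (\<open>spectral_lipschitz\<close>). A spectral gap of order \<open>n\<close>, where \<open>n\<close> is the dimension, makes
  truncated inverses stable (\<open>tinv_stable\<close>). The gap in the hypothesis separates the \<open>k\<close>-th
  eigenvalue only from eigenvalues that differ from it. If \<open>k\<close> lies inside a block of equal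
  eigenvalues, the trace condition holds for every choice of eigenvectors in the block; one
  that is rotated against \<open>h s\<close> shows that the whole block may be dropped from the population
  truncation (\<open>defect_before_block\<close>), and the sample eigenvalue is bounded from below instead,
  by Weyl's inequality or by interlacing with a fixed dimension (\<open>estimates_at_n\<close>,
  \<open>fixed_truncation\<close>).

  The probabilistic input is the law of large numbers in mean square. In dimension \<open>J\<close>, the
  squared Frobenius error of the sample covariance matrix has expectation
  \<open>O (J\<^sup>2 / n)\<close> by the bound on fourth moments, and the squared error of the slice
  means \<open>O (J / n)\<close>. With probability tending to 1 they are therefore at most
  \<open>t\<^sup>2 * J\<close> and \<open>t\<^sup>2\<close>, for every fixed \<open>t > 0\<close>, exactly because \<open>J = o(n)\<close>
  (\<open>good_events\<close>).\<close>

section \<open>Vectors, symmetric matrices and spectral decompositions\<close>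

text \<open>Vectors and matrices of size \<open>n\<close> are functions that are read at indices below
  \<open>n\<close>. In this way the covariance matrices of all dimensions are restrictions of one function,
  and no dimension has to be a type.\<close>

definition dot :: "nat \<Rightarrow> (nat \<Rightarrow> real) \<Rightarrow> (nat \<Rightarrow> real) \<Rightarrow> real" where
  "dot n x y = (\<Sum>a<n. x a * y a)"

definition nrm :: "nat \<Rightarrow> (nat \<Rightarrow> real) \<Rightarrow> real" where
  "nrm n x = sqrt (dot n x x)"

definition mv :: "nat \<Rightarrow> (nat \<Rightarrow> nat \<Rightarrow> real) \<Rightarrow> (nat \<Rightarrow> real) \<Rightarrow> nat \<Rightarrow> real" where
  "mv n A x = (\<lambda>a. \<Sum>b<n. A a b * x b)"

definition frob :: "nat \<Rightarrow> (nat \<Rightarrow> nat \<Rightarrow> real) \<Rightarrow> real" where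
  "frob n A = sqrt (\<Sum>a<n. \<Sum>b<n. (A a b)\<^sup>2)"

definition orthon :: "nat \<Rightarrow> (nat \<Rightarrow> nat \<Rightarrow> real) \<Rightarrow> bool" where
  "orthon n u \<longleftrightarrow> (\<forall>i\<in>{1..n}. \<forall>j\<in>{1..n}. dot n (u i) (u j) = (if i = j then 1 else 0))"

text \<open>The spectral function: the matrix with eigenvectors \<open>u j\<close> and eigenvalues
  \<open>c j\<close>.\<close>

definition comb :: "nat \<Rightarrow> (nat \<Rightarrow> real) \<Rightarrow> (nat \<Rightarrow> nat \<Rightarrow> real) \<Rightarrow> nat \<Rightarrow> nat \<Rightarrow> real" where
  "comb n c u = (\<lambda>a b. \<Sum>j\<in>{1..n}. c j * u j a * u j b)"

text \<open>Coordinates are counted from 0, eigenvalues from 1 and in decreasing order, as in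
  \<open>eigval\<close>.\<close>

definition spec :: "nat \<Rightarrow> (nat \<Rightarrow> nat \<Rightarrow> real) \<Rightarrow> (nat \<Rightarrow> real) \<Rightarrow> (nat \<Rightarrow> nat \<Rightarrow> real) \<Rightarrow> bool" where
  "spec n A l u \<longleftrightarrow> orthon n u \<and> (\<forall>i\<in>{1..n}. \<forall>j\<in>{1..n}. i \<le> j \<longrightarrow> l j \<le> l i) \<and>
     (\<forall>a<n. \<forall>b<n. A a b = comb n l u a b)"

lemma dot_commute: "dot n x y = dot n y x"
  by (simp add: dot_def mult.commute)

lemma dot_cong: "(\<And>a. a < n \<Longrightarrow> x a = x' a) \<Longrightarrow> (\<And>a. a < n \<Longrightarrow> y a = y' a) \<Longrightarrow> dot n x y = dot n x' y'"
  by (simp add: dot_def)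

lemma dot_add_left: "dot n (\<lambda>a. x a + y a) z = dot n x z + dot n y z"
  by (simp add: dot_def sum.distrib distrib_right)
lemma dot_add_right: "dot n z (\<lambda>a. x a + y a) = dot n z x + dot n z y"
  by (simp add: dot_def sum.distrib distrib_left)
lemma dot_diff_left: "dot n (\<lambda>a. x a - y a) z = dot n x z - dot n y z"
  by (simp add: dot_def sum_subtractf left_diff_distrib)
lemma dot_diff_right: "dot n z (\<lambda>a. x a - y a) = dot n z x - dot n z y"
  by (simp add: dot_def sum_subtractf right_diff_distrib)
lemma dot_scale_left: "dot n (\<lambda>a. c * x a) z = c * dot n x z"
  by (simp add: dot_def sum_distrib_left mult.assoc)
lemma dot_scale_right: "dot n z (\<lambda>a. c * x a) = c * dot n z x"
  by (simp add: dot_def sum_distrib_left mult.left_commute)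
lemma dot_sum_left: "dot n (\<lambda>a. \<Sum>i\<in>F. f i a) z = (\<Sum>i\<in>F. dot n (f i) z)"
proof -
  have "dot n (\<lambda>a. \<Sum>i\<in>F. f i a) z = (\<Sum>a<n. \<Sum>i\<in>F. f i a * z a)"
    by (simp add: dot_def sum_distrib_right)
  also have "\<dots> = (\<Sum>i\<in>F. dot n (f i) z)" unfolding dot_def by (rule sum.swap)
  finally show ?thesis .
qed
lemma dot_sum_right: "dot n z (\<lambda>a. \<Sum>i\<in>F. f i a) = (\<Sum>i\<in>F. dot n z (f i))"
  using dot_sum_left[of n f F z] by (simp add: dot_commute)

lemmas dot_simps = dot_add_left dot_add_right dot_diff_left dot_diff_right dot_scale_left dot_scale_right

lemma dot_self_nonneg [simp]: "0 \<le> dot n x x"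
  by (simp add: dot_def sum_nonneg)

lemma nrm_nonneg [simp]: "0 \<le> nrm n x" by (simp add: nrm_def)
lemma nrm_sq: "(nrm n x)\<^sup>2 = dot n x x" by (simp add: nrm_def)
lemma nrm_L2_set: "nrm n x = L2_set x {..<n}"
  by (simp add: nrm_def L2_set_def dot_def power2_eq_square)

lemma nrm_cong: "(\<And>a. a < n \<Longrightarrow> x a = y a) \<Longrightarrow> nrm n x = nrm n y"
  unfolding nrm_def by (subst dot_cong[of n x y x y]) auto

lemma dot_self_0_iff: "dot n x x = 0 \<longleftrightarrow> (\<forall>a<n. x a = 0)"
  by (auto simp: dot_def sum_nonneg_eq_0_iff)

lemma dot_le_nrm: "\<bar>dot n x y\<bar> \<le> nrm n x * nrm n y"
proof -
  have "\<bar>dot n x y\<bar> \<le> (\<Sum>a<n. \<bar>x a\<bar> * \<bar>y a\<bar>)"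
    unfolding dot_def by (rule order_trans[OF sum_abs]) (simp add: abs_mult)
  also have "\<dots> \<le> nrm n x * nrm n y" unfolding nrm_L2_set by (rule L2_set_mult_ineq)
  finally show ?thesis .
qed

lemma nrm_triangle: "nrm n (\<lambda>a. x a + y a) \<le> nrm n x + nrm n y"
  unfolding nrm_L2_set by (rule L2_set_triangle_ineq)

lemma nrm_scale: "nrm n (\<lambda>a. c * x a) = \<bar>c\<bar> * nrm n x"
  by (simp add: nrm_def dot_simps real_sqrt_mult flip: mult.assoc)

lemma nrm_triangle_diff: "nrm n x \<le> nrm n y + nrm n (\<lambda>a. x a - y a)"
  using nrm_triangle[of n y "\<lambda>a. x a - y a"] by simp

lemma dot_mv_swap: "dot n x (mv n A y) = (\<Sum>a<n. \<Sum>b<n. x a * A a b * y b)"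
  by (simp add: dot_def mv_def sum_distrib_left mult.assoc)

lemma dot_mv_sym: "(\<And>a b. a < n \<Longrightarrow> b < n \<Longrightarrow> A a b = A b a) \<Longrightarrow> dot n x (mv n A y) = dot n (mv n A x) y"
proof -
  assume s: "\<And>a b. a < n \<Longrightarrow> b < n \<Longrightarrow> A a b = A b a"
  have "dot n x (mv n A y) = (\<Sum>b<n. \<Sum>a<n. x a * A a b * y b)"
    unfolding dot_mv_swap by (rule sum.swap)
  also have "\<dots> = (\<Sum>b<n. \<Sum>a<n. y b * A b a * x a)"
    by (intro sum.cong refl) (auto simp: s)
  also have "\<dots> = dot n (mv n A x) y" by (simp add: dot_mv_swap[symmetric] dot_commute)
  finally show ?thesis .
qed

lemma mv_cong: "(\<And>b. b < n \<Longrightarrow> A a b = B a b) \<Longrightarrow> (\<And>b. b < n \<Longrightarrow> x b = y b) \<Longrightarrow> mv n A x a = mv n B y a"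
  by (simp add: mv_def)

lemma mv_add: "mv n A (\<lambda>b. x b + y b) a = mv n A x a + mv n A y a"
  by (simp add: mv_def sum.distrib distrib_left)
lemma mv_diff: "mv n A (\<lambda>b. x b - y b) a = mv n A x a - mv n A y a"
  by (simp add: mv_def sum_subtractf right_diff_distrib)
lemma mv_scale: "mv n A (\<lambda>b. c * x b) a = c * mv n A x a"
  by (simp add: mv_def sum_distrib_left mult.left_commute)
lemma mv_diff_mat: "mv n (\<lambda>a b. A a b - B a b) x a = mv n A x a - mv n B x a"
  by (simp add: mv_def sum_subtractf left_diff_distrib)
lemma mv_sum: "mv n A (\<lambda>b. \<Sum>i\<in>F. c i * x i b) a = (\<Sum>i\<in>F. c i * mv n A (x i) a)"
proof -
  have "mv n A (\<lambda>b. \<Sum>i\<in>F. c i * x i b) a = (\<Sum>b<n. \<Sum>i\<in>F. c i * (A a b * x i b))"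
    by (simp add: mv_def sum_distrib_left mult.left_commute)
  also have "\<dots> = (\<Sum>i\<in>F. \<Sum>b<n. c i * (A a b * x i b))" by (rule sum.swap)
  finally show ?thesis by (simp add: mv_def sum_distrib_left)
qed

lemma frob_nonneg [simp]: "0 \<le> frob n A" by (simp add: frob_def sum_nonneg)
lemma frob_sq: "(frob n A)\<^sup>2 = (\<Sum>a<n. \<Sum>b<n. (A a b)\<^sup>2)" by (simp add: frob_def sum_nonneg)
lemma frob_sq_mv: "(frob n A)\<^sup>2 = (\<Sum>a<n. dot n (A a) (A a))"
  unfolding frob_sq by (simp add: dot_def power2_eq_square)

lemma nrm_mv_le_frob: "nrm n (mv n A x) \<le> frob n A * nrm n x"
proof -
  have "dot n (mv n A x) (mv n A x) = (\<Sum>a<n. (dot n (A a) x)\<^sup>2)"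
    by (simp add: dot_def mv_def power2_eq_square)
  also have "\<dots> \<le> (\<Sum>a<n. dot n (A a) (A a) * dot n x x)"
  proof (rule sum_mono)
    fix a
    have "\<bar>dot n (A a) x\<bar>\<^sup>2 \<le> (nrm n (A a) * nrm n x)\<^sup>2"
      by (rule power_mono[OF dot_le_nrm]) simp
    then show "(dot n (A a) x)\<^sup>2 \<le> dot n (A a) (A a) * dot n x x"
      by (simp add: power_mult_distrib nrm_sq)
  qed
  also have "\<dots> = (frob n A * nrm n x)\<^sup>2"
    by (simp add: power_mult_distrib frob_sq_mv nrm_sq sum_distrib_right)
  finally show ?thesis unfolding nrm_def[of n "mv n A x"]
    by (intro real_le_lsqrt) auto
qed

lemma dot_mv_le_frob: "\<bar>dot n x (mv n A y)\<bar> \<le> frob n A * nrm n x * nrm n y"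
  using order_trans[OF dot_le_nrm mult_left_mono[OF nrm_mv_le_frob nrm_nonneg]]
  by (simp add: mult_ac)

text \<open>A one-sided inverse of a square matrix is two-sided.\<close>

lemma orthon_complete:
  assumes "orthon n u" "a < n" "b < n"
  shows "(\<Sum>j\<in>{1..n}. u j a * u j b) = (if a = b then 1 else 0)"
proof -
  let ?U = "Matrix.mat n n (\<lambda>(a, j). u (Suc j) a)"
  have U: "?U \<in> carrier_mat n n" by simp
  have "transpose_mat ?U * ?U = 1\<^sub>m n"
  proof (rule eq_matI)
    fix i j assume ij: "i < dim_row (1\<^sub>m n :: real mat)" "j < dim_col (1\<^sub>m n :: real mat)"
    then have "(transpose_mat ?U * ?U) $$ (i, j) = dot n (u (Suc i)) (u (Suc j))"
      by (simp add: scalar_prod_def dot_def atLeast0LessThan)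
    then show "(transpose_mat ?U * ?U) $$ (i, j) = (1\<^sub>m n :: real mat) $$ (i, j)"
      using ij assms(1) by (auto simp: orthon_def)
  qed auto
  then have "?U * transpose_mat ?U = 1\<^sub>m n"
    using mat_mult_left_right_inverse[of "transpose_mat ?U" n ?U] by auto
  then have "(?U * transpose_mat ?U) $$ (a, b) = (if a = b then 1 else 0)"
    using assms by simp
  moreover have "(?U * transpose_mat ?U) $$ (a, b) = (\<Sum>j<n. u (Suc j) a * u (Suc j) b)"
    using assms(2,3) by (simp add: scalar_prod_def atLeast0LessThan)
  ultimately show ?thesis by (simp only: sum.atLeast1_atMost_eq One_nat_def)
qed

lemma orthon_expand:
  assumes "orthon n u" "a < n"
  shows "x a = (\<Sum>j\<in>{1..n}. dot n (u j) x * u j a)"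
proof -
  have "(\<Sum>j\<in>{1..n}. dot n (u j) x * u j a) = (\<Sum>j\<in>{1..n}. \<Sum>b<n. u j a * u j b * x b)"
    unfolding dot_def sum_distrib_right by (intro sum.cong refl) (simp add: mult_ac)
  also have "\<dots> = (\<Sum>b<n. \<Sum>j\<in>{1..n}. u j a * u j b * x b)" by (rule sum.swap)
  also have "\<dots> = (\<Sum>b<n. (if a = b then 1 else 0) * x b)"
    unfolding sum_distrib_right[symmetric]
    by (intro sum.cong refl) (subst orthon_complete[OF assms(1,2)], auto)
  also have "\<dots> = (\<Sum>b<n. if a = b then x b else 0)" by (intro sum.cong refl) auto
  also have "\<dots> = x a" using assms(2) by simp
  finally show ?thesis by simp
qed

lemma parseval:
  assumes "orthon n u"
  shows "dot n x y = (\<Sum>j\<in>{1..n}. dot n (u j) x * dot n (u j) y)"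
proof -
  have "dot n x y = dot n (\<lambda>a. \<Sum>j\<in>{1..n}. dot n (u j) x * u j a) y"
    by (rule dot_cong) (auto simp: orthon_expand[OF assms, of _ x])
  then show ?thesis by (simp add: dot_sum_left dot_scale_left)
qed

lemma parseval_nrm: "orthon n u \<Longrightarrow> (nrm n x)\<^sup>2 = (\<Sum>j\<in>{1..n}. (dot n (u j) x)\<^sup>2)"
  unfolding nrm_sq by (subst parseval) (auto simp: power2_eq_square)

lemma mv_comb: "mv n (comb n c u) x a = (\<Sum>j\<in>{1..n}. c j * dot n (u j) x * u j a)"
proof -
  have "mv n (comb n c u) x a = (\<Sum>b<n. \<Sum>j\<in>{1..n}. c j * u j a * u j b * x b)"
    by (simp add: mv_def comb_def sum_distrib_right)
  also have "\<dots> = (\<Sum>j\<in>{1..n}. \<Sum>b<n. c j * u j a * u j b * x b)" by (rule sum.swap)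
  finally show ?thesis by (simp add: dot_def sum_distrib_left sum_distrib_right mult_ac)
qed

lemma dot_mv_comb: "dot n x (mv n (comb n c u) y) = (\<Sum>j\<in>{1..n}. c j * dot n (u j) x * dot n (u j) y)"
proof -
  have "dot n x (mv n (comb n c u) y) = dot n x (\<lambda>a. \<Sum>j\<in>{1..n}. (c j * dot n (u j) y) * u j a)"
    by (simp add: mv_comb[abs_def])
  then show ?thesis
    unfolding dot_sum_right dot_scale_right by (simp add: dot_commute[of n x] mult_ac)
qed

lemma comb_sym: "comb n c u a b = comb n c u b a" by (simp add: comb_def mult_ac)

lemma dot_u_mv_comb:
  assumes "orthon n u" "i \<in> {1..n}"
  shows "dot n (u i) (mv n (comb n c u) y) = c i * dot n (u i) y"
proof -
  have "dot n (u i) (mv n (comb n c u) y) = (\<Sum>j\<in>{1..n}. if j = i then c j * dot n (u j) y else 0)"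
    unfolding dot_mv_comb using assms by (intro sum.cong refl) (auto simp: orthon_def)
  then show ?thesis using assms(2) by simp
qed

lemma nrm_mv_comb_le:
  assumes "orthon n u" "\<And>i. i \<in> {1..n} \<Longrightarrow> \<bar>c i\<bar> \<le> K" "0 \<le> K"
  shows "nrm n (mv n (comb n c u) x) \<le> K * nrm n x"
proof -
  have "(nrm n (mv n (comb n c u) x))\<^sup>2 = (\<Sum>j\<in>{1..n}. (c j)\<^sup>2 * (dot n (u j) x)\<^sup>2)"
    by (simp add: parseval_nrm[OF assms(1)] dot_u_mv_comb[OF assms(1)] power_mult_distrib)
  also have "\<dots> \<le> (\<Sum>j\<in>{1..n}. K\<^sup>2 * (dot n (u j) x)\<^sup>2)"
    using power_mono[OF assms(2), of _ 2] by (intro sum_mono mult_right_mono) auto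
  also have "\<dots> = (K * nrm n x)\<^sup>2"
    by (simp add: power_mult_distrib parseval_nrm[OF assms(1)] sum_distrib_left)
  finally show ?thesis by (rule power2_le_imp_le) (simp add: assms(3))
qed

lemma specD:
  assumes "spec n A l u"
  shows "orthon n u" "\<And>i j. i \<in> {1..n} \<Longrightarrow> j \<in> {1..n} \<Longrightarrow> i \<le> j \<Longrightarrow> l j \<le> l i"
    "\<And>a b. a < n \<Longrightarrow> b < n \<Longrightarrow> A a b = comb n l u a b"
  using assms by (auto simp: spec_def)

lemma spec_mv: "spec n A l u \<Longrightarrow> a < n \<Longrightarrow> mv n A x a = mv n (comb n l u) x a"
  by (rule mv_cong) (auto simp: specD)

lemma spec_dot_mv: "spec n A l u \<Longrightarrow> dot n x (mv n A y) = dot n x (mv n (comb n l u) y)"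
  by (rule dot_cong) (auto simp: spec_mv)

lemma spec_sym: "spec n A l u \<Longrightarrow> a < n \<Longrightarrow> b < n \<Longrightarrow> A a b = A b a"
  by (simp add: specD comb_sym)

lemma spec_dot_u: "spec n A l u \<Longrightarrow> i \<in> {1..n} \<Longrightarrow> dot n (u i) (mv n A x) = l i * dot n (u i) x"
  by (simp add: spec_dot_mv dot_u_mv_comb specD(1))

section \<open>Perturbation of spectral functions\<close>

text \<open>The Frobenius norm is invariant under multiplication by orthogonal matrices from
  both sides, and the two matrices may differ. They will be the eigenbases of two different
  matrices.\<close>

lemma frob_mixed:
  assumes u: "orthon n u" and v: "orthon n v"
  shows "(frob n A)\<^sup>2 = (\<Sum>i\<in>{1..n}. \<Sum>j\<in>{1..n}. (dot n (v i) (mv n A (u j)))\<^sup>2)"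
proof -
  have "(frob n A)\<^sup>2 = (\<Sum>a<n. \<Sum>j\<in>{1..n}. (mv n A (u j) a)\<^sup>2)"
    unfolding frob_sq_mv
  proof (intro sum.cong refl)
    fix a show "dot n (A a) (A a) = (\<Sum>j\<in>{1..n}. (mv n A (u j) a)\<^sup>2)"
      by (subst parseval[OF u]) (simp add: mv_def dot_def power2_eq_square mult.commute)
  qed
  also have "\<dots> = (\<Sum>j\<in>{1..n}. \<Sum>a<n. (mv n A (u j) a)\<^sup>2)" by (rule sum.swap)
  also have "\<dots> = (\<Sum>j\<in>{1..n}. (nrm n (mv n A (u j)))\<^sup>2)"
    unfolding nrm_sq by (simp add: dot_def power2_eq_square)
  also have "\<dots> = (\<Sum>j\<in>{1..n}. \<Sum>i\<in>{1..n}. (dot n (v i) (mv n A (u j)))\<^sup>2)"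
    by (simp add: parseval_nrm[OF v])
  also have "\<dots> = (\<Sum>i\<in>{1..n}. \<Sum>j\<in>{1..n}. (dot n (v i) (mv n A (u j)))\<^sup>2)" by (rule sum.swap)
  finally show ?thesis .
qed

text \<open>The identity behind all perturbation bounds below. It compares functions of two
  matrices without comparing their eigenvectors one by one, which would need a gap between
  each pair of eigenvalues.\<close>

lemma dot_comb_diff:
  assumes u: "orthon n u" and v: "orthon n v" and "i \<in> {1..n}" "j \<in> {1..n}"
  shows "dot n (v i) (mv n (\<lambda>a b. comb n f' v a b - comb n f u a b) (u j)) = (f' i - f j) * dot n (v i) (u j)"
proof -
  have 1: "dot n (v i) (mv n (comb n f' v) (u j)) = f' i * dot n (v i) (u j)"
    by (rule dot_u_mv_comb) fact+
  have "dot n (v i) (mv n (comb n f u) (u j)) = dot n (mv n (comb n f u) (v i)) (u j)"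
    by (rule dot_mv_sym) (rule comb_sym)
  then have 2: "dot n (v i) (mv n (comb n f u) (u j)) = f j * dot n (v i) (u j)"
    using dot_u_mv_comb[OF u assms(4), of f "v i"] by (simp add: dot_commute)
  show ?thesis unfolding mv_diff_mat[abs_def] by (simp add: dot_diff_right 1 2 algebra_simps)
qed

lemma frob_cong: "(\<And>a b. a < n \<Longrightarrow> b < n \<Longrightarrow> A a b = B a b) \<Longrightarrow> frob n A = frob n B"
  by (simp add: frob_def)

text \<open>In the mixed basis of the two eigensystems, the entries of both differences are
  multiples of the same inner products of eigenvectors, so the Lipschitz bound may be applied
  entry by entry.\<close>

lemma spectral_lipschitz:
  assumes A: "spec n A l u" and B: "spec n B l' v" and L: "0 \<le> L"
    and f: "\<And>i j. i \<in> {1..n} \<Longrightarrow> j \<in> {1..n} \<Longrightarrow> \<bar>f' i - f j\<bar> \<le> L * \<bar>l' i - l j\<bar>"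
  shows "frob n (\<lambda>a b. comb n f' v a b - comb n f u a b) \<le> L * frob n (\<lambda>a b. B a b - A a b)"
proof -
  note o = specD(1)[OF A] specD(1)[OF B]
  have "(frob n (\<lambda>a b. comb n f' v a b - comb n f u a b))\<^sup>2
      = (\<Sum>i\<in>{1..n}. \<Sum>j\<in>{1..n}. ((f' i - f j) * dot n (v i) (u j))\<^sup>2)"
    unfolding frob_mixed[OF o] by (simp add: dot_comb_diff[OF o])
  also have "\<dots> \<le> (\<Sum>i\<in>{1..n}. \<Sum>j\<in>{1..n}. L\<^sup>2 * ((l' i - l j) * dot n (v i) (u j))\<^sup>2)"
  proof (intro sum_mono)
    fix i j assume ij: "i \<in> {1..n}" "j \<in> {1..n}"
    have "\<bar>f' i - f j\<bar>\<^sup>2 \<le> (L * \<bar>l' i - l j\<bar>)\<^sup>2" using f[OF ij] by (intro power_mono) auto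
    then show "((f' i - f j) * dot n (v i) (u j))\<^sup>2 \<le> L\<^sup>2 * ((l' i - l j) * dot n (v i) (u j))\<^sup>2"
      by (simp add: power_mult_distrib mult_right_mono flip: mult.assoc)
  qed
  also have "\<dots> = L\<^sup>2 * (frob n (\<lambda>a b. comb n l' v a b - comb n l u a b))\<^sup>2"
    unfolding frob_mixed[OF o] by (simp add: dot_comb_diff[OF o] sum_distrib_left)
  also have "frob n (\<lambda>a b. comb n l' v a b - comb n l u a b) = frob n (\<lambda>a b. B a b - A a b)"
    by (rule frob_cong) (simp add: specD(3)[OF A] specD(3)[OF B])
  finally have "(frob n (\<lambda>a b. comb n f' v a b - comb n f u a b))\<^sup>2 \<le> (L * frob n (\<lambda>a b. B a b - A a b))\<^sup>2"
    by (simp add: power_mult_distrib)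
  then show ?thesis by (rule power2_le_imp_le) (simp add: L)
qed

lemma frob_0_D: "frob n A = 0 \<Longrightarrow> a < n \<Longrightarrow> b < n \<Longrightarrow> A a b = 0"
  by (auto simp: frob_def sum_nonneg_eq_0_iff sum_nonneg)

text \<open>Entries in the mixed basis vanish, either because \<open>f' i = f j\<close> or because
  eigenvectors for different eigenvalues are orthogonal.\<close>

lemma spec_fun_unique:
  assumes A: "spec n A l u" and B: "spec n A l' v"
    and f: "\<And>i j. i \<in> {1..n} \<Longrightarrow> j \<in> {1..n} \<Longrightarrow> l' i = l j \<Longrightarrow> f' i = f j"
    and ab: "a < n" "b < n"
  shows "comb n f' v a b = comb n f u a b"
proof -
  note o = specD(1)[OF A] specD(1)[OF B]
  have z: "(f' i - f j) * dot n (v i) (u j) = 0" if ij: "i \<in> {1..n}" "j \<in> {1..n}" for i j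
  proof (cases "dot n (v i) (u j) = 0")
    case False
    have "l' i * dot n (v i) (u j) = dot n (v i) (mv n A (u j))" by (simp add: spec_dot_u[OF B ij(1)])
    also have "\<dots> = dot n (mv n A (v i)) (u j)" by (rule dot_mv_sym) (rule spec_sym[OF A])
    also have "\<dots> = l j * dot n (v i) (u j)" by (simp add: dot_commute[of n _ "u j"] spec_dot_u[OF A ij(2)])
    finally have "l' i = l j" using False by simp
    then show ?thesis using f[OF ij] by simp
  qed simp
  have "(frob n (\<lambda>a b. comb n f' v a b - comb n f u a b))\<^sup>2 = 0"
    unfolding frob_mixed[OF o] by (simp add: dot_comb_diff[OF o] z)
  then show ?thesis using frob_0_D[of n "\<lambda>a b. comb n f' v a b - comb n f u a b", OF _ ab] by simp
qed

section \<open>Variational bounds for eigenvalues\<close>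

text \<open>Completing the system by zero rows gives a singular square matrix. This replaces
  dimension counting in the arguments below.\<close>

lemma nontrivial_kernel:
  fixes c :: "nat \<Rightarrow> nat \<Rightarrow> real"
  assumes "m < n"
  obtains x where "dot n x x = 1" "\<And>i. i < m \<Longrightarrow> dot n (c i) x = 0" "\<And>a. a \<ge> n \<Longrightarrow> x a = 0"
proof -
  let ?C = "Matrix.mat n n (\<lambda>(i, a). if i < m then c i a else 0)"
  have "?C = mat\<^sub>r n n (\<lambda>i. if i = m then 0\<^sub>v n else row ?C i)"
    using assms by (intro eq_matI) auto
  then have "det ?C = 0" using det_row_0[of m n "\<lambda>i. row ?C i"] assms by auto
  then obtain v where v: "v \<in> carrier_vec n" "v \<noteq> 0\<^sub>v n" "?C *\<^sub>v v = 0\<^sub>v n"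
    using det_0_iff_vec_prod_zero_field[of ?C n] by auto
  define y where "y a = (if a < n then v $ a else 0)" for a
  have "dot n y y \<noteq> 0"
    using v(1,2) by (auto simp: dot_self_0_iff y_def intro!: eq_vecI)
  then have p: "dot n y y > 0" using dot_self_nonneg[of n y] by linarith
  have k: "dot n (c i) y = 0" if "i < m" for i
  proof -
    have "(?C *\<^sub>v v) $ i = dot n (c i) y"
      using that assms v(1) by (auto simp: scalar_prod_def dot_def y_def atLeast0LessThan intro!: sum.cong)
    then show ?thesis using v(3) that assms by simp
  qed
  show ?thesis
  proof (rule that[of "\<lambda>a. inverse (nrm n y) * y a"])
    show "dot n (\<lambda>a. inverse (nrm n y) * y a) (\<lambda>a. inverse (nrm n y) * y a) = 1"
      unfolding dot_scale_left dot_scale_right nrm_def using p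
      by (simp add: field_simps flip: real_sqrt_mult)
    fix a assume "n \<le> a"
    then show "inverse (nrm n y) * y a = 0" by (simp add: y_def)
  qed (simp add: dot_scale_right k)
qed

text \<open>One half of the Courant-Fischer principle: the span of \<open>j\<close> vectors \<open>w i\<close>
  contains a vector orthogonal to the first \<open>j - 1\<close> eigenvectors. That the norm is positive
  expresses linear independence.\<close>

lemma minmax_lower:
  assumes A: "spec n A l u" and j: "j \<in> {1..n}"
    and w: "\<And>c. dot j c c = 1 \<Longrightarrow> (\<Sum>a<n. (\<Sum>i<j. c i * w i a)\<^sup>2) > 0 \<and>
       dot n (\<lambda>a. \<Sum>i<j. c i * w i a) (mv n A (\<lambda>a. \<Sum>i<j. c i * w i a)) \<ge> K * (\<Sum>a<n. (\<Sum>i<j. c i * w i a)\<^sup>2)"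
  shows "K \<le> l j"
proof -
  have "j - 1 < j" using j by auto
  then obtain c where c: "dot j c c = 1" "\<And>i. i < j - 1 \<Longrightarrow> dot j (\<lambda>m. dot n (u (Suc i)) (w m)) c = 0"
    using nontrivial_kernel[of "j - 1" j "\<lambda>i m. dot n (u (Suc i)) (w m)"] by metis
  define x where "x a = (\<Sum>i<j. c i * w i a)" for a
  have sq: "(\<Sum>a<n. (x a)\<^sup>2) = dot n x x" by (simp add: dot_def power2_eq_square)
  have ux: "dot n (u i) x = 0" if "i \<in> {1..n}" "i < j" for i
  proof -
    have "dot n (u i) x = dot j (\<lambda>m. dot n (u i) (w m)) c"
      by (simp add: x_def[abs_def] dot_sum_right dot_scale_right dot_def[of j] mult.commute)
    then show ?thesis using c(2)[of "i - 1"] that by auto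
  qed
  have p: "dot n x x > 0" and "K * dot n x x \<le> dot n x (mv n A x)"
    using w[OF c(1)] by (simp_all add: x_def[symmetric] sq)
  note this(2)
  also have "dot n x (mv n A x) = (\<Sum>i\<in>{1..n}. l i * (dot n (u i) x)\<^sup>2)"
    by (simp add: spec_dot_mv[OF A] dot_mv_comb power2_eq_square mult.assoc)
  also have "\<dots> \<le> (\<Sum>i\<in>{1..n}. l j * (dot n (u i) x)\<^sup>2)"
  proof (rule sum_mono)
    fix i assume i: "i \<in> {1..n}"
    show "l i * (dot n (u i) x)\<^sup>2 \<le> l j * (dot n (u i) x)\<^sup>2"
      using ux[OF i] specD(2)[OF A j i] by (cases "i < j") (auto intro: mult_right_mono)
  qed
  also have "\<dots> = l j * dot n x x"
    unfolding sum_distrib_left[symmetric] parseval_nrm[OF specD(1)[OF A], symmetric] nrm_sq ..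
  finally show ?thesis using p by simp
qed

text \<open>The other half: some nonzero vector in the span of the first \<open>j\<close> eigenvectors
  satisfies any \<open>j - 1\<close> linear constraints.\<close>

lemma minmax_upper:
  assumes A: "spec n A l u" and j: "j \<in> {1..n}"
    and w: "\<And>x. dot n x x = 1 \<Longrightarrow> (\<And>i. i < j - 1 \<Longrightarrow> dot n (w i) x = 0) \<Longrightarrow> dot n x (mv n A x) \<le> K"
  shows "l j \<le> K"
proof -
  have "j - 1 < j" using j by auto
  then obtain c where c: "dot j c c = 1" "\<And>i. i < j - 1 \<Longrightarrow> dot j (\<lambda>m. dot n (w i) (u (Suc m))) c = 0"
    using nontrivial_kernel[of "j - 1" j "\<lambda>i m. dot n (w i) (u (Suc m))"] by metis
  define x where "x a = (\<Sum>m<j. c m * u (Suc m) a)" for a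
  have ux: "dot n (u i) x = (if i \<le> j then c (i - 1) else 0)" if i: "i \<in> {1..n}" for i
  proof -
    have "dot n (u i) x = (\<Sum>m<j. c m * dot n (u i) (u (Suc m)))"
      by (simp add: x_def[abs_def] dot_sum_right dot_scale_right)
    also have "\<dots> = (\<Sum>m<j. if m = i - 1 then c m else 0)"
      using specD(1)[OF A] i j by (intro sum.cong refl) (auto simp: orthon_def)
    finally show ?thesis using i by auto
  qed
  have wx: "dot n (w i) x = 0" if "i < j - 1" for i
    using c(2)[OF that] by (simp add: x_def[abs_def] dot_sum_right dot_scale_right dot_def[of j] mult.commute)
  have sub: "(\<Sum>i\<in>{1..n}. g i * (dot n (u i) x)\<^sup>2) = (\<Sum>i\<in>{1..j}. g i * (c (i - 1))\<^sup>2)" for g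
    using j by (intro sum.mono_neutral_cong_right) (auto simp: ux)
  have cc: "(\<Sum>i\<in>{1..j}. (c (i - 1))\<^sup>2) = 1"
    using c(1) by (simp add: dot_def sum.atLeast1_atMost_eq power2_eq_square)
  have xx: "dot n x x = 1"
    using sub[of "\<lambda>_. 1"] unfolding mult_1_left parseval_nrm[OF specD(1)[OF A], symmetric] nrm_sq cc .
  have "l j = (\<Sum>i\<in>{1..j}. l j * (c (i - 1))\<^sup>2)" using cc by (simp flip: sum_distrib_left)
  also have "\<dots> \<le> (\<Sum>i\<in>{1..j}. l i * (c (i - 1))\<^sup>2)"
    using j by (intro sum_mono mult_right_mono specD(2)[OF A]) auto
  also have "\<dots> = dot n x (mv n A x)"
    unfolding spec_dot_mv[OF A] dot_mv_comb sub[symmetric] by (simp add: power2_eq_square mult.assoc)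
  also have "\<dots> \<le> K" using w[OF xx wx] by blast
  finally show ?thesis .
qed

text \<open>Weyl's inequality, with the Frobenius norm in place of the operator norm.\<close>

lemma weyl:
  assumes A: "spec n A l u" and B: "spec n B l' v" and j: "j \<in> {1..n}"
  shows "\<bar>l' j - l j\<bar> \<le> frob n (\<lambda>a b. B a b - A a b)"
proof -
  have one: "l2 j \<le> l1 j + frob n (\<lambda>a b. C2 a b - C1 a b)"
    if C1: "spec n C1 l1 u1" and C2: "spec n C2 l2 u2" for C1 C2 l1 l2 u1 u2
  proof (rule minmax_upper[OF C2 j])
    fix x assume x: "dot n x x = 1" and o: "\<And>i. i < j - 1 \<Longrightarrow> dot n (u1 (Suc i)) x = 0"
    have o': "dot n (u1 i) x = 0" if "i \<in> {1..n}" "i < j" for i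
      using o[of "i - 1"] that by auto
    have "dot n x (mv n C1 x) = (\<Sum>i\<in>{1..n}. l1 i * (dot n (u1 i) x)\<^sup>2)"
      by (simp add: spec_dot_mv[OF C1] dot_mv_comb power2_eq_square mult.assoc)
    also have "\<dots> \<le> (\<Sum>i\<in>{1..n}. l1 j * (dot n (u1 i) x)\<^sup>2)"
    proof (rule sum_mono)
      fix i assume i: "i \<in> {1..n}"
      show "l1 i * (dot n (u1 i) x)\<^sup>2 \<le> l1 j * (dot n (u1 i) x)\<^sup>2"
        using o'[OF i] specD(2)[OF C1 j i] by (cases "i < j") (auto intro: mult_right_mono)
    qed
    also have "\<dots> = l1 j"
      using x unfolding sum_distrib_left[symmetric] parseval_nrm[OF specD(1)[OF C1], symmetric] nrm_sq
      by simp
    finally have 1: "dot n x (mv n C1 x) \<le> l1 j" .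
    have "dot n x (mv n C2 x) = dot n x (mv n C1 x) + dot n x (mv n (\<lambda>a b. C2 a b - C1 a b) x)"
      by (simp add: mv_diff_mat[abs_def] dot_diff_right)
    moreover have "dot n x (mv n (\<lambda>a b. C2 a b - C1 a b) x) \<le> frob n (\<lambda>a b. C2 a b - C1 a b)"
      using dot_mv_le_frob[of n x "\<lambda>a b. C2 a b - C1 a b" x] x by (simp add: nrm_def)
    ultimately show "dot n x (mv n C2 x) \<le> l1 j + frob n (\<lambda>a b. C2 a b - C1 a b)" using 1 by linarith
  qed
  have "frob n (\<lambda>a b. A a b - B a b) = frob n (\<lambda>a b. B a b - A a b)"
    by (simp add: frob_def power2_commute)
  then show ?thesis using one[OF A B] one[OF B A] by linarith
qed

section \<open>The spectral theorem\<close>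

lemma continuous_on_dot: "continuous_on A (\<lambda>x. dot n (f x) (g x))"
  if "\<And>a. continuous_on A (\<lambda>x. f x a)" "\<And>a. continuous_on A (\<lambda>x. g x a)"
  unfolding dot_def by (intro continuous_intros that)

lemma continuous_on_coord: "continuous_on A (\<lambda>x::nat \<Rightarrow> real. x a)"
  by (rule continuous_on_subset[OF continuous_on_product_coordinates]) simp

text \<open>Coordinates from \<open>n\<close> on are fixed to 0, since otherwise the sphere would not be
  compact in the product topology.\<close>

lemma compact_constrained_sphere:
  "compact {x. dot n x x = 1 \<and> (\<forall>i<m. dot n (u i) x = 0) \<and> (\<forall>a\<ge>n. x a = 0)}" (is "compact ?S")
proof -
  let ?B = "PiE UNIV (\<lambda>a::nat. if a < n then {-1..1} else {0::real})"
  have "compactin (product_topology (\<lambda>_. euclidean) UNIV) ?B"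
    unfolding compactin_PiE by auto
  then have B: "compact ?B" by (simp add: euclidean_product_topology)
  have "closed ?S"
  proof -
    have "?S = {x. dot n x x = 1} \<inter> (\<Inter>i\<in>{..<m}. {x. dot n (u i) x = 0}) \<inter> (\<Inter>a\<in>{n..}. {x. x a = 0})"
      by auto
    also have "closed \<dots>"
      by (intro closed_Int closed_INT ballI closed_Collect_eq continuous_on_dot continuous_on_coord
          continuous_on_const)
    finally show ?thesis .
  qed
  moreover have "?S \<subseteq> ?B"
  proof
    fix x assume x: "x \<in> ?S"
    have "\<bar>x a\<bar> \<le> 1" if "a < n" for a
    proof -
      have "(x a)\<^sup>2 \<le> (\<Sum>a<n. x a * x a)"
        using that by (simp add: power2_eq_square) (rule member_le_sum, auto)
      then have "(x a)\<^sup>2 \<le> 1" using x by (simp add: dot_def)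
      then show ?thesis by (simp add: abs_square_le_1)
    qed
    then show "x \<in> ?B" using x by (auto simp: PiE_iff abs_le_iff not_less minus_le_iff)
  qed
  ultimately have "compact (?B \<inter> ?S)" using B by blast
  moreover have "?B \<inter> ?S = ?S" using \<open>?S \<subseteq> ?B\<close> by blast
  ultimately show ?thesis by simp
qed

text \<open>The outcome of \<open>m\<close> steps of successive maximisation of the quadratic form,
  counted from 0.\<close>

definition max_eigvecs :: "nat \<Rightarrow> (nat \<Rightarrow> nat \<Rightarrow> real) \<Rightarrow> nat \<Rightarrow> (nat \<Rightarrow> real) \<Rightarrow> (nat \<Rightarrow> nat \<Rightarrow> real) \<Rightarrow> bool" where
  "max_eigvecs n A m l u \<longleftrightarrow>
    (\<forall>i<m. \<forall>j<m. dot n (u i) (u j) = (if i = j then 1 else 0)) \<and>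
    (\<forall>i<m. \<forall>a<n. mv n A (u i) a = l i * u i a) \<and>
    (\<forall>i<m. \<forall>x. (\<forall>j<i. dot n (u j) x = 0) \<longrightarrow> dot n x (mv n A x) \<le> l i * dot n x x)"

lemma max_eigvecsD:
  assumes "max_eigvecs n A m l u"
  shows "\<And>i j. i < m \<Longrightarrow> j < m \<Longrightarrow> dot n (u i) (u j) = (if i = j then 1 else 0)"
    "\<And>i a. i < m \<Longrightarrow> a < n \<Longrightarrow> mv n A (u i) a = l i * u i a"
    "\<And>i x. i < m \<Longrightarrow> (\<And>j. j < i \<Longrightarrow> dot n (u j) x = 0) \<Longrightarrow> dot n x (mv n A x) \<le> l i * dot n x x"
  using assms unfolding max_eigvecs_def by blast+

text \<open>A maximiser of the quadratic form on the unit sphere of the orthogonal complement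
  of the eigenvectors found so far is an eigenvector.\<close>

lemma max_eigvecs_exist:
  assumes sym: "\<And>a b. a < n \<Longrightarrow> b < n \<Longrightarrow> A a b = A b a" and m: "m \<le> n"
  shows "\<exists>l u. max_eigvecs n A m l u"
  using m
proof (induction m)
  case 0 show ?case by (simp add: max_eigvecs_def)
next
  case (Suc m)
  then have "\<exists>l u. max_eigvecs n A m l u" by simp
  then obtain l u where "max_eigvecs n A m l u" by (elim exE)
  note o = max_eigvecsD(1)[OF this] and e = max_eigvecsD(2)[OF this] and mx = max_eigvecsD(3)[OF this]
  let ?S = "{x. dot n x x = 1 \<and> (\<forall>i<m. dot n (u i) x = 0) \<and> (\<forall>a\<ge>n. x a = 0)}"
  have ne: "?S \<noteq> {}"
  proof -
    have "m < n" using Suc.prems by simp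
    obtain x where x: "dot n x x = 1" "\<And>i. i < m \<Longrightarrow> dot n (u i) x = 0" "\<And>a. a \<ge> n \<Longrightarrow> x a = 0"
      using nontrivial_kernel[OF \<open>m < n\<close>, of u] by blast
    then have "x \<in> ?S" by simp
    then show ?thesis by (rule ex_in_conv[THEN iffD1, OF exI])
  qed
  have cont: "continuous_on ?S (\<lambda>x. dot n x (mv n A x))"
    unfolding mv_def by (intro continuous_on_dot continuous_on_coord continuous_on_sum continuous_on_mult continuous_on_const)
  obtain x where x: "x \<in> ?S" and xmax: "\<And>y. y \<in> ?S \<Longrightarrow> dot n y (mv n A y) \<le> dot n x (mv n A x)"
    using continuous_attains_sup[OF compact_constrained_sphere ne cont] by blast
  define \<mu> where "\<mu> = dot n x (mv n A x)"
  have hom: "dot n z (mv n A z) \<le> \<mu> * dot n z z" if z: "\<And>i. i < m \<Longrightarrow> dot n (u i) z = 0" for z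
  proof (cases "dot n z z = 0")
    case True
    then have "\<And>a. a < n \<Longrightarrow> z a = 0" by (simp add: dot_self_0_iff)
    then show ?thesis by (simp add: True dot_def)
  next
    case False
    define c where "c = inverse (nrm n z)"
    have c: "c\<^sup>2 * dot n z z = 1" using False by (simp add: c_def nrm_def power_inverse)
    define y where "y a = (if a < n then c * z a else 0)" for a
    have yz: "dot n w y = c * dot n w z" for w
      by (simp add: dot_def y_def sum_distrib_left mult.left_commute)
    have my: "mv n A y a = c * mv n A z a" for a
      by (simp add: mv_def y_def sum_distrib_left mult.left_commute)
    have "dot n y y = c\<^sup>2 * dot n z z" using yz[of y] yz[of z] by (simp add: dot_commute power2_eq_square)
    then have "y \<in> ?S" using c z by (auto simp: yz) (simp add: y_def)
    then have "dot n y (mv n A y) \<le> \<mu>" unfolding \<mu>_def by (rule xmax)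
    also have "dot n y (mv n A y) = c\<^sup>2 * dot n z (mv n A z)"
      unfolding my[abs_def] dot_scale_right using yz[of "mv n A z"] by (simp add: dot_commute power2_eq_square)
    finally have "c\<^sup>2 * dot n z (mv n A z) \<le> c\<^sup>2 * (\<mu> * dot n z z)" using c by (simp add: mult.left_commute)
    moreover have "c\<^sup>2 > 0" using c by (metis mult_zero_left zero_less_power2 zero_neq_one power_zero_numeral)
    ultimately show ?thesis by simp
  qed
  have ux: "dot n (u i) x = 0" if "i < m" for i using x that by simp
  have stat: "dot n y (mv n A x) = \<mu> * dot n y x" if y: "\<And>i. i < m \<Longrightarrow> dot n (u i) y = 0" for y
  proof -
    define p where "p = dot n y (mv n A x) - \<mu> * dot n y x"
    define r where "r = \<mu> * dot n y y - dot n y (mv n A y)"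
    have q: "2 * t * p \<le> t\<^sup>2 * r" for t
    proof -
      have "dot n (\<lambda>a. x a + t * y a) (mv n A (\<lambda>a. x a + t * y a)) \<le> \<mu> * dot n (\<lambda>a. x a + t * y a) (\<lambda>a. x a + t * y a)"
        by (rule hom) (simp add: dot_simps ux y)
      moreover have "dot n x (mv n A y) = dot n y (mv n A x)"
        using dot_mv_sym[of n A x y, OF sym] by (simp add: dot_commute)
      ultimately show ?thesis using x
        by (simp add: mv_add[abs_def] mv_scale[abs_def] dot_simps \<mu>_def[symmetric] dot_commute[of n x y]
            p_def r_def power2_eq_square algebra_simps)
    qed
    have "p = 0"
    proof (rule ccontr)
      assume p0: "p \<noteq> 0"
      define t where "t = p / (\<bar>r\<bar> + 1)"
      have tp: "t * p > 0"
      proof -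
        have "p * p > 0" using p0 by (simp add: zero_less_mult_iff linorder_neq_iff) (use p0 in linarith)
        then show ?thesis by (simp add: t_def divide_pos_pos)
      qed
      have "t\<^sup>2 * r \<le> t\<^sup>2 * (\<bar>r\<bar> + 1)" by (intro mult_left_mono) auto
      also have "\<dots> = t * p"
      proof -
        have "t * (\<bar>r\<bar> + 1) = p" by (simp add: t_def)
        then show ?thesis by (metis mult.assoc power2_eq_square)
      qed
      finally show False using q[of t] tp by (simp add: mult.assoc)
    qed
    then show ?thesis by (simp add: p_def)
  qed
  define w where "w a = mv n A x a - \<mu> * x a" for a
  have uw: "dot n (u i) w = 0" if "i < m" for i
  proof -
    have "dot n (u i) (mv n A x) = dot n (mv n A (u i)) x" by (rule dot_mv_sym[OF sym])
    also have "\<dots> = dot n (\<lambda>a. l i * u i a) x" by (rule dot_cong) (simp_all add: e that)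
    finally show ?thesis by (simp add: w_def[abs_def] dot_simps ux that)
  qed
  have "dot n w w = 0"
    using stat[OF uw] by (subst (2) w_def[abs_def]) (simp add: dot_simps)
  then have ex: "mv n A x a = \<mu> * x a" if "a < n" for a
    using that by (auto simp: dot_self_0_iff w_def)
  show ?case unfolding max_eigvecs_def
  proof (intro exI[of _ "l(m := \<mu>)"] exI[of _ "u(m := x)"] conjI allI impI)
    fix i j assume "i < Suc m" "j < Suc m"
    then show "dot n ((u(m := x)) i) ((u(m := x)) j) = (if i = j then 1 else 0)"
    proof -
      have "dot n x x = 1" using x by simp
      moreover have "dot n x (u k) = 0" if "k < m" for k using ux[OF that] by (simp add: dot_commute)
      ultimately show ?thesis using \<open>i < Suc m\<close> \<open>j < Suc m\<close>
        by (cases "i = m"; cases "j = m") (simp_all add: o ux)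
    qed
  next
    fix i a assume "i < Suc m" "a < n"
    then show "mv n A ((u(m := x)) i) a = (l(m := \<mu>)) i * (u(m := x)) i a"
      using e ex by (auto simp: less_Suc_eq)
  next
    fix i y assume i: "i < Suc m" and y: "\<forall>j<i. dot n ((u(m := x)) j) y = 0"
    show "dot n y (mv n A y) \<le> (l(m := \<mu>)) i * dot n y y"
    proof (cases "i = m")
      case True then show ?thesis using hom[of y] y by simp
    next
      case False then show ?thesis using mx[of i y] y i by simp
    qed
  qed
qed

lemma spec_eigenI:
  assumes o: "orthon n u" and l: "\<And>i j. i \<in> {1..n} \<Longrightarrow> j \<in> {1..n} \<Longrightarrow> i \<le> j \<Longrightarrow> l j \<le> l i"
    and e: "\<And>i a. i \<in> {1..n} \<Longrightarrow> a < n \<Longrightarrow> mv n A (u i) a = l i * u i a"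
  shows "spec n A l u"
  unfolding spec_def
proof (intro conjI allI impI ballI)
  fix a b assume ab: "a < n" "b < n"
  have "A a b = mv n A (\<lambda>c. if c = b then 1 else 0) a"
    using ab by (simp add: mv_def if_distrib cong: if_cong)
  also have "\<dots> = mv n A (\<lambda>c. \<Sum>j\<in>{1..n}. u j b * u j c) a"
  proof (rule mv_cong)
    fix c assume "c < n"
    then show "(if c = b then 1 else 0) = (\<Sum>j\<in>{1..n}. u j b * u j c)"
      using orthon_complete[OF o ab(2), of c] by auto
  qed simp
  also have "\<dots> = (\<Sum>j\<in>{1..n}. u j b * mv n A (u j) a)" by (rule mv_sum)
  also have "\<dots> = comb n l u a b" unfolding comb_def by (intro sum.cong refl) (simp add: e ab)
  finally show "A a b = comb n l u a b" .
qed (use o l in auto)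

theorem spectral_theorem:
  assumes sym: "\<And>a b. a < n \<Longrightarrow> b < n \<Longrightarrow> A a b = A b a"
  obtains l u where "spec n A l u"
proof -
  obtain l u where "max_eigvecs n A n l u" using max_eigvecs_exist[of n A n, OF sym] by auto
  note o = max_eigvecsD(1)[OF this] and e = max_eigvecsD(2)[OF this] and mx = max_eigvecsD(3)[OF this]
  have "spec n A (\<lambda>i. l (i - 1)) (\<lambda>i. u (i - 1))"
  proof (rule spec_eigenI)
    show "orthon n (\<lambda>i. u (i - 1))" unfolding orthon_def by (auto simp: o)
    fix i j assume ij: "i \<in> {1..n}" "j \<in> {1..n}" "i \<le> j"
    have "dot n (u (j - 1)) (mv n A (u (j - 1))) = dot n (u (j - 1)) (\<lambda>a. l (j - 1) * u (j - 1) a)"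
      by (rule dot_cong) (use e ij in auto)
    then have "dot n (u (j - 1)) (mv n A (u (j - 1))) = l (j - 1)"
      using o[of "j - 1" "j - 1"] ij by (simp add: dot_simps)
    then show "l (j - 1) \<le> l (i - 1)"
      using mx[of "i - 1" "u (j - 1)"] o[of "j - 1" "j - 1"] o[of _ "j - 1"] ij by auto
  qed (use e in auto)
  then show thesis by (rule that)
qed

section \<open>Matrix powers and truncation\<close>

definition ent :: "real mat \<Rightarrow> nat \<Rightarrow> nat \<Rightarrow> real" where "ent A a b = A $$ (a, b)"

text \<open>An orthonormal eigenbasis makes \<open>A\<close> similar to a diagonal matrix, whose
  characteristic polynomial has the diagonal entries as roots.\<close>

lemma eigval_spec:
  assumes A: "A \<in> carrier_mat n n" and s: "spec n (ent A) l u" and j: "j \<in> {1..n}"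
  shows "eigval A j = l j"
proof -
  let ?U = "Matrix.mat n n (\<lambda>(a, j). u (Suc j) a)"
  let ?D = "Matrix.mat n n (\<lambda>(i, j). if i = j then l (Suc i) else 0)"
  note o = specD(1)[OF s]
  have U: "?U \<in> carrier_mat n n" by simp
  have 1: "transpose_mat ?U * ?U = 1\<^sub>m n"
    using o by (intro eq_matI) (auto simp: scalar_prod_def orthon_def dot_def atLeast0LessThan)
  have 2: "?U * transpose_mat ?U = 1\<^sub>m n"
    using mat_mult_left_right_inverse[of "transpose_mat ?U" n ?U] 1 by auto
  have UD: "?U * ?D = Matrix.mat n n (\<lambda>(a, j). l (Suc j) * u (Suc j) a)"
    by (intro eq_matI) (auto simp: scalar_prod_def if_distrib cong: if_cong)
  have "A = ?U * ?D * transpose_mat ?U"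
  proof (rule eq_matI)
    fix a b assume ab: "a < dim_row (?U * ?D * transpose_mat ?U)" "b < dim_col (?U * ?D * transpose_mat ?U)"
    then have "(?U * ?D * transpose_mat ?U) $$ (a, b) = (\<Sum>j<n. l (Suc j) * u (Suc j) a * u (Suc j) b)"
      unfolding UD by (simp add: scalar_prod_def atLeast0LessThan)
    also have "\<dots> = comb n l u a b" unfolding comb_def by (simp only: sum.atLeast1_atMost_eq One_nat_def)
    also have "\<dots> = A $$ (a, b)" using specD(3)[OF s, of a b] ab by (simp add: ent_def)
    finally show "A $$ (a, b) = (?U * ?D * transpose_mat ?U) $$ (a, b)" by simp
  qed (use A in auto)
  then have "similar_mat A ?D"
    using 1 2 A by (intro similar_matI[of _ _ ?U "transpose_mat ?U" n]) auto
  then have "char_poly A = char_poly ?D" by (rule char_poly_similar)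
  also have "\<dots> = (\<Prod>a \<leftarrow> diag_mat ?D. [:- a, 1:])"
    by (rule char_poly_upper_triangular[of _ n]) (auto simp: upper_triangular_def)
  finally have "proots (char_poly A) = proots (\<Prod>a \<leftarrow> diag_mat ?D. [:- a, 1:])" by simp
  also have "\<dots> = (\<Sum>p \<leftarrow> map (\<lambda>a. [:- a, 1:]) (diag_mat ?D). proots p)"
  proof -
    have "0 \<notin> set (map (\<lambda>a. [:- a, 1:]) (diag_mat ?D))" by auto
    from proots_prod_list[OF this] show ?thesis by simp
  qed
  also have "\<dots> = mset (diag_mat ?D)"
  proof -
    have "(\<Sum>p \<leftarrow> map (\<lambda>a. [:- a, 1:]) xs. proots p) = mset xs" for xs :: "real list"
      by (induction xs) auto
    then show ?thesis by blast
  qed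
  finally have "proots (char_poly A) = mset (diag_mat ?D)" .
  moreover have "sort (diag_mat ?D) = rev (map (\<lambda>i. l (Suc i)) [0..<n])"
  proof (rule properties_for_sort)
    have "diag_mat ?D = map (\<lambda>i. l (Suc i)) [0..<n]" by (auto simp: diag_mat_def)
    then show "mset (rev (map (\<lambda>i. l (Suc i)) [0..<n])) = mset (diag_mat ?D)" by simp
    show "sorted (rev (map (\<lambda>i. l (Suc i)) [0..<n]))"
      by (auto simp: sorted_rev_iff_nth_mono intro!: specD(2)[OF s])
  qed
  ultimately have "eigval A j = map (\<lambda>i. l (Suc i)) [0..<n] ! (j - 1)"
    by (simp add: eigval_def)
  then show ?thesis using j by auto
qed

lemma spec_l_cong: "(\<And>j. j \<in> {1..n} \<Longrightarrow> l j = l' j) \<Longrightarrow> spec n A l u \<Longrightarrow> spec n A l' u"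
proof -
  assume l: "\<And>j. j \<in> {1..n} \<Longrightarrow> l j = l' j" and s: "spec n A l u"
  have "comb n l u a b = comb n l' u a b" for a b
    unfolding comb_def by (intro sum.cong refl) (simp add: l)
  then show "spec n A l' u" using s l unfolding spec_def by (metis (no_types, lifting))
qed

lemma spec_eigval:
  assumes "A \<in> carrier_mat n n" "spec n (ent A) l u"
  shows "spec n (ent A) (eigval A) u"
  by (rule spec_l_cong[OF _ assms(2)]) (simp add: eigval_spec[OF assms])

lemma eigenbasis_iff:
  assumes A: "A \<in> carrier_mat n n"
  shows "eigenbasis A u \<longleftrightarrow> (\<forall>i\<in>{1..n}. u i \<in> carrier_vec n) \<and> spec n (ent A) (eigval A) (\<lambda>i a. u i $ a)"
proof -
  have o: "orthon n (\<lambda>i a. u i $ a) \<longleftrightarrow> (\<forall>i\<in>{1..n}. \<forall>j\<in>{1..n}. u i \<bullet> u j = (if i = j then 1 else 0))"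
    if "\<forall>i\<in>{1..n}. u i \<in> carrier_vec n"
  proof -
    have "u i \<bullet> u j = dot n (\<lambda>a. u i $ a) (\<lambda>a. u j $ a)" if "j \<in> {1..n}" for i j
      using bspec[OF \<open>\<forall>i\<in>{1..n}. u i \<in> carrier_vec n\<close> that]
      by (auto simp: dot_def scalar_prod_def atLeast0LessThan)
    then show ?thesis unfolding orthon_def by auto
  qed
  have m: "A = Matrix.mat n n (\<lambda>(a, b). \<Sum>j\<in>{1..n}. eigval A j * u j $ a * u j $ b) \<longleftrightarrow>
     (\<forall>a<n. \<forall>b<n. ent A a b = comb n (eigval A) (\<lambda>i a. u i $ a) a b)" (is "_ = ?B \<longleftrightarrow> ?rhs")
  proof
    assume e: "A = ?B"
    show ?rhs
    proof (intro allI impI)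
      fix a b assume ab: "a < n" "b < n"
      have "ent A a b = ?B $$ (a, b)" unfolding ent_def using e by (rule arg_cong)
      then show "ent A a b = comb n (eigval A) (\<lambda>i a. u i $ a) a b" using ab by (simp add: comb_def)
    qed
  next
    assume ?rhs
    then show "A = ?B" using A by (intro eq_matI) (auto simp: ent_def comb_def)
  qed
  have d: "dim_row A = n" using A by auto
  show ?thesis
  proof
    assume e: "eigenbasis A u"
    then have c: "\<forall>i\<in>{1..n}. u i \<in> carrier_vec n" and on: "orthon n (\<lambda>i a. u i $ a)"
      and ma: "\<forall>a<n. \<forall>b<n. ent A a b = comb n (eigval A) (\<lambda>i a. u i $ a) a b"
      using o m by (auto simp: eigenbasis_def Let_def d)
    have "ent A a b = ent A b a" if "a < n" "b < n" for a b
      using ma that by (simp add: comb_sym)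
    then obtain l w where "spec n (ent A) l w" using spectral_theorem by blast
    then have "spec n (ent A) (eigval A) w" by (rule spec_eigval[OF A])
    then have "spec n (ent A) (eigval A) (\<lambda>i a. u i $ a)" using on ma unfolding spec_def by blast
    then show "(\<forall>i\<in>{1..n}. u i \<in> carrier_vec n) \<and> spec n (ent A) (eigval A) (\<lambda>i a. u i $ a)" using c by blast
  next
    assume "(\<forall>i\<in>{1..n}. u i \<in> carrier_vec n) \<and> spec n (ent A) (eigval A) (\<lambda>i a. u i $ a)"
    then show "eigenbasis A u" using o m A by (auto simp: eigenbasis_def Let_def d spec_def)
  qed
qed

lemma eigenbasis_of_spec:
  assumes A: "A \<in> carrier_mat n n" and s: "spec n (ent A) l u"
  shows "eigenbasis A (\<lambda>i. Matrix.vec n (u i))"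
proof -
  have o: "orthon n (\<lambda>i a. Matrix.vec n (u i) $ a)"
  proof -
    have "dot n (\<lambda>a. Matrix.vec n (u i) $ a) (\<lambda>a. Matrix.vec n (u j) $ a) = dot n (u i) (u j)" for i j
      by (rule dot_cong) auto
    then show ?thesis using specD(1)[OF s] by (simp add: orthon_def)
  qed
  note s' = spec_eigval[OF A s]
  have "spec n (ent A) (eigval A) (\<lambda>i a. Matrix.vec n (u i) $ a)"
    unfolding spec_def
  proof (intro conjI o allI impI)
    show "\<forall>i\<in>{1..n}. \<forall>j\<in>{1..n}. i \<le> j \<longrightarrow> eigval A j \<le> eigval A i" using specD(2)[OF s'] by blast
    fix a b assume "a < n" "b < n"
    then show "ent A a b = comb n (eigval A) (\<lambda>i a. Matrix.vec n (u i) $ a) a b"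
      using specD(3)[OF s', of a b] by (simp add: comb_def)
  qed
  then show ?thesis by (simp add: eigenbasis_iff[OF A])
qed

text \<open>By uniqueness of spectral functions the power can be computed from any
  eigendecomposition, and need not refer to the selected one.\<close>

lemma mat_power_spec:
  assumes A: "A \<in> carrier_mat n n" and s: "spec n (ent A) l u" and ab: "a < n" "b < n"
  shows "ent (mat_power A \<alpha>) a b = comb n (\<lambda>j. if l j > 0 then l j powr \<alpha> else 0) u a b"
proof -
  define w where "w = (SOME u. eigenbasis A u)"
  have "eigenbasis A w" unfolding w_def by (rule someI[where P = "eigenbasis A"], rule eigenbasis_of_spec[OF A s])
  then have w: "spec n (ent A) (eigval A) (\<lambda>i a. w i $ a)" by (simp add: eigenbasis_iff[OF A])
  have "ent (mat_power A \<alpha>) a b =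
      (\<Sum>j | j \<in> {1..n} \<and> eigval A j > 0. eigval A j powr \<alpha> * w j $ a * w j $ b)"
    using A ab by (simp add: mat_power_def Let_def ent_def w_def)
  also have "\<dots> = comb n (\<lambda>j. if eigval A j > 0 then eigval A j powr \<alpha> else 0) (\<lambda>i a. w i $ a) a b"
    unfolding comb_def by (rule sum.mono_neutral_cong_left) auto
  also have "\<dots> = comb n (\<lambda>j. if l j > 0 then l j powr \<alpha> else 0) u a b"
    by (rule spec_fun_unique[OF s w _ ab]) auto
  finally show ?thesis .
qed

lemma mat_power_carrier: "A \<in> carrier_mat n n \<Longrightarrow> mat_power A \<alpha> \<in> carrier_mat n n"
  by (auto simp: mat_power_def Let_def)

lemma mv_ent: "A \<in> carrier_mat n n \<Longrightarrow> v \<in> carrier_vec n \<Longrightarrow> a < n \<Longrightarrow> (A *\<^sub>v v) $ a = mv n (ent A) (\<lambda>a. v $ a) a"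
  by (auto simp: mv_def ent_def scalar_prod_def atLeast0LessThan)

lemma mv_ent_mult:
  assumes "A \<in> carrier_mat n n" "B \<in> carrier_mat n n" "a < n"
  shows "mv n (ent (A * B)) x a = mv n (ent A) (mv n (ent B) x) a"
proof -
  have "mv n (ent (A * B)) x a = (\<Sum>b<n. \<Sum>c<n. A $$ (a, c) * B $$ (c, b) * x b)"
    unfolding mv_def ent_def using assms
    by (intro sum.cong refl) (auto simp: scalar_prod_def atLeast0LessThan sum_distrib_right)
  also have "\<dots> = (\<Sum>c<n. \<Sum>b<n. A $$ (a, c) * B $$ (c, b) * x b)" by (rule sum.swap)
  also have "\<dots> = mv n (ent A) (mv n (ent B) x) a"
    unfolding mv_def ent_def by (intro sum.cong refl) (simp add: sum_distrib_left mult.assoc)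
  finally show ?thesis .
qed

lemma mv_comb_u:
  assumes "orthon n u" "i \<in> {1..n}"
  shows "mv n (comb n c u) (u i) a = c i * u i a"
proof -
  have "mv n (comb n c u) (u i) a = (\<Sum>j\<in>{1..n}. if j = i then c j * u j a else 0)"
    unfolding mv_comb using assms by (intro sum.cong refl) (auto simp: orthon_def)
  then show ?thesis using assms(2) by simp
qed

lemma spec_mv_u: "spec n A l u \<Longrightarrow> i \<in> {1..n} \<Longrightarrow> a < n \<Longrightarrow> mv n A (u i) a = l i * u i a"
  by (simp add: spec_mv mv_comb_u specD(1))

text \<open>The eigenvectors stay the same and the eigenvalues from \<open>k + 1\<close> on become 0.
  This keeps the order because the eigenvalues of \<open>A\<close> are nonnegative.\<close>

lemma truncated_spec:
  assumes A: "A \<in> carrier_mat n n" and s: "spec n (ent A) l u" and l: "\<And>j. j \<in> {1..n} \<Longrightarrow> l j \<ge> 0"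
    and P: "P = Matrix.mat n n (\<lambda>(a, b). \<Sum>j\<in>{1..k}. u j a * u j b)" and k: "k \<le> n"
  shows "spec n (ent (P * A * P)) (\<lambda>j. if j \<le> k then l j else 0) u"
proof (rule spec_eigenI)
  note o = specD(1)[OF s]
  show "orthon n u" by (rule o)
  show "(if j \<le> k then l j else 0) \<le> (if i \<le> k then l i else 0)" if "i \<in> {1..n}" "j \<in> {1..n}" "i \<le> j" for i j
    using that l specD(2)[OF s that] by auto
  have Pc: "P \<in> carrier_mat n n" by (simp add: P)
  have PA: "P * A \<in> carrier_mat n n" using Pc A by simp
  have entP: "ent P a b = comb n (\<lambda>j. if j \<le> k then 1 else 0) u a b" if "a < n" "b < n" for a b
    unfolding comb_def using that k by (simp add: P ent_def) (rule sum.mono_neutral_cong_left, auto)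
  have mP: "mv n (ent P) x a = mv n (comb n (\<lambda>j. if j \<le> k then 1 else 0) u) x a" if "a < n" for x a
    using that by (intro mv_cong entP) auto
  fix i a assume i: "i \<in> {1..n}" and a: "a < n"
  define e where "e = (if i \<le> k then 1 else 0 :: real)"
  have Pu: "mv n (ent P) (u i) a = e * u i a" if "a < n" for a
    using mP[OF that] mv_comb_u[OF o i] by (simp add: e_def)
  have Au: "mv n (ent A) (u i) a = l i * u i a" if "a < n" for a by (rule spec_mv_u[OF s i that])
  have 1: "mv n (ent (P * A)) (u i) a = l i * e * u i a" if "a < n" for a
  proof -
    have "mv n (ent (P * A)) (u i) a = mv n (ent P) (\<lambda>b. l i * u i b) a"
      unfolding mv_ent_mult[OF Pc A that] by (rule mv_cong) (simp_all add: Au)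
    then show ?thesis by (simp add: mv_scale Pu that)
  qed
  have "mv n (ent (P * A * P)) (u i) a = mv n (ent (P * A)) (\<lambda>b. e * u i b) a"
    unfolding mv_ent_mult[OF PA Pc a] by (rule mv_cong) (simp_all add: Pu)
  then show "mv n (ent (P * A * P)) (u i) a = (if i \<le> k then l i else 0) * u i a"
    by (simp add: mv_scale 1 a e_def)
qed

lemma eigvals_nonneg:
  assumes "spec n A l u" "\<And>x. dot n x (mv n A x) \<ge> 0" "j \<in> {1..n}"
  shows "l j \<ge> 0"
  using assms(2)[of "u j"] spec_dot_u[OF assms(1,3), of "u j"] specD(1)[OF assms(1)] assms(3)
  by (simp add: orthon_def)

lemma trace_eigvals:
  assumes "spec n A l u"
  shows "(\<Sum>a<n. A a a) = (\<Sum>j\<in>{1..n}. l j)"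
proof -
  have "(\<Sum>a<n. A a a) = (\<Sum>a<n. \<Sum>j\<in>{1..n}. l j * u j a * u j a)"
    by (intro sum.cong refl) (simp add: specD(3)[OF assms] comb_def)
  also have "\<dots> = (\<Sum>j\<in>{1..n}. \<Sum>a<n. l j * u j a * u j a)" by (rule sum.swap)
  also have "\<dots> = (\<Sum>j\<in>{1..n}. l j * dot n (u j) (u j))"
    by (simp add: dot_def sum_distrib_left mult.assoc)
  also have "\<dots> = (\<Sum>j\<in>{1..n}. l j)"
    using specD(1)[OF assms] by (intro sum.cong refl) (auto simp: orthon_def)
  finally show ?thesis .
qed

section \<open>Stability of truncated inverses across a spectral gap\<close>

definition first_k :: "nat \<Rightarrow> nat \<Rightarrow> real" where
  "first_k k = (\<lambda>j. if j \<le> k then 1 else 0)"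

text \<open>The eigenvalues of the Moore-Penrose inverse of a matrix that is truncated to its
  first \<open>k\<close> eigenvectors.\<close>

definition tinv :: "nat \<Rightarrow> (nat \<Rightarrow> real) \<Rightarrow> nat \<Rightarrow> real" where
  "tinv k l = (\<lambda>j. if j \<le> k \<and> l j > 0 then 1 / l j else 0)"

text \<open>By Weyl's inequality each eigenvalue moves by at most half of the gap, so the
  first \<open>k\<close> eigenvalues of \<open>B\<close> are still separated from the remaining ones of \<open>A\<close>, and
  conversely. For \<open>k = 0\<close> and \<open>k = n\<close> there is nothing to separate.\<close>

lemma separated_eigenvalues:
  assumes A: "spec n A l u" and B: "spec n B l' v" and k: "k \<le> n" and g: "g > 0"
    and lk: "k = 0 \<or> l k \<ge> g" and gap: "k = 0 \<or> k = n \<or> l k - l (Suc k) \<ge> g"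
    and F: "frob n (\<lambda>a b. B a b - A a b) \<le> g / 2"
    and i: "i \<in> {1..n}" and j: "j \<in> {1..n}"
  shows "i \<le> k \<Longrightarrow> l' i \<ge> g / 2" "j \<le> k \<Longrightarrow> l j \<ge> g"
    "i \<le> k \<Longrightarrow> k < j \<Longrightarrow> l' i - l j \<ge> g / 2" "j \<le> k \<Longrightarrow> k < i \<Longrightarrow> l j - l' i \<ge> g / 2"
proof -
  have w: "l' m - l m \<le> g / 2" "l m - l' m \<le> g / 2" if "m \<in> {1..n}" for m
    using weyl[OF A B that] F by linarith+
  have 1: "l m \<ge> l k" if "m \<in> {1..n}" "m \<le> k" for m
    using specD(2)[OF A that(1), of k] that k by auto
  have 2: "l m \<le> l (Suc k)" if "m \<in> {1..n}" "k < m" for m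
    using specD(2)[OF A _ that(1), of "Suc k"] that k by auto
  have 3: "l' m \<le> l' (Suc k)" if "m \<in> {1..n}" "k < m" for m
    using specD(2)[OF B _ that(1), of "Suc k"] that k by auto
  have 4: "l' m \<ge> l' k" if "m \<in> {1..n}" "m \<le> k" for m
    using specD(2)[OF B that(1), of k] that k by auto
  show "l' i \<ge> g / 2" if "i \<le> k" using 1[OF i that] w(2)[OF i] lk that i by auto
  show "l j \<ge> g" if "j \<le> k" using 1[OF j that] lk that j by auto
  show "l' i - l j \<ge> g / 2" if "i \<le> k" "k < j"
    using 1[OF i that(1)] 2[OF j that(2)] w[OF i] gap that i j by auto
  show "l j - l' i \<ge> g / 2" if "j \<le> k" "k < i"
  proof -
    have "l' (Suc k) - l (Suc k) \<le> g / 2" using w(1)[of "Suc k"] that i by auto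
    then show ?thesis using 1[OF j that(1)] 3[OF i that(2)] gap that i j by auto
  qed
qed

text \<open>The reciprocal has Lipschitz constant at most \<open>2 / g\<^sup>2\<close> on the first \<open>k\<close>
  eigenvalues, which are at least \<open>g / 2\<close>. For pairs on different sides of the gap, values
  that differ by at most \<open>2 / g\<close> belong to eigenvalues at distance at least
  \<open>g / 2\<close>.\<close>

lemma tinv_stable:
  assumes A: "spec n A l u" and B: "spec n B l' v" and k: "k \<le> n" and g: "g > 0"
    and lk: "k = 0 \<or> l k \<ge> g" and gap: "k = 0 \<or> k = n \<or> l k - l (Suc k) \<ge> g"
    and F: "frob n (\<lambda>a b. B a b - A a b) \<le> g / 2"
  shows "frob n (\<lambda>a b. comb n (tinv k l') v a b - comb n (tinv k l) u a b) \<le> 4 / g\<^sup>2 * frob n (\<lambda>a b. B a b - A a b)"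
proof (rule spectral_lipschitz[OF A B])
  show "0 \<le> 4 / g\<^sup>2" by simp
  fix i j assume ij: "i \<in> {1..n}" "j \<in> {1..n}"
  note s = separated_eigenvalues[OF assms ij]
  have big: "1 / y \<le> 4 / g\<^sup>2 * z" if "y \<ge> g / 2" "z \<ge> g / 2" for y z
  proof -
    have "1 / y \<le> 1 / (g / 2)" using that g by (intro divide_left_mono) auto
    also have "\<dots> = 4 / g\<^sup>2 * (g / 2)" using g by (simp add: power2_eq_square)
    also have "\<dots> \<le> 4 / g\<^sup>2 * z" using that by (intro mult_left_mono) auto
    finally show ?thesis .
  qed
  show "\<bar>tinv k l' i - tinv k l j\<bar> \<le> 4 / g\<^sup>2 * \<bar>l' i - l j\<bar>"
  proof (cases "i \<le> k"; cases "j \<le> k")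
    assume c: "i \<le> k" "j \<le> k"
    have p: "l' i \<ge> g / 2" "l j \<ge> g" using s c by auto
    then have p': "l' i > 0" "l j > 0" using g by linarith+
    have "\<bar>1 / l' i - 1 / l j\<bar> = 1 / (l' i * l j) * \<bar>l' i - l j\<bar>"
    proof -
      have "1 / l' i - 1 / l j = (l j - l' i) / (l' i * l j)" using p' by (simp add: field_simps)
      then show ?thesis using p' by (simp add: abs_mult abs_minus_commute)
    qed
    also have "\<dots> \<le> 4 / g\<^sup>2 * \<bar>l' i - l j\<bar>"
    proof (rule mult_right_mono)
      have "g / 2 * g \<le> l' i * l j" using p g by (intro mult_mono) auto
      then have "1 / (l' i * l j) \<le> 1 / (g / 2 * g)" using g p' by (intro divide_left_mono) auto
      also have "\<dots> \<le> 4 / g\<^sup>2" using g by (simp add: power2_eq_square divide_simps)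
      finally show "1 / (l' i * l j) \<le> 4 / g\<^sup>2" .
    qed simp
    finally show ?thesis using c p' by (simp add: tinv_def)
  next
    assume c: "i \<le> k" "\<not> j \<le> k"
    have "1 / l' i \<le> 4 / g\<^sup>2 * \<bar>l' i - l j\<bar>"
      using s(1,3) c abs_ge_self[of "l' i - l j"] by (intro big) linarith+
    then show ?thesis using c s(1) g by (simp add: tinv_def)
  next
    assume c: "\<not> i \<le> k" "j \<le> k"
    have "1 / l j \<le> 4 / g\<^sup>2 * \<bar>l' i - l j\<bar>" using s c g by (intro big) auto
    then show ?thesis using c s(2) g by (simp add: tinv_def)
  qed (simp add: tinv_def)
qed

text \<open>The parameters \<open>\<alpha>\<close> and \<open>\<beta>\<close> cover the spectral projection and its
  complement.\<close>

lemma first_k_stable: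
  assumes A: "spec n A l u" and B: "spec n B l' v" and k: "k \<le> n" and g: "g > 0"
    and lk: "k = 0 \<or> l k \<ge> g" and gap: "k = 0 \<or> k = n \<or> l k - l (Suc k) \<ge> g"
    and F: "frob n (\<lambda>a b. B a b - A a b) \<le> g / 2"
  shows "frob n (\<lambda>a b. comb n (\<lambda>j. \<alpha> + \<beta> * first_k k j) v a b - comb n (\<lambda>j. \<alpha> + \<beta> * first_k k j) u a b)
     \<le> \<bar>\<beta>\<bar> * (2 / g) * frob n (\<lambda>a b. B a b - A a b)"
proof (rule spectral_lipschitz[OF A B])
  show "0 \<le> \<bar>\<beta>\<bar> * (2 / g)" using g by simp
  fix i j assume ij: "i \<in> {1..n}" "j \<in> {1..n}"
  note s = separated_eigenvalues[OF assms ij]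
  have "\<bar>first_k k i - first_k k j\<bar> \<le> 2 / g * \<bar>l' i - l j\<bar>"
    using s(3,4) g by (cases "i \<le> k"; cases "j \<le> k") (auto simp: first_k_def divide_simps abs_if)
  then have "\<bar>\<beta>\<bar> * \<bar>first_k k i - first_k k j\<bar> \<le> \<bar>\<beta>\<bar> * (2 / g * \<bar>l' i - l j\<bar>)" by (rule mult_left_mono) simp
  moreover have "\<bar>\<alpha> + \<beta> * first_k k i - (\<alpha> + \<beta> * first_k k j)\<bar> = \<bar>\<beta>\<bar> * \<bar>first_k k i - first_k k j\<bar>"
    by (simp add: abs_mult[symmetric] right_diff_distrib)
  ultimately show "\<bar>\<alpha> + \<beta> * first_k k i - (\<alpha> + \<beta> * first_k k j)\<bar> \<le> \<bar>\<beta>\<bar> * (2 / g) * \<bar>l' i - l j\<bar>"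
    by (simp add: mult.assoc)
qed

lemma quad_spec: "spec n A l u \<Longrightarrow> dot n x (mv n A x) = (\<Sum>j\<in>{1..n}. l j * (dot n (u j) x)\<^sup>2)"
  by (simp add: spec_dot_mv dot_mv_comb power2_eq_square mult.assoc)

lemma quad_le:
  assumes A: "spec n A l u" and "\<And>j. j \<in> {1..n} \<Longrightarrow> l j \<le> K"
  shows "dot n x (mv n A x) \<le> K * (nrm n x)\<^sup>2"
  unfolding quad_spec[OF A] parseval_nrm[OF specD(1)[OF A]] sum_distrib_left
  by (intro sum_mono mult_right_mono assms) auto

lemma quad_add_le:
  assumes A: "spec n A l u" and l: "\<And>j. j \<in> {1..n} \<Longrightarrow> l j \<ge> 0"
  shows "dot n (\<lambda>a. x a + y a) (mv n A (\<lambda>a. x a + y a)) \<le> 2 * dot n x (mv n A x) + 2 * dot n y (mv n A y)"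
proof -
  have q: "(p + q)\<^sup>2 \<le> 2 * p\<^sup>2 + 2 * q\<^sup>2" for p q :: real
    using zero_le_power2[of "p - q"] by (simp add: power2_eq_square algebra_simps)
  have "dot n (\<lambda>a. x a + y a) (mv n A (\<lambda>a. x a + y a))
      \<le> (\<Sum>j\<in>{1..n}. l j * (2 * (dot n (u j) x)\<^sup>2 + 2 * (dot n (u j) y)\<^sup>2))"
    unfolding quad_spec[OF A] dot_add_right by (intro sum_mono mult_left_mono q l)
  also have "\<dots> = 2 * dot n x (mv n A x) + 2 * dot n y (mv n A y)"
    unfolding quad_spec[OF A] by (simp add: sum.distrib distrib_left sum_distrib_left mult.left_commute)
  finally show ?thesis .
qed

text \<open>Orders of magnitude: covariance matrices in dimension \<open>n\<close> have eigenvalues and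
  gaps of order \<open>n\<close>, and vectors of slice means have norm of order \<open>sqrt n\<close>. The errors are
  \<open>t * sqrt n\<close> for the matrix and \<open>t\<close> for the slice means. Then coefficient vectors, which
  are truncated inverses applied to slice means, have errors of order \<open>t / n\<close>; these are
  harmless in the quadratic form of \<open>A\<close>.\<close>

context
  fixes n k :: nat and A B :: "nat \<Rightarrow> nat \<Rightarrow> real" and l l' :: "nat \<Rightarrow> real"
    and u v :: "nat \<Rightarrow> nat \<Rightarrow> real" and c C C1 t :: real
  assumes A: "spec n A l u" and B: "spec n B l' v" and k: "k \<le> n" and n: "n \<ge> 1"
    and c: "c > 0" and lk: "k = 0 \<or> l k \<ge> c * n" and gap: "k = 0 \<or> k = n \<or> l k - l (Suc k) \<ge> c * n"
    and t: "0 \<le> t" "t \<le> 1" "t \<le> c / 2"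
    and F: "frob n (\<lambda>a b. B a b - A a b) \<le> t * sqrt n"
    and l0: "\<And>j. j \<in> {1..n} \<Longrightarrow> 0 \<le> l j" and lC: "\<And>j. j \<in> {1..n} \<Longrightarrow> l j \<le> C * n"
    and C1: "C1 \<ge> 0"
begin

private lemma sq: "sqrt n \<le> n" "sqrt n * sqrt n = n" "sqrt n > 0" "sqrt n \<ge> 1"
proof -
  show 1: "sqrt n \<ge> 1" "sqrt n > 0" "sqrt n * sqrt n = n" using n by auto
  show "sqrt n \<le> n" using mult_left_mono[OF 1(1), of "sqrt n"] by simp
qed

private lemma F2: "frob n (\<lambda>a b. B a b - A a b) \<le> c * n / 2"
proof -
  have "t * sqrt n \<le> c / 2 * n" using t sq(1) by (intro mult_mono) auto
  then show ?thesis using F by simp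
qed

private lemma g: "c * real n > 0" using c n by simp

private lemmas stab = tinv_stable[OF A B k g lk gap F2] first_k_stable[OF A B k g lk gap F2]

private lemma tinv_bound: "j \<in> {1..n} \<Longrightarrow> \<bar>tinv k l j\<bar> \<le> 1 / (c * n)"
proof -
  assume j: "j \<in> {1..n}"
  show ?thesis
  proof (cases "j \<le> k")
    case True
    then have "l j \<ge> c * n" using separated_eigenvalues(2)[OF A B k g lk gap F2 j j] by simp
    moreover from this have "l j > 0" using g by linarith
    ultimately show ?thesis using True g by (simp add: tinv_def divide_simps)
  qed (use g in \<open>simp add: tinv_def\<close>)
qed

lemma coefficient_error:
  assumes h: "nrm n h \<le> C1 * sqrt n" and hh: "nrm n (\<lambda>a. hh a - h a) \<le> t"
  shows "nrm n (\<lambda>a. mv n (comb n (tinv k l') v) hh a - mv n (comb n (tinv k l) u) h a)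
    \<le> (4 * (C1 + 1) / c\<^sup>2 + 1 / c) * t / n"
proof -
  let ?B' = "comb n (tinv k l') v" and ?B = "comb n (tinv k l) u"
  have hh': "nrm n hh \<le> (C1 + 1) * sqrt n"
    using nrm_triangle_diff[of n hh h] h hh t sq(4) unfolding distrib_right by linarith
  have "nrm n (\<lambda>a. mv n ?B' hh a - mv n ?B h a)
     = nrm n (\<lambda>a. mv n (\<lambda>a b. ?B' a b - ?B a b) hh a + mv n ?B (\<lambda>a. hh a - h a) a)"
    by (rule nrm_cong) (simp add: mv_diff_mat mv_diff)
  also have "\<dots> \<le> nrm n (mv n (\<lambda>a b. ?B' a b - ?B a b) hh) + nrm n (mv n ?B (\<lambda>a. hh a - h a))"
    by (rule nrm_triangle)
  also have "nrm n (mv n (\<lambda>a b. ?B' a b - ?B a b) hh) \<le> (4 / (c * n)\<^sup>2 * (t * sqrt n)) * ((C1 + 1) * sqrt n)"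
  proof (rule order_trans[OF nrm_mv_le_frob], rule mult_mono[OF _ hh'])
    show "frob n (\<lambda>a b. ?B' a b - ?B a b) \<le> 4 / (c * n)\<^sup>2 * (t * sqrt n)"
      using F by (intro order_trans[OF stab(1)] mult_left_mono) auto
    show "0 \<le> 4 / (c * n)\<^sup>2 * (t * sqrt n)" using t by simp
  qed simp
  also have "(4 / (c * n)\<^sup>2 * (t * sqrt n)) * ((C1 + 1) * sqrt n) = 4 / (c * n)\<^sup>2 * t * (C1 + 1) * (sqrt n * sqrt n)"
    by (simp only: mult_ac)
  also have "\<dots> = 4 * (C1 + 1) / c\<^sup>2 * t / n"
    unfolding sq(2) using n by (simp add: power2_eq_square) (simp add: algebra_simps)
  also have "nrm n (mv n ?B (\<lambda>a. hh a - h a)) \<le> 1 / (c * n) * t"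
    using nrm_mv_comb_le[OF specD(1)[OF A] tinv_bound] g hh
    by (intro order_trans[OF nrm_mv_comb_le[OF specD(1)[OF A] tinv_bound]] mult_left_mono) auto
  finally show ?thesis by (simp add: distrib_right add_divide_distrib)
qed

text \<open>The quadratic form of a covariance matrix at a difference of coefficient vectors
  is the squared mean-square distance of the corresponding combinations of the
  process.\<close>

lemma coefficient_error_quad:
  assumes h: "nrm n h \<le> C1 * sqrt n" and hh: "nrm n (\<lambda>a. hh a - h a) \<le> t"
    and x: "x = (\<lambda>a. mv n (comb n (tinv k l') v) hh a - mv n (comb n (tinv k l) u) h a)"
  shows "dot n x (mv n A x) \<le> C * (4 * (C1 + 1) / c\<^sup>2 + 1 / c)\<^sup>2 * t\<^sup>2"
proof -
  let ?K = "4 * (C1 + 1) / c\<^sup>2 + 1 / c"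
  have C0: "C \<ge> 0"
  proof -
    have "0 \<le> C * n" using l0[of 1] lC[of 1] n by auto
    then show ?thesis using n by (simp add: zero_le_mult_iff)
  qed
  have "dot n x (mv n A x) \<le> C * n * (nrm n x)\<^sup>2" by (rule quad_le[OF A lC])
  also have "\<dots> \<le> C * n * (?K * t / n)\<^sup>2"
    unfolding x using C0 by (intro mult_left_mono power_mono coefficient_error h hh) auto
  also have "\<dots> = C * ?K\<^sup>2 * t\<^sup>2 / n" using n by (simp add: power2_eq_square)
  also have "\<dots> \<le> C * ?K\<^sup>2 * t\<^sup>2 / 1" using C0 n by (intro divide_left_mono) auto
  finally show ?thesis by simp
qed

lemma coefficient_error_gram:
  assumes h: "nrm n h \<le> C1 * sqrt n" and hh: "nrm n (\<lambda>a. hh a - h a) \<le> t"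
    and h2: "nrm n h2 \<le> C1 * sqrt n" and hh2: "nrm n (\<lambda>a. hh2 a - h2 a) \<le> t"
  shows "\<bar>dot n hh2 (mv n (comb n (tinv k l') v) hh) - dot n h2 (mv n (comb n (tinv k l) u) h)\<bar>
    \<le> ((C1 + 1) * (4 * (C1 + 1) / c\<^sup>2 + 1 / c) + C1 / c) * t"
proof -
  let ?K = "4 * (C1 + 1) / c\<^sup>2 + 1 / c"
  let ?x = "mv n (comb n (tinv k l') v) hh" and ?y = "mv n (comb n (tinv k l) u) h"
  have hh2': "nrm n hh2 \<le> (C1 + 1) * sqrt n"
    using nrm_triangle_diff[of n hh2 h2] h2 hh2 t sq(4) unfolding distrib_right by linarith
  have y: "nrm n ?y \<le> 1 / (c * n) * (C1 * sqrt n)"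
    using g h by (intro order_trans[OF nrm_mv_comb_le[OF specD(1)[OF A] tinv_bound]] mult_left_mono) auto
  have K: "?K \<ge> 0" using C1 c by simp
  have e: "dot n hh2 ?x - dot n h2 ?y = dot n hh2 (\<lambda>a. ?x a - ?y a) + dot n (\<lambda>a. hh2 a - h2 a) ?y"
    by (simp add: dot_diff_left dot_diff_right)
  have "\<bar>dot n hh2 ?x - dot n h2 ?y\<bar> \<le> nrm n hh2 * nrm n (\<lambda>a. ?x a - ?y a) + nrm n (\<lambda>a. hh2 a - h2 a) * nrm n ?y"
    unfolding e using dot_le_nrm[of n hh2 "\<lambda>a. ?x a - ?y a"] dot_le_nrm[of n "\<lambda>a. hh2 a - h2 a" ?y] by linarith
  also have "\<dots> \<le> ((C1 + 1) * sqrt n) * (?K * t / n) + t * (1 / (c * n) * (C1 * sqrt n))"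
    using t C1 by (intro add_mono mult_mono hh2' coefficient_error h hh hh2 y) auto
  also have "\<dots> = ((C1 + 1) * ?K + C1 / c) * t * (sqrt n / n)" using c n by (simp add: field_simps)
  also have "\<dots> \<le> ((C1 + 1) * ?K + C1 / c) * t * 1"
    using sq(1) n t C1 c K by (intro mult_left_mono) (auto simp: divide_simps)
  finally show ?thesis by simp
qed

text \<open>Here the eigenvalues \<open>k + 1, \<dots>, m\<close> of \<open>A\<close> coincide, and the block of
  equal eigenvalues may extend beyond \<open>m\<close>. The truncation of the sample at \<open>m\<close> has no stable
  counterpart at \<open>m\<close> and is compared with the truncation of the population at \<open>k\<close>, in front of
  the block. The additional terms of the sample inverse have coefficients of order
  \<open>1 / l m\<close>, and they act on the part of the slice mean outside the first \<open>k\<close> eigenvectors,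
  which is small by the bound \<open>\<eta>\<close>.\<close>

context
  fixes m :: nat and \<kappa> \<eta> :: real
  assumes m: "k < m" "m \<le> n" and lm: "l (Suc k) = l m" and \<kappa>: "\<kappa> > 0" "\<kappa> \<le> l m" and l'm: "l' m \<ge> l m / 4" and \<eta>: "\<eta> \<ge> 0"
begin

private lemma l'pos: "j \<in> {1..n} \<Longrightarrow> j \<le> m \<Longrightarrow> l' j \<ge> l m / 4"
  using specD(2)[OF B, of j m] m l'm by auto

text \<open>What the truncated inverse at \<open>m\<close> adds to the one at \<open>k\<close>.\<close>

private definition rc :: "nat \<Rightarrow> real" where "rc j = (if k < j \<and> j \<le> m then 1 / l' j else 0)"

private lemma rc_bound: "j \<in> {1..n} \<Longrightarrow> 0 \<le> rc j \<and> rc j \<le> 4 / l m \<and> (rc j = 0 \<or> k < j)"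
  using l'pos[of j] \<kappa> by (auto simp: rc_def divide_simps)

private lemma tinv_split: "j \<in> {1..n} \<Longrightarrow> tinv m l' j = tinv k l' j + rc j"
proof -
  assume j: "j \<in> {1..n}"
  have "j \<le> m \<Longrightarrow> l' j > 0" using l'pos[OF j] \<kappa> by linarith
  then show ?thesis using m by (auto simp: tinv_def rc_def)
qed

private lemma mv_tinv_split: "mv n (comb n (tinv m l') v) x a = mv n (comb n (tinv k l') v) x a + mv n (comb n rc v) x a"
  unfolding mv_comb sum.distrib[symmetric] by (intro sum.cong refl) (simp add: tinv_split distrib_right)

text \<open>The norm of the component of \<open>x\<close> that is orthogonal to the first \<open>k\<close> eigenvectors
  of \<open>B\<close>.\<close>

private definition rho :: "(nat \<Rightarrow> real) \<Rightarrow> real" where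
  "rho x = nrm n (mv n (comb n (\<lambda>j. 1 + -1 * first_k k j) v) x)"

text \<open>Three errors add up: that of the slice mean, that of the spectral projection, and
  the mass of the population slice mean outside the first \<open>k\<close> eigenvectors. An eigenvalue
  after the \<open>k\<close>-th is at most \<open>l m\<close>, which turns the weights in the bound \<open>\<eta>\<close> into the
  factor \<open>l m\<close>.\<close>

private lemma rho_bound:
  assumes h: "nrm n h \<le> C1 * sqrt n" and hh: "nrm n (\<lambda>a. hh a - h a) \<le> t"
    and ker: "\<And>j. j \<in> {1..n} \<Longrightarrow> l j = 0 \<Longrightarrow> dot n (u j) h = 0"
    and def: "(\<Sum>j\<in>{1..n}. if k < j \<and> 0 < l j then (dot n (u j) h)\<^sup>2 / l j else 0) \<le> \<eta>"
  shows "rho hh \<le> (1 + 2 * C1 / c) * t + sqrt (l m) * sqrt \<eta>"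
proof -
  let ?q = "\<lambda>j. 1 + -1 * first_k k j"
  let ?Q' = "comb n ?q v" and ?Q = "comb n ?q u"
  note o = specD(1)[OF A] and o' = specD(1)[OF B]
  have "rho hh = nrm n (\<lambda>a. (mv n ?Q' (\<lambda>a. hh a - h a) a + mv n (\<lambda>a b. ?Q' a b - ?Q a b) h a) + mv n ?Q h a)"
    unfolding rho_def by (rule nrm_cong) (simp add: mv_diff mv_diff_mat)
  also have "\<dots> \<le> nrm n (mv n ?Q' (\<lambda>a. hh a - h a)) + nrm n (mv n (\<lambda>a b. ?Q' a b - ?Q a b) h) + nrm n (mv n ?Q h)"
    using nrm_triangle by (meson add_right_mono order_trans)
  also have "nrm n (mv n ?Q' (\<lambda>a. hh a - h a)) \<le> 1 * t"
    using hh by (intro order_trans[OF nrm_mv_comb_le[OF o', of _ 1]]) (auto simp: first_k_def)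
  also have "nrm n (mv n (\<lambda>a b. ?Q' a b - ?Q a b) h) \<le> (2 / (c * n) * (t * sqrt n)) * (C1 * sqrt n)"
  proof (rule order_trans[OF nrm_mv_le_frob], rule mult_mono[OF _ h])
    show "frob n (\<lambda>a b. ?Q' a b - ?Q a b) \<le> 2 / (c * n) * (t * sqrt n)"
      using F g by (intro order_trans[OF stab(2)]) (auto intro!: mult_left_mono simp: divide_simps)
    show "0 \<le> 2 / (c * n) * (t * sqrt n)" using t g by simp
  qed simp
  also have "(2 / (c * n) * (t * sqrt n)) * (C1 * sqrt n) = 2 / (c * n) * t * C1 * (sqrt n * sqrt n)" by (simp only: mult_ac)
  also have "\<dots> = 2 * C1 / c * t" unfolding sq(2) using n by simp
  also have "nrm n (mv n ?Q h) \<le> sqrt (l m) * sqrt \<eta>"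
  proof -
    have "(nrm n (mv n ?Q h))\<^sup>2 = (\<Sum>j\<in>{1..n}. (?q j * dot n (u j) h)\<^sup>2)"
      by (simp add: parseval_nrm[OF o] dot_u_mv_comb[OF o])
    also have "\<dots> \<le> (\<Sum>j\<in>{1..n}. l m * (if k < j \<and> 0 < l j then (dot n (u j) h)\<^sup>2 / l j else 0))"
    proof (rule sum_mono)
      fix j assume j: "j \<in> {1..n}"
      consider "j \<le> k" | "k < j" "l j = 0" | "k < j" "0 < l j" using l0[OF j] by fastforce
      then show "(?q j * dot n (u j) h)\<^sup>2 \<le> l m * (if k < j \<and> 0 < l j then (dot n (u j) h)\<^sup>2 / l j else 0)"
      proof cases
        case 3
        have "l j \<le> l m" using specD(2)[OF A, of "Suc k" j] 3 j lm by auto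
        then have "1 * (dot n (u j) h)\<^sup>2 \<le> (l m / l j) * (dot n (u j) h)\<^sup>2"
          using 3 by (intro mult_right_mono) auto
        then show ?thesis using 3 by (simp add: first_k_def)
      qed (use ker[OF j] in \<open>auto simp: first_k_def\<close>)
    qed
    also have "\<dots> \<le> l m * \<eta>" unfolding sum_distrib_left[symmetric] using def \<kappa> by (intro mult_left_mono) auto
    also have "\<dots> = (sqrt (l m) * sqrt \<eta>)\<^sup>2" using \<kappa> \<eta> by (simp add: power_mult_distrib)
    finally show ?thesis by (rule power2_le_imp_le) (use \<kappa> \<eta> in simp)
  qed
  finally show ?thesis by (simp add: distrib_right)
qed

private lemma rho_sq: "(rho x)\<^sup>2 = (\<Sum>j\<in>{1..n}. (if k < j then (dot n (v j) x)\<^sup>2 else 0))"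
  unfolding rho_def parseval_nrm[OF specD(1)[OF B]]
  by (intro sum.cong refl) (simp add: dot_u_mv_comb[OF specD(1)[OF B]] first_k_def)

private lemma rem_nrm: "nrm n (mv n (comb n rc v) x) \<le> 4 / l m * rho x"
proof -
  note o' = specD(1)[OF B]
  have "(nrm n (mv n (comb n rc v) x))\<^sup>2 = (\<Sum>j\<in>{1..n}. (rc j)\<^sup>2 * (dot n (v j) x)\<^sup>2)"
    by (simp add: parseval_nrm[OF o'] dot_u_mv_comb[OF o'] power_mult_distrib)
  also have "\<dots> \<le> (\<Sum>j\<in>{1..n}. (4 / l m)\<^sup>2 * (if k < j then (dot n (v j) x)\<^sup>2 else 0))"
  proof (rule sum_mono)
    fix j assume j: "j \<in> {1..n}"
    have "(rc j)\<^sup>2 \<le> (4 / l m)\<^sup>2" using rc_bound[OF j] by (intro power_mono) auto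
    then show "(rc j)\<^sup>2 * (dot n (v j) x)\<^sup>2 \<le> (4 / l m)\<^sup>2 * (if k < j then (dot n (v j) x)\<^sup>2 else 0)"
      using rc_bound[OF j] by (cases "k < j") (auto intro: mult_right_mono)
  qed
  also have "\<dots> = (4 / l m * rho x)\<^sup>2" unfolding power_mult_distrib rho_sq sum_distrib_left ..
  finally show ?thesis by (rule power2_le_imp_le) (use \<kappa> in \<open>simp add: rho_def\<close>)
qed

private lemma rem_gram: "\<bar>dot n y (mv n (comb n rc v) x)\<bar> \<le> 4 / l m * (rho y * rho x)"
proof -
  note o' = specD(1)[OF B]
  let ?z = "\<lambda>x. mv n (comb n (\<lambda>j. 1 + -1 * first_k k j) v) x"
  have "dot n y (mv n (comb n rc v) x) = dot n (?z y) (mv n (comb n rc v) x)"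
    unfolding parseval[OF o', of "?z y"] parseval[OF o', of y]
  proof (intro sum.cong refl)
    fix j assume j: "j \<in> {1..n}"
    show "dot n (v j) y * dot n (v j) (mv n (comb n rc v) x) = dot n (v j) (?z y) * dot n (v j) (mv n (comb n rc v) x)"
      using rc_bound[OF j] unfolding dot_u_mv_comb[OF o' j] by (auto simp: first_k_def)
  qed
  moreover have "\<bar>dot n (?z y) (mv n (comb n rc v) x)\<bar> \<le> rho y * nrm n (mv n (comb n rc v) x)"
    unfolding rho_def by (rule dot_le_nrm)
  moreover have "rho y * nrm n (mv n (comb n rc v) x) \<le> rho y * (4 / l m * rho x)"
    by (intro mult_left_mono rem_nrm) (simp add: rho_def)
  ultimately show ?thesis by (simp add: mult_ac)
qed

text \<open>The vector \<open>x\<close> is orthogonal to the first \<open>k\<close> eigenvectors of \<open>B\<close>, hence nearly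
  orthogonal to those of \<open>A\<close>. The large eigenvalues of \<open>A\<close>, of order \<open>n\<close>, thus act only on a
  small component, and the others are at most \<open>l m\<close>.\<close>

private lemma rem_quad:
  assumes x: "x = mv n (comb n rc v) y"
  shows "dot n x (mv n A x) \<le> (C * 4 * t\<^sup>2 / c\<^sup>2 + l m) * (4 / l m * rho y)\<^sup>2"
proof -
  note o = specD(1)[OF A] and o' = specD(1)[OF B]
  let ?P' = "comb n (\<lambda>j. 0 + 1 * first_k k j) v" and ?P = "comb n (\<lambda>j. 0 + 1 * first_k k j) u"
  have C0: "0 \<le> C * n" using l0[of 1] lC[of 1] n by auto
  have vx: "(0 + 1 * first_k k j) * dot n (v j) x = 0" if "j \<in> {1..n}" for j
    using rc_bound[OF that] unfolding x dot_u_mv_comb[OF o' that] by (auto simp: first_k_def)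
  have P'x: "mv n ?P' x a = 0" for a
    unfolding mv_comb by (intro sum.neutral ballI) (simp only: vx mult_zero_left)
  have "nrm n (mv n ?P x) = nrm n (mv n (\<lambda>a b. ?P' a b - ?P a b) x)"
    unfolding nrm_def mv_diff_mat[abs_def] P'x by (simp add: dot_def)
  also have "\<dots> \<le> frob n (\<lambda>a b. ?P' a b - ?P a b) * nrm n x" by (rule nrm_mv_le_frob)
  also have "\<dots> \<le> (2 / (c * n) * (t * sqrt n)) * nrm n x"
    using F g by (intro mult_right_mono order_trans[OF stab(2)]) (auto intro!: mult_left_mono simp: divide_simps)
  finally have "(nrm n (mv n ?P x))\<^sup>2 \<le> ((2 / (c * n) * (t * sqrt n)) * nrm n x)\<^sup>2" by (rule power_mono) simp
  also have "\<dots> = 4 * t\<^sup>2 / (c\<^sup>2 * n) * (nrm n x)\<^sup>2"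
    using n by (simp add: power_mult_distrib power_divide) (simp add: power2_eq_square)
  finally have Px: "(nrm n (mv n ?P x))\<^sup>2 \<le> 4 * t\<^sup>2 / (c\<^sup>2 * n) * (nrm n x)\<^sup>2" .
  have "dot n x (mv n A x) \<le> (\<Sum>j\<in>{1..n}. C * n * (first_k k j * dot n (u j) x)\<^sup>2 + l m * (dot n (u j) x)\<^sup>2)"
    unfolding quad_spec[OF A]
  proof (rule sum_mono)
    fix j assume j: "j \<in> {1..n}"
    show "l j * (dot n (u j) x)\<^sup>2 \<le> C * n * (first_k k j * dot n (u j) x)\<^sup>2 + l m * (dot n (u j) x)\<^sup>2"
    proof (cases "j \<le> k")
      case True
      then show ?thesis using mult_right_mono[OF lC[OF j], of "(dot n (u j) x)\<^sup>2"] \<kappa> by (auto simp: first_k_def intro: add_increasing2)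
    next
      case False
      then have "l j \<le> l m" using specD(2)[OF A, of "Suc k" j] j lm by auto
      then show ?thesis using C0 by (auto simp: first_k_def False intro!: mult_right_mono)
    qed
  qed
  also have "\<dots> = C * n * (nrm n (mv n ?P x))\<^sup>2 + l m * (nrm n x)\<^sup>2"
    unfolding parseval_nrm[OF o] sum.distrib sum_distrib_left
    by (simp add: dot_u_mv_comb[OF o])
  also have "\<dots> \<le> C * n * (4 * t\<^sup>2 / (c\<^sup>2 * n) * (nrm n x)\<^sup>2) + l m * (nrm n x)\<^sup>2"
    using C0 by (intro add_right_mono mult_left_mono Px) auto
  also have "\<dots> = (C * 4 * t\<^sup>2 / c\<^sup>2 + l m) * (nrm n x)\<^sup>2" using n by (simp add: field_simps)
  also have "\<dots> \<le> (C * 4 * t\<^sup>2 / c\<^sup>2 + l m) * (4 / l m * rho y)\<^sup>2"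
  proof (intro mult_left_mono power_mono)
    show "nrm n x \<le> 4 / l m * rho y" unfolding x by (rule rem_nrm)
    have "C \<ge> 0" using C0 n by (simp add: zero_le_mult_iff)
    then show "0 \<le> C * 4 * t\<^sup>2 / c\<^sup>2 + l m" using \<kappa> by simp
  qed simp
  finally show ?thesis .
qed

private lemma rho_scaled:
  assumes "rho y \<le> (1 + 2 * C1 / c) * t + sqrt (l m) * sqrt \<eta>"
  shows "rho y / sqrt (l m) \<le> (1 + 2 * C1 / c) * t / sqrt \<kappa> + sqrt \<eta>"
proof -
  have p: "sqrt (l m) > 0" "sqrt \<kappa> > 0" "sqrt \<kappa> \<le> sqrt (l m)" using \<kappa> by auto
  have "rho y / sqrt (l m) \<le> ((1 + 2 * C1 / c) * t + sqrt (l m) * sqrt \<eta>) / sqrt (l m)"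
    using assms p by (intro divide_right_mono) auto
  also have "\<dots> = (1 + 2 * C1 / c) * t / sqrt (l m) + sqrt \<eta>" using p by (simp add: add_divide_distrib)
  also have "\<dots> \<le> (1 + 2 * C1 / c) * t / sqrt \<kappa> + sqrt \<eta>"
    using p t c C1 by (intro add_right_mono divide_left_mono) auto
  finally show ?thesis .
qed

lemma block_error:
  fixes h hh :: "nat \<Rightarrow> real"
  assumes h: "nrm n h \<le> C1 * sqrt n" and hh: "nrm n (\<lambda>a. hh a - h a) \<le> t"
    and ker: "\<And>j. j \<in> {1..n} \<Longrightarrow> l j = 0 \<Longrightarrow> dot n (u j) h = 0"
    and def: "(\<Sum>j\<in>{1..n}. if k < j \<and> 0 < l j then (dot n (u j) h)\<^sup>2 / l j else 0) \<le> \<eta>"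
    and x: "x = (\<lambda>a. mv n (comb n (tinv m l') v) hh a - mv n (comb n (tinv k l) u) h a)"
  shows "dot n x (mv n A x) \<le> 2 * (C * (4 * (C1 + 1) / c\<^sup>2 + 1 / c)\<^sup>2 * t\<^sup>2) +
      32 * (C * 4 * t\<^sup>2 / (c\<^sup>2 * \<kappa>) + 1) * ((1 + 2 * C1 / c) * t / sqrt \<kappa> + sqrt \<eta>)\<^sup>2"
proof -
  define y where "y = (\<lambda>a. mv n (comb n (tinv k l') v) hh a - mv n (comb n (tinv k l) u) h a)"
  define z where "z = mv n (comb n rc v) hh"
  have "x = (\<lambda>a. y a + z a)" unfolding x y_def z_def mv_tinv_split by auto
  then have 1: "dot n x (mv n A x) \<le> 2 * dot n y (mv n A y) + 2 * dot n z (mv n A z)"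
    using quad_add_le[OF A l0, of y z] by simp
  have 2: "dot n y (mv n A y) \<le> C * (4 * (C1 + 1) / c\<^sup>2 + 1 / c)\<^sup>2 * t\<^sup>2"
    by (rule coefficient_error_quad[OF h hh y_def])
  have C0: "C \<ge> 0"
  proof -
    have "0 \<le> C * n" using l0[of 1] lC[of 1] n by auto
    then show ?thesis using n by (simp add: zero_le_mult_iff)
  qed
  let ?e = "(1 + 2 * C1 / c) * t / sqrt \<kappa> + sqrt \<eta>"
  have r: "rho hh / sqrt (l m) \<le> ?e" by (rule rho_scaled[OF rho_bound[OF h hh ker def]])
  have r0: "rho hh \<ge> 0" by (simp add: rho_def)
  have "dot n z (mv n A z) \<le> (C * 4 * t\<^sup>2 / c\<^sup>2 + l m) * (4 / l m * rho hh)\<^sup>2"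
    by (rule rem_quad[OF z_def])
  also have "\<dots> = 16 * (C * 4 * t\<^sup>2 / (c\<^sup>2 * l m) + 1) * (rho hh / sqrt (l m))\<^sup>2"
    using \<kappa> c by (simp add: power_mult_distrib power_divide field_simps power2_eq_square)
  also have "\<dots> \<le> 16 * (C * 4 * t\<^sup>2 / (c\<^sup>2 * \<kappa>) + 1) * ?e\<^sup>2"
  proof (rule mult_mono)
    have "C * 4 * t\<^sup>2 / (c\<^sup>2 * l m) \<le> C * 4 * t\<^sup>2 / (c\<^sup>2 * \<kappa>)"
      using C0 \<kappa> c by (intro divide_left_mono mult_left_mono) auto
    then show "16 * (C * 4 * t\<^sup>2 / (c\<^sup>2 * l m) + 1) \<le> 16 * (C * 4 * t\<^sup>2 / (c\<^sup>2 * \<kappa>) + 1)" by simp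
    show "(rho hh / sqrt (l m))\<^sup>2 \<le> ?e\<^sup>2" using r r0 \<kappa> by (intro power_mono) auto
    show "0 \<le> 16 * (C * 4 * t\<^sup>2 / (c\<^sup>2 * \<kappa>) + 1)" using C0 \<kappa> by simp
  qed simp
  finally show ?thesis using 1 2 by linarith
qed

lemma block_error_gram:
  fixes h hh :: "nat \<Rightarrow> real"
  assumes h: "nrm n h \<le> C1 * sqrt n" and hh: "nrm n (\<lambda>a. hh a - h a) \<le> t"
    and ker: "\<And>j. j \<in> {1..n} \<Longrightarrow> l j = 0 \<Longrightarrow> dot n (u j) h = 0"
    and def: "(\<Sum>j\<in>{1..n}. if k < j \<and> 0 < l j then (dot n (u j) h)\<^sup>2 / l j else 0) \<le> \<eta>"
    and h2: "nrm n h2 \<le> C1 * sqrt n" and hh2: "nrm n (\<lambda>a. hh2 a - h2 a) \<le> t"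
    and ker2: "\<And>j. j \<in> {1..n} \<Longrightarrow> l j = 0 \<Longrightarrow> dot n (u j) h2 = 0"
    and def2: "(\<Sum>j\<in>{1..n}. if k < j \<and> 0 < l j then (dot n (u j) h2)\<^sup>2 / l j else 0) \<le> \<eta>"
  shows "\<bar>dot n hh2 (mv n (comb n (tinv m l') v) hh) - dot n h2 (mv n (comb n (tinv k l) u) h)\<bar>
    \<le> ((C1 + 1) * (4 * (C1 + 1) / c\<^sup>2 + 1 / c) + C1 / c) * t + 4 * ((1 + 2 * C1 / c) * t / sqrt \<kappa> + sqrt \<eta>)\<^sup>2"
proof -
  let ?e = "(1 + 2 * C1 / c) * t / sqrt \<kappa> + sqrt \<eta>"
  have r: "rho hh / sqrt (l m) \<le> ?e" by (rule rho_scaled[OF rho_bound[OF h hh ker def]])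
  have r2: "rho hh2 / sqrt (l m) \<le> ?e" by (rule rho_scaled[OF rho_bound[OF h2 hh2 ker2 def2]])
  have r0: "rho x \<ge> 0" for x by (simp add: rho_def)
  have "\<bar>dot n hh2 (mv n (comb n rc v) hh)\<bar> \<le> 4 / l m * (rho hh2 * rho hh)" by (rule rem_gram)
  also have "\<dots> = 4 * ((rho hh2 / sqrt (l m)) * (rho hh / sqrt (l m)))" using \<kappa> by simp
  also have "\<dots> \<le> 4 * (?e * ?e)"
    using r0 \<kappa> r r2 order_trans[OF _ r] by (intro mult_left_mono mult_mono) auto
  finally have "\<bar>dot n hh2 (mv n (comb n rc v) hh)\<bar> \<le> 4 * ?e\<^sup>2" by (simp add: power2_eq_square)
  moreover have "dot n hh2 (mv n (comb n (tinv m l') v) hh) =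
      dot n hh2 (mv n (comb n (tinv k l') v) hh) + dot n hh2 (mv n (comb n rc v) hh)"
    unfolding mv_tinv_split[abs_def] by (rule dot_add_right)
  ultimately show ?thesis using coefficient_error_gram[OF h hh h2 hh2] by linarith
qed

end
end

section \<open>Square integrable random variables\<close>

lemma L2_D: "f \<in> L2 M \<Longrightarrow> f \<in> borel_measurable M" "f \<in> L2 M \<Longrightarrow> integrable M (\<lambda>w. (f w)\<^sup>2)"
  by (auto simp: L2_def)

lemma L2_mult_integrable:
  assumes "f \<in> L2 M" "g \<in> L2 M"
  shows "integrable M (\<lambda>w. f w * g w)"
proof (rule Bochner_Integration.integrable_bound)
  show "integrable M (\<lambda>w. (f w)\<^sup>2 + (g w)\<^sup>2)" using assms by (auto simp: L2_def)
  show "(\<lambda>w. f w * g w) \<in> borel_measurable M" using assms by (auto simp: L2_def)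
  have "\<bar>a * b\<bar> \<le> a\<^sup>2 + b\<^sup>2" for a b :: real
  proof -
    have "2 * (\<bar>a\<bar> * \<bar>b\<bar>) \<le> a\<^sup>2 + b\<^sup>2" using zero_le_power2[of "\<bar>a\<bar> - \<bar>b\<bar>"] by (simp add: power2_diff)
    moreover have "0 \<le> \<bar>a\<bar> * \<bar>b\<bar>" by simp
    ultimately show ?thesis unfolding abs_mult by linarith
  qed
  then show "AE w in M. norm (f w * g w) \<le> norm ((f w)\<^sup>2 + (g w)\<^sup>2)" by simp
qed

lemma L2_add: "f \<in> L2 M \<Longrightarrow> g \<in> L2 M \<Longrightarrow> (\<lambda>w. f w + g w) \<in> L2 M"
  using L2_mult_integrable[of f M g] by (auto simp: L2_def power2_sum mult.assoc)

lemma L2_scale: "f \<in> L2 M \<Longrightarrow> (\<lambda>w. c * f w) \<in> L2 M"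
  by (auto simp: L2_def power_mult_distrib)

lemma L2_zero: "(\<lambda>_. 0) \<in> L2 M" by (simp add: L2_def)

lemma L2_sum: "(\<And>i. i \<in> F \<Longrightarrow> f i \<in> L2 M) \<Longrightarrow> (\<lambda>w. \<Sum>i\<in>F. f i w) \<in> L2 M"
  by (induction F rule: infinite_finite_induct) (simp_all add: L2_zero L2_add)

lemma L2_diff: "f \<in> L2 M \<Longrightarrow> g \<in> L2 M \<Longrightarrow> (\<lambda>w. f w - g w) \<in> L2 M"
  using L2_add[of f M "\<lambda>w. (-1) * g w"] L2_scale[of g M "-1"] by simp

lemma L2_lincomb: "(\<And>i. i \<in> F \<Longrightarrow> f i \<in> L2 M) \<Longrightarrow> (\<lambda>w. \<Sum>i\<in>F. c i * f i w) \<in> L2 M"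
  by (intro L2_sum L2_scale)

lemma l2_inner_commute: "l2_inner M f g = l2_inner M g f"
  by (simp add: l2_inner_def mult.commute)

lemma l2_inner_add_left: "f \<in> L2 M \<Longrightarrow> g \<in> L2 M \<Longrightarrow> z \<in> L2 M \<Longrightarrow>
    l2_inner M (\<lambda>w. f w + g w) z = l2_inner M f z + l2_inner M g z"
  by (simp add: l2_inner_def distrib_right L2_mult_integrable)
lemma l2_inner_diff_left: "f \<in> L2 M \<Longrightarrow> g \<in> L2 M \<Longrightarrow> z \<in> L2 M \<Longrightarrow>
    l2_inner M (\<lambda>w. f w - g w) z = l2_inner M f z - l2_inner M g z"
  by (simp add: l2_inner_def left_diff_distrib L2_mult_integrable)
lemma l2_inner_scale_left: "l2_inner M (\<lambda>w. c * f w) z = c * l2_inner M f z"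
  by (simp add: l2_inner_def mult.assoc)
lemma l2_inner_sum_left: "(\<And>i. i \<in> F \<Longrightarrow> f i \<in> L2 M) \<Longrightarrow> z \<in> L2 M \<Longrightarrow>
    l2_inner M (\<lambda>w. \<Sum>i\<in>F. f i w) z = (\<Sum>i\<in>F. l2_inner M (f i) z)"
  by (simp add: l2_inner_def sum_distrib_right L2_mult_integrable)

lemma l2_inner_add_right: "f \<in> L2 M \<Longrightarrow> g \<in> L2 M \<Longrightarrow> z \<in> L2 M \<Longrightarrow>
    l2_inner M z (\<lambda>w. f w + g w) = l2_inner M z f + l2_inner M z g"
  using l2_inner_add_left by (metis (no_types) l2_inner_commute)
lemma l2_inner_diff_right: "f \<in> L2 M \<Longrightarrow> g \<in> L2 M \<Longrightarrow> z \<in> L2 M \<Longrightarrow>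
    l2_inner M z (\<lambda>w. f w - g w) = l2_inner M z f - l2_inner M z g"
  using l2_inner_diff_left by (metis (no_types) l2_inner_commute)
lemma l2_inner_scale_right: "l2_inner M z (\<lambda>w. c * f w) = c * l2_inner M z f"
  using l2_inner_scale_left by (metis (no_types) l2_inner_commute)
lemma l2_inner_sum_right: "(\<And>i. i \<in> F \<Longrightarrow> f i \<in> L2 M) \<Longrightarrow> z \<in> L2 M \<Longrightarrow>
    l2_inner M z (\<lambda>w. \<Sum>i\<in>F. f i w) = (\<Sum>i\<in>F. l2_inner M z (f i))"
  using l2_inner_sum_left[of F f M z] by (simp add: l2_inner_commute[of M z])

lemma l2_inner_self_nonneg [simp]: "0 \<le> l2_inner M f f"
  by (simp add: l2_inner_def)

lemma l2_norm_nonneg [simp]: "0 \<le> l2_norm M f" by (simp add: l2_norm_def)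
lemma l2_norm_sq: "(l2_norm M f)\<^sup>2 = l2_inner M f f" by (simp add: l2_norm_def)
lemma l2_norm_scale: "l2_norm M (\<lambda>w. c * f w) = \<bar>c\<bar> * l2_norm M f"
  by (simp add: l2_norm_def l2_inner_scale_left l2_inner_scale_right real_sqrt_mult flip: mult.assoc)

lemma l2_cauchy_schwarz:
  assumes f: "f \<in> L2 M" and g: "g \<in> L2 M"
  shows "\<bar>l2_inner M f g\<bar> \<le> l2_norm M f * l2_norm M g"
proof -
  let ?a = "l2_inner M f f" and ?b = "l2_inner M f g" and ?c = "l2_inner M g g"
  have q: "0 \<le> ?a * t\<^sup>2 + 2 * ?b * t + ?c" for t
  proof -
    have "l2_inner M (\<lambda>w. t * f w + g w) (\<lambda>w. t * f w + g w) = ?a * t\<^sup>2 + 2 * ?b * t + ?c"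
      using f g by (simp add: l2_inner_add_left l2_inner_add_right l2_inner_scale_left l2_inner_scale_right
          L2_scale L2_add l2_inner_commute[of M g f] power2_eq_square algebra_simps)
    then show ?thesis using l2_inner_self_nonneg[of M "\<lambda>w. t * f w + g w"] by simp
  qed
  have "?b\<^sup>2 \<le> ?a * ?c"
  proof (cases "?a = 0")
    case True
    have "?b = 0"
    proof (rule ccontr)
      assume "?b \<noteq> 0"
      then show False using q[of "- (?c + 1) / (2 * ?b)"] True by (simp add: field_simps)
    qed
    then show ?thesis by simp
  next
    case False
    then have "?a > 0" using l2_inner_self_nonneg[of M f] by linarith
    have "0 \<le> ?a * (- ?b / ?a)\<^sup>2 + 2 * ?b * (- ?b / ?a) + ?c" by (rule q)
    also have "\<dots> = (?a * ?c - ?b\<^sup>2) / ?a" using \<open>?a > 0\<close> by (simp add: field_simps power2_eq_square)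
    finally show ?thesis using \<open>?a > 0\<close> by (simp add: zero_le_divide_iff)
  qed
  then have "\<bar>?b\<bar>\<^sup>2 \<le> (l2_norm M f * l2_norm M g)\<^sup>2" by (simp add: power_mult_distrib l2_norm_sq)
  then show ?thesis by (rule power2_le_imp_le) simp
qed

lemma l2_triangle:
  assumes f: "f \<in> L2 M" and g: "g \<in> L2 M"
  shows "l2_norm M (\<lambda>w. f w + g w) \<le> l2_norm M f + l2_norm M g"
proof (rule power2_le_imp_le)
  have "(l2_norm M (\<lambda>w. f w + g w))\<^sup>2 = (l2_norm M f)\<^sup>2 + 2 * l2_inner M f g + (l2_norm M g)\<^sup>2"
    using f g by (simp add: l2_norm_sq l2_inner_add_left l2_inner_add_right L2_add l2_inner_commute[of M g f])
  also have "\<dots> \<le> (l2_norm M f + l2_norm M g)\<^sup>2"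
    using l2_cauchy_schwarz[OF f g] by (simp add: power2_sum)
  finally show "(l2_norm M (\<lambda>w. f w + g w))\<^sup>2 \<le> (l2_norm M f + l2_norm M g)\<^sup>2" .
qed simp

lemma l2_triangle_diff:
  assumes "f \<in> L2 M" "g \<in> L2 M" "z \<in> L2 M"
  shows "l2_norm M (\<lambda>w. f w - z w) \<le> l2_norm M (\<lambda>w. f w - g w) + l2_norm M (\<lambda>w. g w - z w)"
  using l2_triangle[OF L2_diff[OF assms(1,2)] L2_diff[OF assms(2,3)]] by simp

lemma l2_norm_minus_commute: "l2_norm M (\<lambda>w. f w - g w) = l2_norm M (\<lambda>w. g w - f w)"
  using l2_norm_scale[of M "-1" "\<lambda>w. f w - g w"] by simp

lemma l2_triangle_sum:
  assumes "finite F" "\<And>i. i \<in> F \<Longrightarrow> f i \<in> L2 M"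
  shows "l2_norm M (\<lambda>w. \<Sum>i\<in>F. f i w) \<le> (\<Sum>i\<in>F. l2_norm M (f i))"
  using assms
proof (induction F rule: finite_induct)
  case empty show ?case by (simp add: l2_norm_def l2_inner_def)
next
  case (insert i F)
  have "l2_norm M (\<lambda>w. f i w + (\<Sum>i\<in>F. f i w)) \<le> l2_norm M (f i) + l2_norm M (\<lambda>w. \<Sum>i\<in>F. f i w)"
    using insert by (intro l2_triangle L2_sum) auto
  then show ?case using insert by auto
qed

lemma l2_norm_cong_AE: "f \<in> borel_measurable M \<Longrightarrow> g \<in> borel_measurable M \<Longrightarrow> AE w in M. f w = g w \<Longrightarrow> l2_norm M f = l2_norm M g"
  unfolding l2_norm_def l2_inner_def
  by (intro arg_cong[where f = sqrt] integral_cong_AE) auto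

lemma l2_inner_le_of_norm_zero: "f \<in> L2 M \<Longrightarrow> g \<in> L2 M \<Longrightarrow> l2_norm M f = 0 \<Longrightarrow> l2_inner M f g = 0"
  using l2_cauchy_schwarz[of f M g] by simp

section \<open>The closed span of the process\<close>

lemma fun_span_L2: "(\<And>b. b \<in> B \<Longrightarrow> b \<in> L2 M) \<Longrightarrow> f \<in> fun_span B \<Longrightarrow> f \<in> L2 M"
  by (auto simp: fun_span_def intro!: L2_lincomb)

lemma process_span_L2: "(\<And>t. X t \<in> L2 M) \<Longrightarrow> f \<in> fun_span (range X) \<Longrightarrow> f \<in> L2 M"
  by (rule fun_span_L2) auto

lemma fun_span_base: "b \<in> B \<Longrightarrow> b \<in> fun_span B"
  unfolding fun_span_def by (rule CollectI, rule exI[of _ "{b}"], rule exI[of _ "\<lambda>_. 1"]) auto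

lemma fun_span_scale: "f \<in> fun_span B \<Longrightarrow> (\<lambda>x. a * f x) \<in> fun_span B"
proof -
  assume "f \<in> fun_span B"
  then obtain F c where "finite F" "F \<subseteq> B" "f = (\<lambda>x. \<Sum>g\<in>F. c g * g x)" by (auto simp: fun_span_def)
  then show ?thesis unfolding fun_span_def
    by (intro CollectI exI[of _ F] exI[of _ "\<lambda>g. a * c g"]) (auto simp: sum_distrib_left mult.assoc)
qed

lemma fun_span_add: "f \<in> fun_span B \<Longrightarrow> g \<in> fun_span B \<Longrightarrow> (\<lambda>x. f x + g x) \<in> fun_span B"
proof -
  assume "f \<in> fun_span B" "g \<in> fun_span B"
  then obtain F c F' c' where f: "finite F" "F \<subseteq> B" "f = (\<lambda>x. \<Sum>b\<in>F. c b * b x)"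
    and g: "finite F'" "F' \<subseteq> B" "g = (\<lambda>x. \<Sum>b\<in>F'. c' b * b x)" by (auto simp: fun_span_def)
  define d where "d b = (if b \<in> F then c b else 0) + (if b \<in> F' then c' b else 0)" for b
  have "f x + g x = (\<Sum>b\<in>F \<union> F'. d b * b x)" for x
  proof -
    have "f x = (\<Sum>b\<in>F \<union> F'. (if b \<in> F then c b else 0) * b x)"
      unfolding f(3) using f(1) g(1) by (intro sum.mono_neutral_cong_left) auto
    moreover have "g x = (\<Sum>b\<in>F \<union> F'. (if b \<in> F' then c' b else 0) * b x)"
      unfolding g(3) using f(1) g(1) by (intro sum.mono_neutral_cong_left) auto
    ultimately show ?thesis by (simp add: d_def distrib_right sum.distrib)
  qed
  then show ?thesis unfolding fun_span_def using f g
    by (intro CollectI exI[of _ "F \<union> F'"] exI[of _ d]) auto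
qed

lemma fun_span_lincomb2: "f \<in> fun_span B \<Longrightarrow> g \<in> fun_span B \<Longrightarrow> (\<lambda>x. a * f x + b * g x) \<in> fun_span B"
  by (rule fun_span_add[OF fun_span_scale fun_span_scale])

lemma closed_span_L2: "f \<in> closed_span M X \<Longrightarrow> f \<in> L2 M" by (simp add: closed_span_def)

lemma fun_span_closed_span:
  assumes X: "\<And>t. X t \<in> L2 M" and f: "f \<in> fun_span (range X)"
  shows "f \<in> closed_span M X"
  unfolding closed_span_def
proof (intro CollectI conjI allI impI)
  show "f \<in> L2 M" by (rule process_span_L2[OF X f])
  fix e :: real assume "e > 0"
  then show "\<exists>g\<in>fun_span (range X). l2_norm M (\<lambda>w. f w - g w) < e"
    using f by (intro bexI[of _ f]) (auto simp: l2_norm_def l2_inner_def)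
qed

lemma closed_span_lincomb:
  assumes X: "\<And>t. X t \<in> L2 M" and f: "f \<in> closed_span M X" and g: "g \<in> closed_span M X"
  shows "(\<lambda>w. a * f w + b * g w) \<in> closed_span M X"
  unfolding closed_span_def
proof (intro CollectI conjI allI impI)
  have fL: "f \<in> L2 M" and gL: "g \<in> L2 M" using f g closed_span_L2 by blast+
  show "(\<lambda>w. a * f w + b * g w) \<in> L2 M" by (rule L2_add[OF L2_scale[OF fL] L2_scale[OF gL]])
  fix e :: real assume e: "e > 0"
  define e' where "e' = e / (\<bar>a\<bar> + \<bar>b\<bar> + 1)"
  have e': "e' > 0" using e by (simp add: e'_def add_nonneg_pos)
  obtain f' where f': "f' \<in> fun_span (range X)" "l2_norm M (\<lambda>w. f w - f' w) < e'"
    using f e' by (auto simp: closed_span_def)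
  obtain g' where g': "g' \<in> fun_span (range X)" "l2_norm M (\<lambda>w. g w - g' w) < e'"
    using g e' by (auto simp: closed_span_def)
  note L = process_span_L2[OF X f'(1)] process_span_L2[OF X g'(1)]
  have "l2_norm M (\<lambda>w. a * (f w - f' w) + b * (g w - g' w))
      \<le> \<bar>a\<bar> * l2_norm M (\<lambda>w. f w - f' w) + \<bar>b\<bar> * l2_norm M (\<lambda>w. g w - g' w)"
    using l2_triangle[OF L2_scale[OF L2_diff[OF fL L(1)]] L2_scale[OF L2_diff[OF gL L(2)]], of a b]
    unfolding l2_norm_scale .
  also have "\<dots> \<le> \<bar>a\<bar> * e' + \<bar>b\<bar> * e'" using f' g' by (intro add_mono mult_left_mono) auto
  also have "\<dots> < (\<bar>a\<bar> + \<bar>b\<bar> + 1) * e'" using e' by (simp add: distrib_right)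
  also have "\<dots> = e"
  proof -
    have "\<bar>a\<bar> + \<bar>b\<bar> + 1 > 0" by (simp add: add_nonneg_pos)
    then show ?thesis unfolding e'_def by simp
  qed
  finally have "l2_norm M (\<lambda>w. (a * f w + b * g w) - (a * f' w + b * g' w)) < e" by (simp add: algebra_simps)
  then show "\<exists>h\<in>fun_span (range X). l2_norm M (\<lambda>w. (a * f w + b * g w) - h w) < e"
    using fun_span_lincomb2[OF f'(1) g'(1)] by (rule bexI)
qed

text \<open>A minimising sequence for the distance from \<open>y\<close> to the span is a Cauchy sequence
  by the parallelogram identity. The isometry transports it to the reproducing kernel Hilbert
  space, whose completeness supplies the limit.\<close>

lemma closed_span_projection:
  assumes X: "\<And>t. X t \<in> L2 M" and H: "is_rkhs (cov_fun M X) H ip" and Psi: "loeve_isometry M X H ip \<Psi>"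
    and y: "y \<in> L2 M"
  obtains \<eta> where "\<eta> \<in> closed_span M X" "\<And>t. l2_inner M \<eta> (X t) = l2_inner M y (X t)"
proof -
  let ?V = "fun_span (range X)"
  note V = process_span_L2[OF X]
  have XV: "X t \<in> ?V" for t by (rule fun_span_base) simp
  define D where "D = (\<lambda>v. l2_inner M (\<lambda>w. y w - v w) (\<lambda>w. y w - v w)) ` ?V"
  define d where "d = Inf D"
  have bdd: "bdd_below D" unfolding D_def by (rule bdd_belowI[of _ 0]) auto
  have neD: "D \<noteq> {}" unfolding D_def using XV by auto
  have dle: "d \<le> l2_inner M (\<lambda>w. y w - v w) (\<lambda>w. y w - v w)" if "v \<in> ?V" for v
    unfolding d_def using that bdd by (intro cInf_lower) (auto simp: D_def)
  have "\<exists>v\<in>?V. l2_inner M (\<lambda>w. y w - v w) (\<lambda>w. y w - v w) < d + 1 / Suc n" for n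
  proof -
    have "Inf D < d + 1 / Suc n" by (simp add: d_def)
    then obtain z where "z \<in> D" "z < d + 1 / Suc n" using cInf_less_iff[OF neD bdd] by auto
    then show ?thesis by (auto simp: D_def)
  qed
  then obtain v where vV: "\<And>n. v n \<in> ?V" and
    vd: "\<And>n. l2_inner M (\<lambda>w. y w - v n w) (\<lambda>w. y w - v n w) < d + 1 / Suc n" by metis
  have dist: "l2_inner M (\<lambda>w. v m w - v n w) (\<lambda>w. v m w - v n w) \<le> 2 / Suc m + 2 / Suc n" for m n
  proof -
    let ?p = "\<lambda>w. y w - v m w" and ?q = "\<lambda>w. y w - v n w"
    note L = L2_diff[OF y V[OF vV[of m]]] L2_diff[OF y V[OF vV[of n]]]
    have mid: "(\<lambda>w. (1/2) * v m w + (1/2) * v n w) \<in> ?V" by (rule fun_span_lincomb2[OF vV vV])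
    let ?s = "\<lambda>w. ?p w + ?q w"
    have "4 * d \<le> 4 * l2_inner M (\<lambda>w. (1/2) * ?s w) (\<lambda>w. (1/2) * ?s w)"
      using dle[OF mid] by (simp add: algebra_simps)
    also have "\<dots> = l2_inner M ?s ?s" unfolding l2_inner_scale_left l2_inner_scale_right by simp
    finally have s: "4 * d \<le> l2_inner M ?s ?s" .
    have par: "l2_inner M (\<lambda>w. ?q w - ?p w) (\<lambda>w. ?q w - ?p w) + l2_inner M ?s ?s = 2 * l2_inner M ?p ?p + 2 * l2_inner M ?q ?q"
      using L by (simp only: l2_inner_add_left l2_inner_add_right l2_inner_diff_left l2_inner_diff_right L2_add L2_diff)
    have "l2_inner M (\<lambda>w. ?q w - ?p w) (\<lambda>w. ?q w - ?p w) \<le> 2 / Suc m + 2 / Suc n"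
    proof -
      have "2 / real (Suc k) = 2 * (1 / real (Suc k))" for k by simp
      then show ?thesis using s vd[of m] vd[of n] par by linarith
    qed
    moreover have "(\<lambda>w. ?q w - ?p w) = (\<lambda>w. v m w - v n w)" by auto
    ultimately show ?thesis by simp
  qed
  have ortho: "\<bar>l2_inner M (\<lambda>w. y w - v n w) (X t)\<bar> * \<bar>l2_inner M (\<lambda>w. y w - v n w) (X t)\<bar> \<le> l2_inner M (X t) (X t) / Suc n" for n t
  proof -
    let ?p = "\<lambda>w. y w - v n w"
    define a where "a = l2_inner M ?p (X t)"
    define b where "b = l2_inner M (X t) (X t)"
    note L = L2_diff[OF y V[OF vV[of n]]]
    have q: "0 \<le> 1 / Suc n - 2 * c * a + c\<^sup>2 * b" for c
    proof -
      have "(\<lambda>w. 1 * v n w + c * X t w) \<in> ?V" by (rule fun_span_lincomb2[OF vV XV])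
      from dle[OF this] have "d \<le> l2_inner M (\<lambda>w. ?p w - c * X t w) (\<lambda>w. ?p w - c * X t w)" by (simp add: algebra_simps)
      also have "\<dots> = l2_inner M ?p ?p - 2 * c * a + c\<^sup>2 * b"
        using L X[of t] by (simp only: l2_inner_diff_left l2_inner_diff_right L2_diff L2_scale
            l2_inner_scale_left l2_inner_scale_right a_def b_def l2_inner_commute[of M "X t" ?p])
          (simp add: power2_eq_square algebra_simps)
      finally show ?thesis using vd[of n] by simp
    qed
    have "a * a \<le> b / Suc n"
    proof (cases "b = 0")
      case True
      have "a = 0"
      proof (rule ccontr)
        assume "a \<noteq> 0"
        then show False using q[of "1 / a"] True by (simp add: divide_simps split: if_splits)
      qed
      then show ?thesis using True by simp
    next
      case False
      then have "b > 0" using l2_inner_self_nonneg[of M "X t"] unfolding b_def by linarith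
      have "0 \<le> 1 / Suc n - a * a / b" using q[of "a / b"] \<open>b > 0\<close> by (simp add: power2_eq_square)
      then have "a * a / b \<le> 1 / Suc n" by simp
      then show ?thesis using \<open>b > 0\<close> by (simp add: divide_simps mult.commute)
    qed
    then show ?thesis by (simp add: a_def b_def)
  qed
  have iso: "ip (\<lambda>t. \<Psi> f t - \<Psi> g t) (\<lambda>t. \<Psi> f t - \<Psi> g t) = l2_inner M (\<lambda>w. f w - g w) (\<lambda>w. f w - g w)"
    if "f \<in> closed_span M X" "g \<in> closed_span M X" "(\<lambda>w. 1 * f w + (-1) * g w) \<in> closed_span M X" for f g
  proof -
    have "\<Psi> (\<lambda>w. 1 * f w + (-1) * g w) = (\<lambda>t. 1 * \<Psi> f t + (-1) * \<Psi> g t)"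
      using Psi that unfolding loeve_isometry_def by blast
    moreover have "ip (\<Psi> (\<lambda>w. 1 * f w + (-1) * g w)) (\<Psi> (\<lambda>w. 1 * f w + (-1) * g w)) =
        l2_inner M (\<lambda>w. 1 * f w + (-1) * g w) (\<lambda>w. 1 * f w + (-1) * g w)"
      using Psi that unfolding loeve_isometry_def by blast
    ultimately show ?thesis by simp
  qed
  have VC: "f \<in> ?V \<Longrightarrow> f \<in> closed_span M X" for f by (rule fun_span_closed_span[OF X])
  have PsiH: "\<Psi> f \<in> H" if "f \<in> closed_span M X" for f using Psi that by (auto simp: loeve_isometry_def)
  have isoV: "ip (\<lambda>t. \<Psi> f t - \<Psi> g t) (\<lambda>t. \<Psi> f t - \<Psi> g t) = (l2_norm M (\<lambda>w. f w - g w))\<^sup>2"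
    if "f \<in> ?V" "g \<in> ?V" for f g
    unfolding l2_norm_sq using that by (intro iso VC fun_span_lincomb2)
  have "\<forall>e>0. \<exists>n0. \<forall>m\<ge>n0. \<forall>n\<ge>n0. sqrt (ip (\<lambda>t. \<Psi> (v m) t - \<Psi> (v n) t) (\<lambda>t. \<Psi> (v m) t - \<Psi> (v n) t)) < e"
  proof (intro allI impI)
    fix e :: real assume "e > 0"
    then obtain n0 where n0: "4 / e\<^sup>2 < real n0" using reals_Archimedean2 by blast
    have "sqrt (ip (\<lambda>t. \<Psi> (v m) t - \<Psi> (v n) t) (\<lambda>t. \<Psi> (v m) t - \<Psi> (v n) t)) < e" if "m \<ge> n0" "n \<ge> n0" for m n
    proof -
      have "4 / e\<^sup>2 > 0" using \<open>e > 0\<close> by simp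
      then have p: "0 < real n0" using n0 by linarith
      have "2 / real (Suc m) \<le> 2 / real n0" "2 / real (Suc n) \<le> 2 / real n0"
        using that p by (auto intro!: divide_left_mono)
      then have "l2_inner M (\<lambda>w. v m w - v n w) (\<lambda>w. v m w - v n w) \<le> 4 / real n0" using dist[of m n] by simp
      also have "\<dots> < e\<^sup>2" using n0 p \<open>e > 0\<close> by (simp add: field_simps)
      finally have "sqrt (l2_inner M (\<lambda>w. v m w - v n w) (\<lambda>w. v m w - v n w)) < sqrt (e\<^sup>2)" by (rule real_sqrt_less_mono)
      then show ?thesis using \<open>e > 0\<close> by (simp add: isoV[OF vV vV] l2_norm_def)
    qed
    then show "\<exists>n0. \<forall>m\<ge>n0. \<forall>n\<ge>n0. sqrt (ip (\<lambda>t. \<Psi> (v m) t - \<Psi> (v n) t) (\<lambda>t. \<Psi> (v m) t - \<Psi> (v n) t)) < e" by blast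
  qed
  moreover have "\<forall>n. \<Psi> (v n) \<in> H" using PsiH VC vV by blast
  ultimately obtain g where g: "g \<in> H" and lim: "(\<lambda>n. sqrt (ip (\<lambda>t. \<Psi> (v n) t - g t) (\<lambda>t. \<Psi> (v n) t - g t))) \<longlonglongrightarrow> 0"
    using H unfolding is_rkhs_def by (elim conjE) (drule spec[of _ "\<lambda>n. \<Psi> (v n)"], blast)
  have "g \<in> \<Psi> ` closed_span M X" using g Psi unfolding loeve_isometry_def by simp
  then obtain \<eta> where \<eta>: "\<eta> \<in> closed_span M X" "g = \<Psi> \<eta>" by blast
  have gt: "g t = l2_inner M \<eta> (X t)" for t
  proof -
    have "g t = ip g (\<lambda>s. cov_fun M X s t)" using H g unfolding is_rkhs_def by simp
    also have "(\<lambda>s. cov_fun M X s t) = \<Psi> (X t)" using Psi unfolding loeve_isometry_def by simp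
    also have "ip g (\<Psi> (X t)) = l2_inner M \<eta> (X t)"
      using \<eta> Psi VC[OF XV] unfolding loeve_isometry_def by blast
    finally show ?thesis .
  qed
  have v\<eta>: "(\<lambda>n. l2_norm M (\<lambda>w. v n w - \<eta> w)) \<longlonglongrightarrow> 0"
  proof -
    have "sqrt (ip (\<lambda>t. \<Psi> (v n) t - g t) (\<lambda>t. \<Psi> (v n) t - g t)) = l2_norm M (\<lambda>w. v n w - \<eta> w)" for n
      unfolding \<eta>(2) l2_norm_def by (subst iso[OF VC[OF vV] \<eta>(1) closed_span_lincomb[OF X VC[OF vV] \<eta>(1)]]) simp
    then show ?thesis using lim by simp
  qed
  have \<eta>X: "l2_inner M \<eta> (X t) = l2_inner M y (X t)" for t
  proof -
    note L = closed_span_L2[OF \<eta>(1)] V[OF vV]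
    have "(\<lambda>n. l2_inner M (\<lambda>w. v n w - \<eta> w) (X t)) \<longlonglongrightarrow> 0"
    proof (rule Lim_null_comparison)
      show "\<forall>\<^sub>F n in sequentially. norm (l2_inner M (\<lambda>w. v n w - \<eta> w) (X t)) \<le> l2_norm M (\<lambda>w. v n w - \<eta> w) * l2_norm M (X t)"
        using l2_cauchy_schwarz[OF L2_diff[OF L(2,1)] X] by simp
      show "(\<lambda>n. l2_norm M (\<lambda>w. v n w - \<eta> w) * l2_norm M (X t)) \<longlonglongrightarrow> 0"
        using tendsto_mult_left_zero[OF v\<eta>] by simp
    qed
    moreover have "(\<lambda>n. l2_inner M (\<lambda>w. y w - v n w) (X t)) \<longlonglongrightarrow> 0"
    proof -
      have "(\<lambda>n. sqrt (l2_inner M (X t) (X t) * inverse (Suc n))) \<longlonglongrightarrow> sqrt (l2_inner M (X t) (X t) * 0)"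
        by (intro tendsto_intros LIMSEQ_inverse_real_of_nat)
      then have lim0: "(\<lambda>n. sqrt (l2_inner M (X t) (X t) * inverse (Suc n))) \<longlonglongrightarrow> 0" by simp
      show ?thesis
      proof (rule Lim_null_comparison[OF _ lim0])
        show "\<forall>\<^sub>F n in sequentially. norm (l2_inner M (\<lambda>w. y w - v n w) (X t)) \<le> sqrt (l2_inner M (X t) (X t) * inverse (Suc n))"
          using ortho by (intro always_eventually allI) (simp add: real_le_rsqrt power2_eq_square divide_inverse)
      qed
    qed
    ultimately have "(\<lambda>n. l2_inner M (\<lambda>w. v n w - \<eta> w) (X t) + l2_inner M (\<lambda>w. y w - v n w) (X t)) \<longlonglongrightarrow> 0 + 0"
      by (rule tendsto_add)
    moreover have "l2_inner M (\<lambda>w. v n w - \<eta> w) (X t) + l2_inner M (\<lambda>w. y w - v n w) (X t) = l2_inner M y (X t) - l2_inner M \<eta> (X t)" for n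
      using L X y by (simp add: l2_inner_diff_left)
    ultimately show ?thesis by (simp add: tendsto_const_iff)
  qed
  show thesis by (rule that[OF \<eta>(1) \<eta>X])
qed

lemma closed_span_sum:
  assumes X: "\<And>t. X t \<in> L2 M" and F: "finite F" and f: "\<And>i. i \<in> F \<Longrightarrow> f i \<in> closed_span M X"
  shows "(\<lambda>w. \<Sum>i\<in>F. c i * f i w) \<in> closed_span M X"
  using F f
proof (induction F rule: finite_induct)
  case empty
  have "(\<lambda>_. 0) \<in> fun_span (range X)" unfolding fun_span_def by (rule CollectI, rule exI[of _ "{}"]) auto
  then show ?case using fun_span_closed_span[OF X, of "\<lambda>_. 0"] by simp
next
  case (insert i F)
  have "(\<lambda>w. c i * f i w + 1 * (\<Sum>i\<in>F. c i * f i w)) \<in> closed_span M X"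
    by (rule closed_span_lincomb[OF X]) (use insert in auto)
  then show ?case using insert by simp
qed

section \<open>Representers of the slice means and the population eigenproblem\<close>

context
  fixes M :: "'w measure" and X :: "'t \<Rightarrow> 'w \<Rightarrow> real" and H ip \<Psi>
  assumes X: "\<And>t. X t \<in> L2 M" and H: "is_rkhs (cov_fun M X) H ip" and Psi: "loeve_isometry M X H ip \<Psi>"
begin

lemma X_closed_span: "X t \<in> closed_span M X"
  by (rule fun_span_closed_span[OF X]) (simp add: fun_span_base)

lemma Psi_in: "\<eta> \<in> closed_span M X \<Longrightarrow> \<Psi> \<eta> \<in> H"
  using Psi by (auto simp: loeve_isometry_def)

lemma Psi_iso: "\<xi> \<in> closed_span M X \<Longrightarrow> \<eta> \<in> closed_span M X \<Longrightarrow> ip (\<Psi> \<xi>) (\<Psi> \<eta>) = l2_inner M \<xi> \<eta>"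
  using Psi by (auto simp: loeve_isometry_def)

lemma Psi_eval:
  assumes "\<eta> \<in> closed_span M X"
  shows "\<Psi> \<eta> t = l2_inner M \<eta> (X t)"
proof -
  have "\<Psi> \<eta> t = ip (\<Psi> \<eta>) (\<lambda>s. cov_fun M X s t)" using H Psi_in[OF assms] unfolding is_rkhs_def by simp
  also have "(\<lambda>s. cov_fun M X s t) = \<Psi> (X t)" using Psi unfolding loeve_isometry_def by simp
  finally show ?thesis using Psi_iso[OF assms X_closed_span] by simp
qed

lemma closed_span_orthogonal:
  assumes "\<eta> \<in> closed_span M X" "\<And>t. l2_inner M \<eta> (X t) = 0"
  shows "l2_norm M \<eta> = 0"
proof -
  have z: "\<Psi> \<eta> = (\<lambda>_. 0)" using Psi_eval[OF assms(1)] assms(2) by auto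
  have "(\<lambda>_. 0) \<in> H" using Psi_in[OF assms(1)] z by simp
  then have "ip (\<lambda>t. 0 * 0 + 0 * 0) (\<lambda>_. 0) = 0 * ip (\<lambda>_. 0) (\<lambda>_. 0) + 0 * ip (\<lambda>_. 0) (\<lambda>_. 0)"
    using H[unfolded is_rkhs_def, THEN conjunct2, THEN conjunct2, THEN conjunct1, rule_format,
        of "\<lambda>_. 0" "\<lambda>_. 0" "\<lambda>_. 0" 0 0] by simp
  then have "ip (\<Psi> \<eta>) (\<Psi> \<eta>) = 0" by (simp add: z)
  then show ?thesis using Psi_iso[OF assms(1,1)] by (simp add: l2_norm_def)
qed

text \<open>A mean given an event is the inner product with a multiple of the indicator of
  the event; projecting the indicator onto the closed span yields a representer of the slice
  mean.\<close>

lemma Psi_representer: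
  assumes y: "y \<in> L2 M" and g: "\<And>t. g t = l2_inner M y (X t)"
  obtains \<eta> where "\<eta> \<in> closed_span M X" "\<Psi> \<eta> = g" "\<And>t. l2_inner M \<eta> (X t) = g t"
proof -
  obtain \<eta> where "\<eta> \<in> closed_span M X" "\<And>t. l2_inner M \<eta> (X t) = l2_inner M y (X t)"
    using closed_span_projection[OF X H Psi y] by blast
  moreover from this have "\<Psi> \<eta> = g" using Psi_eval[of \<eta>] g by auto
  ultimately show thesis using that[of \<eta>] g by simp
qed

context
  fixes S p :: nat and q :: "nat \<Rightarrow> real" and h :: "nat \<Rightarrow> 't \<Rightarrow> real" and \<eta> \<xi> :: "nat \<Rightarrow> 'w \<Rightarrow> real"
    and lam :: "nat \<Rightarrow> real" and f :: "nat \<Rightarrow> 't \<Rightarrow> real"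
  assumes q: "\<And>s. s \<in> {1..S} \<Longrightarrow> q s > 0"
    and \<eta>: "\<And>s. s \<in> {1..S} \<Longrightarrow> \<eta> s \<in> closed_span M X" and \<eta>h: "\<And>s. s \<in> {1..S} \<Longrightarrow> \<Psi> (\<eta> s) = h s"
    and eigen: "simple_eigensystem H ip (\<lambda>g t. \<Sum>s\<in>{1..S}. q s * tensor_op ip (h s) (h s) g t) p lam f"
    and \<xi>: "\<And>j. j \<in> {1..p} \<Longrightarrow> \<xi> j \<in> closed_span M X" and \<xi>f: "\<And>j. j \<in> {1..p} \<Longrightarrow> \<Psi> (\<xi> j) = f j"
begin

private definition cc :: "nat \<Rightarrow> nat \<Rightarrow> real" where "cc s j = l2_inner M (\<eta> s) (\<xi> j)"

private lemma L2s: "s \<in> {1..S} \<Longrightarrow> \<eta> s \<in> L2 M" "j \<in> {1..p} \<Longrightarrow> \<xi> j \<in> L2 M"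
  using \<eta> \<xi> closed_span_L2 by blast+

private lemma LG_Psi:
  assumes "g \<in> closed_span M X"
  shows "(\<Sum>s\<in>{1..S}. q s * tensor_op ip (h s) (h s) (\<Psi> g) t) =
    l2_inner M (\<lambda>w. \<Sum>s\<in>{1..S}. (q s * l2_inner M (\<eta> s) g) * \<eta> s w) (X t)"
proof -
  have "(\<Sum>s\<in>{1..S}. q s * tensor_op ip (h s) (h s) (\<Psi> g) t) = (\<Sum>s\<in>{1..S}. (q s * l2_inner M (\<eta> s) g) * l2_inner M (\<eta> s) (X t))"
    unfolding tensor_op_def using assms
    by (intro sum.cong refl) (simp add: \<eta>h[symmetric] Psi_iso \<eta> Psi_eval)
  also have "\<dots> = l2_inner M (\<lambda>w. \<Sum>s\<in>{1..S}. (q s * l2_inner M (\<eta> s) g) * \<eta> s w) (X t)"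
    by (subst l2_inner_sum_left) (auto intro!: L2_scale L2s X simp: l2_inner_scale_left)
  finally show ?thesis .
qed

text \<open>The eigenvalue equation, transported by the isometry. Its second form expresses
  the eigenvectors by the slice representers, up to null sets.\<close>

lemma eigen_relation:
  assumes j: "j \<in> {1..p}" and z: "z \<in> closed_span M X"
  shows "lam j * l2_inner M (\<xi> j) z = (\<Sum>s\<in>{1..S}. q s * l2_inner M (\<eta> s) (\<xi> j) * l2_inner M (\<eta> s) z)"
    and "l2_norm M (\<lambda>w. lam j * \<xi> j w - (\<Sum>s\<in>{1..S}. (q s * l2_inner M (\<eta> s) (\<xi> j)) * \<eta> s w)) = 0"
proof -
  let ?g = "\<lambda>w. \<Sum>s\<in>{1..S}. (q s * l2_inner M (\<eta> s) (\<xi> j)) * \<eta> s w"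
  let ?D = "\<lambda>w. lam j * \<xi> j w + (-1) * ?g w"
  have gc: "?g \<in> closed_span M X" by (rule closed_span_sum[OF X]) (auto intro: \<eta>)
  have Dc: "?D \<in> closed_span M X" by (rule closed_span_lincomb[OF X \<xi>[OF j] gc])
  have "f j \<in> op_eigenspace H (\<lambda>g t. \<Sum>s\<in>{1..S}. q s * tensor_op ip (h s) (h s) g t) (lam j)"
    using eigen j unfolding simple_eigensystem_def by blast
  then have e: "(\<Sum>s\<in>{1..S}. q s * tensor_op ip (h s) (h s) (f j) t) = lam j * f j t" for t
    unfolding op_eigenspace_def by (auto dest: fun_cong)
  have "l2_inner M ?D (X t) = 0" for t
  proof -
    have "l2_inner M ?g (X t) = lam j * f j t"
      using LG_Psi[OF \<xi>[OF j], of t] e[of t] \<xi>f[OF j] by simp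
    moreover have "l2_inner M ?D (X t) = lam j * l2_inner M (\<xi> j) (X t) + (-1) * l2_inner M ?g (X t)"
      using X closed_span_L2[OF gc] L2s(2)[OF j] by (simp only: l2_inner_add_left L2_scale l2_inner_scale_left)
    ultimately show ?thesis using Psi_eval[OF \<xi>[OF j], of t] \<xi>f[OF j] by simp
  qed
  then have D0: "l2_norm M ?D = 0" by (rule closed_span_orthogonal[OF Dc])
  then show "l2_norm M (\<lambda>w. lam j * \<xi> j w - ?g w) = 0" by simp
  have "0 = l2_inner M ?D z" using l2_inner_le_of_norm_zero[OF closed_span_L2[OF Dc] closed_span_L2[OF z] D0] by simp
  also have "\<dots> = lam j * l2_inner M (\<xi> j) z + (-1) * l2_inner M ?g z"
    using closed_span_L2[OF z] closed_span_L2[OF gc] L2s(2)[OF j] by (simp only: l2_inner_add_left L2_scale l2_inner_scale_left)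
  also have "l2_inner M ?g z = (\<Sum>s\<in>{1..S}. q s * l2_inner M (\<eta> s) (\<xi> j) * l2_inner M (\<eta> s) z)"
    by (subst l2_inner_sum_left) (auto intro!: L2_scale L2s closed_span_L2[OF z] simp: l2_inner_scale_left)
  finally show "lam j * l2_inner M (\<xi> j) z = (\<Sum>s\<in>{1..S}. q s * l2_inner M (\<eta> s) (\<xi> j) * l2_inner M (\<eta> s) z)" by simp
qed

lemma xi_unit: "j \<in> {1..p} \<Longrightarrow> l2_inner M (\<xi> j) (\<xi> j) = 1"
  using eigen Psi_iso[OF \<xi> \<xi>, of j j] \<xi>f[of j] unfolding simple_eigensystem_def by metis

lemma lam_pos: assumes j: "j \<in> {1..p}" shows "lam j > 0"
proof -
  have "lam j \<in> lam ` {1..p}" using j by blast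
  then have "lam j \<noteq> 0" using eigen unfolding simple_eigensystem_def by auto
  moreover have "lam j = (\<Sum>s\<in>{1..S}. q s * l2_inner M (\<eta> s) (\<xi> j) * l2_inner M (\<eta> s) (\<xi> j))"
    using eigen_relation(1)[OF j \<xi>[OF j]] xi_unit[OF j] by simp
  then have "lam j \<ge> 0" using q
    by (metis (no_types, lifting) sum_nonneg mult.assoc mult_nonneg_nonneg zero_le_square less_imp_le)
  ultimately show ?thesis by simp
qed

lemma xi_orthonormal:
  assumes i: "i \<in> {1..p}" and j: "j \<in> {1..p}"
  shows "l2_inner M (\<xi> i) (\<xi> j) = (if i = j then 1 else 0)"
proof (cases "i = j")
  case False
  have "lam i * l2_inner M (\<xi> i) (\<xi> j) = lam j * l2_inner M (\<xi> j) (\<xi> i)"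
    unfolding eigen_relation(1)[OF i \<xi>[OF j]] eigen_relation(1)[OF j \<xi>[OF i]] by (simp add: mult_ac)
  then have "(lam i - lam j) * l2_inner M (\<xi> i) (\<xi> j) = 0" by (simp add: l2_inner_commute[of M "\<xi> j"] left_diff_distrib)
  moreover have "lam i \<noteq> lam j"
    using eigen i j False unfolding simple_eigensystem_def by (metis less_irrefl nat_neq_iff)
  ultimately show ?thesis using False by simp
qed (use xi_unit i in simp)

text \<open>Parseval's identity: the span of the eigenfunctions for nonzero eigenvalues
  contains the slice means, because all weights are positive. An eigenvector for a positive
  eigenvalue of the weighted Gram matrix of the representers yields an eigenfunction of the
  operator, which is a multiple of some \<open>f j\<close> since the eigenvalues are simple.\<close>

lemma eta_gram_in_eigenspaces:
  assumes r: "r \<in> {1..S}" and s: "s \<in> {1..S}"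
  shows "l2_inner M (\<eta> r) (\<eta> s) = (\<Sum>j\<in>{1..p}. l2_inner M (\<eta> r) (\<xi> j) * l2_inner M (\<eta> s) (\<xi> j))"
proof -
  define A where "A a b = sqrt (q (Suc a)) * sqrt (q (Suc b)) * l2_inner M (\<eta> (Suc a)) (\<eta> (Suc b))" for a b
  obtain m c where mc: "spec S A m c"
  proof (rule spectral_theorem)
    show "A a b = A b a" for a b by (simp add: A_def l2_inner_commute[of M "\<eta> (Suc a)"] mult.commute)
  qed
  define g where "g i w = (\<Sum>s\<in>{1..S}. (sqrt (q s) * c i (s - 1)) * \<eta> s w)" for i w
  have gc: "g i \<in> closed_span M X" for i
    unfolding g_def by (rule closed_span_sum[OF X]) (auto intro: \<eta>)
  have gin: "l2_inner M z (g i) = (\<Sum>s\<in>{1..S}. sqrt (q s) * c i (s - 1) * l2_inner M z (\<eta> s))" if "z \<in> L2 M" for z i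
    unfolding g_def using that by (subst l2_inner_sum_right) (auto intro!: L2_scale L2s simp: l2_inner_scale_right)
  have eg: "sqrt (q (Suc a)) * l2_inner M (\<eta> (Suc a)) (g i) = m i * c i a" if "i \<in> {1..S}" "a < S" for i a
  proof -
    have "sqrt (q (Suc a)) * l2_inner M (\<eta> (Suc a)) (g i) = mv S A (c i) a"
      using that L2s(1)[of "Suc a"] unfolding mv_def A_def
      by (simp add: gin sum_distrib_left sum.atLeast1_atMost_eq mult_ac)
    then show ?thesis using spec_mv_u[OF mc that] by simp
  qed
  have gg: "l2_inner M (g i) (g i) = m i" if i: "i \<in> {1..S}" for i
  proof -
    have "l2_inner M (g i) (g i) = (\<Sum>a<S. c i a * (sqrt (q (Suc a)) * l2_inner M (\<eta> (Suc a)) (g i)))"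
      unfolding gin[OF closed_span_L2[OF gc], of i i] One_nat_def sum.atLeast1_atMost_eq
    proof (intro sum.cong refl)
      fix a
      have "l2_inner M (g i) (\<eta> (Suc a)) = l2_inner M (\<eta> (Suc a)) (g i)" by (rule l2_inner_commute)
      then show "sqrt (q (Suc a)) * c i (Suc a - Suc 0) * l2_inner M (g i) (\<eta> (Suc a)) =
          c i a * (sqrt (q (Suc a)) * l2_inner M (\<eta> (Suc a)) (g i))" by simp
    qed
    also have "\<dots> = m i * dot S (c i) (c i)"
      unfolding dot_def sum_distrib_left by (intro sum.cong refl) (simp add: eg[OF i] mult_ac)
    finally show ?thesis using specD(1)[OF mc] i by (simp add: orthon_def)
  qed
  define D where "D w = \<eta> r w + (-1) * (\<Sum>j\<in>{1..p}. l2_inner M (\<eta> r) (\<xi> j) * \<xi> j w)" for w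
  have \<xi>sum: "(\<lambda>w. \<Sum>j\<in>{1..p}. l2_inner M (\<eta> r) (\<xi> j) * \<xi> j w) \<in> closed_span M X"
    by (rule closed_span_sum[OF X]) (auto intro: \<xi>)
  have Dc: "D \<in> closed_span M X"
    using closed_span_lincomb[OF X \<eta>[OF r] \<xi>sum, of 1 "-1"] by (simp add: D_def[abs_def])
  note DL = closed_span_L2[OF Dc]
  have Din: "l2_inner M D z = l2_inner M (\<eta> r) z - (\<Sum>j\<in>{1..p}. l2_inner M (\<eta> r) (\<xi> j) * l2_inner M (\<xi> j) z)" if z: "z \<in> L2 M" for z
  proof -
    have "l2_inner M D z = l2_inner M (\<eta> r) z + (-1) * l2_inner M (\<lambda>w. \<Sum>j\<in>{1..p}. l2_inner M (\<eta> r) (\<xi> j) * \<xi> j w) z"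
      unfolding D_def using L2s(1)[OF r] closed_span_L2[OF \<xi>sum] z
      by (simp only: l2_inner_add_left L2_scale l2_inner_scale_left)
    also have "l2_inner M (\<lambda>w. \<Sum>j\<in>{1..p}. l2_inner M (\<eta> r) (\<xi> j) * \<xi> j w) z = (\<Sum>j\<in>{1..p}. l2_inner M (\<eta> r) (\<xi> j) * l2_inner M (\<xi> j) z)"
      using z by (subst l2_inner_sum_left) (auto intro!: L2_scale L2s simp: l2_inner_scale_left)
    finally show ?thesis by simp
  qed
  have D\<xi>: "l2_inner M D (\<xi> i) = 0" if i: "i \<in> {1..p}" for i
  proof -
    have "(\<Sum>j\<in>{1..p}. l2_inner M (\<eta> r) (\<xi> j) * l2_inner M (\<xi> j) (\<xi> i)) = (\<Sum>j\<in>{1..p}. if j = i then l2_inner M (\<eta> r) (\<xi> j) else 0)"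
      by (intro sum.cong refl) (use xi_orthonormal[OF _ i] in auto)
    then show ?thesis using i by (simp add: Din L2s(2))
  qed
  have Dg: "l2_inner M D (g i) = 0" if i: "i \<in> {1..S}" for i
  proof (cases "m i = 0")
    case True
    then show ?thesis
      using l2_inner_le_of_norm_zero[OF closed_span_L2[OF gc] DL, of i] gg[OF i]
      by (simp add: l2_norm_def l2_inner_commute)
  next
    case False
    let ?L = "\<lambda>g t. \<Sum>s\<in>{1..S}. q s * tensor_op ip (h s) (h s) g t"
    have "?L (\<Psi> (g i)) t = m i * \<Psi> (g i) t" for t
    proof -
      have "(\<lambda>w. \<Sum>s\<in>{1..S}. (q s * l2_inner M (\<eta> s) (g i)) * \<eta> s w) = (\<lambda>w. m i * g i w)"
      proof
        fix w
        have "(\<Sum>s\<in>{1..S}. (q s * l2_inner M (\<eta> s) (g i)) * \<eta> s w) = (\<Sum>s\<in>{1..S}. m i * ((sqrt (q s) * c i (s - 1)) * \<eta> s w))"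
        proof (intro sum.cong refl)
          fix s assume s: "s \<in> {1..S}"
          have "q s * l2_inner M (\<eta> s) (g i) = sqrt (q s) * (sqrt (q s) * l2_inner M (\<eta> s) (g i))"
            using q[OF s] by simp
          also have "\<dots> = sqrt (q s) * (m i * c i (s - 1))"
          proof -
            have "s - 1 < S" "Suc (s - 1) = s" using s by auto
            then show ?thesis using eg[OF i, of "s - 1"] by simp
          qed
          finally show "q s * l2_inner M (\<eta> s) (g i) * \<eta> s w = m i * ((sqrt (q s) * c i (s - 1)) * \<eta> s w)"
            by (simp add: mult_ac)
        qed
        then show "(\<Sum>s\<in>{1..S}. (q s * l2_inner M (\<eta> s) (g i)) * \<eta> s w) = m i * g i w"
          by (simp add: g_def sum_distrib_left)
      qed
      then show ?thesis using LG_Psi[OF gc, of i t] by (simp add: l2_inner_scale_left Psi_eval[OF gc])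
    qed
    then have eig: "\<Psi> (g i) \<in> op_eigenspace H ?L (m i)" unfolding op_eigenspace_def using Psi_in[OF gc] by auto
    moreover have "\<Psi> (g i) \<noteq> (\<lambda>_. 0)"
    proof
      assume "\<Psi> (g i) = (\<lambda>_. 0)"
      then have "l2_norm M (g i) = 0" using Psi_eval[OF gc, of i] by (intro closed_span_orthogonal[OF gc]) (auto dest: fun_cong)
      then show False using gg[OF i] False by (simp add: l2_norm_def)
    qed
    ultimately have "m i \<in> lam ` {1..p}" using eigen False unfolding simple_eigensystem_def by blast
    then obtain j where j: "j \<in> {1..p}" "m i = lam j" by auto
    then have "\<Psi> (g i) \<in> fun_span {f j}" using eigen eig unfolding simple_eigensystem_def by auto
    then obtain F d where "finite F" "F \<subseteq> {f j}" "\<Psi> (g i) = (\<lambda>x. \<Sum>f\<in>F. d f * f x)" by (auto simp: fun_span_def)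
    then have "\<exists>\<alpha>. \<forall>x. \<Psi> (g i) x = \<alpha> * f j x"
      by (cases "F = {}") (auto simp: subset_singleton_iff intro: exI[of _ 0])
    then obtain \<alpha> where \<alpha>: "\<And>x. \<Psi> (g i) x = \<alpha> * \<Psi> (\<xi> j) x" using \<xi>f[OF j(1)] by auto
    let ?E = "\<lambda>w. 1 * g i w + (-\<alpha>) * \<xi> j w"
    have Ec: "?E \<in> closed_span M X" by (rule closed_span_lincomb[OF X gc \<xi>[OF j(1)]])
    have "l2_inner M ?E (X t) = 0" for t
      using l2_inner_add_left[OF L2_scale[OF closed_span_L2[OF gc, of i], of 1] L2_scale[OF L2s(2)[OF j(1)], of "-\<alpha>"] X[of t]]
        \<alpha>[of t] Psi_eval[OF gc, of i t] Psi_eval[OF \<xi>[OF j(1)], of t]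
      unfolding l2_inner_scale_left by simp
    then have "l2_norm M ?E = 0" by (rule closed_span_orthogonal[OF Ec])
    then have "l2_inner M ?E D = 0" by (rule l2_inner_le_of_norm_zero[OF closed_span_L2[OF Ec] DL])
    then have "l2_inner M (g i) D = \<alpha> * l2_inner M (\<xi> j) D"
      using l2_inner_add_left[OF L2_scale[OF closed_span_L2[OF gc, of i], of 1] L2_scale[OF L2s(2)[OF j(1)], of "-\<alpha>"] DL]
      unfolding l2_inner_scale_left by simp
    then show ?thesis using D\<xi>[OF j(1)] by (simp add: l2_inner_commute)
  qed
  have D\<eta>: "l2_inner M D (\<eta> r) = 0"
  proof -
    have "0 = (\<Sum>i\<in>{1..S}. c i (r - 1) * l2_inner M D (g i))" by (simp add: Dg)
    also have "\<dots> = (\<Sum>i\<in>{1..S}. \<Sum>s\<in>{1..S}. c i (r - 1) * c i (s - 1) * (sqrt (q s) * l2_inner M D (\<eta> s)))"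
      by (simp add: gin[OF DL] sum_distrib_left mult_ac)
    also have "\<dots> = (\<Sum>s\<in>{1..S}. \<Sum>i\<in>{1..S}. c i (r - 1) * c i (s - 1) * (sqrt (q s) * l2_inner M D (\<eta> s)))"
      by (rule sum.swap)
    also have "\<dots> = (\<Sum>s\<in>{1..S}. if s = r then sqrt (q s) * l2_inner M D (\<eta> s) else 0)"
    proof (intro sum.cong refl)
      fix s assume s: "s \<in> {1..S}"
      have "(\<Sum>i\<in>{1..S}. c i (r - 1) * c i (s - 1)) = (if s = r then 1 else 0)"
        using orthon_complete[OF specD(1)[OF mc], of "r - 1" "s - 1"] r s by auto
      then show "(\<Sum>i\<in>{1..S}. c i (r - 1) * c i (s - 1) * (sqrt (q s) * l2_inner M D (\<eta> s))) =
          (if s = r then sqrt (q s) * l2_inner M D (\<eta> s) else 0)"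
        unfolding sum_distrib_right[symmetric] by simp
    qed
    also have "\<dots> = sqrt (q r) * l2_inner M D (\<eta> r)" using r by simp
    finally show ?thesis using q[OF r] by simp
  qed
  have "l2_inner M D D = 0"
  proof -
    have "l2_inner M D D = l2_inner M (\<eta> r) D - (\<Sum>j\<in>{1..p}. l2_inner M (\<eta> r) (\<xi> j) * l2_inner M (\<xi> j) D)" by (rule Din[OF DL])
    moreover have "l2_inner M (\<eta> r) D = 0" using D\<eta> by (simp add: l2_inner_commute)
    moreover have "l2_inner M (\<xi> j) D = 0" if "j \<in> {1..p}" for j using D\<xi>[OF that] by (simp add: l2_inner_commute)
    ultimately show ?thesis by simp
  qed
  then have "l2_inner M D (\<eta> s) = 0"
    by (intro l2_inner_le_of_norm_zero[OF DL L2s(1)[OF s]]) (simp add: l2_norm_def)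
  then show ?thesis using Din[OF L2s(1)[OF s]] by (simp add: l2_inner_commute[of M _ "\<eta> s"])
qed

end
end

section \<open>Linear combinations of the sampled process\<close>

text \<open>The counterpart of \<open>lin_comb\<close> for coefficient vectors given as functions.\<close>

definition proc :: "('t \<Rightarrow> 'w \<Rightarrow> real) \<Rightarrow> (nat \<Rightarrow> 't) \<Rightarrow> nat \<Rightarrow> (nat \<Rightarrow> real) \<Rightarrow> 'w \<Rightarrow> real" where
  "proc X \<tau> n b = (\<lambda>w. \<Sum>a<n. b a * X (\<tau> (Suc a)) w)"

definition gram :: "('t \<Rightarrow> 't \<Rightarrow> real) \<Rightarrow> (nat \<Rightarrow> 't) \<Rightarrow> nat \<Rightarrow> nat \<Rightarrow> real" where
  "gram R \<tau> a b = R (\<tau> (Suc a)) (\<tau> (Suc b))"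

lemma proc_L2: "(\<And>t. X t \<in> L2 M) \<Longrightarrow> proc X \<tau> n b \<in> L2 M"
  unfolding proc_def by (rule L2_lincomb)

lemma l2_inner_proc:
  assumes "\<And>t. X t \<in> L2 M" "z \<in> L2 M"
  shows "l2_inner M z (proc X \<tau> n b) = dot n (\<lambda>a. l2_inner M z (X (\<tau> (Suc a)))) b"
  unfolding proc_def using assms
  by (subst l2_inner_sum_right) (auto intro!: L2_scale simp: l2_inner_scale_right dot_def mult_ac)

lemma l2_inner_proc_proc:
  assumes "\<And>t. X t \<in> L2 M"
  shows "l2_inner M (proc X \<tau> n b) (proc X \<tau> n d) = dot n b (mv n (gram (cov_fun M X) \<tau>) d)"
proof -
  have "l2_inner M (proc X \<tau> n b) (proc X \<tau> n d) = dot n (\<lambda>a. l2_inner M (proc X \<tau> n b) (X (\<tau> (Suc a)))) d"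
    by (rule l2_inner_proc) (auto intro: assms proc_L2)
  also have "\<dots> = dot n (mv n (gram (cov_fun M X) \<tau>) b) d"
  proof (rule dot_cong)
    fix a
    have "l2_inner M (proc X \<tau> n b) (X (\<tau> (Suc a))) = dot n (\<lambda>a'. l2_inner M (X (\<tau> (Suc a))) (X (\<tau> (Suc a')))) b"
      unfolding l2_inner_commute[of M "proc X \<tau> n b"] by (rule l2_inner_proc) (auto intro: assms)
    then show "l2_inner M (proc X \<tau> n b) (X (\<tau> (Suc a))) = mv n (gram (cov_fun M X) \<tau>) b a"
      by (simp add: dot_def mv_def gram_def cov_fun_def l2_inner_def)
  qed simp
  also have "\<dots> = dot n b (mv n (gram (cov_fun M X) \<tau>) d)"
    by (rule dot_mv_sym[symmetric]) (simp add: gram_def cov_fun_def mult.commute)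
  finally show ?thesis .
qed

lemma proc_diff: "proc X \<tau> n (\<lambda>a. b a - d a) w = proc X \<tau> n b w - proc X \<tau> n d w"
  by (simp add: proc_def left_diff_distrib sum_subtractf)

lemma proc_sum: "proc X \<tau> n (\<lambda>a. \<Sum>i\<in>F. c i * b i a) w = (\<Sum>i\<in>F. c i * proc X \<tau> n (b i) w)"
proof -
  have "proc X \<tau> n (\<lambda>a. \<Sum>i\<in>F. c i * b i a) w = (\<Sum>a<n. \<Sum>i\<in>F. c i * (b i a * X (\<tau> (Suc a)) w))"
    by (simp add: proc_def sum_distrib_right mult.assoc)
  also have "\<dots> = (\<Sum>i\<in>F. \<Sum>a<n. c i * (b i a * X (\<tau> (Suc a)) w))" by (rule sum.swap)
  finally show ?thesis by (simp add: proc_def sum_distrib_left)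
qed

section \<open>Eigenvectors of a convergent sum of dyads\<close>

text \<open>With \<open>W\<close> the matrix with columns \<open>y s\<close>, these are \<open>A = W W\<^sup>T\<close> and
  \<open>B = W\<^sup>T W\<close>; the image under \<open>W\<close> of the first \<open>j\<close> eigenvectors of \<open>B\<close> is a test
  space for \<open>A\<close>. As the roles may be exchanged, positive eigenvalues of both matrices
  agree.\<close>

lemma gram_eigval_le:
  assumes A: "spec d A l u" and A_eq: "\<And>a b. a < d \<Longrightarrow> b < d \<Longrightarrow> A a b = (\<Sum>s<S. y s a * y s b)"
    and B: "spec S B g c" and B_eq: "\<And>s r. s < S \<Longrightarrow> r < S \<Longrightarrow> B s r = dot d (y s) (y r)"
    and j: "j \<in> {1..d}" "j \<in> {1..S}" and g: "g j > 0"
  shows "g j \<le> l j"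
proof (rule minmax_lower[OF A j(1), where w = "\<lambda>i a. \<Sum>s<S. c (Suc i) s * y s a"])
  fix \<alpha> :: "nat \<Rightarrow> real" assume \<alpha>: "dot j \<alpha> \<alpha> = 1"
  define x where "x a = (\<Sum>i<j. \<alpha> i * (\<Sum>s<S. c (Suc i) s * y s a))" for a
  define z where "z s = (\<Sum>i<j. \<alpha> i * c (Suc i) s)" for s
  have xz: "x a = (\<Sum>s<S. z s * y s a)" for a
  proof -
    have "x a = (\<Sum>i<j. \<Sum>s<S. \<alpha> i * c (Suc i) s * y s a)" by (simp add: x_def sum_distrib_left mult.assoc)
    also have "\<dots> = (\<Sum>s<S. \<Sum>i<j. \<alpha> i * c (Suc i) s * y s a)" by (rule sum.swap)
    finally show ?thesis by (simp add: z_def sum_distrib_right)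
  qed
  have yx: "dot d (y s) x = mv S B z s" if "s < S" for s
    using that by (simp add: xz[abs_def] dot_sum_right dot_scale_right mv_def B_eq mult.commute)
  have xx: "dot d x x = dot S z (mv S B z)"
  proof -
    have "dot d x x = (\<Sum>s<S. z s * dot d (y s) x)"
      by (subst (1) xz[abs_def]) (simp add: dot_sum_left dot_scale_left)
    also have "\<dots> = dot S z (mv S B z)" unfolding dot_def[of S] by (intro sum.cong refl) (simp add: yx)
    finally show ?thesis .
  qed
  have xAx: "dot d x (mv d A x) = dot S (mv S B z) (mv S B z)"
  proof -
    have Ax: "mv d A x a = (\<Sum>s<S. y s a * dot d (y s) x)" if "a < d" for a
    proof -
      have "mv d A x a = (\<Sum>b<d. \<Sum>s<S. y s a * (y s b * x b))"
        unfolding mv_def using that by (intro sum.cong refl) (simp add: A_eq sum_distrib_right mult.assoc)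
      also have "\<dots> = (\<Sum>s<S. \<Sum>b<d. y s a * (y s b * x b))" by (rule sum.swap)
      finally show ?thesis by (simp add: dot_def sum_distrib_left)
    qed
    have "dot d x (mv d A x) = dot d x (\<lambda>a. \<Sum>s<S. dot d (y s) x * y s a)"
      by (rule dot_cong) (simp_all add: Ax mult.commute)
    also have "\<dots> = (\<Sum>s<S. dot d (y s) x * dot d (y s) x)"
      by (simp add: dot_sum_right dot_scale_right dot_commute[of d x])
    also have "\<dots> = dot S (mv S B z) (mv S B z)" unfolding dot_def[of S] by (intro sum.cong refl) (simp add: yx)
    finally show ?thesis .
  qed
  have o: "orthon S c" by (rule specD(1)[OF B])
  have cz: "dot S (c i) z = (if i \<le> j then \<alpha> (i - 1) else 0)" if i: "i \<in> {1..S}" for i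
  proof -
    have "dot S (c i) z = (\<Sum>m<j. \<alpha> m * dot S (c i) (c (Suc m)))"
      by (simp add: z_def[abs_def] dot_sum_right dot_scale_right)
    also have "\<dots> = (\<Sum>m<j. if m = i - 1 then \<alpha> m else 0)"
      using o i j by (intro sum.cong refl) (auto simp: orthon_def)
    finally show ?thesis using i by auto
  qed
  have sub: "(\<Sum>i\<in>{1..S}. f i * (dot S (c i) z)\<^sup>2) = (\<Sum>i\<in>{1..j}. f i * (\<alpha> (i - 1))\<^sup>2)" for f
    using j by (intro sum.mono_neutral_cong_right) (auto simp: cz)
  have a1: "(\<Sum>i\<in>{1..j}. (\<alpha> (i - 1))\<^sup>2) = 1"
    using \<alpha> by (simp add: dot_def sum.atLeast1_atMost_eq power2_eq_square)
  have gj: "g j \<le> g i" "0 < g i" if "i \<in> {1..j}" for i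
    using specD(2)[OF B, of i j] that j g by auto
  have 1: "dot S z (mv S B z) = (\<Sum>i\<in>{1..j}. g i * (\<alpha> (i - 1))\<^sup>2)" unfolding quad_spec[OF B] sub ..
  have 2: "dot S (mv S B z) (mv S B z) = (\<Sum>i\<in>{1..j}. (g i)\<^sup>2 * (\<alpha> (i - 1))\<^sup>2)"
  proof -
    have "dot S (mv S B z) (mv S B z) = (nrm S (mv S B z))\<^sup>2" by (simp add: nrm_sq)
    also have "\<dots> = (\<Sum>i\<in>{1..S}. (g i)\<^sup>2 * (dot S (c i) z)\<^sup>2)"
      unfolding parseval_nrm[OF o] by (intro sum.cong refl) (simp add: spec_dot_u[OF B] power_mult_distrib)
    finally show ?thesis unfolding sub .
  qed
  have "g j * 1 \<le> dot S z (mv S B z)"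
    unfolding 1 a1[symmetric] sum_distrib_left by (intro sum_mono mult_right_mono gj) auto
  then have pos: "dot d x x > 0" using xx g by simp
  have "g j * dot d x x \<le> dot d x (mv d A x)"
    unfolding xAx xx 1 2 sum_distrib_left mult.assoc[symmetric]
    by (intro sum_mono mult_right_mono) (auto simp: power2_eq_square intro!: mult_right_mono gj less_imp_le[OF gj(2)])
  then show "(\<Sum>a<d. (\<Sum>i<j. \<alpha> i * (\<Sum>s<S. c (Suc i) s * y s a))\<^sup>2) > 0 \<and>
     dot d (\<lambda>a. \<Sum>i<j. \<alpha> i * (\<Sum>s<S. c (Suc i) s * y s a)) (mv d A (\<lambda>a. \<Sum>i<j. \<alpha> i * (\<Sum>s<S. c (Suc i) s * y s a)))
      \<ge> g j * (\<Sum>a<d. (\<Sum>i<j. \<alpha> i * (\<Sum>s<S. c (Suc i) s * y s a))\<^sup>2)"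
    using pos unfolding x_def[symmetric] by (simp add: dot_def power2_eq_square)
qed

text \<open>The vectors \<open>\<theta> m\<close>, an incomplete orthonormal family in general, serve as
  test vectors in both halves of the Courant-Fischer principle.\<close>

lemma eigvals_of_expansion:
  fixes \<theta> :: "nat \<Rightarrow> nat \<Rightarrow> real"
  assumes A: "spec n A l u"
    and A_eq: "\<And>a b. a < n \<Longrightarrow> b < n \<Longrightarrow> A a b = (\<Sum>m\<in>{1..p}. lam m * \<theta> m a * \<theta> m b)"
    and \<theta>: "\<And>i j. i \<in> {1..p} \<Longrightarrow> j \<in> {1..p} \<Longrightarrow> dot n (\<theta> i) (\<theta> j) = (if i = j then 1 else 0)"
    and lam: "\<And>i. i \<in> {1..p} \<Longrightarrow> lam i > 0" "\<And>i j. i \<in> {1..p} \<Longrightarrow> j \<in> {1..p} \<Longrightarrow> i < j \<Longrightarrow> lam j < lam i"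
    and j: "j \<in> {1..p}"
  shows "j \<le> n" "l j = lam j"
proof -
  have quad: "dot n x (mv n A x) = (\<Sum>m\<in>{1..p}. lam m * (dot n (\<theta> m) x)\<^sup>2)" for x
  proof -
    have Ax: "mv n A x a = (\<Sum>m\<in>{1..p}. lam m * dot n (\<theta> m) x * \<theta> m a)" if "a < n" for a
    proof -
      have "mv n A x a = (\<Sum>b<n. \<Sum>m\<in>{1..p}. lam m * \<theta> m a * \<theta> m b * x b)"
        unfolding mv_def using that by (intro sum.cong refl) (simp add: A_eq sum_distrib_right)
      also have "\<dots> = (\<Sum>m\<in>{1..p}. \<Sum>b<n. lam m * \<theta> m a * \<theta> m b * x b)" by (rule sum.swap)
      finally show ?thesis by (simp add: dot_def sum_distrib_left sum_distrib_right mult_ac)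
    qed
    have "dot n x (mv n A x) = dot n x (\<lambda>a. \<Sum>m\<in>{1..p}. (lam m * dot n (\<theta> m) x) * \<theta> m a)"
      by (rule dot_cong) (simp_all add: Ax)
    then show ?thesis by (simp add: dot_sum_right dot_scale_right dot_commute[of n x] power2_eq_square mult.assoc)
  qed
  have lj: "lam j \<le> lam i" if "i \<in> {1..j}" for i
    using lam(2)[of i j] that j by (cases "i = j") auto
  have \<theta>x: "dot n (\<theta> m) (\<lambda>a. \<Sum>i<k. c i * \<theta> (Suc i) a) = (if m \<le> k then c (m - 1) else 0)"
    if "m \<in> {1..p}" "k \<le> p" for m k c
  proof -
    have "dot n (\<theta> m) (\<lambda>a. \<Sum>i<k. c i * \<theta> (Suc i) a) = (\<Sum>i<k. if i = m - 1 then c i else 0)"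
      unfolding dot_sum_right dot_scale_right using that by (intro sum.cong refl) (auto simp: \<theta>)
    then show ?thesis using that by auto
  qed
  have xx: "dot n (\<lambda>a. \<Sum>i<k. c i * \<theta> (Suc i) a) (\<lambda>a. \<Sum>i<k. c i * \<theta> (Suc i) a) = dot k c c" if "k \<le> p" for k c
  proof -
    have "dot n (\<lambda>a. \<Sum>i<k. c i * \<theta> (Suc i) a) (\<lambda>a. \<Sum>i<k. c i * \<theta> (Suc i) a) =
        (\<Sum>i<k. c i * dot n (\<theta> (Suc i)) (\<lambda>a. \<Sum>i<k. c i * \<theta> (Suc i) a))"
      by (simp add: dot_sum_left dot_scale_left)
    also have "\<dots> = (\<Sum>i<k. c i * c i)"
      using that by (intro sum.cong refl) (subst \<theta>x, auto)
    finally show ?thesis by (simp add: dot_def)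
  qed
  have "p \<le> n"
  proof (rule ccontr)
    assume "\<not> p \<le> n"
    then obtain c where c: "dot p c c = 1" "\<And>i. i < n \<Longrightarrow> dot p (\<lambda>m. \<theta> (Suc m) i) c = 0"
      using nontrivial_kernel[of n p "\<lambda>i m. \<theta> (Suc m) i"] by (metis not_le)
    have "dot n (\<lambda>a. \<Sum>i<p. c i * \<theta> (Suc i) a) (\<lambda>a. \<Sum>i<p. c i * \<theta> (Suc i) a) = 0"
      unfolding dot_self_0_iff using c(2) by (simp add: dot_def mult.commute)
    then show False using xx[of p c] c(1) by simp
  qed
  then show jn: "j \<le> n" using j by simp
  then have jn': "j \<in> {1..n}" using j by simp
  have "lam j \<le> l j"
  proof (rule minmax_lower[OF A jn', where w = "\<lambda>i. \<theta> (Suc i)"])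
    fix c :: "nat \<Rightarrow> real" assume c: "dot j c c = 1"
    let ?x = "\<lambda>a. \<Sum>i<j. c i * \<theta> (Suc i) a"
    have 1: "(\<Sum>a<n. (?x a)\<^sup>2) = 1" using xx[of j c] c j by (simp add: dot_def power2_eq_square)
    have "dot n ?x (mv n A ?x) = (\<Sum>m\<in>{1..p}. lam m * (if m \<le> j then c (m - 1) else 0)\<^sup>2)"
      unfolding quad using j by (intro sum.cong refl) (subst \<theta>x, auto)
    also have "\<dots> = (\<Sum>m\<in>{1..j}. lam m * (c (m - 1))\<^sup>2)"
      using j by (intro sum.mono_neutral_cong_right) auto
    also have "\<dots> \<ge> (\<Sum>m\<in>{1..j}. lam j * (c (m - 1))\<^sup>2)"
      by (intro sum_mono mult_right_mono lj) auto
    also have "(\<Sum>m\<in>{1..j}. lam j * (c (m - 1))\<^sup>2) = lam j"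
      using c by (simp add: sum_distrib_left[symmetric] dot_def sum.atLeast1_atMost_eq power2_eq_square)
    finally show "(\<Sum>a<n. (?x a)\<^sup>2) > 0 \<and> dot n ?x (mv n A ?x) \<ge> lam j * (\<Sum>a<n. (?x a)\<^sup>2)" using 1 by simp
  qed
  moreover have "l j \<le> lam j"
  proof (rule minmax_upper[OF A jn', where w = "\<lambda>i. \<theta> (Suc i)"])
    fix x assume x: "dot n x x = 1" and o: "\<And>i. i < j - 1 \<Longrightarrow> dot n (\<theta> (Suc i)) x = 0"
    have "dot n x (mv n A x) \<le> (\<Sum>m\<in>{1..p}. lam j * (dot n (\<theta> m) x)\<^sup>2)"
      unfolding quad
    proof (rule sum_mono)
      fix m assume m: "m \<in> {1..p}"
      show "lam m * (dot n (\<theta> m) x)\<^sup>2 \<le> lam j * (dot n (\<theta> m) x)\<^sup>2"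
      proof (cases "m < j")
        case True then show ?thesis using o[of "m - 1"] m by auto
      next
        case False
        then have "lam m \<le> lam j" using lam(2)[of j m] j m by (cases "m = j") auto
        then show ?thesis by (rule mult_right_mono) simp
      qed
    qed
    also have "\<dots> = lam j * (\<Sum>m\<in>{1..p}. (dot n (\<theta> m) x)\<^sup>2)" by (simp add: sum_distrib_left)
    also have "\<dots> \<le> lam j * 1"
    proof (rule mult_left_mono)
      define c where "c i = dot n (\<theta> (Suc i)) x" for i
      let ?y = "\<lambda>a. \<Sum>i<p. c i * \<theta> (Suc i) a"
      have "0 \<le> dot n (\<lambda>a. x a - ?y a) (\<lambda>a. x a - ?y a)" by simp
      also have "\<dots> = 1 - 2 * dot n ?y x + dot p c c"
      proof -
        have "dot n x ?y = dot n ?y x" by (rule dot_commute)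
        then show ?thesis unfolding dot_diff_left dot_diff_right x xx[OF order_refl] by simp
      qed
      also have "dot n ?y x = dot p c c" by (simp add: dot_sum_left dot_scale_left c_def[symmetric] dot_def[of p])
      also have "dot p c c = (\<Sum>m\<in>{1..p}. (dot n (\<theta> m) x)\<^sup>2)"
        by (simp add: dot_def[of p] c_def sum.atLeast1_atMost_eq power2_eq_square)
      finally show "(\<Sum>m\<in>{1..p}. (dot n (\<theta> m) x)\<^sup>2) \<le> 1" by simp
    qed (use lam(1)[OF j] in simp)
    finally show "dot n x (mv n A x) \<le> lam j" by simp
  qed
  ultimately show "l j = lam j" by simp
qed

text \<open>The dimension \<open>d i\<close> of the eigenproblem may be unbounded, but the problem has
  rank at most \<open>S\<close>: the \<open>S \<times> S\<close> Gram matrix of the weighted vectors \<open>w i s\<close> has the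
  same positive eigenvalues, and it converges to a matrix with simple positive eigenvalues
  \<open>lam\<close>. The vector of inner products of \<open>v i\<close> with the weighted \<open>w i s\<close> is an eigenvector
  of that Gram matrix; its components along the other limiting eigenvectors tend to 0, since
  the eigenvalues stay separated. The remaining component gives \<open>\<alpha> i\<close>, which is a sign
  in the limit.\<close>

lemma eigenvector_coefficients_converge:
  fixes S p j :: nat and q lam :: "nat \<Rightarrow> real" and G cc :: "nat \<Rightarrow> nat \<Rightarrow> real"
    and d :: "nat \<Rightarrow> nat" and w :: "nat \<Rightarrow> nat \<Rightarrow> nat \<Rightarrow> real" and ph :: "nat \<Rightarrow> nat \<Rightarrow> real"
  assumes q: "\<And>s. s \<in> {1..S} \<Longrightarrow> q s > 0"
    and lam: "\<And>i. i \<in> {1..p} \<Longrightarrow> lam i > 0" "\<And>i j. i \<in> {1..p} \<Longrightarrow> j \<in> {1..p} \<Longrightarrow> i < j \<Longrightarrow> lam j < lam i"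
    and cc: "\<And>i j. i \<in> {1..p} \<Longrightarrow> j \<in> {1..p} \<Longrightarrow> (\<Sum>s\<in>{1..S}. q s * cc s i * cc s j) = (if i = j then lam i else 0)"
    and G: "\<And>s r. s \<in> {1..S} \<Longrightarrow> r \<in> {1..S} \<Longrightarrow> G s r = (\<Sum>j\<in>{1..p}. cc s j * cc r j)"
    and j: "j \<in> {1..p}"
    and ph0: "\<And>i s. s \<in> {1..S} \<Longrightarrow> ph i s \<ge> 0"
    and ph: "\<And>s. s \<in> {1..S} \<Longrightarrow> (\<lambda>i. ph i s) \<longlonglongrightarrow> q s"
    and w: "\<And>s r. s \<in> {1..S} \<Longrightarrow> r \<in> {1..S} \<Longrightarrow> (\<lambda>i. dot (d i) (w i s) (w i r)) \<longlonglongrightarrow> G s r"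
    and M: "\<And>i. spec (d i) (Mh i) (l i) (u i)"
    and M_eq: "\<And>i a b. a < d i \<Longrightarrow> b < d i \<Longrightarrow> Mh i a b = (\<Sum>s\<in>{1..S}. ph i s * w i s a * w i s b)"
    and d: "\<And>i. j \<le> d i"
    and v: "\<And>i a. a < d i \<Longrightarrow> mv (d i) (Mh i) (v i) a = l i j * v i a" "\<And>i. dot (d i) (v i) (v i) = 1"
  obtains \<alpha> where "(\<lambda>i. (\<alpha> i)\<^sup>2) \<longlonglongrightarrow> 1"
    "\<And>s. s \<in> {1..S} \<Longrightarrow> (\<lambda>i. ph i s * dot (d i) (w i s) (v i) / l i j - \<alpha> i * (q s * cc s j / lam j)) \<longlonglongrightarrow> 0"
    "(\<lambda>i. l i j) \<longlonglongrightarrow> lam j"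
proof -
  \<comment> \<open>The vectors \<open>\<theta> m\<close> are the unit eigenvectors of the limiting Gram
    matrix \<open>B0\<close>.\<close>
  define \<theta> where "\<theta> m a = sqrt (q (Suc a)) * cc (Suc a) m / sqrt (lam m)" for m a
  define B where "B i a b = sqrt (ph i (Suc a)) * sqrt (ph i (Suc b)) * dot (d i) (w i (Suc a)) (w i (Suc b))" for i a b
  define B0 where "B0 a b = sqrt (q (Suc a)) * sqrt (q (Suc b)) * G (Suc a) (Suc b)" for a b
  have "\<exists>g c. spec S (B i) g c" for i
  proof -
    have sym: "B i a b = B i b a" if "a < S" "b < S" for a b
    proof -
      have "dot (d i) (w i (Suc a)) (w i (Suc b)) = dot (d i) (w i (Suc b)) (w i (Suc a))" by (rule dot_commute)
      then show ?thesis by (simp add: B_def)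
    qed
    show ?thesis by (rule spectral_theorem[of S "B i"], erule (1) sym) (intro exI)
  qed
  then obtain g c where g: "\<And>i. spec S (B i) (g i) (c i)" by metis
  have B0_eq: "B0 a b = (\<Sum>m\<in>{1..p}. lam m * \<theta> m a * \<theta> m b)" if "a < S" "b < S" for a b
  proof -
    have "B0 a b = (\<Sum>m\<in>{1..p}. sqrt (q (Suc a)) * sqrt (q (Suc b)) * (cc (Suc a) m * cc (Suc b) m))"
      using that by (simp add: B0_def G sum_distrib_left)
    also have "\<dots> = (\<Sum>m\<in>{1..p}. lam m * \<theta> m a * \<theta> m b)"
    proof (intro sum.cong refl)
      fix m assume "m \<in> {1..p}"
      then have "lam m > 0" by (rule lam)
      then have "lam m = sqrt (lam m) * sqrt (lam m)" "sqrt (lam m) \<noteq> 0" by auto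
      then show "sqrt (q (Suc a)) * sqrt (q (Suc b)) * (cc (Suc a) m * cc (Suc b) m) = lam m * \<theta> m a * \<theta> m b"
        unfolding \<theta>_def by (simp add: field_simps)
    qed
    finally show ?thesis .
  qed
  obtain g0 c0 where g0: "spec S B0 g0 c0"
  proof (rule spectral_theorem)
    show "B0 a b = B0 b a" if "a < S" "b < S" for a b
      unfolding B0_eq[OF that] B0_eq[OF that(2,1)] by (intro sum.cong refl) (simp add: mult_ac)
  qed
  have \<theta>: "dot S (\<theta> m) (\<theta> m') = (if m = m' then 1 else 0)" if m: "m \<in> {1..p}" "m' \<in> {1..p}" for m m'
  proof -
    have "dot S (\<theta> m) (\<theta> m') = (\<Sum>s\<in>{1..S}. (q s * cc s m * cc s m') / (sqrt (lam m) * sqrt (lam m')))"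
      unfolding dot_def One_nat_def sum.atLeast1_atMost_eq
    proof (intro sum.cong refl)
      fix a assume "a \<in> {..<S}"
      then have "q (Suc a) > 0" using q by auto
      then have "sqrt (q (Suc a)) * sqrt (q (Suc a)) = q (Suc a)" by simp
      then show "\<theta> m a * \<theta> m' a = q (Suc a) * cc (Suc a) m * cc (Suc a) m' / (sqrt (lam m) * sqrt (lam m'))"
        unfolding \<theta>_def by (simp add: field_simps)
    qed
    also have "\<dots> = (if m = m' then lam m else 0) / (sqrt (lam m) * sqrt (lam m'))"
      unfolding sum_divide_distrib[symmetric] cc[OF m] ..
    also have "\<dots> = (if m = m' then 1 else 0)" using lam(1)[OF m(1)] lam(1)[OF m(2)] by simp
    finally show ?thesis .
  qed
  note jS = eigvals_of_expansion[OF g0 B0_eq \<theta> lam j]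
  have jS': "j \<in> {1..S}" using jS(1) j by simp
  have Blim: "(\<lambda>i. B i a b) \<longlonglongrightarrow> B0 a b" if "a < S" "b < S" for a b
    unfolding B_def B0_def using that by (intro tendsto_mult tendsto_real_sqrt ph w) auto
  have Flim: "(\<lambda>i. frob S (\<lambda>a b. B i a b - B0 a b)) \<longlonglongrightarrow> 0"
  proof -
    have "(\<lambda>i. frob S (\<lambda>a b. B i a b - B0 a b)) \<longlonglongrightarrow> sqrt (\<Sum>a<S. \<Sum>b<S. (B0 a b - B0 a b)\<^sup>2)"
      unfolding frob_def by (intro tendsto_real_sqrt tendsto_sum tendsto_power tendsto_diff Blim tendsto_const) auto
    then show ?thesis by simp
  qed
  have glim: "(\<lambda>i. g i j) \<longlonglongrightarrow> lam j"
  proof (rule LIM_zero_cancel, rule Lim_null_comparison[OF _ Flim])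
    show "\<forall>\<^sub>F i in sequentially. norm (g i j - lam j) \<le> frob S (\<lambda>a b. B i a b - B0 a b)"
      using weyl[OF g0 g jS'] jS(2) by (intro always_eventually allI) simp
  qed
  let ?y = "\<lambda>i s a. sqrt (ph i (Suc s)) * w i (Suc s) a"
  have M_eq': "Mh i a b = (\<Sum>s<S. ?y i s a * ?y i s b)" if "a < d i" "b < d i" for i a b
    unfolding M_eq[OF that] One_nat_def sum.atLeast1_atMost_eq
  proof (intro sum.cong refl)
    fix s assume "s \<in> {..<S}"
    then have "sqrt (ph i (Suc s)) * sqrt (ph i (Suc s)) = ph i (Suc s)" using ph0 by auto
    then show "ph i (Suc s) * w i (Suc s) a * w i (Suc s) b = ?y i s a * ?y i s b" by (simp add: mult_ac) 
  qed
  have B_eq': "B i s r = dot (d i) (?y i s) (?y i r)" for i s r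
    by (simp add: B_def dot_scale_left dot_scale_right)
  have dj: "j \<in> {1..d i}" for i using d[of i] j by simp
  have "\<forall>\<^sub>F i in sequentially. g i j > 0" using glim lam(1)[OF j] by (rule order_tendstoD)
  then have lg: "\<forall>\<^sub>F i in sequentially. l i j = g i j"
  proof eventually_elim
    case (elim i)
    have "g i j \<le> l i j" by (rule gram_eigval_le[OF M M_eq' g B_eq' dj jS' elim])
    moreover have "l i j \<le> g i j"
    proof (rule gram_eigval_le[where y = "\<lambda>a s. ?y i s a", OF g _ M _ jS' dj])
      show "B i a b = (\<Sum>s<d i. ?y i a s * ?y i b s)" for a b unfolding B_eq' dot_def ..
      show "Mh i s r = dot S (\<lambda>a. ?y i a s) (\<lambda>a. ?y i a r)" if "s < d i" "r < d i" for s r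
        unfolding M_eq'[OF that] dot_def ..
      show "l i j > 0" using calculation elim by simp
    qed
    ultimately show ?case by simp
  qed
  have llim: "(\<lambda>i. l i j) \<longlonglongrightarrow> lam j"
    by (rule Lim_transform_eventually[OF glim]) (use lg in \<open>simp add: eq_commute\<close>)
  define z where "z i s = dot (d i) (?y i s) (v i)" for i s
  have Mv: "mv (d i) (Mh i) (v i) a = (\<Sum>s<S. z i s * ?y i s a)" if "a < d i" for i a
  proof -
    have "mv (d i) (Mh i) (v i) a = (\<Sum>b<d i. \<Sum>s<S. ?y i s a * (?y i s b * v i b))"
      unfolding mv_def using that by (intro sum.cong refl) (simp add: M_eq' sum_distrib_right mult.assoc)
    also have "\<dots> = (\<Sum>s<S. \<Sum>b<d i. ?y i s a * (?y i s b * v i b))" by (rule sum.swap)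
    finally show ?thesis by (simp add: z_def dot_def sum_distrib_left mult_ac)
  qed
  have zz: "dot S (z i) (z i) = l i j" for i
  proof -
    have "l i j = dot (d i) (v i) (\<lambda>a. l i j * v i a)" by (simp add: dot_scale_right v)
    also have "\<dots> = dot (d i) (v i) (\<lambda>a. \<Sum>s<S. z i s * ?y i s a)"
      by (rule dot_cong) (simp_all add: v(1)[symmetric] Mv)
    also have "\<dots> = dot S (z i) (z i)"
      unfolding dot_sum_right dot_scale_right[of "d i" "v i" "z i _"] by (simp add: dot_commute[of "d i" "v i"] z_def[symmetric] dot_def[of S])
    finally show ?thesis by simp
  qed
  have Bz: "mv S (B i) (z i) s = l i j * z i s" if "s < S" for i s
  proof -
    have "mv S (B i) (z i) s = dot (d i) (?y i s) (\<lambda>a. \<Sum>r<S. z i r * ?y i r a)"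
      unfolding dot_sum_right dot_scale_right[of "d i" "?y i s" "z i _"] mv_def B_eq' by (simp add: mult.commute)
    also have "\<dots> = dot (d i) (?y i s) (\<lambda>a. l i j * v i a)"
      by (rule dot_cong) (simp_all add: v(1)[symmetric] Mv)
    also have "\<dots> = l i j * z i s" unfolding dot_scale_right[of _ _ "l i j"] z_def ..
    finally show ?thesis .
  qed
  have zbd: "\<bar>z i s\<bar> \<le> sqrt (l i j)" if "s < S" for i s
  proof -
    have "(z i s)\<^sup>2 \<le> (\<Sum>s<S. z i s * z i s)" using that by (simp add: power2_eq_square) (rule member_le_sum, auto)
    then have "\<bar>z i s\<bar>\<^sup>2 \<le> l i j" using zz[of i] by (simp add: dot_def)
    then show ?thesis by (rule real_le_rsqrt)
  qed
  have B0z: "(\<lambda>i. mv S B0 (z i) s - l i j * z i s) \<longlonglongrightarrow> 0" if s: "s < S" for s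
  proof (rule Lim_null_comparison)
    have sl: "(\<lambda>i. sqrt (l i j)) \<longlonglongrightarrow> sqrt (lam j)" by (rule tendsto_real_sqrt[OF llim])
    have "(\<lambda>i. \<Sum>r<S. \<bar>B0 s r - B i s r\<bar> * sqrt (l i j)) \<longlonglongrightarrow> (\<Sum>r<S. \<bar>B0 s r - B0 s r\<bar> * sqrt (lam j))"
      using s by (intro tendsto_sum tendsto_mult tendsto_rabs tendsto_diff tendsto_const Blim sl) auto
    then show "(\<lambda>i. \<Sum>r<S. \<bar>B0 s r - B i s r\<bar> * sqrt (l i j)) \<longlonglongrightarrow> 0" by simp
    have "\<bar>mv S B0 (z i) s - l i j * z i s\<bar> \<le> (\<Sum>r<S. \<bar>B0 s r - B i s r\<bar> * sqrt (l i j))" for i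
    proof -
      have "mv S B0 (z i) s - l i j * z i s = (\<Sum>r<S. (B0 s r - B i s r) * z i r)"
        unfolding Bz[OF s, symmetric] mv_def by (simp add: sum_subtractf left_diff_distrib)
      also have "\<bar>\<dots>\<bar> \<le> (\<Sum>r<S. \<bar>(B0 s r - B i s r) * z i r\<bar>)" by (rule sum_abs)
      also have "\<dots> \<le> (\<Sum>r<S. \<bar>B0 s r - B i s r\<bar> * sqrt (l i j))"
        unfolding abs_mult by (intro sum_mono mult_left_mono zbd) auto
      finally show ?thesis .
    qed
    then show "\<forall>\<^sub>F i in sequentially. norm (mv S B0 (z i) s - l i j * z i s) \<le> (\<Sum>r<S. \<bar>B0 s r - B i s r\<bar> * sqrt (l i j))"
      by simp
  qed
  define t where "t m i = dot S (\<theta> m) (z i)" for m i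
  have B0x: "mv S B0 x a = (\<Sum>m\<in>{1..p}. lam m * dot S (\<theta> m) x * \<theta> m a)" if "a < S" for a x
  proof -
    have "mv S B0 x a = (\<Sum>b<S. \<Sum>m\<in>{1..p}. lam m * \<theta> m a * \<theta> m b * x b)"
      unfolding mv_def using that by (intro sum.cong refl) (simp add: B0_eq sum_distrib_right)
    also have "\<dots> = (\<Sum>m\<in>{1..p}. \<Sum>b<S. lam m * \<theta> m a * \<theta> m b * x b)" by (rule sum.swap)
    finally show ?thesis by (simp add: dot_def sum_distrib_left sum_distrib_right mult_ac)
  qed
  have t0: "(\<lambda>i. t m i) \<longlonglongrightarrow> 0" if m: "m \<in> {1..p}" "m \<noteq> j" for m
  proof -
    have e: "(\<Sum>s<S. \<theta> m s * (mv S B0 (z i) s - l i j * z i s)) = (lam m - l i j) * t m i" for i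
    proof -
      have "dot S (\<theta> m) (mv S B0 (z i)) = dot S (\<theta> m) (\<lambda>a. \<Sum>k\<in>{1..p}. (lam k * t k i) * \<theta> k a)"
        by (rule dot_cong) (simp_all add: B0x t_def)
      also have "\<dots> = (\<Sum>k\<in>{1..p}. if k = m then lam k * t k i else 0)"
        unfolding dot_sum_right dot_scale_right using m by (intro sum.cong refl) (auto simp: \<theta>)
      also have "\<dots> = lam m * t m i" using m by simp
      finally have "dot S (\<theta> m) (\<lambda>s. mv S B0 (z i) s - l i j * z i s) = (lam m - l i j) * t m i"
        by (simp add: dot_diff_right dot_scale_right t_def[symmetric] left_diff_distrib)
      then show ?thesis by (simp add: dot_def)
    qed
    have "(\<lambda>i. \<Sum>s<S. \<theta> m s * (mv S B0 (z i) s - l i j * z i s)) \<longlonglongrightarrow> (\<Sum>s<S. \<theta> m s * 0)"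
      by (intro tendsto_sum tendsto_mult tendsto_const B0z) auto
    then have 1: "(\<lambda>i. (lam m - l i j) * t m i) \<longlonglongrightarrow> 0" by (simp add: e)
    have ne: "lam m - lam j \<noteq> 0" using lam(2)[of m j] lam(2)[of j m] m j by (cases "m < j") auto
    have 2: "(\<lambda>i. lam m - l i j) \<longlonglongrightarrow> lam m - lam j" by (intro tendsto_diff tendsto_const llim)
    have 3: "(\<lambda>i. (lam m - l i j) * t m i / (lam m - l i j)) \<longlonglongrightarrow> 0 / (lam m - lam j)"
      by (rule tendsto_divide[OF 1 2 ne])
    have "\<forall>\<^sub>F i in sequentially. lam m - l i j \<noteq> 0" using 2 ne by (rule tendsto_imp_eventually_ne)
    then have "\<forall>\<^sub>F i in sequentially. (lam m - l i j) * t m i / (lam m - l i j) = t m i"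
      by eventually_elim simp
    then show ?thesis using 3 by (simp add: tendsto_cong)
  qed
  have lamj: "lam j > 0" by (rule lam(1)[OF j])
  have zlim: "(\<lambda>i. z i s - t j i * \<theta> j s) \<longlonglongrightarrow> 0" if s: "s < S" for s
  proof -
    have e: "mv S B0 (z i) s = lam j * t j i * \<theta> j s + (\<Sum>m\<in>{1..p} - {j}. lam m * t m i * \<theta> m s)" for i
      unfolding B0x[OF s] t_def[symmetric] using j by (intro sum.remove) auto
    have tb: "\<bar>t j i\<bar> \<le> 1 * sqrt (l i j)" for i
      using dot_le_nrm[of S "\<theta> j" "z i"] \<theta>[OF j j] zz[of i] by (simp add: t_def nrm_def)
    have sl: "(\<lambda>i. sqrt (l i j)) \<longlonglongrightarrow> sqrt (lam j)" by (rule tendsto_real_sqrt[OF llim])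
    have 1: "(\<lambda>i. (lam j - l i j) * t j i) \<longlonglongrightarrow> 0"
    proof (rule Lim_null_comparison)
      show "\<forall>\<^sub>F i in sequentially. norm ((lam j - l i j) * t j i) \<le> \<bar>lam j - l i j\<bar> * sqrt (l i j)"
        using tb by (intro always_eventually allI) (simp add: abs_mult mult_left_mono)
      have "(\<lambda>i. \<bar>lam j - l i j\<bar> * sqrt (l i j)) \<longlonglongrightarrow> \<bar>lam j - lam j\<bar> * sqrt (lam j)"
        by (intro tendsto_mult tendsto_rabs tendsto_diff tendsto_const llim sl)
      then show "(\<lambda>i. \<bar>lam j - l i j\<bar> * sqrt (l i j)) \<longlonglongrightarrow> 0" by simp
    qed
    have 2: "(\<lambda>i. \<Sum>m\<in>{1..p} - {j}. lam m * t m i * \<theta> m s) \<longlonglongrightarrow> (\<Sum>m\<in>{1..p} - {j}. lam m * 0 * \<theta> m s)"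
      by (intro tendsto_sum tendsto_mult tendsto_const t0) auto
    have "(\<lambda>i. (lam j - l i j) * t j i * \<theta> j s + (\<Sum>m\<in>{1..p} - {j}. lam m * t m i * \<theta> m s)
        - (mv S B0 (z i) s - l i j * z i s)) \<longlonglongrightarrow> 0 * \<theta> j s + (\<Sum>m\<in>{1..p} - {j}. lam m * 0 * \<theta> m s) - 0"
      by (intro tendsto_diff tendsto_add tendsto_mult 1 2 B0z s tendsto_const)
    moreover have "(lam j - l i j) * t j i * \<theta> j s + (\<Sum>m\<in>{1..p} - {j}. lam m * t m i * \<theta> m s)
        - (mv S B0 (z i) s - l i j * z i s) = l i j * (z i s - t j i * \<theta> j s)" for i
      unfolding e by (simp add: algebra_simps)
    ultimately have 3: "(\<lambda>i. l i j * (z i s - t j i * \<theta> j s)) \<longlonglongrightarrow> 0" by simp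
    have 4: "(\<lambda>i. l i j * (z i s - t j i * \<theta> j s) / l i j) \<longlonglongrightarrow> 0 / lam j"
      using lamj by (intro tendsto_divide 3 llim) simp
    have "\<forall>\<^sub>F i in sequentially. l i j \<noteq> 0" using llim lamj by (intro tendsto_imp_eventually_ne) auto
    then have "\<forall>\<^sub>F i in sequentially. l i j * (z i s - t j i * \<theta> j s) / l i j = z i s - t j i * \<theta> j s"
      by eventually_elim simp
    then show ?thesis using 4 by (simp add: tendsto_cong)
  qed
  define \<alpha> where "\<alpha> i = t j i / sqrt (lam j)" for i
  have t_sq: "(\<lambda>i. (t j i)\<^sup>2) \<longlonglongrightarrow> lam j"
  proof -
    have "dot S (\<lambda>s. z i s - t j i * \<theta> j s) (\<lambda>s. z i s - t j i * \<theta> j s) = l i j - (t j i)\<^sup>2" for i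
      using \<theta>[OF j j] by (simp add: dot_simps zz dot_commute[of S "z i" "\<theta> j"] t_def[symmetric] power2_eq_square)
    moreover have "(\<lambda>i. dot S (\<lambda>s. z i s - t j i * \<theta> j s) (\<lambda>s. z i s - t j i * \<theta> j s)) \<longlonglongrightarrow> (\<Sum>s<S. 0 * 0)"
      unfolding dot_def by (intro tendsto_sum tendsto_mult zlim) auto
    ultimately have "(\<lambda>i. l i j - (t j i)\<^sup>2) \<longlonglongrightarrow> 0" by simp
    from tendsto_diff[OF llim this] show ?thesis by simp
  qed
  show thesis
  proof (rule that[of \<alpha>])
    have "(\<lambda>i. (t j i)\<^sup>2 / lam j) \<longlonglongrightarrow> lam j / lam j" using lamj by (intro tendsto_divide t_sq tendsto_const) simp
    then show "(\<lambda>i. (\<alpha> i)\<^sup>2) \<longlonglongrightarrow> 1" using lamj by (simp add: \<alpha>_def power_divide)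
    show "(\<lambda>i. l i j) \<longlonglongrightarrow> lam j" by (rule llim)
    fix s assume s: "s \<in> {1..S}"
    define a where "a = s - 1"
    have a: "a < S" "Suc a = s" using s by (auto simp: a_def)
    have tb: "Bseq (\<lambda>i. t j i)"
    proof -
      have "Bseq (\<lambda>i. (t j i)\<^sup>2)" by (rule convergent_imp_Bseq) (use t_sq in \<open>auto simp: convergent_def\<close>)
      then obtain K where K: "\<And>i. norm ((t j i)\<^sup>2) \<le> K" by (auto simp: Bseq_def)
      have "norm (t j i) \<le> sqrt K" for i using K[of i] by (intro real_le_rsqrt) simp
      then show ?thesis by (rule BseqI')
    qed
    have 1: "(\<lambda>i. sqrt (ph i s) / l i j) \<longlonglongrightarrow> sqrt (q s) / lam j"
      using lamj s by (intro tendsto_divide tendsto_real_sqrt ph llim) auto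
    have 2: "(\<lambda>i. sqrt (ph i s) / l i j * (z i a - t j i * \<theta> j a)) \<longlonglongrightarrow> sqrt (q s) / lam j * 0"
      by (intro tendsto_mult 1 zlim a)
    have 3: "(\<lambda>i. (sqrt (ph i s) / l i j - sqrt (q s) / lam j) * t j i) \<longlonglongrightarrow> 0"
    proof -
      have "(\<lambda>i. sqrt (ph i s) / l i j - sqrt (q s) / lam j) \<longlonglongrightarrow> 0" by (rule LIM_zero[OF 1])
      then have "Zfun (\<lambda>i. sqrt (ph i s) / l i j - sqrt (q s) / lam j) sequentially" by (simp add: tendsto_Zfun_iff)
      then have "Zfun (\<lambda>i. (sqrt (ph i s) / l i j - sqrt (q s) / lam j) * t j i) sequentially"
        using tb by (intro bounded_bilinear.Zfun_prod_Bfun[OF bounded_bilinear_mult])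
      then show ?thesis by (simp add: tendsto_Zfun_iff)
    qed
    have "(\<lambda>i. sqrt (ph i s) / l i j * (z i a - t j i * \<theta> j a) + (sqrt (ph i s) / l i j - sqrt (q s) / lam j) * t j i * \<theta> j a)
        \<longlonglongrightarrow> sqrt (q s) / lam j * 0 + 0 * \<theta> j a"
      by (intro tendsto_add 2 tendsto_mult 3 tendsto_const)
    moreover have "sqrt (ph i s) / l i j * (z i a - t j i * \<theta> j a) + (sqrt (ph i s) / l i j - sqrt (q s) / lam j) * t j i * \<theta> j a
        = ph i s * dot (d i) (w i s) (v i) / l i j - \<alpha> i * (q s * cc s j / lam j)" for i
    proof -
      have p: "sqrt (ph i s) * sqrt (ph i s) = ph i s" "sqrt (q s) * sqrt (q s) = q s" using ph0[OF s, of i] q[OF s] by auto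
      have "sqrt (ph i s) * z i a = ph i s * dot (d i) (w i s) (v i)"
        unfolding z_def dot_scale_left a(2) mult.assoc[symmetric] p ..
      moreover have "sqrt (q s) * t j i * \<theta> j a = \<alpha> i * (q s * cc s j)"
      proof -
        have "sqrt (q s) * t j i * \<theta> j a = (sqrt (q s) * sqrt (q s)) * t j i * cc s j / sqrt (lam j)"
          by (simp add: \<theta>_def a(2))
        then show ?thesis unfolding p by (simp add: \<alpha>_def)
      qed
      moreover have "sqrt (ph i s) / l i j * (z i a - t j i * \<theta> j a) + (sqrt (ph i s) / l i j - sqrt (q s) / lam j) * t j i * \<theta> j a
        = sqrt (ph i s) * z i a / l i j - sqrt (q s) * t j i * \<theta> j a / lam j"
        by (simp add: algebra_simps diff_divide_distrib)
      ultimately show ?thesis by simp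
    qed
    ultimately show "(\<lambda>i. ph i s * dot (d i) (w i s) (v i) / l i j - \<alpha> i * (q s * cc s j / lam j)) \<longlonglongrightarrow> 0" by simp
  qed
qed

section \<open>Mean-square law of large numbers\<close>

text \<open>The observations live on a space of their own; the generic observation \<open>W0\<close>,
  which has the same law, lives on the space of the process.\<close>

locale iid_sample = D: prob_space D
  for D :: "'v measure" +
  fixes M :: "'w measure" and N :: "'z measure" and W :: "nat \<Rightarrow> 'v \<Rightarrow> 'z" and W0 :: "'w \<Rightarrow> 'z"
  assumes indep: "D.indep_vars (\<lambda>_. N) W {1..}"
    and W0: "W0 \<in> measurable M N"
    and same: "\<And>i. i \<ge> 1 \<Longrightarrow> distr D N (W i) = distr M N W0"
begin

lemma W_measurable [measurable]: "i \<ge> 1 \<Longrightarrow> W i \<in> measurable D N"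
  using indep by (auto simp: D.indep_vars_def)

lemma expectation_W:
  fixes g :: "'z \<Rightarrow> real"
  assumes "i \<ge> 1" "g \<in> borel_measurable N"
  shows "(\<integral>\<omega>. g (W i \<omega>) \<partial>D) = (\<integral>w. g (W0 w) \<partial>M)" "integrable D (\<lambda>\<omega>. g (W i \<omega>)) \<longleftrightarrow> integrable M (\<lambda>w. g (W0 w))"
proof -
  have "(\<integral>\<omega>. g (W i \<omega>) \<partial>D) = (\<integral>z. g z \<partial>distr D N (W i))"
    using assms by (simp add: integral_distr W_measurable)
  then show "(\<integral>\<omega>. g (W i \<omega>) \<partial>D) = (\<integral>w. g (W0 w) \<partial>M)"
    using assms W0 by (simp add: same integral_distr)
  have "integrable D (\<lambda>\<omega>. g (W i \<omega>)) \<longleftrightarrow> integrable (distr D N (W i)) g"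
    using assms by (simp add: integrable_distr_eq W_measurable)
  then show "integrable D (\<lambda>\<omega>. g (W i \<omega>)) \<longleftrightarrow> integrable M (\<lambda>w. g (W0 w))"
    using assms W0 by (simp add: same integrable_distr_eq)
qed

lemma AE_W:
  assumes "i \<ge> 1" "Measurable.pred N P" "AE w in M. P (W0 w)"
  shows "AE \<omega> in D. P (W i \<omega>)"
proof -
  have "AE z in distr M N W0. P z" using assms W0 by (subst AE_distr_iff) auto
  then have "AE z in distr D N (W i). P z" unfolding same[OF assms(1)] .
  then show ?thesis using assms W_measurable[OF assms(1)] by (subst (asm) AE_distr_iff) auto
qed

definition avg :: "('z \<Rightarrow> real) \<Rightarrow> nat \<Rightarrow> 'v \<Rightarrow> real" where
  "avg g n \<omega> = (\<Sum>i\<in>{1..n}. g (W i \<omega>)) / real n"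

definition mean :: "('z \<Rightarrow> real) \<Rightarrow> real" where "mean g = (\<integral>w. g (W0 w) \<partial>M)"

lemma avg_measurable [measurable]: "g \<in> borel_measurable N \<Longrightarrow> avg g n \<in> borel_measurable D"
  unfolding avg_def[abs_def] by (intro borel_measurable_divide borel_measurable_sum measurable_const)
    (auto intro: measurable_compose[OF W_measurable])

lemma mean_square_error:
  assumes g: "g \<in> borel_measurable N" and g2: "integrable M (\<lambda>w. (g (W0 w))\<^sup>2)" and n: "n \<ge> 1"
  shows "integrable D (\<lambda>\<omega>. (avg g n \<omega> - mean g)\<^sup>2)"
    and "(\<integral>\<omega>. (avg g n \<omega> - mean g)\<^sup>2 \<partial>D) \<le> (\<integral>w. (g (W0 w))\<^sup>2 \<partial>M) / n"
proof -
  define U where "U i \<omega> = g (W i \<omega>) - mean g" for i \<omega>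
  define V where "V = (\<integral>w. (g (W0 w))\<^sup>2 \<partial>M)"
  have gg: "(\<lambda>z. (g z)\<^sup>2) \<in> borel_measurable N" using g by simp
  have i2: "integrable D (\<lambda>\<omega>. (g (W i \<omega>))\<^sup>2)" if "i \<ge> 1" for i
    using expectation_W(2)[OF that gg] g2 by simp
  have gm: "(\<lambda>\<omega>. g (W i \<omega>)) \<in> borel_measurable D" if "i \<ge> 1" for i
    using measurable_compose[OF W_measurable[OF that] g] by simp
  have i1: "integrable D (\<lambda>\<omega>. g (W i \<omega>))" if "i \<ge> 1" for i
    using D.square_integrable_imp_integrable[OF gm[OF that] i2[OF that]] .
  have iU: "integrable D (U i)" if "i \<ge> 1" for i
    unfolding U_def[abs_def] using i1[OF that] by simp
  have EU: "(\<integral>\<omega>. U i \<omega> \<partial>D) = 0" if "i \<ge> 1" for i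
    unfolding U_def using i1[OF that] expectation_W(1)[OF that g] by (simp add: D.prob_space mean_def)
  have Usq: "(U i \<omega>)\<^sup>2 = (g (W i \<omega>))\<^sup>2 - 2 * mean g * g (W i \<omega>) + (mean g)\<^sup>2" for i \<omega>
    by (simp add: U_def power2_diff)
  have iU2: "integrable D (\<lambda>\<omega>. (U i \<omega>)\<^sup>2)" if "i \<ge> 1" for i
    unfolding Usq using i1[OF that] i2[OF that] by simp
  have EU2: "(\<integral>\<omega>. (U i \<omega>)\<^sup>2 \<partial>D) \<le> V" if "i \<ge> 1" for i
  proof -
    have "(\<integral>\<omega>. (U i \<omega>)\<^sup>2 \<partial>D) = (\<integral>\<omega>. (g (W i \<omega>))\<^sup>2 \<partial>D) - 2 * mean g * (\<integral>\<omega>. g (W i \<omega>) \<partial>D) + (mean g)\<^sup>2"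
      unfolding Usq using i1[OF that] i2[OF that] by (simp add: D.prob_space)
    also have "\<dots> = V - (mean g)\<^sup>2"
      unfolding expectation_W(1)[OF that gg] expectation_W(1)[OF that g] mean_def[symmetric] V_def[symmetric]
      by (simp add: power2_eq_square)
    finally show ?thesis by simp
  qed
  have indU: "D.indep_vars (\<lambda>_. borel) U {1..}"
    unfolding U_def[abs_def] by (rule D.indep_vars_compose2[OF indep]) (use g in measurable)
  have cross: "integrable D (\<lambda>\<omega>. U i \<omega> * U j \<omega>) \<and> (\<integral>\<omega>. U i \<omega> * U j \<omega> \<partial>D) \<le> (if i = j then V else 0)"
    if ij: "i \<ge> 1" "j \<ge> 1" for i j
  proof (cases "i = j")
    case True
    then show ?thesis using iU2[OF ij(1)] EU2[OF ij(1)] by (simp add: power2_eq_square)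
  next
    case False
    have ind: "D.indep_vars (\<lambda>_. borel) U {i, j}" by (rule D.indep_vars_subset[OF indU]) (use ij in auto)
    have "integrable D (\<lambda>\<omega>. \<Prod>k\<in>{i, j}. U k \<omega>)"
      by (rule D.indep_vars_integrable[OF _ ind]) (use ij iU in auto)
    moreover have "(\<integral>\<omega>. (\<Prod>k\<in>{i, j}. U k \<omega>) \<partial>D) = (\<Prod>k\<in>{i, j}. \<integral>\<omega>. U k \<omega> \<partial>D)"
      by (rule D.indep_vars_lebesgue_integral[OF _ ind]) (use ij iU in auto)
    ultimately show ?thesis using False ij by (simp add: EU)
  qed
  have sq: "(avg g n \<omega> - mean g)\<^sup>2 = (\<Sum>i\<in>{1..n}. \<Sum>j\<in>{1..n}. U i \<omega> * U j \<omega>) / (real n)\<^sup>2" for \<omega>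
  proof -
    have "avg g n \<omega> - mean g = (\<Sum>i\<in>{1..n}. U i \<omega>) / n"
      using n by (simp add: avg_def U_def sum_subtractf field_simps)
    then have "(avg g n \<omega> - mean g)\<^sup>2 = (\<Sum>i\<in>{1..n}. U i \<omega>) * (\<Sum>i\<in>{1..n}. U i \<omega>) / (real n)\<^sup>2"
      by (simp add: power_divide power2_eq_square)
    then show ?thesis by (simp add: sum_product)
  qed
  show "integrable D (\<lambda>\<omega>. (avg g n \<omega> - mean g)\<^sup>2)"
    unfolding sq using cross by (intro integrable_divide Bochner_Integration.integrable_sum) auto
  have "(\<integral>\<omega>. (avg g n \<omega> - mean g)\<^sup>2 \<partial>D) = (\<Sum>i\<in>{1..n}. \<Sum>j\<in>{1..n}. \<integral>\<omega>. U i \<omega> * U j \<omega> \<partial>D) / (real n)\<^sup>2"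
  proof -
    have "(\<integral>\<omega>. (\<Sum>i\<in>{1..n}. \<Sum>j\<in>{1..n}. U i \<omega> * U j \<omega>) \<partial>D) = (\<Sum>i\<in>{1..n}. \<integral>\<omega>. (\<Sum>j\<in>{1..n}. U i \<omega> * U j \<omega>) \<partial>D)"
      using cross by (intro Bochner_Integration.integral_sum Bochner_Integration.integrable_sum) auto
    also have "\<dots> = (\<Sum>i\<in>{1..n}. \<Sum>j\<in>{1..n}. \<integral>\<omega>. U i \<omega> * U j \<omega> \<partial>D)"
      using cross by (intro sum.cong refl Bochner_Integration.integral_sum) auto
    finally show ?thesis unfolding sq by simp
  qed
  also have "\<dots> \<le> (\<Sum>i\<in>{1..n}. \<Sum>j\<in>{1..n}. if i = j then V else 0) / (real n)\<^sup>2"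
    using cross by (intro divide_right_mono sum_mono) auto
  also have "\<dots> = V / n" using n by (simp add: power2_eq_square)
  finally show "(\<integral>\<omega>. (avg g n \<omega> - mean g)\<^sup>2 \<partial>D) \<le> (\<integral>w. (g (W0 w))\<^sup>2 \<partial>M) / n" by (simp add: V_def)
qed

text \<open>Markov's inequality for the sum of the mean-square errors. A common bound for the
  second moments suffices, so the family may grow with \<open>n\<close>.\<close>

lemma family_deviation:
  fixes g :: "'k \<Rightarrow> 'z \<Rightarrow> real" and V c :: real and n :: nat
  assumes "finite F" and g: "\<And>f. f \<in> F \<Longrightarrow> g f \<in> borel_measurable N"
    and g2: "\<And>f. f \<in> F \<Longrightarrow> integrable M (\<lambda>w. (g f (W0 w))\<^sup>2)"
    and V: "\<And>f. f \<in> F \<Longrightarrow> (\<integral>w. (g f (W0 w))\<^sup>2 \<partial>M) \<le> V"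
    and n: "n \<ge> 1" and c: "c > 0"
  shows "{\<omega>\<in>space D. c \<le> (\<Sum>f\<in>F. (avg (g f) n \<omega> - mean (g f))\<^sup>2)} \<in> sets D"
    and "measure D {\<omega>\<in>space D. c \<le> (\<Sum>f\<in>F. (avg (g f) n \<omega> - mean (g f))\<^sup>2)} \<le> card F * V / (n * c)"
proof -
  let ?u = "\<lambda>\<omega>. \<Sum>f\<in>F. (avg (g f) n \<omega> - mean (g f))\<^sup>2"
  have i: "integrable D ?u" using mean_square_error(1)[OF g g2 n] by (intro Bochner_Integration.integrable_sum) auto
  then have m: "?u \<in> borel_measurable D" by simp
  then show s: "{\<omega>\<in>space D. c \<le> ?u \<omega>} \<in> sets D" by measurable
  have "measure D {\<omega>\<in>space D. c \<le> ?u \<omega>} \<le> (\<integral>\<omega>. ?u \<omega> \<partial>D) / c"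
    by (rule integral_Markov_inequality_measure[OF i sets.top]) (auto simp: c intro!: sum_nonneg)
  also have "(\<integral>\<omega>. ?u \<omega> \<partial>D) = (\<Sum>f\<in>F. \<integral>\<omega>. (avg (g f) n \<omega> - mean (g f))\<^sup>2 \<partial>D)"
    using mean_square_error(1)[OF g g2 n] by (intro Bochner_Integration.integral_sum) auto
  also have "\<dots> \<le> (\<Sum>f\<in>F. V / n)"
    using order_trans[OF mean_square_error(2)[OF g g2 n] divide_right_mono[OF V]] by (intro sum_mono) auto
  finally have "measure D {\<omega>\<in>space D. c \<le> ?u \<omega>} \<le> (\<Sum>f\<in>F. V / n) / c" using c by (simp add: divide_right_mono)
  then show "measure D {\<omega>\<in>space D. c \<le> ?u \<omega>} \<le> card F * V / (n * c)" by simp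
qed

end

section \<open>Gram matrices of the sampled process\<close>

lemma spec_cong: "(\<And>a b. a < n \<Longrightarrow> b < n \<Longrightarrow> A a b = B a b) \<Longrightarrow> spec n A l u \<longleftrightarrow> spec n B l u"
  by (auto simp: spec_def)

lemma ent_kernel_mat: "a < J \<Longrightarrow> b < J \<Longrightarrow> ent (kernel_mat R \<tau> J) a b = gram R \<tau> a b"
  by (simp add: ent_def kernel_mat_def gram_def)

lemma kernel_mat_carrier [simp]: "kernel_mat R \<tau> J \<in> carrier_mat J J"
  by (simp add: kernel_mat_def)

lemma spec_kernel_mat: "spec J (ent (kernel_mat R \<tau> J)) l u \<longleftrightarrow> spec J (gram R \<tau>) l u"
  by (rule spec_cong) (rule ent_kernel_mat)

lemma gram_quad: "(\<And>t. X t \<in> L2 M) \<Longrightarrow> dot n b (mv n (gram (cov_fun M X) \<tau>) b) = (l2_norm M (proc X \<tau> n b))\<^sup>2"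
  by (simp add: l2_norm_sq l2_inner_proc_proc)

section \<open>Conditional expectation given the response\<close>

lemma indicator_L2: "prob_space M \<Longrightarrow> A \<in> sets M \<Longrightarrow> (indicator A :: 'a \<Rightarrow> real) \<in> L2 M"
proof -
  assume p: "prob_space M" and A: "A \<in> sets M"
  interpret prob_space M by (rule p)
  have "(\<lambda>w. (indicator A w :: real)\<^sup>2) = indicator A" by (auto simp: indicator_def)
  then show ?thesis using A by (simp add: L2_def integrable_indicator_iff emeasure_eq_measure)
qed

text \<open>Slice events are measurable with respect to the response, so \<open>Z t\<close> and \<open>X t\<close>
  have the same integral over them.\<close>

lemma conditional_expectation_slice:
  fixes X :: "'t \<Rightarrow> 'w \<Rightarrow> real"
  assumes M: "prob_space M" and X: "\<And>t. X t \<in> L2 M" and Y: "Y \<in> measurable M N"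
    and Z: "\<And>t. Z t \<in> borel_measurable (sigma_rv M N Y)"
      "\<And>t. AE w in M. Z t w = real_cond_exp M (sigma_rv M N Y) (X t) w"
    and A: "A \<in> sets N"
  shows "Z t \<in> L2 M"
    and "l2_inner M (indicator (Y -` A \<inter> space M)) (Z t) = l2_inner M (indicator (Y -` A \<inter> space M)) (X t)"
proof -
  interpret prob_space M by (rule M)
  let ?F = "sigma_rv M N Y"
  have YN: "Y \<in> space M \<rightarrow> space N" using Y by (auto simp: measurable_def)
  have subalg: "subalgebra M ?F"
    unfolding subalgebra_def sigma_rv_def using Y by (auto simp: sets_vimage_algebra2[OF YN] measurable_sets)
  interpret finite_measure_subalgebra M ?F by unfold_locales (rule subalg)
  have ZM: "Z t \<in> borel_measurable M" by (rule measurable_from_subalg[OF subalg Z(1)])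
  have X1: "integrable M (X t)"
    using square_integrable_imp_integrable[OF L2_D[OF X]] .
  have X2: "integrable M (\<lambda>w. (X t w)\<^sup>2)" by (rule L2_D(2)[OF X])
  have conv: "convex_on UNIV (\<lambda>x::real. x\<^sup>2)"
    using convex_power_even[of 2] by simp
  have "integrable M (\<lambda>w. (real_cond_exp M ?F (X t) w)\<^sup>2)"
    by (rule integrable_convex_cond_exp[where I = UNIV and q = "\<lambda>x. x\<^sup>2", OF X1 _ _ X2 conv]) auto
  moreover have "integrable M (\<lambda>w. (real_cond_exp M ?F (X t) w)\<^sup>2) \<longleftrightarrow> integrable M (\<lambda>w. (Z t w)\<^sup>2)"
    by (rule integrable_cong_AE) (use ZM Z(2)[of t] in \<open>auto intro: measurable_from_subalg[OF subalg]\<close>)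
  ultimately show ZL: "Z t \<in> L2 M" using ZM by (simp add: L2_def)
  have B: "Y -` A \<inter> space M \<in> sets ?F" unfolding sigma_rv_def using A by (auto simp: sets_vimage_algebra2[OF YN])
  let ?B = "Y -` A \<inter> space M"
  have "l2_inner M (indicator ?B) (Z t) = (\<integral>w. indicator ?B w * real_cond_exp M ?F (X t) w \<partial>M)"
    unfolding l2_inner_def
  proof (rule integral_cong_AE)
    show "(\<lambda>w. indicator ?B w * Z t w) \<in> borel_measurable M"
      using ZM Y A by measurable
    show "(\<lambda>w. indicator ?B w * real_cond_exp M ?F (X t) w) \<in> borel_measurable M"
      using Y A by measurable
    show "AE w in M. indicator ?B w * Z t w = indicator ?B w * real_cond_exp M ?F (X t) w"
      using Z(2)[of t] by eventually_elim simp
  qed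
  also have "\<dots> = (\<integral>w\<in>?B. X t w \<partial>M)"
    using real_cond_exp_intA[OF X1 B] by (simp add: set_lebesgue_integral_def)
  also have "\<dots> = l2_inner M (indicator ?B) (X t)" by (simp add: l2_inner_def set_lebesgue_integral_def)
  finally show "l2_inner M (indicator ?B) (Z t) = l2_inner M (indicator ?B) (X t)" .
qed

text \<open>The left side is \<open>1 / q\<close> times the squared inner product of the slice indicator
  with a combination of the \<open>Z t\<close>; the indicator has squared norm \<open>q\<close>.\<close>

lemma slice_mean_le_conditional_covariance:
  fixes X :: "'t \<Rightarrow> 'w \<Rightarrow> real"
  assumes M: "prob_space M" and X: "\<And>t. X t \<in> L2 M" and Y: "Y \<in> measurable M N"
    and Z: "\<And>t. Z t \<in> borel_measurable (sigma_rv M N Y)"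
      "\<And>t. AE w in M. Z t w = real_cond_exp M (sigma_rv M N Y) (X t) w"
    and A: "A \<in> sets N" and q: "q = measure M (Y -` A \<inter> space M)" "q > 0"
    and h: "\<And>t. h t = l2_inner M (indicator (Y -` A \<inter> space M)) (X t) / q"
  shows "q * (dot n (\<lambda>a. h (\<tau> (Suc a))) b)\<^sup>2 \<le> dot n b (mv n (gram (cov_fun M Z) \<tau>) b)"
proof -
  interpret prob_space M by (rule M)
  let ?B = "Y -` A \<inter> space M"
  have Zs: "Z t \<in> L2 M"
    "l2_inner M (indicator (Y -` A \<inter> space M)) (Z t) = l2_inner M (indicator (Y -` A \<inter> space M)) (X t)" for t
    by (rule conditional_expectation_slice[OF M X Y Z A])+
  have B: "?B \<in> sets M" using Y A by measurable
  have IL: "(indicator ?B :: 'w \<Rightarrow> real) \<in> L2 M" by (rule indicator_L2[OF M B])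
  have "q * dot n (\<lambda>a. h (\<tau> (Suc a))) b = dot n (\<lambda>a. l2_inner M (indicator ?B) (Z (\<tau> (Suc a)))) b"
    using q(2) by (simp add: dot_scale_left[symmetric] h Zs(2))
  also have "\<dots> = l2_inner M (indicator ?B) (proc Z \<tau> n b)" by (rule l2_inner_proc[OF Zs(1) IL, symmetric])
  finally have e: "q * dot n (\<lambda>a. h (\<tau> (Suc a))) b = l2_inner M (indicator ?B) (proc Z \<tau> n b)" .
  have iq: "(l2_norm M (indicator ?B))\<^sup>2 = q"
  proof -
    have "(\<lambda>w. indicator ?B w * indicator ?B w :: real) = indicator ?B" by (auto simp: indicator_def)
    then show ?thesis using B by (simp add: l2_norm_sq l2_inner_def q(1) emeasure_eq_measure)
  qed
  have "\<bar>l2_inner M (indicator ?B) (proc Z \<tau> n b)\<bar>\<^sup>2 \<le> (l2_norm M (indicator ?B) * l2_norm M (proc Z \<tau> n b))\<^sup>2"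
    by (intro power_mono l2_cauchy_schwarz IL proc_L2 Zs(1)) simp
  then have "(q * dot n (\<lambda>a. h (\<tau> (Suc a))) b)\<^sup>2 \<le> q * dot n b (mv n (gram (cov_fun M Z) \<tau>) b)"
    unfolding e using gram_quad[of Z M n b \<tau>] Zs(1) by (simp add: power_mult_distrib iq)
  then have "q * (q * (dot n (\<lambda>a. h (\<tau> (Suc a))) b)\<^sup>2) \<le> q * dot n b (mv n (gram (cov_fun M Z) \<tau>) b)"
    by (simp add: power_mult_distrib power2_eq_square mult_ac)
  then show ?thesis using q(2) by simp
qed

section \<open>The trace condition\<close>

definition proj_mat :: "nat \<Rightarrow> (nat \<Rightarrow> nat \<Rightarrow> real) \<Rightarrow> nat \<Rightarrow> real mat" where
  "proj_mat n u k = Matrix.mat n n (\<lambda>(a, b). \<Sum>j\<in>{1..k}. u j a * u j b)"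

lemma proj_mat_top_projs:
  assumes A: "A \<in> carrier_mat n n" and s: "spec n (ent A) l u" and k: "k \<le> n"
  shows "proj_mat n u k \<in> top_projs A k"
proof -
  have "proj_mat n u k = Matrix.mat (dim_row A) (dim_row A) (\<lambda>(a, b). \<Sum>j\<in>{1..k}. Matrix.vec n (u j) $ a * Matrix.vec n (u j) $ b)"
    using A by (intro eq_matI) (auto simp: proj_mat_def)
  then show ?thesis unfolding top_projs_def
    by (intro CollectI exI[of _ "\<lambda>j. Matrix.vec n (u j)"] conjI eigenbasis_of_spec[OF A s])
qed

text \<open>In the eigenbasis of \<open>A\<close> the trace is the sum of
  \<open>(u j \<bullet> B u j) / l j\<close> over the discarded eigenvectors with positive
  eigenvalue, and \<open>B\<close> dominates the dyad \<open>q h h\<^sup>T\<close>.\<close>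

lemma trace_lower_bound:
  assumes A: "A \<in> carrier_mat n n" and s: "spec n (ent A) l u" and l: "\<And>j. j \<in> {1..n} \<Longrightarrow> l j \<ge> 0"
    and k: "k \<le> n" and B: "B \<in> carrier_mat n n"
    and Bq: "\<And>b. q * (dot n h b)\<^sup>2 \<le> dot n b (mv n (ent B) b)" and q: "q > 0"
  shows "q * (\<Sum>j\<in>{1..n}. if k < j \<and> 0 < l j then (dot n (u j) h)\<^sup>2 / l j else 0)
    \<le> mat_trace ((pinv A - pinv (proj_mat n u k * A * proj_mat n u k)) * B)"
proof -
  let ?P = "proj_mat n u k" and ?l = "\<lambda>j. if j \<le> k then l j else 0"
  have P: "?P \<in> carrier_mat n n" by (simp add: proj_mat_def)
  have PAP: "?P * A * ?P \<in> carrier_mat n n" using P A by simp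
  have s': "spec n (ent (?P * A * ?P)) ?l u" by (rule truncated_spec[OF A s l _ k]) (auto simp: proj_mat_def)
  define e where "e j = (if k < j \<and> 0 < l j then 1 / l j else 0)" for j
  have D: "ent (pinv A) a b - ent (pinv (?P * A * ?P)) a b = comb n e u a b" if ab: "a < n" "b < n" for a b
    unfolding pinv_def mat_power_spec[OF A s ab] mat_power_spec[OF PAP s' ab] comb_def sum_subtractf[symmetric]
    by (intro sum.cong refl) (auto simp: e_def powr_minus_divide left_diff_distrib)
  have c: "pinv A \<in> carrier_mat n n" "pinv (?P * A * ?P) \<in> carrier_mat n n"
    unfolding pinv_def by (intro mat_power_carrier A PAP)+
  have "mat_trace ((pinv A - pinv (?P * A * ?P)) * B) = (\<Sum>a<n. \<Sum>b<n. comb n e u a b * ent B b a)"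
  proof -
    have "((pinv A - pinv (?P * A * ?P)) * B) $$ (a, a) = (\<Sum>b<n. comb n e u a b * ent B b a)" if "a < n" for a
      using that c B D by (auto simp: scalar_prod_def atLeast0LessThan ent_def intro!: sum.cong)
    then show ?thesis using c by (simp add: mat_trace_def)
  qed
  also have "\<dots> = (\<Sum>a<n. \<Sum>b<n. \<Sum>j\<in>{1..n}. e j * (u j b * ent B b a * u j a))"
    unfolding comb_def sum_distrib_right by (intro sum.cong refl) (simp add: mult_ac)
  also have "\<dots> = (\<Sum>a<n. \<Sum>j\<in>{1..n}. \<Sum>b<n. e j * (u j b * ent B b a * u j a))"
    by (intro sum.cong refl sum.swap)
  also have "\<dots> = (\<Sum>j\<in>{1..n}. \<Sum>a<n. \<Sum>b<n. e j * (u j b * ent B b a * u j a))"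
    by (rule sum.swap)
  also have "\<dots> = (\<Sum>j\<in>{1..n}. e j * dot n (u j) (mv n (ent B) (u j)))"
    unfolding dot_mv_swap sum_distrib_left by (intro sum.cong refl sum.swap)
  also have "\<dots> \<ge> (\<Sum>j\<in>{1..n}. e j * (q * (dot n h (u j))\<^sup>2))"
    by (intro sum_mono mult_left_mono Bq) (auto simp: e_def)
  also have "(\<Sum>j\<in>{1..n}. e j * (q * (dot n h (u j))\<^sup>2)) =
      q * (\<Sum>j\<in>{1..n}. if k < j \<and> 0 < l j then (dot n (u j) h)\<^sup>2 / l j else 0)"
    unfolding sum_distrib_left by (intro sum.cong refl) (auto simp: e_def dot_commute)
  finally show ?thesis .
qed

text \<open>A Householder reflection within the eigenspace moves the projection of \<open>h\<close> onto
  the eigenspace into the direction of the eigenvector with index \<open>m + 1\<close>, so that the other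
  eigenvectors of the block become orthogonal to \<open>h\<close>.\<close>

lemma block_rotation:
  assumes A: "spec n A l u" and m: "a < m" "m < n" and eq: "l (Suc a) = l (Suc m)"
    and a: "a = 0 \<or> l (Suc a) < l a"
  obtains u' where "spec n A l u'" "\<And>i. i \<in> {1..n} \<Longrightarrow> a < i \<Longrightarrow> i \<le> m \<Longrightarrow> dot n (u' i) h = 0"
proof -
  define c where "c = l (Suc a)"
  note o = specD(1)[OF A]
  have oij: "dot n (u i) (u j) = (if i = j then 1 else 0)" if "i \<in> {1..n}" "j \<in> {1..n}" for i j
    using o that by (simp add: orthon_def)
  have lc: "l i = c" if "a < i" "i \<le> Suc m" for i
    using specD(2)[OF A, of "Suc a" i] specD(2)[OF A, of i "Suc m"] that m eq by (simp add: c_def)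
  define e where "e j = (if l j = c then 1 else 0 :: real)" for j
  define y where "y = mv n (comb n e u) h"
  have uy: "dot n (u i) y = e i * dot n (u i) h" if "i \<in> {1..n}" for i
    unfolding y_def by (rule dot_u_mv_comb[OF o that])
  let ?r = "u (Suc m)"
  have rm: "Suc m \<in> {1..n}" using m by simp
  show thesis
  proof (cases "nrm n y = 0")
    case True
    then have y0: "\<And>a. a < n \<Longrightarrow> y a = 0" by (simp add: nrm_def dot_self_0_iff)
    show thesis
    proof (rule that[OF A])
      fix i assume i: "i \<in> {1..n}" "a < i" "i \<le> m"
      have "dot n (u i) y = 0" unfolding dot_def using y0 by simp
      then show "dot n (u i) h = 0" using uy[OF i(1)] lc[of i] i by (simp add: e_def)
    qed
  next
    case False
    then have ny: "nrm n y > 0" using nrm_nonneg[of n y] by linarith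
    define z where "z x = y x / nrm n y" for x
    have z_scale: "z = (\<lambda>x. inverse (nrm n y) * y x)" by (auto simp: z_def divide_inverse)
    have zz: "dot n z z = 1"
      unfolding z_scale dot_scale_left dot_scale_right nrm_sq[symmetric] using ny by (simp add: power2_eq_square field_simps)
    have uz: "dot n (u i) z = 0" if "i \<in> {1..n}" "l i \<noteq> c" for i
      unfolding z_scale dot_scale_right uy[OF that(1)] using that by (simp add: e_def)
    define w where "w x = ?r x - z x" for x
    have uw: "dot n (u i) w = 0" if "i \<in> {1..n}" "l i \<noteq> c" for i
      using uz[OF that] oij[OF that(1) rm] lc[of "Suc m"] m that by (auto simp: w_def[abs_def] dot_diff_right)
    define K where "K = dot n w w"
    have rr: "dot n ?r ?r = 1" using oij[OF rm rm] by simp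
    have K: "K = 2 * (1 - dot n ?r z)"
      using rr zz dot_commute[of n z ?r] by (simp add: K_def w_def[abs_def] dot_simps)
    \<comment> \<open>for \<open>K = 0\<close> the reflection degenerates to the identity, since division by 0 yields 0\<close>
    define H where "H x = (\<lambda>b. x b - 2 * dot n w x / K * w b)" for x
    have H_inner: "dot n (H x) (H x') = dot n x x'" for x x'
    proof (cases "K = 0")
      case True then show ?thesis by (simp add: H_def)
    next
      case False
      have "dot n (H x) (H x') = dot n x x' - 2 * dot n w x' / K * dot n x w - 2 * dot n w x / K * dot n w x'
          + 2 * dot n w x / K * (2 * dot n w x' / K) * K"
        unfolding H_def dot_diff_left dot_diff_right dot_scale_left dot_scale_right K_def by (simp add: algebra_simps)
      also have "\<dots> = dot n x x'" using False by (simp add: dot_commute[of n x w] field_simps)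
      finally show ?thesis .
    qed
    have H_r: "nrm n y * H ?r b = y b" if b: "b < n" for b
    proof (cases "K = 0")
      case True
      then have "w b = 0" using b by (simp add: K_def dot_self_0_iff)
      then have "?r b = z b" by (simp add: w_def)
      then show ?thesis using ny True by (simp add: H_def z_def)
    next
      case False
      have "dot n w ?r = 1 - dot n ?r z" using rr dot_commute[of n z ?r] by (simp add: w_def[abs_def] dot_diff_left)
      then have "2 * dot n w ?r / K = 1" using False K by simp
      then have "H ?r b = z b" by (simp add: H_def w_def)
      then show ?thesis using ny by (simp add: z_def)
    qed
    have Aw: "mv n A w x = c * w x" if "x < n" for x
    proof -
      have "mv n A w x = (\<Sum>j\<in>{1..n}. l j * dot n (u j) w * u j x)" using that by (simp add: spec_mv[OF A] mv_comb)
      also have "\<dots> = (\<Sum>j\<in>{1..n}. c * (dot n (u j) w * u j x))"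
        by (intro sum.cong refl) (use uw in force)
      also have "\<dots> = c * w x" unfolding sum_distrib_left[symmetric] orthon_expand[OF o that, of w, symmetric] ..
      finally show ?thesis .
    qed
    have Hu: "mv n A (H (u i)) x = l i * H (u i) x" if i: "i \<in> {1..n}" and x: "x < n" for i x
    proof -
      have 1: "mv n A (H (u i)) x = l i * u i x - 2 * dot n w (u i) / K * (c * w x)"
        unfolding H_def mv_diff mv_scale Aw[OF x] spec_mv_u[OF A i x] ..
      show ?thesis
      proof (cases "l i = c")
        case True then show ?thesis unfolding 1 by (simp add: H_def algebra_simps)
      next
        case False
        then have "dot n w (u i) = 0" using uw[OF i] by (simp add: dot_commute)
        then show ?thesis unfolding 1 by (simp add: H_def)
      qed
    qed
    show thesis
    proof (rule that[of "\<lambda>i. H (u i)"])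
      show "spec n A l (\<lambda>i. H (u i))"
        by (rule spec_eigenI[OF _ specD(2)[OF A]]) (auto simp: orthon_def H_inner oij Hu)
      fix i assume i: "i \<in> {1..n}" "a < i" "i \<le> m"
      have li: "l i = c" using lc[of i] i by simp
      have "dot n (H (u i)) y = nrm n y * dot n (H (u i)) (H ?r)"
        unfolding dot_scale_right[symmetric] by (rule dot_cong) (simp_all add: H_r)
      then have Hy: "dot n (H (u i)) y = 0" using i m oij[OF i(1) rm] by (simp add: H_inner)
      have uHe: "dot n (u j) (H (u i)) * (1 - e j) = 0" if j: "j \<in> {1..n}" for j
      proof (cases "l j = c")
        case False
        then have "dot n (u j) (u i) = 0" using oij[OF j i(1)] li by auto
        then show ?thesis using uw[OF j False] unfolding H_def dot_diff_right dot_scale_right by simp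
      qed (simp add: e_def)
      have "dot n (H (u i)) h - dot n (H (u i)) y = (\<Sum>j\<in>{1..n}. dot n (u j) (H (u i)) * (1 - e j) * dot n (u j) h)"
        unfolding parseval[OF o, of "H (u i)" h] parseval[OF o, of "H (u i)" y] sum_subtractf[symmetric]
        by (intro sum.cong refl) (simp add: uy algebra_simps)
      also have "\<dots> = 0" by (rule sum.neutral) (use uHe in auto)
      finally show "dot n (H (u i)) h = 0" using Hy by simp
    qed
  qed
qed

section \<open>Approximation of the slice means in the sampled span\<close>

lemma tinv_quad:
  assumes o: "orthon n u"
  shows "dot n h (mv n (comb n (tinv k l) u) h) = (\<Sum>j\<in>{1..n}. if j \<le> k \<and> 0 < l j then (dot n (u j) h)\<^sup>2 / l j else 0)"
  unfolding dot_mv_comb by (intro sum.cong refl) (auto simp: tinv_def power2_eq_square)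

text \<open>The random variable with coefficients \<open>comb n (tinv k l) u\<close> applied to \<open>h\<close>
  is the orthogonal projection of \<open>\<eta>\<close> onto the first \<open>k\<close> principal components of the
  sampled process.\<close>

context
  fixes M :: "'w measure" and X :: "'t \<Rightarrow> 'w \<Rightarrow> real" and \<tau> :: "nat \<Rightarrow> 't" and n :: nat
    and l :: "nat \<Rightarrow> real" and u :: "nat \<Rightarrow> nat \<Rightarrow> real" and \<eta> :: "'w \<Rightarrow> real" and h :: "nat \<Rightarrow> real"
  assumes X: "\<And>t. X t \<in> L2 M" and s: "spec n (gram (cov_fun M X) \<tau>) l u" and \<eta>: "\<eta> \<in> L2 M"
    and h: "h = (\<lambda>a. l2_inner M \<eta> (X (\<tau> (Suc a))))"
begin

private lemma l0: "j \<in> {1..n} \<Longrightarrow> l j \<ge> 0"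
  by (rule eigvals_nonneg[OF s]) (simp_all add: gram_quad[OF X])

text \<open>A combination of the process with zero variance has inner product 0 with
  \<open>\<eta>\<close>.\<close>

lemma kernel_orthogonal: "j \<in> {1..n} \<Longrightarrow> l j = 0 \<Longrightarrow> dot n (u j) h = 0"
proof -
  assume j: "j \<in> {1..n}" "l j = 0"
  have "(l2_norm M (proc X \<tau> n (u j)))\<^sup>2 = l j * dot n (u j) (u j)"
    unfolding gram_quad[OF X, symmetric] by (rule spec_dot_u[OF s j(1)])
  then have "l2_norm M (proc X \<tau> n (u j)) = 0" using j by simp
  then have "l2_inner M (proc X \<tau> n (u j)) \<eta> = 0" by (rule l2_inner_le_of_norm_zero[OF proc_L2[OF X] \<eta>])
  then show ?thesis using l2_inner_proc[OF X \<eta>, where n = n and \<tau> = \<tau> and b = "u j"] by (simp add: h l2_inner_commute[of M _ \<eta>] dot_commute)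
qed

lemma distance_to_proc:
  "(l2_norm M (\<lambda>w. proc X \<tau> n b w - \<eta> w))\<^sup>2 = dot n b (mv n (gram (cov_fun M X) \<tau>) b) - 2 * dot n h b + (l2_norm M \<eta>)\<^sup>2"
  using l2_inner_proc[OF X \<eta>, where n = n and \<tau> = \<tau> and b = b] proc_L2[OF X, where n = n and \<tau> = \<tau> and b = b] \<eta> l2_inner_commute[of M "proc X \<tau> n b" \<eta>]
  by (simp add: l2_norm_sq l2_inner_diff_left l2_inner_diff_right L2_diff l2_inner_proc_proc[OF X] h)

lemma truncated_inner:
  assumes s2: "\<eta>2 \<in> L2 M" and h2: "h2 = (\<lambda>a. l2_inner M \<eta>2 (X (\<tau> (Suc a))))"
  shows "dot n (mv n (comb n (tinv k l) u) h2) (mv n (gram (cov_fun M X) \<tau>) (mv n (comb n (tinv k l) u) h))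
    = dot n h2 (mv n (comb n (tinv k l) u) h)"
proof -
  note o = specD(1)[OF s]
  show ?thesis unfolding spec_dot_mv[OF s] dot_mv_comb[of n _ l] dot_mv_comb[of n h2]
  proof (intro sum.cong refl)
    fix j assume j: "j \<in> {1..n}"
    show "l j * dot n (u j) (mv n (comb n (tinv k l) u) h2) * dot n (u j) (mv n (comb n (tinv k l) u) h) =
        tinv k l j * dot n (u j) h2 * dot n (u j) h"
      unfolding dot_u_mv_comb[OF o j] by (auto simp: tinv_def)
  qed
qed

lemma distance_truncated:
  "(l2_norm M (\<lambda>w. proc X \<tau> n (mv n (comb n (tinv k l) u) h) w - \<eta> w))\<^sup>2 =
    (l2_norm M \<eta>)\<^sup>2 - dot n h (mv n (comb n (tinv k l) u) h)"
  unfolding distance_to_proc truncated_inner[OF \<eta> h] by simp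

text \<open>For \<open>k = n\<close> this is the projection onto the whole sampled span, which is at
  least as close as any other combination; each omitted component adds its squared coefficient
  to the squared distance.\<close>

lemma truncated_defect:
  "(l2_norm M (\<lambda>w. proc X \<tau> n (mv n (comb n (tinv k l) u) h) w - \<eta> w))\<^sup>2 \<le>
    (l2_norm M (\<lambda>w. proc X \<tau> n b w - \<eta> w))\<^sup>2 + (\<Sum>j\<in>{1..n}. if k < j \<and> 0 < l j then (dot n (u j) h)\<^sup>2 / l j else 0)"
proof -
  note o = specD(1)[OF s]
  have "(\<Sum>j\<in>{1..n}. - (if 0 < l j then (dot n (u j) h)\<^sup>2 / l j else 0)) \<le>
      (\<Sum>j\<in>{1..n}. l j * (dot n (u j) b)\<^sup>2 - 2 * (dot n (u j) h * dot n (u j) b))"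
  proof (rule sum_mono)
    fix j assume j: "j \<in> {1..n}"
    show "- (if 0 < l j then (dot n (u j) h)\<^sup>2 / l j else 0) \<le> l j * (dot n (u j) b)\<^sup>2 - 2 * (dot n (u j) h * dot n (u j) b)"
    proof (cases "l j > 0")
      case True
      have "0 \<le> (l j * dot n (u j) b - dot n (u j) h)\<^sup>2 / l j" using True by simp
      also have "\<dots> = l j * (dot n (u j) b)\<^sup>2 - 2 * (dot n (u j) h * dot n (u j) b) + (dot n (u j) h)\<^sup>2 / l j"
        using True by (simp add: power2_eq_square field_simps)
      finally show ?thesis using True by simp
    next
      case False
      then have "l j = 0" using l0[OF j] by simp
      then show ?thesis using kernel_orthogonal[OF j] by simp
    qed
  qed
  also have "\<dots> = dot n b (mv n (gram (cov_fun M X) \<tau>) b) - 2 * dot n h b"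
    unfolding quad_spec[OF s] parseval[OF o, of h b] by (simp add: sum_subtractf sum_distrib_left)
  finally have "(l2_norm M \<eta>)\<^sup>2 - (\<Sum>j\<in>{1..n}. if 0 < l j then (dot n (u j) h)\<^sup>2 / l j else 0)
      \<le> (l2_norm M (\<lambda>w. proc X \<tau> n b w - \<eta> w))\<^sup>2"
    unfolding distance_to_proc by (simp add: sum_negf)
  moreover have "(\<Sum>j\<in>{1..n}. if 0 < l j then (dot n (u j) h)\<^sup>2 / l j else 0) =
      dot n h (mv n (comb n (tinv k l) u) h) + (\<Sum>j\<in>{1..n}. if k < j \<and> 0 < l j then (dot n (u j) h)\<^sup>2 / l j else 0)"
    unfolding tinv_quad[OF o] sum.distrib[symmetric] by (intro sum.cong refl) auto
  ultimately show ?thesis unfolding distance_truncated by simp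
qed

end

section \<open>Lower bounds for sample eigenvalues\<close>

text \<open>Cauchy interlacing: extending the first \<open>k\<close> eigenvectors of the leading submatrix
  by 0 gives a test space in dimension \<open>n\<close>. Only the error of the leading submatrix enters,
  and that is small even if the error in dimension \<open>n\<close> is not.\<close>

lemma interlacing_lower_bound:
  assumes A: "spec n0 A l u" and B: "spec n B l' v" and k: "k \<in> {1..n0}" and n: "n0 \<le> n"
    and F: "frob n0 (\<lambda>a b. B a b - A a b) \<le> t"
  shows "l k - t \<le> l' k"
proof (rule minmax_lower[OF B, where w = "\<lambda>i a. if a < n0 then u (Suc i) a else 0"])
  show "k \<in> {1..n}" using k n by simp
  fix c :: "nat \<Rightarrow> real" assume c: "dot k c c = 1"
  define x where "x a = (\<Sum>i<k. c i * (if a < n0 then u (Suc i) a else 0))" for a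
  define y where "y a = (\<Sum>i<k. c i * u (Suc i) a)" for a
  have xy: "x a = (if a < n0 then y a else 0)" for a by (simp add: x_def y_def)
  have sub: "(\<Sum>a<n. f a * x a) = (\<Sum>a<n0. f a * y a)" for f :: "nat \<Rightarrow> real"
    using n by (intro sum.mono_neutral_cong_right) (auto simp: xy)
  have o: "orthon n0 u" by (rule specD(1)[OF A])
  have uy: "dot n0 (u i) y = (if i \<le> k then c (i - 1) else 0)" if i: "i \<in> {1..n0}" for i
  proof -
    have "dot n0 (u i) y = (\<Sum>m<k. c m * dot n0 (u i) (u (Suc m)))"
      by (simp add: y_def[abs_def] dot_sum_right dot_scale_right)
    also have "\<dots> = (\<Sum>m<k. if m = i - 1 then c m else 0)"
      using o i k by (intro sum.cong refl) (auto simp: orthon_def)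
    finally show ?thesis using i by auto
  qed
  have subk: "(\<Sum>i\<in>{1..n0}. f i * (dot n0 (u i) y)\<^sup>2) = (\<Sum>i\<in>{1..k}. f i * (c (i - 1))\<^sup>2)" for f
    using k by (intro sum.mono_neutral_cong_right) (auto simp: uy)
  have c1: "(\<Sum>i\<in>{1..k}. (c (i - 1))\<^sup>2) = 1"
    using c by (simp add: dot_def sum.atLeast1_atMost_eq power2_eq_square)
  have yy: "dot n0 y y = 1"
    using parseval_nrm[OF o, of y] subk[of "\<lambda>_. 1"] c1 by (simp add: nrm_sq)
  have xx: "(\<Sum>a<n. (x a)\<^sup>2) = 1"
  proof -
    have "(\<Sum>a<n. (x a)\<^sup>2) = (\<Sum>a<n. x a * x a)" by (simp add: power2_eq_square)
    also have "\<dots> = (\<Sum>a<n0. x a * y a)" by (rule sub)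
    also have "\<dots> = dot n0 y y" unfolding dot_def by (intro sum.cong refl) (simp add: xy)
    finally show ?thesis using yy by simp
  qed
  have "dot n x (mv n B x) = (\<Sum>a<n. mv n B x a * x a)" by (simp add: dot_def mult.commute)
  also have "\<dots> = (\<Sum>a<n0. mv n B x a * y a)" by (rule sub)
  also have "\<dots> = dot n0 y (mv n0 B y)"
    unfolding dot_def mv_def sub by (intro sum.cong refl) (rule mult.commute)
  also have "\<dots> = dot n0 y (mv n0 A y) + dot n0 y (mv n0 (\<lambda>a b. B a b - A a b) y)"
    by (simp add: mv_diff_mat[abs_def] dot_diff_right)
  finally have e: "dot n x (mv n B x) = dot n0 y (mv n0 A y) + dot n0 y (mv n0 (\<lambda>a b. B a b - A a b) y)" .
  have "\<bar>dot n0 y (mv n0 (\<lambda>a b. B a b - A a b) y)\<bar> \<le> t"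
    using dot_mv_le_frob[of n0 y "\<lambda>a b. B a b - A a b" y] yy F by (simp add: nrm_def)
  moreover have "l k \<le> dot n0 y (mv n0 A y)"
  proof -
    have "l k = (\<Sum>i\<in>{1..k}. l k * (c (i - 1))\<^sup>2)" unfolding sum_distrib_left[symmetric] c1 by simp
    also have "\<dots> \<le> (\<Sum>i\<in>{1..k}. l i * (c (i - 1))\<^sup>2)"
      using k by (intro sum_mono mult_right_mono specD(2)[OF A]) auto
    also have "\<dots> = dot n0 y (mv n0 A y)" unfolding quad_spec[OF A] subk ..
    finally show ?thesis .
  qed
  ultimately have "l k - t \<le> dot n x (mv n B x)" using e by linarith
  then show "(\<Sum>a<n. (\<Sum>i<k. c i * (if a < n0 then u (Suc i) a else 0))\<^sup>2) > 0 \<and>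
     dot n (\<lambda>a. \<Sum>i<k. c i * (if a < n0 then u (Suc i) a else 0)) (mv n B (\<lambda>a. \<Sum>i<k. c i * (if a < n0 then u (Suc i) a else 0)))
      \<ge> (l k - t) * (\<Sum>a<n. (\<Sum>i<k. c i * (if a < n0 then u (Suc i) a else 0))\<^sup>2)"
    using xx unfolding x_def[symmetric] by simp
qed

lemma comb_cong: "(\<And>j. j \<in> {1..n} \<Longrightarrow> c j = c' j) \<Longrightarrow> comb n c u = comb n c' u"
  unfolding comb_def by (intro ext sum.cong refl) simp

text \<open>Directions of zero population variance carry no sample variance, so the sample
  matrix has at most as many positive eigenvalues as the population matrix.\<close>

lemma sample_rank_le:
  assumes A: "spec n A l u" and B: "spec n B l' v"
    and l0: "\<And>j. j \<in> {1..n} \<Longrightarrow> l j \<ge> 0" and ker: "\<And>j a. j \<in> {1..n} \<Longrightarrow> l j = 0 \<Longrightarrow> a < n \<Longrightarrow> mv n B (u j) a = 0"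
    and r: "l (Suc r) = 0" and j: "j \<in> {1..n}" "r < j"
  shows "l' j \<le> 0"
proof -
  note o = specD(1)[OF A]
  have sr: "Suc r \<in> {1..n}" using j by simp
  have lz: "l m = 0" if "m \<in> {1..n}" "r < m" for m
    using specD(2)[OF A sr that(1)] l0[OF that(1)] that r by simp
  have "l' (Suc r) \<le> 0"
  proof (rule minmax_upper[OF B sr, where w = "\<lambda>i. u (Suc i)"])
    fix x assume o': "\<And>i. i < Suc r - 1 \<Longrightarrow> dot n (u (Suc i)) x = 0"
    have "mv n B x a = 0" if a: "a < n" for a
    proof -
      have "mv n B x a = mv n B (\<lambda>b. \<Sum>m\<in>{1..n}. dot n (u m) x * u m b) a"
        by (rule mv_cong) (auto simp: orthon_expand[OF o, of _ x])
      also have "\<dots> = (\<Sum>m\<in>{1..n}. dot n (u m) x * mv n B (u m) a)" by (rule mv_sum)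
      also have "\<dots> = 0"
      proof (rule sum.neutral, rule ballI)
        fix m assume m: "m \<in> {1..n}"
        show "dot n (u m) x * mv n B (u m) a = 0"
        proof (cases "m \<le> r")
          case True then show ?thesis using o'[of "m - 1"] m by auto
        next
          case False then show ?thesis using ker[OF m lz[OF m] a] by simp
        qed
      qed
      finally show ?thesis .
    qed
    then show "dot n x (mv n B x) \<le> 0" by (simp add: dot_def)
  qed
  then show ?thesis using specD(2)[OF B sr j(1)] j by simp
qed

text \<open>The second bound does not depend on \<open>n\<close>: if the eigenvalues from the \<open>j\<close>-th on
  coincide, there are \<open>n - j + 1\<close> of them, their sum is at most \<open>C * n\<close>, and
  \<open>n \<le> j * (n - j + 1)\<close>.\<close>

lemma eigval_trace_bound:
  assumes A: "spec n A l u" and l0: "\<And>j. j \<in> {1..n} \<Longrightarrow> l j \<ge> 0" and tr: "\<And>a. a < n \<Longrightarrow> A a a \<le> C"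
    and j: "j \<in> {1..n}"
  shows "l j \<le> C * n" "l n = l j \<Longrightarrow> l j \<le> C * j"
proof -
  have s: "(\<Sum>i\<in>{1..n}. l i) \<le> C * n"
    unfolding trace_eigvals[OF A, symmetric] using sum_mono[of "{..<n}" "\<lambda>a. A a a" "\<lambda>_. C"] tr by (simp add: mult.commute)
  have "l j \<le> (\<Sum>i\<in>{1..n}. l i)" using j l0 by (intro member_le_sum) auto
  then show 1: "l j \<le> C * n" using s by simp
  assume e: "l n = l j"
  have "(real n - real j + 1) * l j = (\<Sum>i\<in>{j..n}. l j)" using j by (simp add: of_nat_diff)
  also have "\<dots> \<le> (\<Sum>i\<in>{j..n}. l i)"
    using j e specD(2)[OF A _ , of _ n] by (intro sum_mono) auto
  also have "\<dots> \<le> (\<Sum>i\<in>{1..n}. l i)" using j l0 by (intro sum_mono2) auto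
  finally have a: "(real n - real j + 1) * l j \<le> C * n" using s by simp
  have jn: "1 \<le> real j" "real j \<le> real n" using j by auto
  have C0: "0 \<le> C" using 1 l0[OF j] jn by (smt (verit) mult_neg_pos)
  have "real n \<le> real j * (real n - real j + 1)"
  proof -
    have "0 \<le> (real j - 1) * (real n - real j)" using jn by (intro mult_nonneg_nonneg) auto
    then show ?thesis by (simp add: algebra_simps)
  qed
  then have "C * n \<le> C * (real j * (real n - real j + 1))" using C0 by (rule mult_left_mono)
  then have "(real n - real j + 1) * l j \<le> (real n - real j + 1) * (C * j)" using a by (simp add: mult_ac)
  then show "l j \<le> C * j" using jn by simp
qed

section \<open>Truncation inside a block of equal eigenvalues\<close>

text \<open>For \<open>h\<close> the vector of inner products of \<open>\<eta>\<close> with the sampled process, this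
  is the squared norm of the principal components of \<open>\<eta>\<close> that are omitted by truncation
  at \<open>k\<close>.\<close>

definition defect :: "nat \<Rightarrow> nat \<Rightarrow> (nat \<Rightarrow> real) \<Rightarrow> (nat \<Rightarrow> nat \<Rightarrow> real) \<Rightarrow> (nat \<Rightarrow> real) \<Rightarrow> real" where
  "defect n k l u h = (\<Sum>j\<in>{1..n}. if k < j \<and> 0 < l j then (dot n (u j) h)\<^sup>2 / l j else 0)"

text \<open>The bound holds for all choices of eigenvectors, also for one in which the
  eigenvectors \<open>a + 1, \<dots>, k\<close> are orthogonal to \<open>h\<close>. For that choice truncation at
  \<open>a\<close> and at \<open>k\<close> omit the same components, and the defect at \<open>a\<close>, in front of the block, does
  not depend on the choice.\<close>

lemma defect_before_block:
  assumes A: "spec n A l u" and k: "a < k" "k < n" and eq: "l (Suc a) = l k" "l (Suc k) = l k"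
    and a: "a = 0 \<or> l (Suc a) < l a"
    and d: "\<And>u'. spec n A l u' \<Longrightarrow> defect n k l u' h \<le> \<eta>"
  shows "defect n a l u h \<le> \<eta>"
proof -
  obtain u' where u': "spec n A l u'" and z: "\<And>i. i \<in> {1..n} \<Longrightarrow> a < i \<Longrightarrow> i \<le> k \<Longrightarrow> dot n (u' i) h = 0"
    using block_rotation[OF A k, of h] eq a by auto
  let ?e = "\<lambda>j. if a < j \<and> 0 < l j then 1 / l j else 0"
  have iff: "a < i \<longleftrightarrow> l i \<le> l k" if i: "i \<in> {1..n}" for i
  proof
    assume "a < i"
    then show "l i \<le> l k" using specD(2)[OF A, of "Suc a" i] i k eq by auto
  next
    assume l: "l i \<le> l k"
    show "a < i"
    proof (rule ccontr)
      assume "\<not> a < i"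
      then have "a \<noteq> 0" "l a \<le> l i" using specD(2)[OF A i, of a] i k by auto
      then show False using a l eq by simp
    qed
  qed
  have "defect n a l u h = dot n h (mv n (comb n ?e u) h)"
    unfolding defect_def dot_mv_comb by (intro sum.cong refl) (auto simp: power2_eq_square)
  also have "\<dots> = dot n h (mv n (comb n ?e u') h)"
    by (intro dot_cong mv_cong refl spec_fun_unique[OF u' A]) (auto simp: iff)
  also have "\<dots> = defect n k l u' h"
    unfolding defect_def dot_mv_comb
  proof (intro sum.cong refl)
    fix j assume j: "j \<in> {1..n}"
    show "?e j * dot n (u' j) h * dot n (u' j) h = (if k < j \<and> 0 < l j then (dot n (u' j) h)\<^sup>2 / l j else 0)"
      using z[OF j] k by (cases "k < j"; cases "a < j") (auto simp: power2_eq_square)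
  qed
  also have "\<dots> \<le> \<eta>" by (rule d[OF u'])
  finally show ?thesis .
qed

text \<open>The bounds of \<open>block_error\<close> and \<open>block_error_gram\<close>, which also cover truncation
  at a gap. For \<open>t\<close> tending to 0 only the contribution of the defect \<open>\<eta>\<close> remains.\<close>

definition quad_bound :: "real \<Rightarrow> real \<Rightarrow> real \<Rightarrow> real \<Rightarrow> real \<Rightarrow> real \<Rightarrow> real" where
  "quad_bound C C1 c \<kappa> \<eta> t = 2 * (C * (4 * (C1 + 1) / c\<^sup>2 + 1 / c)\<^sup>2 * t\<^sup>2) +
      32 * (C * 4 * t\<^sup>2 / (c\<^sup>2 * \<kappa>) + 1) * ((1 + 2 * C1 / c) * t / sqrt \<kappa> + sqrt \<eta>)\<^sup>2"

definition gram_bound :: "real \<Rightarrow> real \<Rightarrow> real \<Rightarrow> real \<Rightarrow> real \<Rightarrow> real" where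
  "gram_bound C1 c \<kappa> \<eta> t = ((C1 + 1) * (4 * (C1 + 1) / c\<^sup>2 + 1 / c) + C1 / c) * t +
      4 * ((1 + 2 * C1 / c) * t / sqrt \<kappa> + sqrt \<eta>)\<^sup>2"

text \<open>The sample truncated at \<open>k\<close> is compared with the population truncated at a
  suitable \<open>k0\<close>. If the \<open>k\<close>-th eigenvalue is 0, then \<open>k0\<close> is the rank, and the sample has no
  larger rank. If the \<open>k\<close>-th and the next eigenvalue differ, \<open>k0 = k\<close>. Otherwise \<open>k\<close> lies
  inside a block of equal positive eigenvalues, and \<open>k0\<close> is the index in front of the block.
  In that case the sample eigenvalue needs a lower bound: if the block is followed by a
  smaller eigenvalue, the gap makes the block of order \<open>n\<close> and Weyl's inequality applies; if
  it extends to the last eigenvalue, the bound is a hypothesis.\<close>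

lemma estimates_at_n:
  fixes n k S :: nat and A :: "nat \<Rightarrow> nat \<Rightarrow> real" and l :: "nat \<Rightarrow> real" and u h :: "nat \<Rightarrow> nat \<Rightarrow> real"
    and c C C1 t \<kappa> \<eta> :: real
  assumes A: "spec n A l u" and l0: "\<And>j. j \<in> {1..n} \<Longrightarrow> 0 \<le> l j" and lC: "\<And>j. j \<in> {1..n} \<Longrightarrow> l j \<le> C * n"
    and k: "k \<in> {1..n}" and c: "c > 0" and t: "0 \<le> t" "t \<le> 1" "t \<le> c / 2" and C1: "C1 \<ge> 0"
    and gap: "\<And>j. j \<in> {1..n} \<Longrightarrow> l j \<noteq> l k \<Longrightarrow> \<bar>l j - l k\<bar> \<ge> c * n"
    and low: "k = n \<Longrightarrow> l k = 0 \<or> l k \<ge> c * n"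
    and \<kappa>: "0 < \<kappa>" "\<kappa> \<le> c" and tail\<kappa>: "k < n \<Longrightarrow> l n = l k \<Longrightarrow> l k > 0 \<Longrightarrow> \<kappa> \<le> l k"
    and \<eta>: "\<eta> \<ge> 0" and d: "\<And>u s. spec n A l u \<Longrightarrow> s \<in> {1..S} \<Longrightarrow> defect n k l u (h s) \<le> \<eta>"
    and h: "\<And>s. s \<in> {1..S} \<Longrightarrow> nrm n (h s) \<le> C1 * sqrt n"
    and hker: "\<And>s j. s \<in> {1..S} \<Longrightarrow> j \<in> {1..n} \<Longrightarrow> l j = 0 \<Longrightarrow> dot n (u j) (h s) = 0"
  obtains k0 where "\<And>s. s \<in> {1..S} \<Longrightarrow> defect n k0 l u (h s) \<le> \<eta>"
    "\<And>B l' v H s r x. spec n B l' v \<Longrightarrow> frob n (\<lambda>a b. B a b - A a b) \<le> t * sqrt n \<Longrightarrow>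
      (\<And>j a. j \<in> {1..n} \<Longrightarrow> l j = 0 \<Longrightarrow> a < n \<Longrightarrow> mv n B (u j) a = 0) \<Longrightarrow>
      (k < n \<Longrightarrow> l n = l k \<Longrightarrow> l k > 0 \<Longrightarrow> l' k \<ge> l k / 4) \<Longrightarrow>
      (\<And>s. s \<in> {1..S} \<Longrightarrow> nrm n (\<lambda>a. H s a - h s a) \<le> t) \<Longrightarrow> s \<in> {1..S} \<Longrightarrow> r \<in> {1..S} \<Longrightarrow>
      x = (\<lambda>a. mv n (comb n (tinv k l') v) (H s) a - mv n (comb n (tinv k0 l) u) (h s) a) \<Longrightarrow>
      dot n x (mv n A x) \<le> quad_bound C C1 c \<kappa> \<eta> t \<and>
      \<bar>dot n (H r) (mv n (comb n (tinv k l') v) (H s)) - dot n (h r) (mv n (comb n (tinv k0 l) u) (h s))\<bar>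
        \<le> gram_bound C1 c \<kappa> \<eta> t"
proof -
  note main = that
  have n: "n \<ge> 1" using k by simp
  have C0: "C \<ge> 0"
  proof -
    have "0 \<le> C * n" using l0[OF k] lC[OF k] by simp
    then show ?thesis using n by (simp add: zero_le_mult_iff)
  qed
  \<comment> \<open>The block of eigenvalues equal to the \<open>k\<close>-th begins at \<open>m\<close>, and \<open>a\<close> is
    the index before it.\<close>
  define m where "m = (LEAST m. 1 \<le> m \<and> l m = l k)"
  have mP: "1 \<le> m \<and> l m = l k" unfolding m_def by (rule LeastI[of _ k]) (use k in simp)
  have mk: "m \<le> k" unfolding m_def by (rule Least_le) (use k in simp)
  have mmin: "l i \<noteq> l k" if "1 \<le> i" "i < m" for i
    using not_less_Least[of i "\<lambda>m. 1 \<le> m \<and> l m = l k"] that by (simp add: m_def)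
  define a where "a = m - 1"
  have a: "Suc a = m" "a < k" "a \<le> n" "a < n" using mP mk k by (auto simp: a_def)
  have la: "l (Suc a) = l k" using mP a by simp
  have aa: "a = 0 \<or> l a - l (Suc a) \<ge> c * n \<and> l (Suc a) < l a \<and> l a \<ge> c * n"
  proof (cases "a = 0")
    case False
    then have ai: "a \<in> {1..n}" using a by simp
    have "l a \<noteq> l k" using mmin[of a] False a by simp
    moreover have "l k \<le> l a" using specD(2)[OF A ai k] a by simp
    ultimately show ?thesis using gap[OF ai] la l0[OF k] by auto
  qed simp
  have stable: thesis
    if k0: "k0 \<le> n" and lk0: "k0 = 0 \<or> l k0 \<ge> c * n" and gap0: "k0 = 0 \<or> k0 = n \<or> l k0 - l (Suc k0) \<ge> c * n"
      and d0: "\<And>s. s \<in> {1..S} \<Longrightarrow> defect n k0 l u (h s) \<le> \<eta>"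
      and same: "\<And>B l' v j. spec n B l' v \<Longrightarrow> (\<And>j a. j \<in> {1..n} \<Longrightarrow> l j = 0 \<Longrightarrow> a < n \<Longrightarrow> mv n B (u j) a = 0) \<Longrightarrow>
        j \<in> {1..n} \<Longrightarrow> tinv k l' j = tinv k0 l' j" for k0
  proof (rule main[of k0, OF d0])
    fix B l' v H s r x
    assume B: "spec n B l' v" and F: "frob n (\<lambda>a b. B a b - A a b) \<le> t * sqrt n"
      and ker: "\<And>j a. j \<in> {1..n} \<Longrightarrow> l j = 0 \<Longrightarrow> a < n \<Longrightarrow> mv n B (u j) a = 0"
      and H: "\<And>s. s \<in> {1..S} \<Longrightarrow> nrm n (\<lambda>a. H s a - h s a) \<le> t" and s: "s \<in> {1..S}" and r: "r \<in> {1..S}"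
      and x: "x = (\<lambda>a. mv n (comb n (tinv k l') v) (H s) a - mv n (comb n (tinv k0 l) u) (h s) a)"
    have e: "comb n (tinv k l') v = comb n (tinv k0 l') v" by (rule comb_cong) (rule same[OF B ker])
    have q: "dot n x (mv n A x) \<le> C * (4 * (C1 + 1) / c\<^sup>2 + 1 / c)\<^sup>2 * t\<^sup>2"
      by (rule coefficient_error_quad[OF A B k0 n c lk0 gap0 t F l0 lC C1 h[OF s] H[OF s] x[unfolded e]])
    have g: "\<bar>dot n (H r) (mv n (comb n (tinv k0 l') v) (H s)) - dot n (h r) (mv n (comb n (tinv k0 l) u) (h s))\<bar>
        \<le> ((C1 + 1) * (4 * (C1 + 1) / c\<^sup>2 + 1 / c) + C1 / c) * t"
      by (rule coefficient_error_gram[OF A B k0 n c lk0 gap0 t F l0 lC C1 h[OF s] H[OF s] h[OF r] H[OF r]])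
    have "0 \<le> C * (4 * (C1 + 1) / c\<^sup>2 + 1 / c)\<^sup>2 * t\<^sup>2" using C0 by simp
    moreover have "0 \<le> 32 * (C * 4 * t\<^sup>2 / (c\<^sup>2 * \<kappa>) + 1) * ((1 + 2 * C1 / c) * t / sqrt \<kappa> + sqrt \<eta>)\<^sup>2"
      using C0 \<kappa> by simp
    ultimately have "dot n x (mv n A x) \<le> quad_bound C C1 c \<kappa> \<eta> t" using q unfolding quad_bound_def by linarith
    moreover have "((C1 + 1) * (4 * (C1 + 1) / c\<^sup>2 + 1 / c) + C1 / c) * t \<le> gram_bound C1 c \<kappa> \<eta> t"
      unfolding gram_bound_def by simp
    ultimately show "dot n x (mv n A x) \<le> quad_bound C C1 c \<kappa> \<eta> t \<and>
      \<bar>dot n (H r) (mv n (comb n (tinv k l') v) (H s)) - dot n (h r) (mv n (comb n (tinv k0 l) u) (h s))\<bar>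
        \<le> gram_bound C1 c \<kappa> \<eta> t" using g unfolding e by linarith
  qed
  consider (zero) "l k = 0" | (block) "l k > 0" "k < n" "l (Suc k) = l k" | (clean) "l k > 0" "k = n \<or> l (Suc k) \<noteq> l k"
    using l0[OF k] k by fastforce
  then show thesis
  proof cases
    case zero
    have lz: "l j = 0" if "j \<in> {1..n}" "a < j" for j
      using specD(2)[OF A, of "Suc a" j] l0[OF that(1)] that la zero a by auto
    show thesis
    proof (rule stable[of a])
      show "a \<le> n" "a = 0 \<or> l a \<ge> c * n" "a = 0 \<or> a = n \<or> l a - l (Suc a) \<ge> c * n" using a aa by auto
      fix s assume "s \<in> {1..S}"
      have "defect n a l u (h s) = 0" unfolding defect_def by (rule sum.neutral) (use lz in force)
      then show "defect n a l u (h s) \<le> \<eta>" using \<eta> by simp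
    next
      fix B l' v j
      assume B: "spec n B l' v" and ker: "\<And>j a. j \<in> {1..n} \<Longrightarrow> l j = 0 \<Longrightarrow> a < n \<Longrightarrow> mv n B (u j) a = 0" and j: "j \<in> {1..n}"
      have "l (Suc a) = 0" using la zero by simp
      show "tinv k l' j = tinv a l' j"
      proof (cases "a < j")
        case True
        have "l' j \<le> 0"
          by (rule sample_rank_le[OF A B, of a]) (use l0 ker \<open>l (Suc a) = 0\<close> j True in auto)
        then show ?thesis by (simp add: tinv_def)
      qed (use a in \<open>simp add: tinv_def\<close>)
    qed
  next
    case clean
    show thesis
    proof (rule stable[of k])
      have g: "k = n \<or> l k - l (Suc k) \<ge> c * n"
      proof (cases "k = n")
        case False
        then have sk: "Suc k \<in> {1..n}" using k by simp
        have "l (Suc k) \<le> l k" using specD(2)[OF A k sk] by simp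
        then show ?thesis using gap[OF sk] clean False by auto
      qed simp
      then show "k = 0 \<or> k = n \<or> l k - l (Suc k) \<ge> c * n" by simp
      show "k = 0 \<or> l k \<ge> c * n"
      proof (cases "k = n")
        case True then show ?thesis using low clean by auto
      next
        case False
        then have "Suc k \<in> {1..n}" using k by simp
        then show ?thesis using g False l0[of "Suc k"] by auto
      qed
    qed (use k d[OF A] in auto)
  next
    case block
    show thesis
    proof (rule main[of a])
      fix s assume s: "s \<in> {1..S}"
      show "defect n a l u (h s) \<le> \<eta>"
        by (rule defect_before_block[OF A a(2) block(2) la block(3)]) (use aa d[OF _ s] in auto)
    next
      fix B l' v H s r x
      assume B: "spec n B l' v" and F: "frob n (\<lambda>a b. B a b - A a b) \<le> t * sqrt n"
        and tl: "k < n \<Longrightarrow> l n = l k \<Longrightarrow> l k > 0 \<Longrightarrow> l' k \<ge> l k / 4"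
        and H: "\<And>s. s \<in> {1..S} \<Longrightarrow> nrm n (\<lambda>a. H s a - h s a) \<le> t" and s: "s \<in> {1..S}" and r: "r \<in> {1..S}"
        and x: "x = (\<lambda>b. mv n (comb n (tinv k l') v) (H s) b - mv n (comb n (tinv a l) u) (h s) b)"
      have da: "(\<Sum>j\<in>{1..n}. if a < j \<and> 0 < l j then (dot n (u j) (h s))\<^sup>2 / l j else 0) \<le> \<eta>" if "s \<in> {1..S}" for s
        unfolding defect_def[symmetric]
        by (rule defect_before_block[OF A a(2) block(2) la block(3)]) (use aa d[OF _ that] in auto)
      have lb: "\<kappa> \<le> l k \<and> l k / 4 \<le> l' k"
      proof (cases "l n = l k")
        case True then show ?thesis using tl tail\<kappa> block by simp
      next
        case False
        have nn: "n \<in> {1..n}" using n by simp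
        have "l n \<le> l k" using specD(2)[OF A k nn] k by simp
        then have 1: "l k \<ge> c * n" using gap[OF nn False] l0[OF nn] by simp
        have "t * sqrt n \<le> c / 2 * n"
        proof (rule mult_mono)
          have "1 \<le> sqrt n" using n by simp
          then have "sqrt n * 1 \<le> sqrt n * sqrt n" by (intro mult_left_mono) auto
          then show "sqrt n \<le> n" by simp
        qed (use t c in auto)
        then have "l k - l' k \<le> l k / 2" using weyl[OF A B k] F 1 by simp
        moreover have "c * 1 \<le> c * n" using c n by (intro mult_left_mono) auto
        ultimately show ?thesis using 1 \<kappa> block(1) by (intro conjI) linarith+
      qed
      have gap': "a = 0 \<or> a = n \<or> l a - l (Suc a) \<ge> c * n" and la': "a = 0 \<or> l a \<ge> c * n" using aa by auto
      have kn: "k \<le> n" using k by simp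
      note pre = A B a(3) n c la' gap' t F l0 lC C1 a(2) kn la \<kappa>(1) conjunct1[OF lb] conjunct2[OF lb] \<eta>
      have kers: "dot n (u j) (h s) = 0" if "j \<in> {1..n}" "l j = 0" for j by (rule hker[OF s that])
      have kerr: "dot n (u j) (h r) = 0" if "j \<in> {1..n}" "l j = 0" for j by (rule hker[OF r that])
      have q: "dot n x (mv n A x) \<le> quad_bound C C1 c \<kappa> \<eta> t"
        unfolding quad_bound_def
        by (rule block_error[where n = n and k = a and m = k and B = B and l = l and l' = l' and u = u
              and h = "h s" and hh = "H s"])
          (rule pre h[OF s] H[OF s] kers da[OF s] x; assumption?)+
      have g: "\<bar>dot n (H r) (mv n (comb n (tinv k l') v) (H s)) - dot n (h r) (mv n (comb n (tinv a l) u) (h s))\<bar>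
          \<le> gram_bound C1 c \<kappa> \<eta> t"
        unfolding gram_bound_def
        by (rule block_error_gram[where n = n and k = a and m = k and A = A and B = B and l = l and l' = l' and u = u
              and h = "h s" and hh = "H s" and C = C])
          (rule pre h[OF s] H[OF s] kers da[OF s] h[OF r] H[OF r] kerr da[OF r]; assumption?)+
      from q g show "dot n x (mv n A x) \<le> quad_bound C C1 c \<kappa> \<eta> t \<and>
        \<bar>dot n (H r) (mv n (comb n (tinv k l') v) (H s)) - dot n (h r) (mv n (comb n (tinv a l) u) (h s))\<bar>
          \<le> gram_bound C1 c \<kappa> \<eta> t" by (rule conjI)
    qed
  qed
qed

lemma bounds_tendsto:
  "(quad_bound C C1 c \<kappa> \<eta> \<longlongrightarrow> 32 * (sqrt \<eta>)\<^sup>2) (at_right 0)"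
  "(gram_bound C1 c \<kappa> \<eta> \<longlongrightarrow> 4 * (sqrt \<eta>)\<^sup>2) (at_right 0)"
proof -
  have "((\<lambda>t. 2 * (C * (4 * (C1 + 1) / c\<^sup>2 + 1 / c)\<^sup>2 * t\<^sup>2) +
      32 * (C * 4 * t\<^sup>2 * inverse (c\<^sup>2 * \<kappa>) + 1) * ((1 + 2 * C1 / c) * t * inverse (sqrt \<kappa>) + sqrt \<eta>)\<^sup>2) \<longlongrightarrow>
      2 * (C * (4 * (C1 + 1) / c\<^sup>2 + 1 / c)\<^sup>2 * 0\<^sup>2) +
      32 * (C * 4 * 0\<^sup>2 * inverse (c\<^sup>2 * \<kappa>) + 1) * ((1 + 2 * C1 / c) * 0 * inverse (sqrt \<kappa>) + sqrt \<eta>)\<^sup>2) (at_right 0)"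
    by (intro tendsto_intros)
  then show "(quad_bound C C1 c \<kappa> \<eta> \<longlongrightarrow> 32 * (sqrt \<eta>)\<^sup>2) (at_right 0)"
    by (simp add: quad_bound_def[abs_def] divide_inverse)
  have "((\<lambda>t. ((C1 + 1) * (4 * (C1 + 1) / c\<^sup>2 + 1 / c) + C1 / c) * t +
      4 * ((1 + 2 * C1 / c) * t * inverse (sqrt \<kappa>) + sqrt \<eta>)\<^sup>2) \<longlongrightarrow>
      ((C1 + 1) * (4 * (C1 + 1) / c\<^sup>2 + 1 / c) + C1 / c) * 0 +
      4 * ((1 + 2 * C1 / c) * 0 * inverse (sqrt \<kappa>) + sqrt \<eta>)\<^sup>2) (at_right 0)"
    by (intro tendsto_intros)
  then show "(gram_bound C1 c \<kappa> \<eta> \<longlongrightarrow> 4 * (sqrt \<eta>)\<^sup>2) (at_right 0)"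
    by (simp add: gram_bound_def[abs_def] divide_inverse)
qed

section \<open>Accuracy of the estimated slice representers\<close>

lemma l2_inner_close:
  assumes "x \<in> L2 M" "y \<in> L2 M" "a \<in> L2 M" "b \<in> L2 M"
  shows "\<bar>l2_inner M x y - l2_inner M a b\<bar> \<le> l2_norm M (\<lambda>w. x w - a w) * l2_norm M y + l2_norm M a * l2_norm M (\<lambda>w. y w - b w)"
proof -
  have "l2_inner M x y - l2_inner M a b = l2_inner M (\<lambda>w. x w - a w) y + l2_inner M a (\<lambda>w. y w - b w)"
    using assms by (simp add: l2_inner_diff_left l2_inner_diff_right)
  then show ?thesis
    using l2_cauchy_schwarz[OF L2_diff[OF assms(1,3)] assms(2)] l2_cauchy_schwarz[OF assms(3) L2_diff[OF assms(2,4)]]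
    by linarith
qed

text \<open>In the reference dimension \<open>n0\<close> the matrix error is of order 1 instead of
  \<open>sqrt n\<close>. The third condition says that the sample has no variance in directions of zero
  population variance.\<close>

definition close_sample ::
  "(nat \<Rightarrow> nat \<Rightarrow> real) \<Rightarrow> (nat \<Rightarrow> real) \<Rightarrow> (nat \<Rightarrow> nat \<Rightarrow> real) \<Rightarrow> (nat \<Rightarrow> nat \<Rightarrow> real) \<Rightarrow> nat \<Rightarrow> nat \<Rightarrow> nat \<Rightarrow> real \<Rightarrow>
    (nat \<Rightarrow> nat \<Rightarrow> real) \<Rightarrow> (nat \<Rightarrow> nat \<Rightarrow> real) \<Rightarrow> bool" where
  "close_sample A l u h S n0 n t B H \<longleftrightarrow>
     frob n (\<lambda>a b. B a b - A a b) \<le> t * sqrt n \<and> frob n0 (\<lambda>a b. B a b - A a b) \<le> t \<and>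
     (\<forall>j\<in>{1..n}. l j = 0 \<longrightarrow> (\<forall>a<n. mv n B (u j) a = 0)) \<and>
     (\<forall>s\<in>{1..S}. nrm n (\<lambda>a. H s a - h s a) \<le> t)"

text \<open>The accuracy \<open>t\<close> that is required of the sample depends on the truncation index
  but not on \<open>n\<close>. The constants 33 and 5 leave room beyond the limits 32 and 4 of the bounds
  at \<open>t = 0\<close>.\<close>

lemma fixed_truncation:
  fixes M :: "'w measure" and X :: "'t \<Rightarrow> 'w \<Rightarrow> real" and \<tau> :: "nat \<Rightarrow> 't" and \<eta> :: "nat \<Rightarrow> 'w \<Rightarrow> real"
    and l :: "nat \<Rightarrow> nat \<Rightarrow> real" and u :: "nat \<Rightarrow> nat \<Rightarrow> nat \<Rightarrow> real" and J :: "nat \<Rightarrow> nat"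
    and S k :: nat and c C C2 \<rho> :: real
  defines "A \<equiv> gram (cov_fun M X) \<tau>" and "h \<equiv> \<lambda>s a. l2_inner M (\<eta> s) (X (\<tau> (Suc a)))"
  assumes X: "\<And>t. X t \<in> L2 M" and XC: "\<And>t. l2_inner M (X t) (X t) \<le> C"
    and \<eta>: "\<And>s. s \<in> {1..S} \<Longrightarrow> \<eta> s \<in> L2 M" and \<eta>C: "\<And>s. s \<in> {1..S} \<Longrightarrow> l2_norm M (\<eta> s) \<le> C2"
    and A: "\<And>m. spec m A (l m) (u m)"
    and J: "mono J" "\<And>n. J n > 0" and k: "k > 0"
    and Jk: "(\<forall>\<^sub>F n in sequentially. k < J n) \<or> (\<forall>\<^sub>F n in sequentially. J n = k)"
    and c: "c > 0" and gap: "\<forall>\<^sub>F n in sequentially. \<forall>j\<in>{1..J n}. l (J n) j \<noteq> l (J n) k \<longrightarrow> \<bar>l (J n) j - l (J n) k\<bar> \<ge> c * J n"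
    and \<rho>: "\<rho> > 0"
    and def: "\<forall>\<^sub>F n in sequentially. \<forall>u s. spec (J n) A (l (J n)) u \<longrightarrow> s \<in> {1..S} \<longrightarrow> defect (J n) k (l (J n)) u (h s) \<le> \<rho>"
    and dens: "\<And>s. s \<in> {1..S} \<Longrightarrow> \<forall>\<^sub>F n in sequentially. \<exists>b. (l2_norm M (\<lambda>w. proc X \<tau> (J n) b w - \<eta> s w))\<^sup>2 < \<rho>"
  obtains t n0 where "t > 0" "t \<le> \<rho>"
    "\<forall>\<^sub>F n in sequentially. k \<le> J n \<and> J n0 \<le> J n \<and> (\<forall>B l' v H. spec (J n) B l' v \<longrightarrow> close_sample A (l (J n)) (u (J n)) h S (J n0) (J n) t B H \<longrightarrow>
       (\<forall>s\<in>{1..S}. l2_norm M (\<lambda>w. proc X \<tau> (J n) (mv (J n) (comb (J n) (tinv k l') v) (H s)) w - \<eta> s w) \<le> sqrt (33 * \<rho>) + sqrt (2 * \<rho>) \<and>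
         (\<forall>r\<in>{1..S}. \<bar>dot (J n) (H r) (mv (J n) (comb (J n) (tinv k l') v) (H s)) - l2_inner M (\<eta> r) (\<eta> s)\<bar>
           \<le> 5 * \<rho> + sqrt (2 * \<rho>) * (2 * C2 + sqrt (2 * \<rho>)))))"
proof -
  have hs: "h s = (\<lambda>a. l2_inner M (\<eta> s) (X (\<tau> (Suc a))))" for s by (simp add: h_def)
  define L where "L n = l (J n)" for n
  define U where "U n = u (J n)" for n
  have Ls: "spec (J n) A (L n) (U n)" for n unfolding L_def U_def by (rule A)
  have L0: "0 \<le> L n j" if "j \<in> {1..J n}" for n j
    by (rule eigvals_nonneg[OF Ls _ that]) (simp add: A_def gram_quad[OF X])
  have diag: "A a a \<le> C" for a
    using XC[of "\<tau> (Suc a)"] by (simp add: A_def gram_def cov_fun_def l2_inner_def)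
  have LC: "L n j \<le> C * J n" if "j \<in> {1..J n}" for n j
    by (rule eigval_trace_bound(1)[OF Ls L0 diag that])
  have C0: "C \<ge> 0" using order_trans[OF l2_inner_self_nonneg XC] .
  have kJ: "\<forall>\<^sub>F n in sequentially. k \<le> J n" using Jk by (auto elim: eventually_mono)
  \<comment> \<open>If the dimension equals \<open>k\<close>, no eigenvalue follows the \<open>k\<close>-th, and the
    gap condition gives no lower bound for it; but then the matrix is a fixed one, and \<open>c2\<close>
    bounds its smallest positive eigenvalue.\<close>
  define c2 where "c2 = (if l k k > 0 then l k k / k else 1)"
  define c' where "c' = min c c2"
  have c': "c' > 0" using c k by (auto simp: c'_def c2_def)
  \<comment> \<open>The dimensions in which all eigenvalues from the \<open>k\<close>-th on are equal and
    positive. Their common value is bounded because of the trace, so some dimension \<open>n0\<close> in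
    this set attains at least half of the supremum. In larger dimensions, interlacing with
    \<open>n0\<close> bounds the sample eigenvalue from below.\<close>
  define tail where "tail = {n. k < J n \<and> L n (J n) = L n k \<and> L n k > 0}"
  define \<Lambda> where "\<Lambda> = (\<lambda>n. L n k) ` tail"
  obtain n0 \<kappa>0 where \<kappa>0: "\<kappa>0 > 0" and tailn0: "\<And>n. n \<in> tail \<Longrightarrow> n0 \<in> tail \<and> \<kappa>0 = L n0 k \<and> L n k \<le> 2 * \<kappa>0"
  proof (cases "tail = {}")
    case True then show thesis using that[of 1 0] by simp
  next
    case False
    have bdd: "bdd_above \<Lambda>"
    proof (rule bdd_aboveI)
      fix x assume "x \<in> \<Lambda>"
      then obtain n where n: "n \<in> tail" "x = L n k" by (auto simp: \<Lambda>_def)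
      then have kn: "k \<in> {1..J n}" using k by (auto simp: tail_def)
      show "x \<le> C * k" using eigval_trace_bound(2)[OF Ls L0 diag kn] n by (simp add: tail_def)
    qed
    obtain n1 where n1: "n1 \<in> tail" using False by blast
    have "Sup \<Lambda> \<ge> L n1 k" using bdd n1 by (intro cSup_upper) (auto simp: \<Lambda>_def)
    then have "Sup \<Lambda> > 0" using n1 by (auto simp: tail_def)
    then have "Sup \<Lambda> / 2 < Sup \<Lambda>" by simp
    then obtain x where "x \<in> \<Lambda>" "Sup \<Lambda> / 2 < x" using less_cSup_iff[OF _ bdd, of "Sup \<Lambda> / 2"] False by (auto simp: \<Lambda>_def)
    then obtain n2 where n2: "n2 \<in> tail" "Sup \<Lambda> / 2 < L n2 k" by (auto simp: \<Lambda>_def)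
    show thesis
    proof (rule that[of "L n2 k" n2])
      show "L n2 k > 0" using n2 by (simp add: tail_def)
      fix n assume "n \<in> tail"
      then have "L n k \<le> Sup \<Lambda>" using bdd by (intro cSup_upper) (auto simp: \<Lambda>_def)
      then show "n2 \<in> tail \<and> L n2 k = L n2 k \<and> L n k \<le> 2 * L n2 k" using n2 by simp
    qed
  qed
  define \<kappa> where "\<kappa> = min c' \<kappa>0"
  have \<kappa>: "0 < \<kappa>" "\<kappa> \<le> c'" "\<kappa> \<le> \<kappa>0" using c' \<kappa>0 by (auto simp: \<kappa>_def)
  define C1 where "C1 = C2 * sqrt C"
  have hb: "\<bar>h s a\<bar> \<le> \<bar>C1\<bar>" if s: "s \<in> {1..S}" for s a
  proof -
    have "\<bar>h s a\<bar> \<le> l2_norm M (\<eta> s) * l2_norm M (X (\<tau> (Suc a)))" unfolding h_def by (rule l2_cauchy_schwarz[OF \<eta>[OF s] X])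
    also have "\<dots> \<le> C2 * sqrt C"
      using \<eta>C[OF s] XC[of "\<tau> (Suc a)"] by (intro mult_mono) (auto simp: l2_norm_def intro: order_trans[OF _ \<eta>C[OF s], unfolded l2_norm_def])
    finally show ?thesis by (simp add: C1_def)
  qed
  have hn: "nrm n (h s) \<le> \<bar>C1\<bar> * sqrt n" if s: "s \<in> {1..S}" for n s
  proof (rule power2_le_imp_le)
    have "(nrm n (h s))\<^sup>2 = (\<Sum>a<n. \<bar>h s a\<bar>\<^sup>2)" unfolding nrm_sq dot_def by (simp add: power2_eq_square)
    also have "\<dots> \<le> (\<Sum>a<n. \<bar>C1\<bar>\<^sup>2)" by (intro sum_mono power_mono hb s) auto
    finally show "(nrm n (h s))\<^sup>2 \<le> (\<bar>C1\<bar> * sqrt n)\<^sup>2" by (simp add: power_mult_distrib mult.commute)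
  qed simp
  have "\<forall>\<^sub>F t in at_right 0. quad_bound C \<bar>C1\<bar> c' \<kappa> \<rho> t < 33 * \<rho>"
    using order_tendstoD(2)[OF bounds_tendsto(1)[of C "\<bar>C1\<bar>" c' \<kappa> \<rho>], of "33 * \<rho>"] \<rho> by simp
  moreover have "\<forall>\<^sub>F t in at_right 0. gram_bound \<bar>C1\<bar> c' \<kappa> \<rho> t < 5 * \<rho>"
    using order_tendstoD(2)[OF bounds_tendsto(2)[of "\<bar>C1\<bar>" c' \<kappa> \<rho>], of "5 * \<rho>"] \<rho> by simp
  moreover have "\<forall>\<^sub>F t in at_right 0. t < min (min 1 \<rho>) (min (c' / 2) (\<kappa>0 / 2))"
    using \<rho> c' \<kappa>0 by (intro eventually_at_right_less order_tendstoD(2)[OF tendsto_ident_at]) auto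
  moreover have "\<forall>\<^sub>F t::real in at_right 0. 0 < t" by (rule eventually_at_right_less)
  ultimately have "\<forall>\<^sub>F t in at_right 0. quad_bound C \<bar>C1\<bar> c' \<kappa> \<rho> t < 33 * \<rho> \<and> gram_bound \<bar>C1\<bar> c' \<kappa> \<rho> t < 5 * \<rho> \<and>
      t < min (min 1 \<rho>) (min (c' / 2) (\<kappa>0 / 2)) \<and> 0 < t" by eventually_elim simp
  then have "\<exists>t. quad_bound C \<bar>C1\<bar> c' \<kappa> \<rho> t < 33 * \<rho> \<and> gram_bound \<bar>C1\<bar> c' \<kappa> \<rho> t < 5 * \<rho> \<and>
      t < min (min 1 \<rho>) (min (c' / 2) (\<kappa>0 / 2)) \<and> 0 < t"
    by (rule eventually_happens'[OF trivial_limit_at_right_real])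
  then obtain t where t: "quad_bound C \<bar>C1\<bar> c' \<kappa> \<rho> t < 33 * \<rho>" "gram_bound \<bar>C1\<bar> c' \<kappa> \<rho> t < 5 * \<rho>"
    "t < min (min 1 \<rho>) (min (c' / 2) (\<kappa>0 / 2))" "0 < t"
    by (elim exE conjE)
  have t': "0 \<le> t" "t \<le> 1" "t \<le> c' / 2" "t \<le> \<kappa>0 / 2" "t \<le> \<rho>" using t(3,4) by simp_all
  have n0: "\<forall>\<^sub>F n in sequentially. n0 \<le> n" by (rule eventually_ge_at_top)
  have dens': "\<forall>\<^sub>F n in sequentially. \<forall>s\<in>{1..S}. \<exists>b. (l2_norm M (\<lambda>w. proc X \<tau> (J n) b w - \<eta> s w))\<^sup>2 < \<rho>"
    by (rule eventually_ball_finite[OF finite_atLeastAtMost]) (rule ballI, rule dens)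
  have low: "\<forall>\<^sub>F n in sequentially. k = J n \<longrightarrow> L n k = 0 \<or> L n k \<ge> c' * J n"
  proof (rule always_eventually, intro allI impI)
    fix n assume kn: "k = J n"
    show "L n k = 0 \<or> L n k \<ge> c' * J n"
    proof (cases "L n k = 0")
      case False
      have Lk: "L n k = l k k" unfolding L_def kn[symmetric] ..
      have "0 \<le> L n k" by (rule L0) (use kn k in auto)
      then have "l k k > 0" using False Lk by linarith
      then have "c2 * k = L n k" using k Lk by (simp add: c2_def)
      moreover have "c' * k \<le> c2 * k" by (intro mult_right_mono) (auto simp: c'_def)
      ultimately show ?thesis using kn by simp
    qed simp
  qed
  show thesis
  proof (rule that[OF t(4) t'(5), of n0], use kJ gap def dens' n0 low in eventually_elim)
    case (elim n)
    have Jn0: "J n0 \<le> J n" using J(1) elim by (simp add: monoD)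
    have kn: "k \<in> {1..J n}" using elim k by simp
    have gapn: "\<bar>L n j - L n k\<bar> \<ge> c' * J n" if "j \<in> {1..J n}" "L n j \<noteq> L n k" for j
    proof -
      have "c' * J n \<le> c * J n" by (intro mult_right_mono) (auto simp: c'_def)
      moreover have "c * J n \<le> \<bar>L n j - L n k\<bar>" using elim(2) that unfolding L_def by blast
      ultimately show ?thesis by linarith
    qed
    have defn: "defect (J n) k (L n) u (h s) \<le> \<rho>" if "spec (J n) A (L n) u" "s \<in> {1..S}" for u s
      using elim(3) that unfolding L_def by blast
    have tl: "\<kappa> \<le> L n k \<and> (\<forall>B l' v. spec (J n) B l' v \<longrightarrow> frob (J n0) (\<lambda>a b. B a b - A a b) \<le> t \<longrightarrow> L n k / 4 \<le> l' k)"
      if "k < J n" "L n (J n) = L n k" "L n k > 0"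
    proof -
      have nt: "n \<in> tail" using that by (simp add: tail_def)
      note q = tailn0[OF nt]
      have k0: "k \<in> {1..J n0}" using q k by (auto simp: tail_def)
      have "L n0 k - 0 \<le> L n k"
        by (rule interlacing_lower_bound[OF Ls Ls k0 Jn0]) (simp add: frob_def)
      moreover have "L n k / 4 \<le> l' k" if B: "spec (J n) B l' v" and F: "frob (J n0) (\<lambda>a b. B a b - A a b) \<le> t" for B l' v
        using interlacing_lower_bound[OF Ls B k0 Jn0 F] q t' by linarith
      ultimately show ?thesis using q \<kappa> by auto
    qed
    have hker: "dot (J n) (U n j) (h s) = 0" if "s \<in> {1..S}" "j \<in> {1..J n}" "L n j = 0" for s j
      by (rule kernel_orthogonal[OF X Ls[unfolded A_def] \<eta>[OF that(1)] hs that(2,3)])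
    obtain k0 where k0: "\<And>s. s \<in> {1..S} \<Longrightarrow> defect (J n) k0 (L n) (U n) (h s) \<le> \<rho>"
      and est: "\<And>B l' v H s r x. spec (J n) B l' v \<Longrightarrow> frob (J n) (\<lambda>a b. B a b - A a b) \<le> t * sqrt (J n) \<Longrightarrow>
      (\<And>j a. j \<in> {1..J n} \<Longrightarrow> L n j = 0 \<Longrightarrow> a < J n \<Longrightarrow> mv (J n) B (U n j) a = 0) \<Longrightarrow>
      (k < J n \<Longrightarrow> L n (J n) = L n k \<Longrightarrow> L n k > 0 \<Longrightarrow> l' k \<ge> L n k / 4) \<Longrightarrow>
      (\<And>s. s \<in> {1..S} \<Longrightarrow> nrm (J n) (\<lambda>a. H s a - h s a) \<le> t) \<Longrightarrow> s \<in> {1..S} \<Longrightarrow> r \<in> {1..S} \<Longrightarrow>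
      x = (\<lambda>a. mv (J n) (comb (J n) (tinv k l') v) (H s) a - mv (J n) (comb (J n) (tinv k0 (L n)) (U n)) (h s) a) \<Longrightarrow>
      dot (J n) x (mv (J n) A x) \<le> quad_bound C \<bar>C1\<bar> c' \<kappa> \<rho> t \<and>
      \<bar>dot (J n) (H r) (mv (J n) (comb (J n) (tinv k l') v) (H s)) - dot (J n) (h r) (mv (J n) (comb (J n) (tinv k0 (L n)) (U n)) (h s))\<bar>
        \<le> gram_bound \<bar>C1\<bar> c' \<kappa> \<rho> t"
      by (rule estimates_at_n[where n = "J n" and A = A and l = "L n" and u = "U n" and C = C and k = k and c = c' and t = t
          and \<kappa> = \<kappa> and \<eta> = \<rho> and S = S and h = h and ?C1.0 = "\<bar>C1\<bar>",
          OF Ls L0 LC kn c' t'(1,2,3) abs_ge_zero gapn _ \<kappa>(1,2) _ less_imp_le[OF \<rho>] defn hn hker])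
        (use elim tl in auto)
    define D where "D s = proc X \<tau> (J n) (mv (J n) (comb (J n) (tinv k0 (L n)) (U n)) (h s))" for s
    have DL: "D s \<in> L2 M" for s unfolding D_def by (rule proc_L2[OF X])
    have Dclose: "l2_norm M (\<lambda>w. D s w - \<eta> s w) \<le> sqrt (2 * \<rho>)" if s: "s \<in> {1..S}" for s
    proof -
      obtain b where b: "(l2_norm M (\<lambda>w. proc X \<tau> (J n) b w - \<eta> s w))\<^sup>2 < \<rho>" using elim(4) s by blast
      have "(l2_norm M (\<lambda>w. D s w - \<eta> s w))\<^sup>2 \<le> (l2_norm M (\<lambda>w. proc X \<tau> (J n) b w - \<eta> s w))\<^sup>2 + defect (J n) k0 (L n) (U n) (h s)"
        unfolding D_def defect_def by (rule truncated_defect[OF X Ls[unfolded A_def] \<eta>[OF s] hs])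
      then have "(l2_norm M (\<lambda>w. D s w - \<eta> s w))\<^sup>2 \<le> 2 * \<rho>" using b k0[OF s] by linarith
      then show ?thesis by (rule real_le_rsqrt)
    qed
    have Dinner: "l2_inner M (D r) (D s) = dot (J n) (h r) (mv (J n) (comb (J n) (tinv k0 (L n)) (U n)) (h s))"
      if "r \<in> {1..S}" "s \<in> {1..S}" for r s
      unfolding D_def l2_inner_proc_proc[OF X]
      by (rule truncated_inner[OF X Ls[unfolded A_def] \<eta>[OF that(2)] hs \<eta>[OF that(1)] hs])
    show ?case
    proof (intro conjI Jn0 elim(1) allI impI ballI)
      fix B l' v H s
      assume B: "spec (J n) B l' v" and close: "close_sample A (l (J n)) (u (J n)) h S (J n0) (J n) t B H" and s: "s \<in> {1..S}"
      define x where "x r = (\<lambda>a. mv (J n) (comb (J n) (tinv k l') v) (H r) a - mv (J n) (comb (J n) (tinv k0 (L n)) (U n)) (h r) a)" for r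
      have main: "dot (J n) (x s) (mv (J n) A (x s)) \<le> quad_bound C \<bar>C1\<bar> c' \<kappa> \<rho> t \<and>
        \<bar>dot (J n) (H r) (mv (J n) (comb (J n) (tinv k l') v) (H s)) - dot (J n) (h r) (mv (J n) (comb (J n) (tinv k0 (L n)) (U n)) (h s))\<bar>
        \<le> gram_bound \<bar>C1\<bar> c' \<kappa> \<rho> t" if r: "r \<in> {1..S}" for r
      proof (rule est[where B = B and l' = l' and v = v and H = H and s = s and r = r and x = "x s", OF B])
        show "frob (J n) (\<lambda>a b. B a b - A a b) \<le> t * sqrt (J n)"
          using close unfolding close_sample_def by blast
        show "mv (J n) B (U n j) a = 0" if "j \<in> {1..J n}" "L n j = 0" "a < J n" for j a
          using close that unfolding close_sample_def L_def U_def by blast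
        show "nrm (J n) (\<lambda>a. H s a - h s a) \<le> t" if "s \<in> {1..S}" for s
          using close that unfolding close_sample_def by blast
        assume "k < J n" "L n (J n) = L n k" "0 < L n k"
        from tl[OF this] show "L n k / 4 \<le> l' k" using B close unfolding close_sample_def by blast
      qed (rule s r x_def)+
      let ?P = "proc X \<tau> (J n) (mv (J n) (comb (J n) (tinv k l') v) (H s))"
      have PL: "?P \<in> L2 M" by (rule proc_L2[OF X])
      have "(l2_norm M (\<lambda>w. ?P w - D s w))\<^sup>2 =  dot (J n) (x s) (mv (J n) A (x s))"
        unfolding D_def proc_diff[symmetric] x_def A_def gram_quad[OF X] ..
      then have "(l2_norm M (\<lambda>w. ?P w - D s w))\<^sup>2 \<le> 33 * \<rho>" using main[OF s] t(1) by linarith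
      then have "l2_norm M (\<lambda>w. ?P w - D s w) \<le> sqrt (33 * \<rho>)" by (rule real_le_rsqrt)
      then show "l2_norm M (\<lambda>w. ?P w - \<eta> s w) \<le> sqrt (33 * \<rho>) + sqrt (2 * \<rho>)"
        using l2_triangle_diff[OF PL DL[of s] \<eta>[OF s]] Dclose[OF s] by linarith
      fix r assume r: "r \<in> {1..S}"
      have "\<bar>l2_inner M (D r) (D s) - l2_inner M (\<eta> r) (\<eta> s)\<bar> \<le>
          l2_norm M (\<lambda>w. D r w - \<eta> r w) * l2_norm M (D s) + l2_norm M (\<eta> r) * l2_norm M (\<lambda>w. D s w - \<eta> s w)"
        by (rule l2_inner_close[OF DL DL \<eta>[OF r] \<eta>[OF s]])
      also have "\<dots> \<le> sqrt (2 * \<rho>) * (C2 + sqrt (2 * \<rho>)) + C2 * sqrt (2 * \<rho>)"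
      proof (intro add_mono mult_mono Dclose r s \<eta>C)
        have "l2_norm M (\<lambda>w. (D s w - \<eta> s w) + \<eta> s w) \<le> l2_norm M (\<lambda>w. D s w - \<eta> s w) + l2_norm M (\<eta> s)"
          by (rule l2_triangle[OF L2_diff[OF DL \<eta>[OF s]] \<eta>[OF s]])
        then show "l2_norm M (D s) \<le> C2 + sqrt (2 * \<rho>)" using Dclose[OF s] \<eta>C[OF s] by simp
        show "0 \<le> C2" using order_trans[OF l2_norm_nonneg \<eta>C[OF r]] .
      qed (use \<rho> in auto)
      also have "\<dots> = sqrt (2 * \<rho>) * (2 * C2 + sqrt (2 * \<rho>))" by (simp add: algebra_simps)
      finally show "\<bar>dot (J n) (H r) (mv (J n) (comb (J n) (tinv k l') v) (H s)) - l2_inner M (\<eta> r) (\<eta> s)\<bar>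
           \<le> 5 * \<rho> + sqrt (2 * \<rho>) * (2 * C2 + sqrt (2 * \<rho>))"
        using main[OF r] t(2) unfolding Dinner[OF r s] by linarith
    qed
  qed
qed

section \<open>From slice representers to eigenvectors\<close>

text \<open>If no \<open>\<zeta>\<close> worked, there would be a sequence of problems, of varying
  dimension, that converge to the population problem while the error of the estimated vector
  stays above \<open>\<epsilon>\<close>; this contradicts convergence up to sign together with the sign
  convention.\<close>

lemma eigenvector_perturbation:
  fixes S p j :: nat and q lam :: "nat \<Rightarrow> real" and \<eta> :: "nat \<Rightarrow> 'w \<Rightarrow> real" and \<xi> :: "'w \<Rightarrow> real" and cc :: "nat \<Rightarrow> nat \<Rightarrow> real"
  assumes q: "\<And>s. s \<in> {1..S} \<Longrightarrow> q s > 0"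
    and lam: "\<And>i. i \<in> {1..p} \<Longrightarrow> lam i > 0" "\<And>i j. i \<in> {1..p} \<Longrightarrow> j \<in> {1..p} \<Longrightarrow> i < j \<Longrightarrow> lam j < lam i"
    and cc: "\<And>i j. i \<in> {1..p} \<Longrightarrow> j \<in> {1..p} \<Longrightarrow> (\<Sum>s\<in>{1..S}. q s * cc s i * cc s j) = (if i = j then lam i else 0)"
    and G: "\<And>s r. s \<in> {1..S} \<Longrightarrow> r \<in> {1..S} \<Longrightarrow> l2_inner M (\<eta> s) (\<eta> r) = (\<Sum>j\<in>{1..p}. cc s j * cc r j)"
    and j: "j \<in> {1..p}" and \<eta>: "\<And>s. s \<in> {1..S} \<Longrightarrow> \<eta> s \<in> L2 M" and \<xi>: "\<xi> \<in> L2 M"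
    and \<xi>1: "l2_inner M \<xi> \<xi> = 1"
    and exp: "l2_norm M (\<lambda>w. \<xi> w - (\<Sum>s\<in>{1..S}. (q s * cc s j / lam j) * \<eta> s w)) = 0"
    and \<epsilon>: "\<epsilon> > 0"
  obtains \<zeta> where "\<zeta> > 0"
    "\<And>d w ph Mh l u v P xhat. spec d Mh l u \<Longrightarrow>
      (\<And>a b. a < d \<Longrightarrow> b < d \<Longrightarrow> Mh a b = (\<Sum>s\<in>{1..S}. ph s * w s a * w s b)) \<Longrightarrow> j \<le> d \<Longrightarrow>
      (\<And>s. s \<in> {1..S} \<Longrightarrow> ph s \<ge> 0) \<Longrightarrow> (\<And>s. s \<in> {1..S} \<Longrightarrow> \<bar>ph s - q s\<bar> \<le> \<zeta>) \<Longrightarrow>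
      (\<And>s r. s \<in> {1..S} \<Longrightarrow> r \<in> {1..S} \<Longrightarrow> \<bar>dot d (w s) (w r) - l2_inner M (\<eta> s) (\<eta> r)\<bar> \<le> \<zeta>) \<Longrightarrow>
      (\<And>a. a < d \<Longrightarrow> mv d Mh v a = l j * v a) \<Longrightarrow> dot d v v = 1 \<Longrightarrow>
      (\<And>s. s \<in> {1..S} \<Longrightarrow> P s \<in> L2 M) \<Longrightarrow> (\<And>s. s \<in> {1..S} \<Longrightarrow> l2_norm M (\<lambda>w. P s w - \<eta> s w) \<le> \<zeta>) \<Longrightarrow>
      (l j \<noteq> 0 \<Longrightarrow> xhat = (\<lambda>x. \<Sum>s\<in>{1..S}. (ph s * dot d (w s) v / l j) * P s x)) \<Longrightarrow>
      l2_inner M xhat \<xi> \<ge> 0 \<Longrightarrow> l2_norm M (\<lambda>x. xhat x - \<xi> x) \<le> \<epsilon>"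
proof -
  define good where "good \<zeta> d w ph Mh l u v P xhat \<longleftrightarrow> spec d Mh l u \<and>
      (\<forall>a b. a < d \<longrightarrow> b < d \<longrightarrow> Mh a b = (\<Sum>s\<in>{1..S}. ph s * w s a * w s b)) \<and> j \<le> d \<and>
      (\<forall>s\<in>{1..S}. ph s \<ge> 0) \<and> (\<forall>s\<in>{1..S}. \<bar>ph s - q s\<bar> \<le> \<zeta>) \<and>
      (\<forall>s\<in>{1..S}. \<forall>r\<in>{1..S}. \<bar>dot d (w s) (w r) - l2_inner M (\<eta> s) (\<eta> r)\<bar> \<le> \<zeta>) \<and>
      (\<forall>a<d. mv d Mh v a = l j * v a) \<and> dot d v v = 1 \<and>
      (\<forall>s\<in>{1..S}. P s \<in> L2 M) \<and> (\<forall>s\<in>{1..S}. l2_norm M (\<lambda>w. P s w - \<eta> s w) \<le> \<zeta>) \<and>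
      (l j \<noteq> 0 \<longrightarrow> xhat = (\<lambda>x. \<Sum>s\<in>{1..S}. (ph s * dot d (w s) v / l j) * P s x)) \<and>
      l2_inner M xhat \<xi> \<ge> 0"
    for \<zeta> d w ph Mh and l :: "nat \<Rightarrow> real" and u v P xhat
  have "\<exists>\<zeta>>0. \<forall>d w ph Mh l u v P xhat. good \<zeta> d w ph Mh l u v P xhat \<longrightarrow> l2_norm M (\<lambda>x. xhat x - \<xi> x) \<le> \<epsilon>"
  proof (rule ccontr)
    assume neg: "\<not> ?thesis"
    have "\<exists>d w ph Mh l u v P xhat. good (1 / Suc i) d w ph Mh l u v P xhat \<and> \<not> l2_norm M (\<lambda>x. xhat x - \<xi> x) \<le> \<epsilon>" for i
    proof -
      have "1 / real (Suc i) > 0" by simp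
      then show ?thesis using neg by blast
    qed
    then have "\<forall>i. \<exists>d w ph Mh l u v P xhat. good (1 / Suc i) d w ph Mh l u v P xhat \<and> \<not> l2_norm M (\<lambda>x. xhat x - \<xi> x) \<le> \<epsilon>"
      by (rule allI)
    then obtain d w ph Mh l u v P xhat where all: "\<forall>i. good (1 / Suc i) (d i) (w i) (ph i) (Mh i) (l i) (u i) (v i) (P i) (xhat i) \<and>
        \<not> l2_norm M (\<lambda>x. xhat i x - \<xi> x) \<le> \<epsilon>"
      by (simp only: choice_iff) (elim exE)
    note gd = all[THEN HOL.spec, THEN conjunct1] and bad = all[THEN HOL.spec, THEN conjunct2]
    have lim0: "(\<lambda>i. 1 / real (Suc i)) \<longlonglongrightarrow> 0" using LIMSEQ_inverse_real_of_nat by (simp add: inverse_eq_divide)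
    have sp: "spec (d i) (Mh i) (l i) (u i)" for i using gd[of i] unfolding good_def by blast
    have Me: "Mh i a b = (\<Sum>s\<in>{1..S}. ph i s * w i s a * w i s b)" if "a < d i" "b < d i" for i a b
      using gd[of i] that unfolding good_def by blast
    have dj: "j \<le> d i" for i using gd[of i] unfolding good_def by blast
    have ph0: "ph i s \<ge> 0" if "s \<in> {1..S}" for i s using gd[of i] that unfolding good_def by blast
    have vv: "dot (d i) (v i) (v i) = 1" for i using gd[of i] unfolding good_def by blast
    have ve: "mv (d i) (Mh i) (v i) a = l i j * v i a" if "a < d i" for i a using gd[of i] that unfolding good_def by blast
    have PL: "P i s \<in> L2 M" if "s \<in> {1..S}" for i s using gd[of i] that unfolding good_def by blast
    have xe: "xhat i = (\<lambda>x. \<Sum>s\<in>{1..S}. (ph i s * dot (d i) (w i s) (v i) / l i j) * P i s x)" if "l i j \<noteq> 0" for i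
      using gd[of i] that unfolding good_def by blast
    have sg: "l2_inner M (xhat i) \<xi> \<ge> 0" for i using gd[of i] unfolding good_def by blast
    have phl: "(\<lambda>i. ph i s) \<longlonglongrightarrow> q s" if s: "s \<in> {1..S}" for s
    proof (rule LIM_zero_cancel, rule Lim_null_comparison[OF _ lim0])
      show "\<forall>\<^sub>F i in sequentially. norm (ph i s - q s) \<le> 1 / real (Suc i)"
        using gd s unfolding good_def by (intro always_eventually allI) simp
    qed
    have wl: "(\<lambda>i. dot (d i) (w i s) (w i r)) \<longlonglongrightarrow> l2_inner M (\<eta> s) (\<eta> r)" if s: "s \<in> {1..S}" "r \<in> {1..S}" for s r
    proof (rule LIM_zero_cancel, rule Lim_null_comparison[OF _ lim0])
      show "\<forall>\<^sub>F i in sequentially. norm (dot (d i) (w i s) (w i r) - l2_inner M (\<eta> s) (\<eta> r)) \<le> 1 / real (Suc i)"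
        using gd s unfolding good_def by (intro always_eventually allI) simp
    qed
    have Pl: "(\<lambda>i. l2_norm M (\<lambda>x. P i s x - \<eta> s x)) \<longlonglongrightarrow> 0" if s: "s \<in> {1..S}" for s
    proof (rule Lim_null_comparison[OF _ lim0])
      show "\<forall>\<^sub>F i in sequentially. norm (l2_norm M (\<lambda>x. P i s x - \<eta> s x)) \<le> 1 / real (Suc i)"
        using gd s unfolding good_def by (intro always_eventually allI) simp
    qed
    obtain \<alpha> where \<alpha>: "(\<lambda>i. (\<alpha> i)\<^sup>2) \<longlonglongrightarrow> 1"
      and coef: "\<And>s. s \<in> {1..S} \<Longrightarrow> (\<lambda>i. ph i s * dot (d i) (w i s) (v i) / l i j - \<alpha> i * (q s * cc s j / lam j)) \<longlonglongrightarrow> 0"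
      and ll: "(\<lambda>i. l i j) \<longlonglongrightarrow> lam j"
      using eigenvector_coefficients_converge[OF q lam cc G j ph0 phl wl sp Me dj ve vv] by blast
    define \<beta> where "\<beta> s = q s * cc s j / lam j" for s
    define \<gamma> where "\<gamma> i s = ph i s * dot (d i) (w i s) (v i) / l i j" for i s
    have \<gamma>l: "(\<lambda>i. \<gamma> i s - \<alpha> i * \<beta> s) \<longlonglongrightarrow> 0" if "s \<in> {1..S}" for s
      using coef[OF that] by (simp add: \<gamma>_def \<beta>_def)
    have \<alpha>b: "\<bar>\<alpha> i\<bar> \<le> (\<alpha> i)\<^sup>2 + 1" for i using zero_le_power2[of "\<bar>\<alpha> i\<bar> - 1"] by (simp add: power2_diff)
    define x where "x i = (\<lambda>x. \<Sum>s\<in>{1..S}. \<gamma> i s * P i s x)" for i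
    define e where "e i = (\<Sum>s\<in>{1..S}. \<bar>\<gamma> i s - \<alpha> i * \<beta> s\<bar> * (l2_norm M (\<lambda>x. P i s x - \<eta> s x) + l2_norm M (\<eta> s)) +
        ((\<alpha> i)\<^sup>2 + 1) * \<bar>\<beta> s\<bar> * l2_norm M (\<lambda>x. P i s x - \<eta> s x))" for i
    have el: "e \<longlonglongrightarrow> 0"
    proof -
      have "(\<lambda>i. \<Sum>s\<in>{1..S}. \<bar>\<gamma> i s - \<alpha> i * \<beta> s\<bar> * (l2_norm M (\<lambda>x. P i s x - \<eta> s x) + l2_norm M (\<eta> s)) +
        ((\<alpha> i)\<^sup>2 + 1) * \<bar>\<beta> s\<bar> * l2_norm M (\<lambda>x. P i s x - \<eta> s x)) \<longlonglongrightarrow>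
        (\<Sum>s\<in>{1..S}. \<bar>0\<bar> * (0 + l2_norm M (\<eta> s)) + (1 + 1) * \<bar>\<beta> s\<bar> * 0)"
        by (intro tendsto_intros Pl \<gamma>l \<alpha>) auto
      then show ?thesis by (simp add: e_def[abs_def])
    qed
    define y where "y = (\<lambda>x. \<Sum>s\<in>{1..S}. \<beta> s * \<eta> s x)"
    have yL: "y \<in> L2 M" unfolding y_def by (rule L2_lincomb[OF \<eta>])
    have xL: "x i \<in> L2 M" for i unfolding x_def by (rule L2_lincomb[OF PL])
    have xy: "l2_norm M (\<lambda>z. x i z - \<alpha> i * y z) \<le> e i" for i
    proof -
      have "(\<lambda>z. x i z - \<alpha> i * y z) = (\<lambda>z. \<Sum>s\<in>{1..S}. (\<gamma> i s - \<alpha> i * \<beta> s) * P i s z + (\<alpha> i * \<beta> s) * (P i s z - \<eta> s z))"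
        by (simp add: x_def y_def sum_distrib_left sum_subtractf[symmetric] algebra_simps)
      then have "l2_norm M (\<lambda>z. x i z - \<alpha> i * y z) \<le>
          (\<Sum>s\<in>{1..S}. l2_norm M (\<lambda>z. (\<gamma> i s - \<alpha> i * \<beta> s) * P i s z + (\<alpha> i * \<beta> s) * (P i s z - \<eta> s z)))"
        by (simp only:) (rule l2_triangle_sum, auto intro!: L2_add L2_scale L2_diff PL \<eta>)
      also have "\<dots> \<le> e i" unfolding e_def
      proof (rule sum_mono)
        fix s assume s: "s \<in> {1..S}"
        have "l2_norm M (\<lambda>z. (\<gamma> i s - \<alpha> i * \<beta> s) * P i s z + (\<alpha> i * \<beta> s) * (P i s z - \<eta> s z)) \<le>
            \<bar>\<gamma> i s - \<alpha> i * \<beta> s\<bar> * l2_norm M (P i s) + \<bar>\<alpha> i * \<beta> s\<bar> * l2_norm M (\<lambda>z. P i s z - \<eta> s z)"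
          using l2_triangle[OF L2_scale[OF PL[OF s]] L2_scale[OF L2_diff[OF PL[OF s] \<eta>[OF s]]]] unfolding l2_norm_scale .
        also have "\<dots> \<le> \<bar>\<gamma> i s - \<alpha> i * \<beta> s\<bar> * (l2_norm M (\<lambda>x. P i s x - \<eta> s x) + l2_norm M (\<eta> s)) +
            ((\<alpha> i)\<^sup>2 + 1) * \<bar>\<beta> s\<bar> * l2_norm M (\<lambda>x. P i s x - \<eta> s x)"
        proof (intro add_mono mult_left_mono mult_right_mono)
          show "l2_norm M (P i s) \<le> l2_norm M (\<lambda>x. P i s x - \<eta> s x) + l2_norm M (\<eta> s)"
            using l2_triangle[OF L2_diff[OF PL[OF s] \<eta>[OF s]] \<eta>[OF s], of i] by simp
          show "\<bar>\<alpha> i * \<beta> s\<bar> \<le> ((\<alpha> i)\<^sup>2 + 1) * \<bar>\<beta> s\<bar>" unfolding abs_mult by (intro mult_right_mono \<alpha>b) simp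
        qed auto
        finally show "l2_norm M (\<lambda>z. (\<gamma> i s - \<alpha> i * \<beta> s) * P i s z + (\<alpha> i * \<beta> s) * (P i s z - \<eta> s z)) \<le>
          \<bar>\<gamma> i s - \<alpha> i * \<beta> s\<bar> * (l2_norm M (\<lambda>x. P i s x - \<eta> s x) + l2_norm M (\<eta> s)) +
            ((\<alpha> i)\<^sup>2 + 1) * \<bar>\<beta> s\<bar> * l2_norm M (\<lambda>x. P i s x - \<eta> s x)" .
      qed
      finally show ?thesis .
    qed
    have y\<xi>: "l2_norm M (\<lambda>z. y z - \<xi> z) = 0" using exp unfolding y_def \<beta>_def by (subst l2_norm_minus_commute) simp
    have x\<xi>: "l2_norm M (\<lambda>z. x i z - \<alpha> i * \<xi> z) \<le> e i" for i
    proof -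
      have "l2_norm M (\<lambda>z. x i z - \<alpha> i * \<xi> z) \<le> l2_norm M (\<lambda>z. x i z - \<alpha> i * y z) + l2_norm M (\<lambda>z. \<alpha> i * y z - \<alpha> i * \<xi> z)"
        by (rule l2_triangle_diff) (auto intro: xL L2_scale yL \<xi>)
      also have "(\<lambda>z. \<alpha> i * y z - \<alpha> i * \<xi> z) = (\<lambda>z. \<alpha> i * (y z - \<xi> z))" by (simp add: right_diff_distrib)
      finally show ?thesis using xy[of i] by (simp add: l2_norm_scale y\<xi>)
    qed
    have ne: "\<forall>\<^sub>F i in sequentially. l i j \<noteq> 0" using ll lam(1)[OF j] by (intro tendsto_imp_eventually_ne) auto
    \<comment> \<open>the sign convention excludes \<open>\<alpha> \<approx> -1\<close>\<close>
    have \<alpha>low: "\<forall>\<^sub>F i in sequentially. - e i \<le> \<alpha> i"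
      using ne
    proof eventually_elim
      case (elim i)
      have xx: "xhat i = x i" using xe[OF elim] by (simp add: x_def \<gamma>_def)
      have n1: "l2_norm M \<xi> = 1" using \<xi>1 by (simp add: l2_norm_def)
      have "l2_inner M (\<lambda>z. x i z - \<alpha> i * \<xi> z) \<xi> = l2_inner M (x i) \<xi> - \<alpha> i"
        using xL \<xi> \<xi>1 by (simp add: l2_inner_diff_left L2_scale l2_inner_scale_left)
      moreover have "\<bar>l2_inner M (\<lambda>z. x i z - \<alpha> i * \<xi> z) \<xi>\<bar> \<le> e i"
        using l2_cauchy_schwarz[OF L2_diff[OF xL L2_scale[OF \<xi>]] \<xi>, of i "\<alpha> i"] x\<xi>[of i] n1 by simp
      ultimately show ?case using sg[of i] xx by simp
    qed
    have \<alpha>1: "\<alpha> \<longlonglongrightarrow> 1"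
    proof (rule LIM_zero_cancel, rule Lim_null_comparison)
      have "(\<lambda>i. e i) \<longlonglongrightarrow> 0" by (rule el)
      then have "\<forall>\<^sub>F i in sequentially. e i < 1 / 2" by (rule order_tendstoD) simp
      then show "\<forall>\<^sub>F i in sequentially. norm (\<alpha> i - 1) \<le> 2 * \<bar>(\<alpha> i)\<^sup>2 - 1\<bar>" using \<alpha>low
      proof eventually_elim
        case (elim i)
        then have "\<alpha> i + 1 \<ge> 1 / 2" by linarith
        then have "\<bar>\<alpha> i - 1\<bar> * (1 / 2) \<le> \<bar>\<alpha> i - 1\<bar> * \<bar>\<alpha> i + 1\<bar>" by (intro mult_left_mono) auto
        also have "\<dots> = \<bar>(\<alpha> i)\<^sup>2 - 1\<bar>" by (simp add: abs_mult[symmetric] power2_eq_square algebra_simps)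
        finally show ?case by simp
      qed
      have "(\<lambda>i. 2 * \<bar>(\<alpha> i)\<^sup>2 - 1\<bar>) \<longlonglongrightarrow> 2 * \<bar>1 - 1\<bar>" by (intro tendsto_intros \<alpha>)
      then show "(\<lambda>i. 2 * \<bar>(\<alpha> i)\<^sup>2 - 1\<bar>) \<longlonglongrightarrow> 0" by simp
    qed
    have "(\<lambda>i. e i + \<bar>\<alpha> i - 1\<bar>) \<longlonglongrightarrow> 0 + \<bar>1 - 1\<bar>" by (intro tendsto_intros el \<alpha>1)
    then have "\<forall>\<^sub>F i in sequentially. e i + \<bar>\<alpha> i - 1\<bar> < \<epsilon>" using \<epsilon> by (intro order_tendstoD(2)) auto
    then have "\<forall>\<^sub>F i in sequentially. False" using ne
    proof eventually_elim
      case (elim i)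
      have xx: "xhat i = x i" using xe[OF elim(2)] by (simp add: x_def \<gamma>_def)
      have n1: "l2_norm M \<xi> = 1" using \<xi>1 by (simp add: l2_norm_def)
      have "l2_norm M (\<lambda>z. x i z - \<xi> z) \<le> l2_norm M (\<lambda>z. x i z - \<alpha> i * \<xi> z) + l2_norm M (\<lambda>z. \<alpha> i * \<xi> z - \<xi> z)"
        by (rule l2_triangle_diff) (auto intro: xL L2_scale \<xi>)
      also have "(\<lambda>z. \<alpha> i * \<xi> z - \<xi> z) = (\<lambda>z. (\<alpha> i - 1) * \<xi> z)" by (simp add: left_diff_distrib)
      also have "l2_norm M (\<lambda>z. (\<alpha> i - 1) * \<xi> z) = \<bar>\<alpha> i - 1\<bar>" by (simp add: l2_norm_scale n1)
      finally show False using bad[of i] x\<xi>[of i] elim(1) xx by simp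
    qed
    then show False by simp
  qed
  then obtain \<zeta> where \<zeta>: "\<zeta> > 0" "\<And>d w ph Mh l u v P xhat. good \<zeta> d w ph Mh l u v P xhat \<Longrightarrow> l2_norm M (\<lambda>x. xhat x - \<xi> x) \<le> \<epsilon>"
    by blast
  show thesis
  proof (rule that[OF \<zeta>(1)], rule \<zeta>(2))
  qed (auto simp: good_def)
qed

section \<open>The estimator as a combination of estimated slice representers\<close>

lemma mv_comb_mv_comb:
  assumes "orthon n u"
  shows "mv n (comb n c u) (mv n (comb n d u) x) a = mv n (comb n (\<lambda>j. c j * d j) u) x a"
  unfolding mv_comb[of n c] mv_comb[of n "\<lambda>j. c j * d j"]
  by (intro sum.cong refl) (simp add: dot_u_mv_comb[OF assms] mult_ac)

lemma dot_mv_comb_both: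
  assumes "orthon n u"
  shows "dot n (mv n (comb n c u) x) (mv n (comb n d u) y) = dot n x (mv n (comb n (\<lambda>j. c j * d j) u) y)"
proof -
  have "dot n (mv n (comb n c u) x) (mv n (comb n d u) y) = dot n x (mv n (comb n c u) (mv n (comb n d u) y))"
    by (rule dot_mv_sym[symmetric]) (rule comb_sym)
  also have "\<dots> = dot n x (mv n (comb n (\<lambda>j. c j * d j) u) y)"
    by (rule dot_cong) (simp_all add: mv_comb_mv_comb[OF assms])
  finally show ?thesis .
qed

lemma mult_entry:
  assumes "A \<in> carrier_mat n n" "B \<in> carrier_mat n n" "a < n" "b < n"
  shows "(A * B) $$ (a, b) = (\<Sum>d<n. A $$ (a, d) * B $$ (d, b))"
  using assms by (auto simp: scalar_prod_def atLeast0LessThan intro!: sum.cong)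

lemma top_projs_spec:
  assumes C: "C \<in> carrier_mat n n" and P: "P \<in> top_projs C k"
  obtains v where "spec n (ent C) (eigval C) v" "P = proj_mat n v k"
proof -
  obtain u where P_eq: "P = Matrix.mat (dim_row C) (dim_row C) (\<lambda>(a, b). \<Sum>j\<in>{1..k}. u j $ a * u j $ b)" and u: "eigenbasis C u"
    using P unfolding top_projs_def by blast
  show thesis
  proof (rule that)
    show "spec n (ent C) (eigval C) (\<lambda>i a. u i $ a)" using u eigenbasis_iff[OF C] by simp
    show "P = proj_mat n (\<lambda>i a. u i $ a) k" using C by (simp add: P_eq proj_mat_def)
  qed
qed

definition isqrt_coef :: "nat \<Rightarrow> (nat \<Rightarrow> real) \<Rightarrow> nat \<Rightarrow> real" where
  "isqrt_coef k l = (\<lambda>j. if j \<le> k \<and> l j > 0 then l j powr (- (1 / 2)) else 0)"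

lemma isqrt_coef_sq: "isqrt_coef k l j * isqrt_coef k l j = tinv k l j"
  by (simp add: isqrt_coef_def tinv_def powr_add[symmetric] powr_minus_divide)

text \<open>For an eigenvector \<open>x\<close> of \<open>Q Sl Q\<close> with eigenvalue \<open>\<mu>\<close>, the vector \<open>Q x\<close>
  is the combination of the \<open>Q\<^sup>2 Hv s\<close> with coefficients
  \<open>ph s * (w s \<bullet> x) / \<mu>\<close>, where \<open>w s = Q Hv s\<close> is the whitened slice
  mean; and \<open>Q\<^sup>2\<close> is the truncated inverse of \<open>C\<close>. So the inverse square root disappears
  from the estimator.\<close>

lemma estimator_representation:
  fixes X :: "'t \<Rightarrow> 'w \<Rightarrow> real" and ph :: "nat \<Rightarrow> real" and Hv :: "nat \<Rightarrow> real vec"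
  assumes C: "C \<in> carrier_mat n n" and psd: "\<And>x. dot n x (mv n (ent C) x) \<ge> 0"
    and P: "P \<in> top_projs C k" and k: "k \<le> n"
    and Sl: "Sl = Matrix.mat n n (\<lambda>(a, b). \<Sum>s\<in>{1..S}. ph s * Hv s $ a * Hv s $ b)"
    and Q: "Q = mat_power (P * C * P) (- (1 / 2))" and Mm: "Mm = Q * Sl * Q"
  obtains l v w u where "spec n (ent C) l v"
    "\<And>a b. a < n \<Longrightarrow> b < n \<Longrightarrow> ent Mm a b = (\<Sum>s\<in>{1..S}. ph s * w s a * w s b)"
    "\<And>s r. dot n (w s) (w r) = dot n (\<lambda>a. Hv s $ a) (mv n (comb n (tinv k l) v) (\<lambda>a. Hv r $ a))"
    "spec n (ent Mm) (eigval Mm) u"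
    "Mm \<in> carrier_mat n n"
    "\<And>x \<mu>. x \<in> carrier_vec n \<Longrightarrow> Mm *\<^sub>v x = \<mu> \<cdot>\<^sub>v x \<Longrightarrow> \<mu> \<noteq> 0 \<Longrightarrow>
      lin_comb X \<tau> (Q *\<^sub>v x) = (\<lambda>z. \<Sum>s\<in>{1..S}. (ph s * dot n (w s) (\<lambda>a. x $ a) / \<mu>) *
        proc X \<tau> n (mv n (comb n (tinv k l) v) (\<lambda>a. Hv s $ a)) z)"
proof -
  obtain v where v: "spec n (ent C) (eigval C) v" and P_eq: "P = proj_mat n v k" using top_projs_spec[OF C P] .
  define l where "l = eigval C"
  note vl = v[folded l_def]
  note o = specD(1)[OF vl]
  have l0: "l j \<ge> 0" if "j \<in> {1..n}" for j by (rule eigvals_nonneg[OF vl psd that])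
  have Pc: "P \<in> carrier_mat n n" by (simp add: P_eq proj_mat_def)
  have PCP: "P * C * P \<in> carrier_mat n n" using Pc C by simp
  have s': "spec n (ent (P * C * P)) (\<lambda>j. if j \<le> k then l j else 0) v"
    by (rule truncated_spec[OF C vl l0 _ k]) (auto simp: P_eq proj_mat_def)
  let ?i = "isqrt_coef k l"
  have Qc: "Q \<in> carrier_mat n n" unfolding Q by (rule mat_power_carrier[OF PCP])
  have Qe: "ent Q a b = comb n ?i v a b" if "a < n" "b < n" for a b
    unfolding Q mat_power_spec[OF PCP s' that] by (intro arg_cong[where f = "\<lambda>c. comb n c v a b"] ext) (auto simp: isqrt_coef_def)
  have Slc: "Sl \<in> carrier_mat n n" by (simp add: Sl)
  have Mc: "Mm \<in> carrier_mat n n" using Qc Slc by (simp add: Mm)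
  define w where "w s = mv n (comb n ?i v) (\<lambda>a. Hv s $ a)" for s
  have Me: "ent Mm a b = (\<Sum>s\<in>{1..S}. ph s * w s a * w s b)" if ab: "a < n" "b < n" for a b
  proof -
    have "ent Mm a b = (\<Sum>d<n. (\<Sum>c<n. ent Q a c * ent Sl c d) * ent Q d b)"
    proof -
      have QS: "Q * Sl \<in> carrier_mat n n" using Qc Slc by simp
      have "(Q * Sl * Q) $$ (a, b) = (\<Sum>d<n. (Q * Sl) $$ (a, d) * Q $$ (d, b))"
        by (rule mult_entry[OF QS Qc ab])
      also have "\<dots> = (\<Sum>d<n. (\<Sum>c<n. Q $$ (a, c) * Sl $$ (c, d)) * Q $$ (d, b))"
        using ab Qc Slc by (intro sum.cong refl) (simp add: scalar_prod_def atLeast0LessThan)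
      finally show ?thesis by (simp add: Mm ent_def)
    qed
    also have "\<dots> = (\<Sum>d<n. \<Sum>c<n. \<Sum>s\<in>{1..S}. ph s * (comb n ?i v a c * Hv s $ c) * (comb n ?i v b d * Hv s $ d))"
      unfolding sum_distrib_right
    proof (intro sum.cong refl)
      fix d c assume "d \<in> {..<n}" "c \<in> {..<n}"
      then show "ent Q a c * ent Sl c d * ent Q d b = (\<Sum>s\<in>{1..S}. ph s * (comb n ?i v a c * Hv s $ c) * (comb n ?i v b d * Hv s $ d))"
        using ab by (simp add: Qe comb_sym[of n ?i v d b] Sl ent_def[of "Matrix.mat _ _ _"] sum_distrib_left sum_distrib_right mult_ac)
    qed
    also have "\<dots> = (\<Sum>d<n. \<Sum>s\<in>{1..S}. \<Sum>c<n. ph s * (comb n ?i v a c * Hv s $ c) * (comb n ?i v b d * Hv s $ d))"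
      by (intro sum.cong refl sum.swap)
    also have "\<dots> = (\<Sum>s\<in>{1..S}. \<Sum>d<n. \<Sum>c<n. ph s * (comb n ?i v a c * Hv s $ c) * (comb n ?i v b d * Hv s $ d))"
      by (rule sum.swap)
    also have "\<dots> = (\<Sum>s\<in>{1..S}. ph s * w s a * w s b)"
    proof (intro sum.cong refl)
      fix s
      have "(\<Sum>d<n. \<Sum>c<n. ph s * (comb n ?i v a c * Hv s $ c) * (comb n ?i v b d * Hv s $ d)) =
          (\<Sum>d<n. (ph s * w s a) * (comb n ?i v b d * Hv s $ d))"
        unfolding w_def mv_def by (simp add: sum_distrib_left sum_distrib_right mult.assoc)
      also have "\<dots> = ph s * w s a * w s b"
        unfolding sum_distrib_left[symmetric] by (simp add: w_def mv_def)
      finally show "(\<Sum>d<n. \<Sum>c<n. ph s * (comb n ?i v a c * Hv s $ c) * (comb n ?i v b d * Hv s $ d)) = ph s * w s a * w s b" .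
    qed
    finally show ?thesis .
  qed
  have ww: "dot n (w s) (w r) = dot n (\<lambda>a. Hv s $ a) (mv n (comb n (tinv k l) v) (\<lambda>a. Hv r $ a))" for s r
    unfolding w_def dot_mv_comb_both[OF o] isqrt_coef_sq ..
  have "ent Mm a b = ent Mm b a" if "a < n" "b < n" for a b
    unfolding Me[OF that] Me[OF that(2,1)] by (simp add: mult_ac)
  then obtain l1 u where "spec n (ent Mm) l1 u" using spectral_theorem[of n "ent Mm"] by metis
  then have u: "spec n (ent Mm) (eigval Mm) u" by (rule spec_eigval[OF Mc])
  show thesis
  proof (rule that[of l v w u, OF vl Me ww u Mc])
    fix x :: "real vec" and \<mu> assume x: "x \<in> carrier_vec n" and e: "Mm *\<^sub>v x = \<mu> \<cdot>\<^sub>v x" and \<mu>: "\<mu> \<noteq> 0"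
    define y where "y a = x $ a" for a
    define \<gamma> where "\<gamma> s = ph s * dot n (w s) y / \<mu>" for s
    have ya: "y a = (\<Sum>s\<in>{1..S}. \<gamma> s * w s a)" if a: "a < n" for a
    proof -
      have "\<mu> * y a = (Mm *\<^sub>v x) $ a" using e x a by (simp add: y_def)
      also have "\<dots> = mv n (ent Mm) y a" unfolding y_def by (rule mv_ent[OF Mc x a])
      also have "\<dots> = (\<Sum>b<n. \<Sum>s\<in>{1..S}. ph s * w s a * w s b * y b)"
        unfolding mv_def using a by (intro sum.cong refl) (simp add: Me sum_distrib_right)
      also have "\<dots> = (\<Sum>s\<in>{1..S}. \<Sum>b<n. ph s * w s a * w s b * y b)" by (rule sum.swap)
      also have "\<dots> = (\<Sum>s\<in>{1..S}. \<mu> * (\<gamma> s * w s a))"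
      proof (intro sum.cong refl)
        fix s
        have "(\<Sum>b<n. ph s * w s a * w s b * y b) = ph s * w s a * dot n (w s) y"
          by (simp add: dot_def sum_distrib_left mult.assoc)
        then show "(\<Sum>b<n. ph s * w s a * w s b * y b) = \<mu> * (\<gamma> s * w s a)" using \<mu> by (simp add: \<gamma>_def)
      qed
      finally have "\<mu> * y a = \<mu> * (\<Sum>s\<in>{1..S}. \<gamma> s * w s a)" by (simp add: sum_distrib_left)
      then show ?thesis using \<mu> by simp
    qed
    have coef: "(Q *\<^sub>v x) $ a = (\<Sum>s\<in>{1..S}. \<gamma> s * mv n (comb n (tinv k l) v) (\<lambda>a. Hv s $ a) a)" if a: "a < n" for a
    proof -
      have "(Q *\<^sub>v x) $ a = mv n (ent Q) y a" unfolding y_def by (rule mv_ent[OF Qc x a])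
      also have "\<dots> = mv n (comb n ?i v) (\<lambda>b. \<Sum>s\<in>{1..S}. \<gamma> s * w s b) a"
        by (rule mv_cong) (simp_all add: Qe a ya)
      also have "\<dots> = (\<Sum>s\<in>{1..S}. \<gamma> s * mv n (comb n ?i v) (w s) a)" by (rule mv_sum)
      finally show ?thesis unfolding w_def mv_comb_mv_comb[OF o] isqrt_coef_sq .
    qed
    show "lin_comb X \<tau> (Q *\<^sub>v x) = (\<lambda>z. \<Sum>s\<in>{1..S}. (ph s * dot n (w s) (\<lambda>a. x $ a) / \<mu>) *
        proc X \<tau> n (mv n (comb n (tinv k l) v) (\<lambda>a. Hv s $ a)) z)"
    proof
      fix z
      have "lin_comb X \<tau> (Q *\<^sub>v x) z = proc X \<tau> n (\<lambda>a. \<Sum>s\<in>{1..S}. \<gamma> s * mv n (comb n (tinv k l) v) (\<lambda>a. Hv s $ a) a) z"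
        unfolding lin_comb_def proc_def using Qc by (intro sum.cong) (auto simp: coef simp del: index_mult_mat_vec)
      also have "\<dots> = (\<Sum>s\<in>{1..S}. \<gamma> s * proc X \<tau> n (mv n (comb n (tinv k l) v) (\<lambda>a. Hv s $ a)) z)" by (rule proc_sum)
      finally show "lin_comb X \<tau> (Q *\<^sub>v x) z = (\<Sum>s\<in>{1..S}. (ph s * dot n (w s) (\<lambda>a. x $ a) / \<mu>) *
        proc X \<tau> n (mv n (comb n (tinv k l) v) (\<lambda>a. Hv s $ a)) z)" by (simp add: \<gamma>_def y_def[abs_def])
    qed
  qed
qed

section \<open>Slice means and density of the sampled span\<close>

text \<open>The slice mean is the ratio of \<open>m\<close>, an average over the whole sample, and the
  frequency \<open>p\<close>. As \<open>h\<close> has norm of order \<open>sqrt n\<close>, the frequency must be accurate to order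
  \<open>1 / sqrt n\<close>.\<close>

lemma slice_mean_error:
  assumes q: "q0 > 0" "q \<ge> q0" and p: "\<bar>p - q\<bar> * sqrt n \<le> e" and n: "n \<ge> 1" and e: "e \<le> q0 / 2"
    and m: "nrm n (\<lambda>a. m a - q * h a) \<le> e" and h: "nrm n h \<le> C1 * sqrt n" and C1: "C1 \<ge> 0"
  shows "nrm n (\<lambda>a. m a / p - h a) \<le> 2 / q0 * (1 + C1) * e" "\<bar>p - q\<bar> \<le> e"
proof -
  have sn: "sqrt n \<ge> 1" using n by simp
  have "\<bar>p - q\<bar> * 1 \<le> \<bar>p - q\<bar> * sqrt n" by (rule mult_left_mono[OF sn]) simp
  then show pq: "\<bar>p - q\<bar> \<le> e" using p by simp
  then have pp: "p \<ge> q0 / 2" using q e by linarith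
  then have p0: "p > 0" using q by linarith
  have "nrm n (\<lambda>a. m a / p - h a) = nrm n (\<lambda>a. inverse p * ((m a - q * h a) + (q - p) * h a))"
    by (rule nrm_cong) (use p0 in \<open>simp add: field_simps\<close>)
  also have "\<dots> = inverse p * nrm n (\<lambda>a. (m a - q * h a) + (q - p) * h a)" unfolding nrm_scale using p0 by simp
  also have "\<dots> \<le> inverse p * (e + C1 * e)"
  proof (rule mult_left_mono)
    have "nrm n (\<lambda>a. (m a - q * h a) + (q - p) * h a) \<le> nrm n (\<lambda>a. m a - q * h a) + \<bar>q - p\<bar> * nrm n h"
      using nrm_triangle[of n "\<lambda>a. m a - q * h a" "\<lambda>a. (q - p) * h a"] unfolding nrm_scale .
    also have "\<bar>q - p\<bar> * nrm n h \<le> \<bar>q - p\<bar> * (C1 * sqrt n)" by (rule mult_left_mono[OF h]) simp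
    also have "\<dots> = C1 * (\<bar>p - q\<bar> * sqrt n)" by (simp add: abs_minus_commute)
    also have "\<dots> \<le> C1 * e" by (rule mult_left_mono[OF p C1])
    finally show "nrm n (\<lambda>a. (m a - q * h a) + (q - p) * h a) \<le> e + C1 * e" using m by linarith
  qed (use p0 in simp)
  also have "\<dots> \<le> (2 / q0) * (e + C1 * e)"
  proof (rule mult_right_mono)
    show "inverse p \<le> 2 / q0" using pp p0 q by (simp add: field_simps)
    have "e \<ge> 0" using pq by linarith
    then show "0 \<le> e + C1 * e" using C1 by simp
  qed
  finally show "nrm n (\<lambda>a. m a / p - h a) \<le> 2 / q0 * (1 + C1) * e" by (simp add: algebra_simps)
qed

lemma eventually_towards_le:
  assumes "filterlim J (towards Jinf) sequentially" "enat k \<le> Jinf"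
  shows "(\<forall>\<^sub>F n in sequentially. k < J n) \<or> (\<forall>\<^sub>F n in sequentially. J n = k)"
proof (cases Jinf)
  case infinity
  then have "filterlim J sequentially sequentially" using assms(1) by (simp add: towards_def)
  then have "\<forall>\<^sub>F n in sequentially. Suc k \<le> J n" by (simp add: filterlim_at_top)
  then show ?thesis by (simp add: Suc_le_eq)
next
  case (enat m)
  then have e: "\<forall>\<^sub>F n in sequentially. J n = m" using assms(1) by (simp add: towards_def filterlim_principal)
  show ?thesis
  proof (cases "k = m")
    case False
    then have "k < m" using assms(2) enat by simp
    then have "\<forall>\<^sub>F n in sequentially. k < J n" using e by (auto elim: eventually_mono)
    then show ?thesis ..
  qed (use e in simp)
qed

lemma proc_lincomb: "proc X \<tau> n (\<lambda>a. c * b a + d * e a) = (\<lambda>w. c * proc X \<tau> n b w + d * proc X \<tau> n e w)"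
  by (intro ext) (simp add: proc_def sum.distrib sum_distrib_left distrib_right mult.assoc)

lemma fun_span_proc:
  assumes "g \<in> fun_span (X ` \<tau> ` {1..m})"
  obtains b where "g = proc X \<tau> m b"
proof -
  obtain F c where F: "finite F" "F \<subseteq> X ` \<tau> ` {1..m}" "g = (\<lambda>x. \<Sum>f\<in>F. c f * f x)"
    using assms by (auto simp: fun_span_def)
  have "\<exists>b. (\<lambda>x. \<Sum>f\<in>F. c f * f x) = proc X \<tau> m b" using F(1,2)
  proof (induction F rule: finite_induct)
    case empty
    have "(\<lambda>x. \<Sum>f\<in>{}. c f * f x) = proc X \<tau> m (\<lambda>_. 0)" by (auto simp: proc_def)
    then show ?case by blast
  next
    case (insert f F)
    then obtain b where b: "(\<lambda>x. \<Sum>f\<in>F. c f * f x) = proc X \<tau> m b" by auto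
    obtain i where i: "i \<in> {1..m}" "f = X (\<tau> i)" using insert by auto
    have f: "f = proc X \<tau> m (\<lambda>a. if a = i - 1 then 1 else 0)"
    proof
      fix x
      have "proc X \<tau> m (\<lambda>a. if a = i - 1 then 1 else 0) x = (\<Sum>a<m. if a = i - 1 then X (\<tau> (Suc a)) x else 0)"
        unfolding proc_def by (intro sum.cong refl) auto
      then show "f x = proc X \<tau> m (\<lambda>a. if a = i - 1 then 1 else 0) x" using i by auto
    qed
    have "(\<lambda>x. \<Sum>f\<in>insert f F. c f * f x) = (\<lambda>x. c f * f x + 1 * (\<Sum>f\<in>F. c f * f x))"
      using insert by (intro ext) simp
    also have "\<dots> = (\<lambda>x. c f * proc X \<tau> m (\<lambda>a. if a = i - 1 then 1 else 0) x + 1 * proc X \<tau> m b x)"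
      using f fun_cong[OF b] by (intro ext) metis
    finally show ?case unfolding proc_lincomb[symmetric] by blast
  qed
  then show thesis using that F(3) by blast
qed

text \<open>Elements of the span involve finitely many times. Each is a sampling time or a
  limit of sampling times, and continuity of the covariance function is continuity of the
  process in mean square. If the dimension stays bounded, the process lies in the sampled span
  by assumption.\<close>

lemma sampled_span_dense:
  fixes X :: "'t :: {metric_space, second_countable_topology} \<Rightarrow> 'w \<Rightarrow> real"
  assumes X: "\<And>t. X t \<in> L2 M"
    and J_lim: "filterlim J (towards Jinf) sequentially"
    and J_finite: "\<And>m t. Jinf = enat m \<Longrightarrow> \<exists>g\<in>fun_span (X ` \<tau> ` {1..m}). AE w in M. X t w = g w"
    and T_cover: "(\<Union>m\<in>{1..}. \<tau> ` {1..m}) = UNIV \<or>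
      (closure (\<Union>m\<in>{1..}. \<tau> ` {1..m}) = UNIV \<and> continuous_on UNIV (\<lambda>(s, t). cov_fun M X s t))"
    and \<eta>: "\<eta> \<in> closed_span M X" and e: "e > 0"
  shows "\<forall>\<^sub>F n in sequentially. \<exists>b. l2_norm M (\<lambda>w. proc X \<tau> (J n) b w - \<eta> w) < e"
proof -
  have one: "\<forall>\<^sub>F n in sequentially. \<exists>b. l2_norm M (\<lambda>w. proc X \<tau> (J n) b w - X t w) < e" if e: "e > 0" for e t
  proof (cases Jinf)
    case (enat m)
    then have Jm: "\<forall>\<^sub>F n in sequentially. J n = m" using J_lim by (simp add: towards_def filterlim_principal)
    obtain g where g: "g \<in> fun_span (X ` \<tau> ` {1..m})" "AE w in M. X t w = g w" using J_finite[OF enat] by blast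
    obtain b where b: "g = proc X \<tau> m b" by (rule fun_span_proc[OF g(1)])
    have "l2_norm M (\<lambda>w. proc X \<tau> m b w - X t w) = l2_norm M (\<lambda>_. 0)"
      by (rule l2_norm_cong_AE) (use g b X[of t] proc_L2[where X = X, OF X, of \<tau> m b] in \<open>auto simp: L2_def\<close>)
    then have "l2_norm M (\<lambda>w. proc X \<tau> m b w - X t w) < e" using e by (simp add: l2_norm_def l2_inner_def)
    then have ex: "\<exists>b. l2_norm M (\<lambda>w. proc X \<tau> m b w - X t w) < e" by blast
    from Jm show ?thesis by eventually_elim (use ex in simp)
  next
    case infinity
    then have Jl: "filterlim J at_top sequentially" using J_lim by (simp add: towards_def)
    have "\<exists>i\<ge>1. l2_norm M (\<lambda>w. X (\<tau> i) w - X t w) < e"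
      using T_cover
    proof
      assume "(\<Union>m\<in>{1..}. \<tau> ` {1..m}) = UNIV"
      then have "t \<in> (\<Union>m\<in>{1..}. \<tau> ` {1..m})" by (simp only: UNIV_I)
      then obtain i where "i \<ge> 1" "t = \<tau> i" by (auto simp del: UN_simps)
      then show ?thesis using e by (intro exI[of _ i]) (simp add: l2_norm_def l2_inner_def)
    next
      let ?R = "cov_fun M X"
      assume a: "closure (\<Union>m\<in>{1..}. \<tau> ` {1..m}) = UNIV \<and> continuous_on UNIV (\<lambda>(s, t). ?R s t)"
      then obtain x where x: "\<And>n. x n \<in> (\<Union>m\<in>{1..}. \<tau> ` {1..m})" "x \<longlonglongrightarrow> t"
        using closure_sequential[of t "\<Union>m\<in>{1..}. \<tau> ` {1..m}"] by auto
      have cont: "isCont (\<lambda>(s, t). ?R s t) (t, t)" using a by (simp add: continuous_on_eq_continuous_at)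
      have l: "(\<lambda>n. (\<lambda>(s, t). ?R s t) (y n, z n)) \<longlonglongrightarrow> (\<lambda>(s, t). ?R s t) (t, t)" if "y \<longlonglongrightarrow> t" "z \<longlonglongrightarrow> t" for y z
        by (rule isCont_tendsto_compose[OF cont]) (intro tendsto_Pair that)
      have d: "(l2_norm M (\<lambda>w. X (x n) w - X t w))\<^sup>2 = ?R (x n) (x n) - 2 * ?R (x n) t + ?R t t" for n
        using X[of "x n"] X[of t] l2_inner_commute[of M "X (x n)" "X t"]
        by (simp add: l2_norm_sq l2_inner_diff_left l2_inner_diff_right L2_diff) (simp add: l2_inner_def cov_fun_def)
      have "(\<lambda>n. ?R (x n) (x n) - 2 * ?R (x n) t + ?R t t) \<longlonglongrightarrow> ?R t t - 2 * ?R t t + ?R t t"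
        using l[OF x(2) x(2)] l[OF x(2) tendsto_const] by (intro tendsto_intros) auto
      then have "(\<lambda>n. (l2_norm M (\<lambda>w. X (x n) w - X t w))\<^sup>2) \<longlonglongrightarrow> 0" by (simp add: d)
      then have "\<forall>\<^sub>F n in sequentially. (l2_norm M (\<lambda>w. X (x n) w - X t w))\<^sup>2 < e\<^sup>2"
        by (rule order_tendstoD(2)) (use e in simp)
      then obtain n where "(l2_norm M (\<lambda>w. X (x n) w - X t w))\<^sup>2 < e\<^sup>2" using eventually_happens[OF _ ] by fastforce
      then have "l2_norm M (\<lambda>w. X (x n) w - X t w) < e" using e by (simp add: power2_less_imp_less)
      moreover obtain i where "i \<ge> 1" "x n = \<tau> i" using x(1)[of n] by auto
      ultimately show ?thesis by auto
    qed
    then obtain i where i: "i \<ge> 1" "l2_norm M (\<lambda>w. X (\<tau> i) w - X t w) < e" by blast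
    have "\<forall>\<^sub>F n in sequentially. i \<le> J n" using Jl by (simp add: filterlim_at_top)
    then show ?thesis
    proof eventually_elim
      case (elim n)
      have "X (\<tau> i) \<in> fun_span (X ` \<tau> ` {1..J n})" by (rule fun_span_base) (use elim i in auto)
      then obtain b where "X (\<tau> i) = proc X \<tau> (J n) b" by (rule fun_span_proc)
      then show ?case using i(2) by metis
    qed
  qed
  have fin: "\<forall>\<^sub>F n in sequentially. \<exists>b. l2_norm M (\<lambda>w. proc X \<tau> (J n) b w - (\<Sum>f\<in>F. c f * f w)) < e"
    if "finite F" "F \<subseteq> range X" "e > 0" for F c e
    using that
  proof (induction F arbitrary: e rule: finite_induct)
    case empty
    have "l2_norm M (\<lambda>w. proc X \<tau> (J n) (\<lambda>_. 0) w - (\<Sum>f\<in>{}. c f * f w)) < e" for n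
      using empty by (simp add: proc_def l2_norm_def l2_inner_def)
    then show ?case by (intro always_eventually) blast
  next
    case (insert f F)
    obtain t where t: "f = X t" using insert by auto
    define e1 where "e1 = e / (2 * (\<bar>c f\<bar> + 1))"
    have e1: "e1 > 0" using insert by (simp add: e1_def)
    have ce: "\<bar>c f\<bar> * e1 \<le> e / 2"
    proof -
      have "\<bar>c f\<bar> * e1 \<le> (\<bar>c f\<bar> + 1) * e1" using e1 by (intro mult_right_mono) auto
      also have "\<dots> = e / 2" by (simp add: e1_def field_simps)
      finally show ?thesis .
    qed
    have FL: "(\<lambda>w. \<Sum>f\<in>F. c f * f w) \<in> L2 M" using X insert by (intro L2_lincomb) auto
    have "\<forall>\<^sub>F n in sequentially. \<exists>b. l2_norm M (\<lambda>w. proc X \<tau> (J n) b w - (\<Sum>f\<in>F. c f * f w)) < e / 2"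
      using insert by (intro insert.IH) auto
    moreover have "\<forall>\<^sub>F n in sequentially. \<exists>b. l2_norm M (\<lambda>w. proc X \<tau> (J n) b w - X t w) < e1" by (rule one[OF e1])
    ultimately show ?case
    proof eventually_elim
      case (elim n)
      then obtain b b' where b: "l2_norm M (\<lambda>w. proc X \<tau> (J n) b w - (\<Sum>f\<in>F. c f * f w)) < e / 2"
        and b': "l2_norm M (\<lambda>w. proc X \<tau> (J n) b' w - X t w) < e1" by blast
      have PL: "proc X \<tau> (J n) d \<in> L2 M" for d by (rule proc_L2[OF X])
      let ?d = "\<lambda>a. c f * b' a + 1 * b a"
      have "(\<lambda>w. proc X \<tau> (J n) ?d w - (\<Sum>f\<in>insert f F. c f * f w)) =
          (\<lambda>w. c f * (proc X \<tau> (J n) b' w - X t w) + (proc X \<tau> (J n) b w - (\<Sum>f\<in>F. c f * f w)))"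
        using insert unfolding proc_lincomb by (intro ext) (simp add: t algebra_simps)
      then have "l2_norm M (\<lambda>w. proc X \<tau> (J n) ?d w - (\<Sum>f\<in>insert f F. c f * f w)) \<le>
          \<bar>c f\<bar> * l2_norm M (\<lambda>w. proc X \<tau> (J n) b' w - X t w) + l2_norm M (\<lambda>w. proc X \<tau> (J n) b w - (\<Sum>f\<in>F. c f * f w))"
        using l2_triangle[OF L2_scale[OF L2_diff[OF PL X]] L2_diff[OF PL FL]] unfolding l2_norm_scale by simp
      also have "\<dots> < e / 2 + e / 2"
        using b mult_left_mono[OF less_imp_le[OF b'], of "\<bar>c f\<bar>"] ce by linarith
      finally show ?case by auto
    qed
  qed
  obtain g where g: "g \<in> fun_span (range X)" "l2_norm M (\<lambda>w. \<eta> w - g w) < e / 2"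
  proof -
    have "\<forall>e>0. \<exists>g\<in>fun_span (range X). l2_norm M (\<lambda>w. \<eta> w - g w) < e" using \<eta> unfolding closed_span_def by simp
    then show thesis using that half_gt_zero[OF e] by blast
  qed
  obtain F c where F: "finite F" "F \<subseteq> range X" "g = (\<lambda>x. \<Sum>f\<in>F. c f * f x)" using g(1) by (auto simp: fun_span_def)
  have "\<forall>\<^sub>F n in sequentially. \<exists>b. l2_norm M (\<lambda>w. proc X \<tau> (J n) b w - g w) < e / 2"
    unfolding F(3) using F e by (intro fin) auto
  then show ?thesis
  proof eventually_elim
    case (elim n)
    then obtain b where b: "l2_norm M (\<lambda>w. proc X \<tau> (J n) b w - g w) < e / 2" by blast
    have "l2_norm M (\<lambda>w. proc X \<tau> (J n) b w - \<eta> w) \<le> l2_norm M (\<lambda>w. proc X \<tau> (J n) b w - g w) + l2_norm M (\<lambda>w. g w - \<eta> w)"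
      by (rule l2_triangle_diff[OF proc_L2[OF X] process_span_L2[OF X g(1)] closed_span_L2[OF \<eta>]])
    also have "l2_norm M (\<lambda>w. g w - \<eta> w) < e / 2" using g(2) l2_norm_minus_commute[of M g \<eta>] by simp
    finally show ?case using b by (intro exI[of _ b]) linarith
  qed
qed

section \<open>Events of high probability\<close>

lemma sum_pairs: "(\<Sum>f\<in>{..<m}\<times>{..<m}. g f) = (\<Sum>a<m. \<Sum>b<m. g (a, b))" for g :: "nat \<times> nat \<Rightarrow> real"
  by (simp add: sum.cartesian_product case_prod_unfold)

text \<open>The expectations of the four sums are of order \<open>J\<^sup>2 / n\<close>, \<open>1 / n\<close>,
  \<open>J / n\<close> and, with the factor \<open>J\<close> of the last one, \<open>J / n\<close>. The statement on directions
  of zero variance holds almost surely. It is what makes rank-deficient covariance matrices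
  harmless, as perturbations of an eigenvalue 0 would be unbounded in the inverse.\<close>

lemma good_events:
  fixes M :: "'w measure" and X :: "'t \<Rightarrow> 'w \<Rightarrow> real" and N :: "'y measure" and Y :: "'w \<Rightarrow> 'y"
    and D :: "'v measure" and Yd :: "nat \<Rightarrow> 'v \<Rightarrow> 'y" and Xd :: "nat \<Rightarrow> 't \<Rightarrow> 'v \<Rightarrow> real"
    and \<tau> :: "nat \<Rightarrow> 't" and J :: "nat \<Rightarrow> nat" and I :: "nat \<Rightarrow> 'y set" and l :: "nat \<Rightarrow> nat \<Rightarrow> real"
    and u :: "nat \<Rightarrow> nat \<Rightarrow> nat \<Rightarrow> real" and t :: real
  assumes M: "prob_space M" and X: "\<And>t. X t \<in> L2 M" and Y: "Y \<in> measurable M N" and D: "prob_space D"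
    and indep: "prob_space.indep_vars D (\<lambda>_. N \<Otimes>\<^sub>M (\<Pi>\<^sub>M t\<in>UNIV. borel)) (\<lambda>i \<omega>. (Yd i \<omega>, \<lambda>t. Xd i t \<omega>)) {1..}"
    and distr: "\<And>i. i \<ge> 1 \<Longrightarrow>
      distr D (N \<Otimes>\<^sub>M (\<Pi>\<^sub>M t\<in>UNIV. borel)) (\<lambda>\<omega>. (Yd i \<omega>, \<lambda>t. Xd i t \<omega>)) =
      distr M (N \<Otimes>\<^sub>M (\<Pi>\<^sub>M t\<in>UNIV. borel)) (\<lambda>w. (Y w, \<lambda>t. X t w))"
    and X4: "\<And>t. integrable M (\<lambda>w. X t w ^ 4)" "\<And>t. (\<integral>w. X t w ^ 4 \<partial>M) \<le> C4"
    and I: "\<And>s. s \<in> {1..S} \<Longrightarrow> I s \<in> sets N"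
    and q: "\<And>s. s \<in> {1..S} \<Longrightarrow> q s = measure M (Y -` I s \<inter> space M)"
    and h: "\<And>s t. s \<in> {1..S} \<Longrightarrow> q s * h s t = (\<integral>w. X t w * indicator (I s) (Y w) \<partial>M)"
    and J_pos: "\<And>n. J n > 0" and J_small: "(\<lambda>n. real (J n)) \<in> o(\<lambda>n. real n)"
    and A: "\<And>m. spec m (gram (cov_fun M X) \<tau>) (l m) (u m)"
    and t: "t > 0"
  obtains bad where "\<And>n. n \<ge> 1 \<Longrightarrow> bad n \<in> sets D" "(\<lambda>n. measure D (bad n)) \<longlonglongrightarrow> 0"
    "\<And>n \<omega>. n \<ge> 1 \<Longrightarrow> \<omega> \<in> space D - bad n \<Longrightarrow>
      (\<Sum>a<J n. \<Sum>b<J n. ((\<Sum>i\<in>{1..n}. Xd i (\<tau> (Suc a)) \<omega> * Xd i (\<tau> (Suc b)) \<omega>) / real n - gram (cov_fun M X) \<tau> a b)\<^sup>2) \<le> t\<^sup>2 * J n \<and>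
      (\<Sum>a<m0. \<Sum>b<m0. ((\<Sum>i\<in>{1..n}. Xd i (\<tau> (Suc a)) \<omega> * Xd i (\<tau> (Suc b)) \<omega>) / real n - gram (cov_fun M X) \<tau> a b)\<^sup>2) \<le> t\<^sup>2 \<and>
      (\<forall>j\<in>{1..J n}. l (J n) j = 0 \<longrightarrow> (\<forall>i\<in>{1..n}. (\<Sum>a<J n. u (J n) j a * Xd i (\<tau> (Suc a)) \<omega>) = 0)) \<and>
      (\<forall>s\<in>{1..S}. (\<Sum>a<J n. ((\<Sum>i\<in>{1..n}. Xd i (\<tau> (Suc a)) \<omega> * indicator (I s) (Yd i \<omega>)) / real n - q s * h s (\<tau> (Suc a)))\<^sup>2) \<le> t\<^sup>2 \<and>
        ((\<Sum>i\<in>{1..n}. indicator (I s) (Yd i \<omega>)) / real n - q s)\<^sup>2 * J n \<le> t\<^sup>2)"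
proof -
  interpret M: prob_space M by (rule M)
  let ?N = "N \<Otimes>\<^sub>M (\<Pi>\<^sub>M t\<in>(UNIV :: 't set). borel :: real measure)"
  let ?obs = "\<lambda>i \<omega>. (Yd i \<omega>, \<lambda>t. Xd i t \<omega>)" and ?base = "\<lambda>w. (Y w, \<lambda>t. X t w)"
  have W0: "?base \<in> measurable M ?N"
    using Y X by (intro measurable_Pair measurable_PiM_single') (auto simp: L2_def)
  interpret iid_sample D M ?N ?obs ?base
    by (intro iid_sample.intro D iid_sample_axioms.intro indep distr W0)
  have sq_mult: "(a * b)\<^sup>2 \<le> a ^ 4 + b ^ 4" for a b :: real
  proof -
    have "2 * (a\<^sup>2 * b\<^sup>2) \<le> (a\<^sup>2)\<^sup>2 + (b\<^sup>2)\<^sup>2" using zero_le_power2[of "a\<^sup>2 - b\<^sup>2"] by (simp add: power2_diff)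
    moreover have "0 \<le> a\<^sup>2 * b\<^sup>2" by simp
    moreover have "(a\<^sup>2)\<^sup>2 = a ^ 4" "(b\<^sup>2)\<^sup>2 = b ^ 4" by simp_all
    ultimately show ?thesis unfolding power_mult_distrib by linarith
  qed
  have Xm: "X t \<in> borel_measurable M" for t using X[of t] by (simp add: L2_def)
  define g where "g f z = snd z (\<tau> (Suc (fst f))) * snd z (\<tau> (Suc (snd f)))" for f :: "nat \<times> nat" and z :: "'y \<times> ('t \<Rightarrow> real)"
  define gm where "gm s a z = snd z (\<tau> (Suc a)) * indicator (I s) (fst z)" for s a and z :: "'y \<times> ('t \<Rightarrow> real)"
  define gp where "gp s z = (indicator (I s) (fst z) :: real)" for s and z :: "'y \<times> ('t \<Rightarrow> real)"
  have cm: "(\<lambda>z. snd z t) \<in> borel_measurable ?N" for t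
    by (rule measurable_compose[OF measurable_snd measurable_component_singleton]) simp
  have im: "(\<lambda>z. indicator (I s) (fst z) :: real) \<in> borel_measurable ?N" if "s \<in> {1..S}" for s
    by (rule measurable_compose[OF measurable_fst borel_measurable_indicator[OF I[OF that]]])
  have g_meas: "g f \<in> borel_measurable ?N" for f unfolding g_def by (intro borel_measurable_times cm)
  have gm_meas: "gm s a \<in> borel_measurable ?N" if "s \<in> {1..S}" for s a unfolding gm_def by (intro borel_measurable_times cm im that)
  have gp_meas: "gp s \<in> borel_measurable ?N" if "s \<in> {1..S}" for s unfolding gp_def by (intro im that)
  have Im: "(\<lambda>w. indicator (I s) (Y w) :: real) \<in> borel_measurable M" if "s \<in> {1..S}" for s
    by (rule measurable_compose[OF Y borel_measurable_indicator[OF I[OF that]]])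
  define V where "V = 2 * C4"
  have g2: "integrable M (\<lambda>w. (g f (?base w))\<^sup>2)" and gV: "(\<integral>w. (g f (?base w))\<^sup>2 \<partial>M) \<le> V" for f
  proof -
    let ?s = "\<tau> (Suc (fst f))" and ?t = "\<tau> (Suc (snd f))"
    have i4: "integrable M (\<lambda>w. X ?s w ^ 4 + X ?t w ^ 4)" by (intro Bochner_Integration.integrable_add X4)
    have e: "(g f (?base w))\<^sup>2 = (X ?s w * X ?t w)\<^sup>2" for w by (simp add: g_def)
    show i: "integrable M (\<lambda>w. (g f (?base w))\<^sup>2)" unfolding e
      by (rule Bochner_Integration.integrable_bound[OF i4]) (use sq_mult Xm in \<open>auto intro!: borel_measurable_power borel_measurable_times\<close>)
    have "(\<integral>w. (g f (?base w))\<^sup>2 \<partial>M) \<le> (\<integral>w. X ?s w ^ 4 + X ?t w ^ 4 \<partial>M)"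
      by (rule integral_mono[OF i i4]) (unfold e, rule sq_mult)
    also have "\<dots> = (\<integral>w. X ?s w ^ 4 \<partial>M) + (\<integral>w. X ?t w ^ 4 \<partial>M)" by (intro Bochner_Integration.integral_add X4)
    also have "\<dots> \<le> V" using X4(2)[of ?s] X4(2)[of ?t] unfolding V_def by linarith
    finally show "(\<integral>w. (g f (?base w))\<^sup>2 \<partial>M) \<le> V" .
  qed
  have x2: "x\<^sup>2 \<le> 1 + x ^ 4" for x :: real
  proof -
    have "2 * x\<^sup>2 \<le> x ^ 4 + 1" using zero_le_power2[of "x\<^sup>2 - 1"] by (simp add: power2_diff)
    then show ?thesis using zero_le_power2[of x] by linarith
  qed
  define V1 where "V1 = 1 + C4"
  have gm2: "integrable M (\<lambda>w. (gm s a (?base w))\<^sup>2)" and gmV: "(\<integral>w. (gm s a (?base w))\<^sup>2 \<partial>M) \<le> V1" if s: "s \<in> {1..S}" for s a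
  proof -
    let ?t = "\<tau> (Suc a)"
    have i4: "integrable M (\<lambda>w. 1 + X ?t w ^ 4)" by (intro Bochner_Integration.integrable_add X4) simp
    have b: "(gm s a (?base w))\<^sup>2 \<le> 1 + X ?t w ^ 4" for w
      using x2[of "X ?t w"] zero_le_even_power[of 4 "X ?t w"] by (auto simp: gm_def indicator_def)
    have m: "(\<lambda>w. (gm s a (?base w))\<^sup>2) \<in> borel_measurable M"
      unfolding gm_def using Xm[of ?t] Im[OF s] by simp
    show i: "integrable M (\<lambda>w. (gm s a (?base w))\<^sup>2)"
      by (rule Bochner_Integration.integrable_bound[OF i4 m]) (use b in auto)
    have "(\<integral>w. (gm s a (?base w))\<^sup>2 \<partial>M) \<le> (\<integral>w. 1 + X ?t w ^ 4 \<partial>M)" by (rule integral_mono[OF i i4 b])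
    also have "\<dots> = 1 + (\<integral>w. X ?t w ^ 4 \<partial>M)" using X4(1)[of ?t] by (simp add: M.prob_space)
    also have "\<dots> \<le> V1" using X4(2)[of ?t] by (simp add: V1_def)
    finally show "(\<integral>w. (gm s a (?base w))\<^sup>2 \<partial>M) \<le> V1" .
  qed
  have gp2: "integrable M (\<lambda>w. (gp s (?base w))\<^sup>2)" and gpV: "(\<integral>w. (gp s (?base w))\<^sup>2 \<partial>M) \<le> 1" if s: "s \<in> {1..S}" for s
  proof -
    have m: "(\<lambda>w. (gp s (?base w))\<^sup>2) \<in> borel_measurable M" unfolding gp_def using Im[OF s] by simp
    show i: "integrable M (\<lambda>w. (gp s (?base w))\<^sup>2)"
      by (rule M.integrable_const_bound[of _ 1, OF _ m]) (auto simp: gp_def indicator_def)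
    have "(\<integral>w. (gp s (?base w))\<^sup>2 \<partial>M) \<le> (\<integral>w. 1 \<partial>M)" by (rule integral_mono[OF i]) (auto simp: gp_def indicator_def)
    then show "(\<integral>w. (gp s (?base w))\<^sup>2 \<partial>M) \<le> 1" by (simp add: M.prob_space)
  qed
  have mean_g: "mean (g (a, b)) = gram (cov_fun M X) \<tau> a b" for a b by (simp add: mean_def g_def gram_def cov_fun_def)
  have mean_gm: "mean (gm s a) = q s * h s (\<tau> (Suc a))" if "s \<in> {1..S}" for s a by (simp add: mean_def gm_def h[OF that])
  have mean_gp: "mean (gp s) = q s" if s: "s \<in> {1..S}" for s
  proof -
    have "(\<integral>w. indicator (I s) (Y w) \<partial>M) = (\<integral>w. indicator (Y -` I s \<inter> space M) w \<partial>M :: real)"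
      by (rule Bochner_Integration.integral_cong) (auto simp: indicator_def)
    also have "\<dots> = q s" using measurable_sets[OF Y I[OF s]] by (simp add: q[OF s] M.emeasure_eq_measure)
    finally show ?thesis by (simp add: mean_def gp_def)
  qed
  define B1 where "B1 n = {\<omega>\<in>space D. t\<^sup>2 * J n \<le> (\<Sum>f\<in>{..<J n}\<times>{..<J n}. (avg (g f) n \<omega> - mean (g f))\<^sup>2)}" for n
  define B2 where "B2 n = {\<omega>\<in>space D. t\<^sup>2 \<le> (\<Sum>f\<in>{..<m0}\<times>{..<m0}. (avg (g f) n \<omega> - mean (g f))\<^sup>2)}" for n
  define B3 where "B3 s n = {\<omega>\<in>space D. t\<^sup>2 \<le> (\<Sum>a\<in>{..<J n}. (avg (gm s a) n \<omega> - mean (gm s a))\<^sup>2)}" for s n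
  define B4 where "B4 s n = {\<omega>\<in>space D. t\<^sup>2 / J n \<le> (\<Sum>a\<in>{..<1::nat}. (avg (gp s) n \<omega> - mean (gp s))\<^sup>2)}" for s n
  have t2: "t\<^sup>2 > 0" using t by simp
  have Jp: "real (J n) > 0" for n using J_pos[of n] by simp
  have B1: "B1 n \<in> sets D" "measure D (B1 n) \<le> V / t\<^sup>2 * (J n / n)" if n: "n \<ge> 1" for n
  proof -
    have c: "t\<^sup>2 * J n > 0" using t2 Jp by simp
    note f = family_deviation[where F = "{..<J n}\<times>{..<J n}" and g = g and V = V and c = "t\<^sup>2 * real (J n)" and n = n, OF _ g_meas g2 gV n c]
    show "B1 n \<in> sets D" unfolding B1_def by (rule f(1)) auto
    have "measure D (B1 n) \<le> card ({..<J n}\<times>{..<J n}) * V / (n * (t\<^sup>2 * J n))" unfolding B1_def by (rule f(2)) auto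
    also have "\<dots> = V / t\<^sup>2 * (J n / n)" using Jp[of n] t2 n by (simp add: field_simps)
    finally show "measure D (B1 n) \<le> V / t\<^sup>2 * (J n / n)" .
  qed
  have B2: "B2 n \<in> sets D" "measure D (B2 n) \<le> real (m0 * m0) * V / t\<^sup>2 * inverse n" if n: "n \<ge> 1" for n
  proof -
    note f = family_deviation[where F = "{..<m0}\<times>{..<m0}" and g = g and V = V and c = "t\<^sup>2" and n = n, OF _ g_meas g2 gV n t2]
    show "B2 n \<in> sets D" unfolding B2_def by (rule f(1)) auto
    have "measure D (B2 n) \<le> card ({..<m0}\<times>{..<m0}) * V / (n * t\<^sup>2)" unfolding B2_def by (rule f(2)) auto
    also have "\<dots> = real (m0 * m0) * V / t\<^sup>2 * inverse n" using t2 n by (simp add: field_simps)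
    finally show "measure D (B2 n) \<le> real (m0 * m0) * V / t\<^sup>2 * inverse n" .
  qed
  have B3: "B3 s n \<in> sets D" "measure D (B3 s n) \<le> V1 / t\<^sup>2 * (J n / n)" if n: "n \<ge> 1" and s: "s \<in> {1..S}" for n s
  proof -
    note f = family_deviation[where F = "{..<J n}" and g = "gm s" and V = V1 and c = "t\<^sup>2" and n = n, OF _ gm_meas[OF s] gm2[OF s] gmV[OF s] n t2]
    show "B3 s n \<in> sets D" unfolding B3_def by (rule f(1)) auto
    have "measure D (B3 s n) \<le> card {..<J n} * V1 / (n * t\<^sup>2)" unfolding B3_def by (rule f(2)) auto
    also have "\<dots> = V1 / t\<^sup>2 * (J n / n)" using t2 n by (simp add: field_simps)
    finally show "measure D (B3 s n) \<le> V1 / t\<^sup>2 * (J n / n)" .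
  qed
  have B4: "B4 s n \<in> sets D" "measure D (B4 s n) \<le> 1 / t\<^sup>2 * (J n / n)" if n: "n \<ge> 1" and s: "s \<in> {1..S}" for n s
  proof -
    have c: "t\<^sup>2 / J n > 0" using t2 Jp by simp
    note f = family_deviation[where F = "{..<1::nat}" and g = "\<lambda>_. gp s" and V = 1 and c = "t\<^sup>2 / real (J n)" and n = n, OF _ gp_meas[OF s] gp2[OF s] gpV[OF s] n c]
    show "B4 s n \<in> sets D" unfolding B4_def by (rule f(1)) auto
    have "measure D (B4 s n) \<le> real (card {..<1::nat}) * 1 / (n * (t\<^sup>2 / J n))" unfolding B4_def by (rule f(2)) auto
    also have "\<dots> = 1 / t\<^sup>2 * (J n / n)" using t2 n Jp[of n] by (simp add: field_simps)
    finally show "measure D (B4 s n) \<le> 1 / t\<^sup>2 * (J n / n)" .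
  qed
  have ker: "AE \<omega> in D. \<forall>j\<in>{1..J n}. l (J n) j = 0 \<longrightarrow> (\<forall>i\<in>{1..n}. (\<Sum>a<J n. u (J n) j a * Xd i (\<tau> (Suc a)) \<omega>) = 0)" for n
  proof (rule AE_finite_allI)
    fix j assume j: "j \<in> {1..J n}"
    show "AE \<omega> in D. l (J n) j = 0 \<longrightarrow> (\<forall>i\<in>{1..n}. (\<Sum>a<J n. u (J n) j a * Xd i (\<tau> (Suc a)) \<omega>) = 0)"
    proof (cases "l (J n) j = 0")
      case True
      have "(l2_norm M (proc X \<tau> (J n) (u (J n) j)))\<^sup>2 = 0"
        unfolding gram_quad[OF X, symmetric] using spec_dot_u[OF A[of "J n"] j] True by simp
      then have "(\<integral>w. (proc X \<tau> (J n) (u (J n) j) w)\<^sup>2 \<partial>M) = 0"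
        by (simp add: l2_norm_def l2_inner_def power2_eq_square)
      moreover have "integrable M (\<lambda>w. (proc X \<tau> (J n) (u (J n) j) w)\<^sup>2)" using proc_L2[of X M, OF X] by (simp add: L2_def)
      ultimately have 0: "AE w in M. (proc X \<tau> (J n) (u (J n) j) w)\<^sup>2 = 0"
        by (subst integral_nonneg_eq_0_iff_AE[symmetric]) auto
      have "AE \<omega> in D. (\<Sum>a<J n. u (J n) j a * snd (?obs i \<omega>) (\<tau> (Suc a))) = 0" if i: "i \<ge> 1" for i
      proof (rule AE_W[OF i, where P = "\<lambda>z. (\<Sum>a<J n. u (J n) j a * snd z (\<tau> (Suc a))) = 0"])
        have "(\<lambda>z. \<Sum>a<J n. u (J n) j a * snd z (\<tau> (Suc a))) \<in> borel_measurable ?N"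
          by (intro borel_measurable_sum borel_measurable_times cm) auto
        then show "Measurable.pred ?N (\<lambda>z. (\<Sum>a<J n. u (J n) j a * snd z (\<tau> (Suc a))) = 0)" by measurable
        show "AE w in M. (\<Sum>a<J n. u (J n) j a * snd (?base w) (\<tau> (Suc a))) = 0" using 0 by (simp add: proc_def)
      qed
      then show ?thesis by (intro AE_impI AE_finite_allI) auto
    qed simp
  qed simp
  have "\<exists>B\<in>null_sets D. \<forall>\<omega>\<in>space D - B. \<forall>j\<in>{1..J n}. l (J n) j = 0 \<longrightarrow> (\<forall>i\<in>{1..n}. (\<Sum>a<J n. u (J n) j a * Xd i (\<tau> (Suc a)) \<omega>) = 0)" for n
    using ker[of n] by (auto elim!: AE_E3)
  then obtain B5 where B5: "\<And>n. B5 n \<in> null_sets D" and B5ker: "\<And>n \<omega>. \<omega> \<in> space D - B5 n \<Longrightarrow>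
      \<forall>j\<in>{1..J n}. l (J n) j = 0 \<longrightarrow> (\<forall>i\<in>{1..n}. (\<Sum>a<J n. u (J n) j a * Xd i (\<tau> (Suc a)) \<omega>) = 0)" by metis
  define bad where "bad n = B1 n \<union> (B2 n \<union> ((\<Union>s\<in>{1..S}. B3 s n) \<union> ((\<Union>s\<in>{1..S}. B4 s n) \<union> B5 n)))" for n
  have sets3: "(\<Union>s\<in>{1..S}. B3 s n) \<in> sets D" "(\<Union>s\<in>{1..S}. B4 s n) \<in> sets D" "B5 n \<in> sets D" if "n \<ge> 1" for n
    using B3(1)[OF that] B4(1)[OF that] B5[of n] by auto
  show thesis
  proof (rule that[of bad])
    show "bad n \<in> sets D" if "n \<ge> 1" for n unfolding bad_def using B1(1)[OF that] B2(1)[OF that] sets3[OF that] by auto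
    have bound: "measure D (bad n) \<le> V / t\<^sup>2 * (J n / n) + (real (m0 * m0) * V / t\<^sup>2 * inverse n +
        (real S * (V1 / t\<^sup>2 * (J n / n)) + (real S * (1 / t\<^sup>2 * (J n / n)) + 0)))" if n: "n \<ge> 1" for n
    proof -
      have "measure D (\<Union>s\<in>{1..S}. B3 s n) \<le> (\<Sum>s\<in>{1..S}. measure D (B3 s n))"
        by (rule D.finite_measure_subadditive_finite) (use B3(1)[OF n] in auto)
      also have "\<dots> \<le> (\<Sum>s\<in>{1..S}. V1 / t\<^sup>2 * (J n / n))" by (intro sum_mono B3(2) n)
      finally have 3: "measure D (\<Union>s\<in>{1..S}. B3 s n) \<le> real S * (V1 / t\<^sup>2 * (J n / n))" by simp
      have "measure D (\<Union>s\<in>{1..S}. B4 s n) \<le> (\<Sum>s\<in>{1..S}. measure D (B4 s n))"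
        by (rule D.finite_measure_subadditive_finite) (use B4(1)[OF n] in auto)
      also have "\<dots> \<le> (\<Sum>s\<in>{1..S}. 1 / t\<^sup>2 * (J n / n))" by (intro sum_mono B4(2) n)
      finally have 4: "measure D (\<Union>s\<in>{1..S}. B4 s n) \<le> real S * (1 / t\<^sup>2 * (J n / n))" by simp
      have 5: "measure D (B5 n) \<le> 0" using B5[of n] by (simp add: null_sets_def measure_def)
      note s = B1(1)[OF n] B2(1)[OF n] sets3[OF n]
      show ?thesis unfolding bad_def using s
        by (intro order_trans[OF measure_Un_le] add_mono B1(2) B2(2) 3 4 5 n) auto
    qed
    have Jn: "(\<lambda>n. real (J n) / real n) \<longlonglongrightarrow> 0" by (rule smalloD_tendsto[OF J_small])
    have "(\<lambda>n. V / t\<^sup>2 * (J n / n) + (real (m0 * m0) * V / t\<^sup>2 * inverse n +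
        (real S * (V1 / t\<^sup>2 * (J n / n)) + (real S * (1 / t\<^sup>2 * (J n / n)) + 0)))) \<longlonglongrightarrow>
        V / t\<^sup>2 * 0 + (real (m0 * m0) * V / t\<^sup>2 * 0 + (real S * (V1 / t\<^sup>2 * 0) + (real S * (1 / t\<^sup>2 * 0) + 0)))"
      by (intro tendsto_add tendsto_mult tendsto_const Jn lim_inverse_n)
    then have lim: "(\<lambda>n. V / t\<^sup>2 * (J n / n) + (real (m0 * m0) * V / t\<^sup>2 * inverse n +
        (real S * (V1 / t\<^sup>2 * (J n / n)) + (real S * (1 / t\<^sup>2 * (J n / n)) + 0)))) \<longlonglongrightarrow> 0" by simp
    show "(\<lambda>n. measure D (bad n)) \<longlonglongrightarrow> 0"
    proof (rule Lim_null_comparison[OF _ lim])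
      show "\<forall>\<^sub>F n in sequentially. norm (measure D (bad n)) \<le> V / t\<^sup>2 * (J n / n) + (real (m0 * m0) * V / t\<^sup>2 * inverse n +
        (real S * (V1 / t\<^sup>2 * (J n / n)) + (real S * (1 / t\<^sup>2 * (J n / n)) + 0)))"
        using eventually_ge_at_top[of 1] by eventually_elim (use bound in simp)
    qed
    fix n \<omega> assume n: "n \<ge> (1::nat)" and \<omega>: "\<omega> \<in> space D - bad n"
    have w: "\<omega> \<in> space D" "\<omega> \<notin> B1 n" "\<omega> \<notin> B2 n" "\<omega> \<in> space D - B5 n"
      "\<And>s. s \<in> {1..S} \<Longrightarrow> \<omega> \<notin> B3 s n" "\<And>s. s \<in> {1..S} \<Longrightarrow> \<omega> \<notin> B4 s n" using \<omega> by (auto simp: bad_def)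
    have ag: "avg (g (a, b)) n \<omega> = (\<Sum>i\<in>{1..n}. Xd i (\<tau> (Suc a)) \<omega> * Xd i (\<tau> (Suc b)) \<omega>) / real n" for a b
      by (simp add: avg_def g_def)
    have am: "avg (gm s a) n \<omega> = (\<Sum>i\<in>{1..n}. Xd i (\<tau> (Suc a)) \<omega> * indicator (I s) (Yd i \<omega>)) / real n" for s a
      by (simp add: avg_def gm_def)
    have ap: "avg (gp s) n \<omega> = (\<Sum>i\<in>{1..n}. indicator (I s) (Yd i \<omega>)) / real n" for s by (simp add: avg_def gp_def)
    have e1: "(\<Sum>a<J n. \<Sum>b<J n. ((\<Sum>i\<in>{1..n}. Xd i (\<tau> (Suc a)) \<omega> * Xd i (\<tau> (Suc b)) \<omega>) / real n - gram (cov_fun M X) \<tau> a b)\<^sup>2) \<le> t\<^sup>2 * J n"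
      using w(1,2) unfolding B1_def sum_pairs mean_g by (simp add: ag)
    have e2: "(\<Sum>a<m0. \<Sum>b<m0. ((\<Sum>i\<in>{1..n}. Xd i (\<tau> (Suc a)) \<omega> * Xd i (\<tau> (Suc b)) \<omega>) / real n - gram (cov_fun M X) \<tau> a b)\<^sup>2) \<le> t\<^sup>2"
      using w(1,3) unfolding B2_def sum_pairs mean_g by (simp add: ag)
    have e3: "(\<Sum>a<J n. ((\<Sum>i\<in>{1..n}. Xd i (\<tau> (Suc a)) \<omega> * indicator (I s) (Yd i \<omega>)) / real n - q s * h s (\<tau> (Suc a)))\<^sup>2) \<le> t\<^sup>2"
      if s: "s \<in> {1..S}" for s
      using w(1) w(5)[OF s] unfolding B3_def mean_gm[OF s] by (simp add: am)
    have e4: "((\<Sum>i\<in>{1..n}. indicator (I s) (Yd i \<omega>)) / real n - q s)\<^sup>2 * J n \<le> t\<^sup>2" if s: "s \<in> {1..S}" for s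
    proof -
      have "(avg (gp s) n \<omega> - q s)\<^sup>2 \<le> t\<^sup>2 / J n" using w(1) w(6)[OF s] unfolding B4_def mean_gp[OF s] by simp
      then show ?thesis using Jp[of n] unfolding ap by (simp add: field_simps)
    qed
    show "(\<Sum>a<J n. \<Sum>b<J n. ((\<Sum>i\<in>{1..n}. Xd i (\<tau> (Suc a)) \<omega> * Xd i (\<tau> (Suc b)) \<omega>) / real n - gram (cov_fun M X) \<tau> a b)\<^sup>2) \<le> t\<^sup>2 * J n \<and>
      (\<Sum>a<m0. \<Sum>b<m0. ((\<Sum>i\<in>{1..n}. Xd i (\<tau> (Suc a)) \<omega> * Xd i (\<tau> (Suc b)) \<omega>) / real n - gram (cov_fun M X) \<tau> a b)\<^sup>2) \<le> t\<^sup>2 \<and>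
      (\<forall>j\<in>{1..J n}. l (J n) j = 0 \<longrightarrow> (\<forall>i\<in>{1..n}. (\<Sum>a<J n. u (J n) j a * Xd i (\<tau> (Suc a)) \<omega>) = 0)) \<and>
      (\<forall>s\<in>{1..S}. (\<Sum>a<J n. ((\<Sum>i\<in>{1..n}. Xd i (\<tau> (Suc a)) \<omega> * indicator (I s) (Yd i \<omega>)) / real n - q s * h s (\<tau> (Suc a)))\<^sup>2) \<le> t\<^sup>2 \<and>
        ((\<Sum>i\<in>{1..n}. indicator (I s) (Yd i \<omega>)) / real n - q s)\<^sup>2 * J n \<le> t\<^sup>2)"
      using e1 e2 e3 e4 B5ker[OF w(4)] by blast
  qed
qed

section \<open>Consistency of the estimator\<close>

lemma slice_projection_mean:
  assumes "prob_space M" "A \<in> sets M" "q = measure M A" "q > 0"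
  shows "(\<lambda>w. (1 / q) * indicator A w) \<in> L2 M"
    and "l2_inner M (\<lambda>w. (1 / q) * indicator A w) Z = exp_given M A Z"
    and "l2_inner M (indicator A) Z / q = exp_given M A Z"
proof -
  show "(\<lambda>w. (1 / q) * indicator A w) \<in> L2 M" by (rule L2_scale[OF indicator_L2[OF assms(1,2)]])
  have "l2_inner M (indicator A) Z = (LINT w:A|M. Z w)"
    by (simp add: l2_inner_def set_lebesgue_integral_def)
  then show "l2_inner M (\<lambda>w. (1 / q) * indicator A w) Z = exp_given M A Z" "l2_inner M (indicator A) Z / q = exp_given M A Z"
    unfolding l2_inner_scale_left by (simp_all add: exp_given_def assms(3))
qed

text \<open>If the process is spanned by \<open>m\<close> of its values, then more than \<open>m\<close> orthonormal
  vectors in the closed span would have a nonzero combination that is orthogonal to the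
  process.\<close>

lemma number_of_components_le:
  fixes p m :: nat and \<tau> :: "nat \<Rightarrow> 't" and X :: "'t \<Rightarrow> 'w \<Rightarrow> real"
  assumes X: "\<And>t. X t \<in> L2 M" and H: "is_rkhs (cov_fun M X) H ip" and Psi: "loeve_isometry M X H ip \<Psi>"
    and \<xi>: "\<And>j. j \<in> {1..p} \<Longrightarrow> \<xi> j \<in> closed_span M X"
    and o: "\<And>i j. i \<in> {1..p} \<Longrightarrow> j \<in> {1..p} \<Longrightarrow> l2_inner M (\<xi> i) (\<xi> j) = (if i = j then 1 else 0)"
    and fin: "\<And>t. \<exists>g\<in>fun_span (X ` \<tau> ` {1..m}). AE w in M. X t w = g w"
  shows "p \<le> m"
proof (rule ccontr)
  assume "\<not> p \<le> m"
  then have "m < p" by simp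
  then obtain c where c: "dot p c c = 1"
    and cz: "\<And>i. i < m \<Longrightarrow> dot p (\<lambda>j. l2_inner M (\<xi> (Suc j)) (X (\<tau> (Suc i)))) c = 0"
    using nontrivial_kernel[of m p "\<lambda>i j. l2_inner M (\<xi> (Suc j)) (X (\<tau> (Suc i)))"] by metis
  define z where "z = (\<lambda>w. \<Sum>j\<in>{1..p}. c (j - 1) * \<xi> j w)"
  have zc: "z \<in> closed_span M X" unfolding z_def by (rule closed_span_sum[OF X _ \<xi>]) auto
  have \<xi>L: "\<xi> j \<in> L2 M" if "j \<in> {1..p}" for j by (rule closed_span_L2[OF \<xi>[OF that]])
  have zin: "l2_inner M z y = (\<Sum>j\<in>{1..p}. c (j - 1) * l2_inner M (\<xi> j) y)" if "y \<in> L2 M" for y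
    unfolding z_def using that by (subst l2_inner_sum_left) (auto intro!: L2_scale \<xi>L simp: l2_inner_scale_left)
  have "l2_inner M z (X t) = 0" for t
  proof -
    obtain g where g: "g \<in> fun_span (X ` \<tau> ` {1..m})" "AE w in M. X t w = g w" using fin by blast
    obtain b where b: "g = proc X \<tau> m b" by (rule fun_span_proc[OF g(1)])
    have zX: "l2_inner M z (X (\<tau> (Suc i))) = 0" if "i < m" for i
    proof -
      have "l2_inner M z (X (\<tau> (Suc i))) = (\<Sum>j<p. l2_inner M (\<xi> (Suc j)) (X (\<tau> (Suc i))) * c j)"
        unfolding zin[OF X] One_nat_def sum.atLeast1_atMost_eq by (intro sum.cong refl) simp
      then show ?thesis using cz[OF that] by (simp add: dot_def)
    qed
    have PL: "proc X \<tau> m b \<in> L2 M" by (rule proc_L2[OF X])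
    have "l2_inner M z (X t) = l2_inner M z (proc X \<tau> m b)"
      unfolding l2_inner_def
      by (rule integral_cong_AE)
        (use g b L2_D(1)[OF X[of t]] L2_D(1)[OF PL] L2_D(1)[OF closed_span_L2[OF zc]] in \<open>auto intro!: borel_measurable_times\<close>)
    also have "\<dots> = dot m (\<lambda>a. l2_inner M z (X (\<tau> (Suc a)))) b" by (rule l2_inner_proc[OF X closed_span_L2[OF zc]])
    also have "\<dots> = 0" unfolding dot_def by (rule sum.neutral) (simp add: zX)
    finally show ?thesis .
  qed
  then have "l2_norm M z = 0" by (rule closed_span_orthogonal[OF X H Psi zc])
  moreover have "l2_inner M z z = 1"
  proof -
    have "l2_inner M (\<xi> j) z = c (j - 1)" if j: "j \<in> {1..p}" for j
    proof -
      have "l2_inner M (\<xi> j) z = (\<Sum>i\<in>{1..p}. c (i - 1) * l2_inner M (\<xi> i) (\<xi> j))"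
        using zin[OF \<xi>L[OF j]] by (simp add: l2_inner_commute)
      also have "\<dots> = (\<Sum>i\<in>{1..p}. if i = j then c (i - 1) else 0)" by (intro sum.cong refl) (use o[OF _ j] in auto)
      finally show ?thesis using j by simp
    qed
    then have "l2_inner M z z = (\<Sum>j\<in>{1..p}. c (j - 1) * c (j - 1))"
      unfolding zin[OF closed_span_L2[OF zc]] by (intro sum.cong refl) simp
    also have "\<dots> = dot p c c" unfolding dot_def One_nat_def sum.atLeast1_atMost_eq by simp
    finally show ?thesis using c by simp
  qed
  ultimately show False by (simp add: l2_norm_def)
qed

lemma eventually_along_towards:
  "filterlim J (towards Jinf) F \<Longrightarrow> eventually P (towards Jinf) \<Longrightarrow> eventually (\<lambda>n. P (J n)) F"
  by (simp add: filterlim_iff)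

text \<open>Choosing, for each dimension and truncation index, a projection that violates the
  bound whenever there is one makes the trace condition uniform in the choice of
  eigenvectors.\<close>

lemma uniform_trace_condition:
  assumes trace_lim: "\<And>P. (\<And>m k. k \<le> m \<Longrightarrow> P m k \<in> top_projs (R m) k) \<Longrightarrow>
      ((\<lambda>k. Limsup (towards Jinf) (\<lambda>m. ereal (T m (P m k)))) \<longlongrightarrow> 0) (towards kinf)"
    and ne: "\<And>m k. k \<le> m \<Longrightarrow> top_projs (R m) k \<noteq> {}"
    and J_lim: "filterlim J (towards Jinf) sequentially" and kk_lim: "filterlim kk (towards kinf) sequentially"
    and e: "e > (0::real)"
  shows "\<forall>\<^sub>F i in sequentially. \<forall>\<^sub>F n in sequentially. kk i \<le> J n \<longrightarrow> (\<forall>Q\<in>top_projs (R (J n)) (kk i). T (J n) Q < e)"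
proof -
  define P where "P m k = (if \<exists>Q\<in>top_projs (R m) k. e \<le> T m Q then SOME Q. Q \<in> top_projs (R m) k \<and> e \<le> T m Q
      else SOME Q. Q \<in> top_projs (R m) k)" for m k
  have P: "P m k \<in> top_projs (R m) k \<and> ((\<exists>Q\<in>top_projs (R m) k. e \<le> T m Q) \<longrightarrow> e \<le> T m (P m k))" if "k \<le> m" for m k
  proof (cases "\<exists>Q\<in>top_projs (R m) k. e \<le> T m Q")
    case True
    then have "\<exists>Q. Q \<in> top_projs (R m) k \<and> e \<le> T m Q" by blast
    then have "P m k \<in> top_projs (R m) k \<and> e \<le> T m (P m k)" unfolding P_def using True by (simp add: someI_ex[of "\<lambda>Q. Q \<in> top_projs (R m) k \<and> e \<le> T m Q"])
    then show ?thesis by blast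
  next
    case False
    then have "P m k \<in> top_projs (R m) k" unfolding P_def using ne[OF that] by (simp add: some_in_eq)
    then show ?thesis using False by blast
  qed
  have "((\<lambda>k. Limsup (towards Jinf) (\<lambda>m. ereal (T m (P m k)))) \<longlongrightarrow> 0) (towards kinf)" by (rule trace_lim) (use P in blast)
  then have "\<forall>\<^sub>F k in towards kinf. Limsup (towards Jinf) (\<lambda>m. ereal (T m (P m k))) < ereal e"
    by (rule order_tendstoD(2)) (use e in simp)
  then have "\<forall>\<^sub>F i in sequentially. Limsup (towards Jinf) (\<lambda>m. ereal (T m (P m (kk i)))) < ereal e"
    by (rule eventually_along_towards[OF kk_lim])
  then show ?thesis
  proof eventually_elim
    case (elim i)
    then have "\<forall>\<^sub>F m in towards Jinf. ereal (T m (P m (kk i))) < ereal e" by (rule Limsup_lessD)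
    then have "\<forall>\<^sub>F n in sequentially. ereal (T (J n) (P (J n) (kk i))) < ereal e" by (rule eventually_along_towards[OF J_lim])
    then show ?case
    proof eventually_elim
      case (elim n)
      show ?case
      proof (intro impI ballI)
        fix Q assume "kk i \<le> J n" "Q \<in> top_projs (R (J n)) (kk i)"
        then show "T (J n) Q < e" using P[of "kk i" "J n"] elim by (meson ereal_less_eq(3) linorder_not_less not_less)
      qed
    qed
  qed
qed

lemma eigengap_bound:
  fixes J :: "nat \<Rightarrow> nat"
  assumes J_lim: "filterlim J (towards Jinf) sequentially" and J_pos: "\<And>n. J n > 0"
    and gap: "Liminf (towards Jinf) (\<lambda>i. eigengap k (R i) / ereal (real i)) > 0"
    and R: "\<And>m. R m \<in> carrier_mat m m"
  obtains c :: real where "c > 0" "\<forall>\<^sub>F n in sequentially. \<forall>j\<in>{1..J n}. eigval (R (J n)) j \<noteq> eigval (R (J n)) k \<longrightarrow>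
    \<bar>eigval (R (J n)) j - eigval (R (J n)) k\<bar> \<ge> c * J n"
proof -
  obtain c where c: "0 < ereal c" "ereal c < Liminf (towards Jinf) (\<lambda>i. eigengap k (R i) / ereal (real i))"
    using ereal_dense2[OF gap] by auto
  have "\<forall>\<^sub>F i in towards Jinf. ereal c < eigengap k (R i) / ereal (real i)" by (rule less_LiminfD[OF c(2)])
  then have ev: "\<forall>\<^sub>F n in sequentially. ereal c < eigengap k (R (J n)) / ereal (real (J n))" by (rule eventually_along_towards[OF J_lim])
  show thesis
  proof (rule that[of c])
    show "c > 0" using c(1) by simp
    show "\<forall>\<^sub>F n in sequentially. \<forall>j\<in>{1..J n}. eigval (R (J n)) j \<noteq> eigval (R (J n)) k \<longrightarrow>
      \<bar>eigval (R (J n)) j - eigval (R (J n)) k\<bar> \<ge> c * J n" using ev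
    proof eventually_elim
      case (elim n)
      show ?case
      proof (intro ballI impI)
        fix j assume j: "j \<in> {1..J n}" "eigval (R (J n)) j \<noteq> eigval (R (J n)) k"
        have d: "dim_row (R (J n)) = J n" using R[of "J n"] by auto
        have "eigengap k (R (J n)) \<le> ereal \<bar>eigval (R (J n)) j - eigval (R (J n)) k\<bar>"
          unfolding eigengap_def by (rule INF_lower) (use j d in auto)
        then have "eigengap k (R (J n)) / ereal (real (J n)) \<le> ereal \<bar>eigval (R (J n)) j - eigval (R (J n)) k\<bar> / ereal (real (J n))"
          using J_pos[of n] by (intro ereal_divide_right_mono) auto
        with elim have "ereal c < ereal \<bar>eigval (R (J n)) j - eigval (R (J n)) k\<bar> / ereal (real (J n))" by (rule less_le_trans)
        then have "c < \<bar>eigval (R (J n)) j - eigval (R (J n)) k\<bar> / J n" using J_pos[of n] by simp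
        then show "\<bar>eigval (R (J n)) j - eigval (R (J n)) k\<bar> \<ge> c * J n" using J_pos[of n] by (simp add: field_simps)
      qed
    qed
  qed
qed

theorem theorem11:
  fixes M :: "'w measure"
    and X :: "'t :: {metric_space, second_countable_topology} \<Rightarrow> 'w \<Rightarrow> real"
    and N :: "'y measure" and Y :: "'w \<Rightarrow> 'y"
    and R :: "'t \<Rightarrow> 't \<Rightarrow> real"
    and HR :: "('t \<Rightarrow> real) set" and ip :: "('t \<Rightarrow> real) \<Rightarrow> ('t \<Rightarrow> real) \<Rightarrow> real"
    and \<Psi> :: "('w \<Rightarrow> real) \<Rightarrow> 't \<Rightarrow> real"
    and p :: nat and \<xi> :: "nat \<Rightarrow> 'w \<Rightarrow> real"
    and Z :: "'t \<Rightarrow> 'w \<Rightarrow> real" and K :: "'t \<Rightarrow> 't \<Rightarrow> real"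
    and S :: nat and I :: "nat \<Rightarrow> 'y set" and q :: "nat \<Rightarrow> real"
    and G :: "'w measure" and KG :: "'t \<Rightarrow> 't \<Rightarrow> real"
    and HKG :: "('t \<Rightarrow> real) set" and ipG :: "('t \<Rightarrow> real) \<Rightarrow> ('t \<Rightarrow> real) \<Rightarrow> real"
    and h :: "nat \<Rightarrow> 't \<Rightarrow> real" and LG :: "('t \<Rightarrow> real) \<Rightarrow> 't \<Rightarrow> real"
    and lam :: "nat \<Rightarrow> real" and f :: "nat \<Rightarrow> 't \<Rightarrow> real"
    and D :: "'v measure" and Yd :: "nat \<Rightarrow> 'v \<Rightarrow> 'y" and Xd :: "nat \<Rightarrow> 't \<Rightarrow> 'v \<Rightarrow> real"
    and \<tau> :: "nat \<Rightarrow> 't" and J :: "nat \<Rightarrow> nat" and Jinf kinf :: enat and kk :: "nat \<Rightarrow> nat"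
    and Phat :: "nat \<Rightarrow> nat \<Rightarrow> 'v \<Rightarrow> real mat" and v :: "nat \<Rightarrow> nat \<Rightarrow> nat \<Rightarrow> 'v \<Rightarrow> real vec"
    and \<xi>hat :: "nat \<Rightarrow> nat \<Rightarrow> nat \<Rightarrow> 'v \<Rightarrow> 'w \<Rightarrow> real"
  assumes prob_M: "prob_space M"
    and X_L2: "\<And>t. X t \<in> L2 M"
    and X_mean: "\<And>t. (\<integral>w. X t w \<partial>M) = 0"
    and Y_meas: "Y \<in> measurable M N"
    and R_eq: "R = cov_fun M X"
    and HR_rkhs: "is_rkhs R HR ip"
    and Psi: "loeve_isometry M X HR ip \<Psi>"
    and \<xi>_in: "\<And>j. j \<in> {1..p} \<Longrightarrow> \<xi> j \<in> closed_span M X"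
    and Z_cond_exp: "\<And>t. Z t \<in> borel_measurable (sigma_rv M N Y)"
      "\<And>t. AE w in M. Z t w = real_cond_exp M (sigma_rv M N Y) (X t) w"
    and K_eq: "K = cov_fun M Z"
    and cond_independent: "cond_indep M (sigma_rv M N Y) (sigma_fam M UNIV X) (sigma_fam M {1..p} \<xi>)"
    and linearity: "\<And>\<eta>. \<eta> \<in> closed_span M X \<Longrightarrow>
      \<exists>g\<in>fun_span (\<xi> ` {1..p}). AE w in M. real_cond_exp M (sigma_fam M {1..p} \<xi>) \<eta> w = g w"
    and regularity: "countable (UNIV :: 't set) \<or>
      (continuous_on UNIV (\<lambda>(s, t). R s t) \<and> (AE w in M. continuous_on UNIV (\<lambda>t. Z t w)))"
    and I_sets: "\<And>s. s \<in> {1..S} \<Longrightarrow> I s \<in> sets N"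
    and I_disjoint: "disjoint_family_on I {1..S}"
    and I_cover: "(\<Union>s\<in>{1..S}. I s) = space N"
    and q_eq: "\<And>s. s \<in> {1..S} \<Longrightarrow> q s = measure M (Y -` I s \<inter> space M)"
    and q_pos: "\<And>s. s \<in> {1..S} \<Longrightarrow> q s > 0"
    and G_eq: "G = sigma (space M) ((\<lambda>s. Y -` I s \<inter> space M) ` {1..S})"
    and KG_eq: "KG = cov_fun M (\<lambda>t. real_cond_exp M G (Z t))"
    and HKG_rkhs: "is_rkhs KG HKG ipG"
    and HKG_eq: "HKG = fun_span (\<Psi> ` \<xi> ` {1..p})"
    and h_eq: "\<And>s t. s \<in> {1..S} \<Longrightarrow> h s t = exp_given M (Y -` I s \<inter> space M) (X t)"
    and LG_eq: "LG = (\<lambda>g t. \<Sum>s\<in>{1..S}. q s * tensor_op ip (h s) (h s) g t)"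
    and eigen: "simple_eigensystem HR ip LG p lam f"
    and \<xi>_eq: "\<And>j. j \<in> {1..p} \<Longrightarrow> \<Psi> (\<xi> j) = f j"
    and prob_D: "prob_space D"
    and data_indep: "prob_space.indep_vars D (\<lambda>_. N \<Otimes>\<^sub>M (\<Pi>\<^sub>M t\<in>UNIV. borel))
      (\<lambda>i \<omega>. (Yd i \<omega>, \<lambda>t. Xd i t \<omega>)) {1..}"
    and data_distr: "\<And>i. i \<ge> 1 \<Longrightarrow>
      distr D (N \<Otimes>\<^sub>M (\<Pi>\<^sub>M t\<in>UNIV. borel)) (\<lambda>\<omega>. (Yd i \<omega>, \<lambda>t. Xd i t \<omega>)) =
      distr M (N \<Otimes>\<^sub>M (\<Pi>\<^sub>M t\<in>UNIV. borel)) (\<lambda>w. (Y w, \<lambda>t. X t w))"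
    and J_mono: "mono J"
    and J_pos: "\<And>n. J n > 0"
    and J_lim: "filterlim J (towards Jinf) sequentially"
    and J_finite: "\<And>m t. Jinf = enat m \<Longrightarrow>
      \<exists>g\<in>fun_span (X ` \<tau> ` {1..m}). AE w in M. X t w = g w"
    and Phat: "\<And>n k \<omega>. k \<le> J n \<Longrightarrow> \<omega> \<in> space D \<Longrightarrow>
      Phat n k \<omega> \<in> top_projs (samp_cov Xd \<tau> n (J n) \<omega>) k"
    and v_eigen: "\<And>n k j \<omega>. k \<le> J n \<Longrightarrow> j \<in> {1..p} \<Longrightarrow> j \<le> J n \<Longrightarrow> \<omega> \<in> space D \<Longrightarrow>
      eigenvector (samp_M Yd Xd \<tau> I S n (J n) (Phat n k \<omega>) \<omega>) (v n k j \<omega>)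
        (eigval (samp_M Yd Xd \<tau> I S n (J n) (Phat n k \<omega>) \<omega>) j)"
    and v_unit: "\<And>n k j \<omega>. k \<le> J n \<Longrightarrow> j \<in> {1..p} \<Longrightarrow> j \<le> J n \<Longrightarrow> \<omega> \<in> space D \<Longrightarrow>
      v n k j \<omega> \<bullet> v n k j \<omega> = 1"
    and \<xi>hat_eq: "\<And>n k j \<omega>.
      \<xi>hat n k j \<omega> = lin_comb X \<tau> (samp_isqrt Xd \<tau> n (J n) (Phat n k \<omega>) \<omega> *\<^sub>v v n k j \<omega>)"
    and v_sign: "\<And>n k j \<omega>. k \<le> J n \<Longrightarrow> j \<in> {1..p} \<Longrightarrow> j \<le> J n \<Longrightarrow> \<omega> \<in> space D \<Longrightarrow>
      l2_inner M (\<xi>hat n k j \<omega>) (\<xi> j) \<ge> 0"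
    and error_meas: "\<And>n k j. k \<le> J n \<Longrightarrow> j \<in> {1..p} \<Longrightarrow> j \<le> J n \<Longrightarrow>
      (\<lambda>\<omega>. l2_norm M (\<lambda>w. \<xi>hat n k j \<omega> w - \<xi> j w)) \<in> borel_measurable D"
    and fourth_moment: "(SUP t. \<integral>\<^sup>+ w. ennreal (X t w ^ 4) \<partial>M) < \<infinity>"
    and J_small: "(\<lambda>n. real (J n)) \<in> o(\<lambda>n. real n)"
    and T_cover: "(\<Union>m\<in>{1..}. \<tau> ` {1..m}) = UNIV \<or>
      (closure (\<Union>m\<in>{1..}. \<tau> ` {1..m}) = UNIV \<and> continuous_on UNIV (\<lambda>(s, t). R s t))"
    and kinf_le: "kinf \<le> Jinf"
    and trace_lim: "\<And>P. (\<And>m k. k \<le> m \<Longrightarrow> P m k \<in> top_projs (kernel_mat R \<tau> m) k) \<Longrightarrow>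
      ((\<lambda>k. Limsup (towards Jinf) (\<lambda>m. ereal (mat_trace
          ((pinv (kernel_mat R \<tau> m) - pinv (P m k * kernel_mat R \<tau> m * P m k)) * kernel_mat K \<tau> m))))
        \<longlongrightarrow> 0) (towards kinf)"
    and kk_pos: "\<And>l. kk l > 0"
    and kk_le: "\<And>l. enat (kk l) \<le> Jinf"
    and kk_lim: "filterlim kk (towards kinf) sequentially"
    and gap: "\<And>m. m \<in> range kk \<Longrightarrow>
      Liminf (towards Jinf) (\<lambda>i. eigengap m (kernel_mat R \<tau> i) / ereal (real i)) > 0"
  shows "\<forall>j\<in>{1..p}. iterated_tendsto_prob D
    (\<lambda>n l \<omega>. l2_norm M (\<lambda>w. \<xi>hat n (kk l) j \<omega> w - \<xi> j w))"

proof -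
  interpret M: prob_space M by (rule prob_M)
  interpret D: prob_space D by (rule prob_D)
  let ?R = "\<lambda>m. kernel_mat R \<tau> m"
  let ?A = "gram (cov_fun M X) \<tau>"
  note HR' = HR_rkhs[unfolded R_eq]
  define C4 where "C4 = enn2real (SUP t. \<integral>\<^sup>+ w. ennreal (X t w ^ 4) \<partial>M)"
  have Xm: "X t \<in> borel_measurable M" for t using X_L2[of t] by (simp add: L2_def)
  have nn4: "(\<integral>\<^sup>+ w. ennreal (X t w ^ 4) \<partial>M) \<le> ennreal C4" for t
  proof -
    have "(\<integral>\<^sup>+ w. ennreal (X t w ^ 4) \<partial>M) \<le> (SUP t. \<integral>\<^sup>+ w. ennreal (X t w ^ 4) \<partial>M)" by (rule SUP_upper) simp
    then show ?thesis unfolding C4_def using fourth_moment by (simp add: less_top)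
  qed
  have X4: "integrable M (\<lambda>w. X t w ^ 4)" for t
  proof (rule integrableI_bounded)
    show "(\<lambda>w. X t w ^ 4) \<in> borel_measurable M" using Xm by simp
    have "(\<integral>\<^sup>+ w. ennreal (norm (X t w ^ 4)) \<partial>M) = (\<integral>\<^sup>+ w. ennreal (X t w ^ 4) \<partial>M)" by simp
    also have "\<dots> < \<infinity>" using le_less_trans[OF nn4[of t]] by simp
    finally show "(\<integral>\<^sup>+ w. ennreal (norm (X t w ^ 4)) \<partial>M) < \<infinity>" .
  qed
  have X4C: "(\<integral>w. X t w ^ 4 \<partial>M) \<le> C4" for t
  proof -
    have "ennreal (\<integral>w. X t w ^ 4 \<partial>M) = (\<integral>\<^sup>+ w. ennreal (X t w ^ 4) \<partial>M)"
      by (rule nn_integral_eq_integral[symmetric, OF X4]) simp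
    then have "ennreal (\<integral>w. X t w ^ 4 \<partial>M) \<le> ennreal C4" using nn4[of t] by simp
    moreover have "C4 \<ge> 0" by (simp add: C4_def)
    ultimately show ?thesis by (simp add: ennreal_le_iff)
  qed
  define C where "C = 1 + C4"
  have XC: "l2_inner M (X t) (X t) \<le> C" for t
  proof -
    have "X t w * X t w \<le> 1 + X t w ^ 4" for w
    proof -
      have "2 * (X t w)\<^sup>2 \<le> (X t w) ^ 4 + 1" using zero_le_power2[of "(X t w)\<^sup>2 - 1"] by (simp add: power2_diff)
      then show ?thesis using zero_le_power2[of "X t w"] unfolding power2_eq_square[of "X t w"] by linarith
    qed
    moreover have "integrable M (\<lambda>w. 1 + X t w ^ 4)" by (intro Bochner_Integration.integrable_add X4) simp
    ultimately have "l2_inner M (X t) (X t) \<le> (\<integral>w. 1 + X t w ^ 4 \<partial>M)"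
      unfolding l2_inner_def by (intro integral_mono L2_mult_integrable X_L2) auto
    also have "\<dots> = 1 + (\<integral>w. X t w ^ 4 \<partial>M)" using X4[of t] by (simp add: M.prob_space)
    finally show ?thesis using X4C[of t] by (simp add: C_def)
  qed
  let ?E = "\<lambda>s. Y -` I s \<inter> space M"
  have E: "?E s \<in> sets M" if "s \<in> {1..S}" for s using measurable_sets[OF Y_meas I_sets[OF that]] .
  note slice = slice_projection_mean[OF prob_M E q_eq q_pos]
  have "\<exists>\<eta>. s \<in> {1..S} \<longrightarrow> \<eta> \<in> closed_span M X \<and> \<Psi> \<eta> = h s \<and> (\<forall>t. l2_inner M \<eta> (X t) = h s t)" for s
  proof (cases "s \<in> {1..S}")
    case True
    obtain \<eta> where "\<eta> \<in> closed_span M X" "\<Psi> \<eta> = h s" "\<And>t. l2_inner M \<eta> (X t) = h s t"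
      using Psi_representer[OF X_L2 HR' Psi slice(1)[OF True True True], of "h s"] slice(2)[OF True True True] h_eq[OF True]
      by (metis)
    then show ?thesis by blast
  qed blast
  then obtain \<eta> where \<eta>all: "\<And>s. s \<in> {1..S} \<longrightarrow> \<eta> s \<in> closed_span M X \<and> \<Psi> (\<eta> s) = h s \<and> (\<forall>t. l2_inner M (\<eta> s) (X t) = h s t)" by metis
  have \<eta>c: "\<eta> s \<in> closed_span M X" and \<eta>h: "\<Psi> (\<eta> s) = h s" and \<eta>X: "l2_inner M (\<eta> s) (X t) = h s t" if "s \<in> {1..S}" for s t
    using \<eta>all that by blast+
  have \<eta>L: "\<eta> s \<in> L2 M" if "s \<in> {1..S}" for s by (rule closed_span_L2[OF \<eta>c[OF that]])
  note pop = X_L2 HR' Psi q_pos \<eta>c \<eta>h eigen[unfolded LG_eq] \<xi>_in \<xi>_eq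
  define cc where "cc s j = l2_inner M (\<eta> s) (\<xi> j)" for s j
  have lam_pos: "lam j > 0" if "j \<in> {1..p}" for j by (rule lam_pos[OF pop that])
  have lam_dec: "lam j < lam i" if "i \<in> {1..p}" "j \<in> {1..p}" "i < j" for i j
    using eigen that unfolding simple_eigensystem_def by blast
  have \<xi>orth: "l2_inner M (\<xi> i) (\<xi> j) = (if i = j then 1 else 0)" if "i \<in> {1..p}" "j \<in> {1..p}" for i j
    by (rule xi_orthonormal[OF pop that])
  have cc_orth: "(\<Sum>s\<in>{1..S}. q s * cc s i * cc s j) = (if i = j then lam i else 0)" if "i \<in> {1..p}" "j \<in> {1..p}" for i j
    using eigen_relation(1)[OF pop that(1) \<xi>_in[OF that(2)]] \<xi>orth[OF that] by (cases "i = j") (simp_all add: cc_def)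
  have G: "l2_inner M (\<eta> s) (\<eta> r) = (\<Sum>j\<in>{1..p}. cc s j * cc r j)" if "s \<in> {1..S}" "r \<in> {1..S}" for s r
    unfolding cc_def by (rule eta_gram_in_eigenspaces[OF pop that])
  have expansion: "l2_norm M (\<lambda>w. \<xi> j w - (\<Sum>s\<in>{1..S}. (q s * cc s j / lam j) * \<eta> s w)) = 0" if j: "j \<in> {1..p}" for j
  proof -
    have "(\<lambda>w. lam j * \<xi> j w - (\<Sum>s\<in>{1..S}. (q s * cc s j) * \<eta> s w)) = (\<lambda>w. lam j * (\<xi> j w - (\<Sum>s\<in>{1..S}. (q s * cc s j / lam j) * \<eta> s w)))"
      using lam_pos[OF j] by (intro ext) (simp add: right_diff_distrib sum_distrib_left)
    then have "\<bar>lam j\<bar> * l2_norm M (\<lambda>w. \<xi> j w - (\<Sum>s\<in>{1..S}. (q s * cc s j / lam j) * \<eta> s w)) = 0"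
      using eigen_relation(2)[OF pop j \<xi>_in[OF j]] unfolding cc_def by (simp add: l2_norm_scale)
    then show ?thesis using lam_pos[OF j] by simp
  qed
  have "\<exists>u. spec m (ent (?R m)) (eigval (?R m)) u" for m
  proof -
    have "ent (?R m) a b = ent (?R m) b a" if "a < m" "b < m" for a b
      using that by (simp add: ent_kernel_mat gram_def R_eq cov_fun_def mult.commute)
    then obtain l u where "spec m (ent (?R m)) l u" using spectral_theorem[of m "ent (?R m)"] by metis
    then show ?thesis using spec_eigval[OF kernel_mat_carrier] by blast
  qed
  then obtain u where u_ent: "\<And>m. spec m (ent (?R m)) (eigval (?R m)) (u m)" by metis
  define l where "l m = eigval (?R m)" for m
  have A: "spec m ?A (l m) (u m)" for m
    using u_ent[of m] unfolding l_def spec_kernel_mat R_eq .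
  define C2 where "C2 = (\<Sum>s\<in>{1..S}. l2_norm M (\<eta> s))"
  have \<eta>C: "l2_norm M (\<eta> s) \<le> C2" if "s \<in> {1..S}" for s
    unfolding C2_def using that by (intro member_le_sum) auto
  have C20: "C2 \<ge> 0" unfolding C2_def by (intro sum_nonneg) simp
  \<comment> \<open>The element 1 covers the case of no slices.\<close>
  define q0 where "q0 = Min (insert 1 (q ` {1..S}))"
  have q0: "q0 > 0" "\<And>s. s \<in> {1..S} \<Longrightarrow> q0 \<le> q s" using q_pos by (auto simp: q0_def intro: Min_le simp del: Min_insert)
  define C1 where "C1 = C2 * sqrt C"
  have C0: "C \<ge> 0" using order_trans[OF l2_inner_self_nonneg XC] .
  have C10: "C1 \<ge> 0" using C20 C0 by (simp add: C1_def)
  define hv where "hv s a = h s (\<tau> (Suc a))" for s a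
  have hv_nrm: "nrm n (hv s) \<le> C1 * sqrt n" if s: "s \<in> {1..S}" for n s
  proof (rule power2_le_imp_le)
    have "\<bar>hv s a\<bar> \<le> C1" for a
    proof -
      have "\<bar>hv s a\<bar> \<le> l2_norm M (\<eta> s) * l2_norm M (X (\<tau> (Suc a)))"
        unfolding hv_def \<eta>X[OF s, symmetric] by (rule l2_cauchy_schwarz[OF \<eta>L[OF s] X_L2])
      also have "\<dots> \<le> C2 * sqrt C"
        by (rule mult_mono[OF \<eta>C[OF s] _ C20]) (simp_all add: l2_norm_def XC)
      finally show ?thesis by (simp add: C1_def)
    qed
    then have "(\<Sum>a<n. \<bar>hv s a\<bar>\<^sup>2) \<le> (\<Sum>a<n. C1\<^sup>2)" by (intro sum_mono power_mono) auto
    moreover have "(nrm n (hv s))\<^sup>2 = (\<Sum>a<n. \<bar>hv s a\<bar>\<^sup>2)" unfolding nrm_sq dot_def by (simp add: power2_eq_square)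
    ultimately show "(nrm n (hv s))\<^sup>2 \<le> (C1 * sqrt n)\<^sup>2" by (simp add: power_mult_distrib mult.commute)
  qed (use C10 in simp)
  have hv_rep: "hv s = (\<lambda>a. l2_inner M (\<eta> s) (X (\<tau> (Suc a))))" if "s \<in> {1..S}" for s
    by (rule ext) (simp add: hv_def \<eta>X[OF that])
  \<comment> \<open>the trace condition bounds the part of the slice means that truncation removes\<close>
  have defect_small: "\<forall>\<^sub>F i in sequentially. \<forall>\<^sub>F n in sequentially. kk i \<le> J n \<longrightarrow>
      (\<forall>u s. spec (J n) ?A (l (J n)) u \<longrightarrow> s \<in> {1..S} \<longrightarrow> defect (J n) (kk i) (l (J n)) u (hv s) \<le> \<rho>)" if \<rho>: "\<rho> > 0" for \<rho>
  proof -
    have ne: "top_projs (?R m) k \<noteq> {}" if "k \<le> m" for m k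
      using proj_mat_top_projs[OF kernel_mat_carrier u_ent that] by blast
    have "q0 * \<rho> > 0" using q0 \<rho> by simp
    have "\<forall>\<^sub>F i in sequentially. \<forall>\<^sub>F n in sequentially. kk i \<le> J n \<longrightarrow> (\<forall>Q\<in>top_projs (?R (J n)) (kk i).
        mat_trace ((pinv (?R (J n)) - pinv (Q * ?R (J n) * Q)) * kernel_mat K \<tau> (J n)) < q0 * \<rho>)"
      by (rule uniform_trace_condition[where R = ?R and T = "\<lambda>m Q. mat_trace ((pinv (?R m) - pinv (Q * ?R m * Q)) * kernel_mat K \<tau> m)",
          OF trace_lim ne J_lim kk_lim \<open>q0 * \<rho> > 0\<close>])
    then show ?thesis
    proof eventually_elim
      case (elim i)
      then show ?case
      proof eventually_elim
        case (elim n)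
        show ?case
        proof (intro impI allI)
          fix u s assume k: "kk i \<le> J n" and u: "spec (J n) ?A (l (J n)) u" and s: "s \<in> {1..S}"
          have ue: "spec (J n) (ent (?R (J n))) (l (J n)) u" using u unfolding spec_kernel_mat R_eq .
          have l0: "l (J n) j \<ge> 0" if "j \<in> {1..J n}" for j
            by (rule eigvals_nonneg[OF u _ that]) (simp add: gram_quad[OF X_L2])
          have Kq: "q s * (dot (J n) (hv s) b)\<^sup>2 \<le> dot (J n) b (mv (J n) (ent (kernel_mat K \<tau> (J n))) b)" for b
          proof -
            have "q s * (dot (J n) (hv s) b)\<^sup>2 \<le> dot (J n) b (mv (J n) (gram (cov_fun M Z) \<tau>) b)"
              unfolding hv_def
              by (rule slice_mean_le_conditional_covariance[OF prob_M X_L2 Y_meas Z_cond_exp I_sets[OF s] q_eq[OF s] q_pos[OF s]])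
                (simp add: slice(3)[OF s s s] h_eq[OF s])
            also have "\<dots> = dot (J n) b (mv (J n) (ent (kernel_mat K \<tau> (J n))) b)"
              by (intro dot_cong mv_cong refl) (simp_all add: ent_kernel_mat K_eq)
            finally show ?thesis .
          qed
          have "q s * defect (J n) (kk i) (l (J n)) u (hv s) \<le>
              mat_trace ((pinv (?R (J n)) - pinv (proj_mat (J n) u (kk i) * ?R (J n) * proj_mat (J n) u (kk i))) * kernel_mat K \<tau> (J n))"
            unfolding defect_def by (rule trace_lower_bound[OF kernel_mat_carrier ue l0 k kernel_mat_carrier Kq q_pos[OF s]])
          also have "\<dots> < q0 * \<rho>" using elim k proj_mat_top_projs[OF kernel_mat_carrier ue k] by blast
          also have "\<dots> \<le> q s * \<rho>" using q0(2)[OF s] \<rho> by (intro mult_right_mono) auto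
          finally show "defect (J n) (kk i) (l (J n)) u (hv s) \<le> \<rho>" using q_pos[OF s] by simp
        qed
      qed
    qed
  qed
  have kJ: "\<forall>\<^sub>F n in sequentially. kk i \<le> J n" for i
    using eventually_towards_le[OF J_lim kk_le[of i]] by (auto elim: eventually_mono)
  have pJ: "\<forall>\<^sub>F n in sequentially. p \<le> J n"
  proof (cases Jinf)
    case infinity
    then have "filterlim J at_top sequentially" using J_lim by (simp add: towards_def)
    then show ?thesis by (simp add: filterlim_at_top)
  next
    case (enat m)
    have "p \<le> m" by (rule number_of_components_le[OF X_L2 HR' Psi \<xi>_in \<xi>orth J_finite[OF enat]])
    moreover have "\<forall>\<^sub>F n in sequentially. J n = m" using J_lim enat by (simp add: towards_def filterlim_principal)
    ultimately show ?thesis by (auto elim: eventually_mono)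
  qed
  show ?thesis
  proof (intro ballI)
    fix j assume j: "j \<in> {1..p}"
    show "iterated_tendsto_prob D (\<lambda>n l \<omega>. l2_norm M (\<lambda>w. \<xi>hat n (kk l) j \<omega> w - \<xi> j w))"
      unfolding iterated_tendsto_prob_def
    proof (intro allI impI)
      fix \<epsilon> :: real assume \<epsilon>: "\<epsilon> > 0"
      show "(\<lambda>i. limsup (\<lambda>n. ereal (measure D {\<omega>\<in>space D. \<bar>l2_norm M (\<lambda>w. \<xi>hat n (kk i) j \<omega> w - \<xi> j w)\<bar> > \<epsilon>}))) \<longlonglongrightarrow> 0"
      proof (rule eigenvector_perturbation[where q = q and lam = lam and cc = cc and \<eta> = \<eta> and \<xi> = "\<xi> j" and M = M and S = S and p = p and j = j and \<epsilon> = \<epsilon>,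
            OF q_pos lam_pos lam_dec cc_orth G j \<eta>L closed_span_L2[OF \<xi>_in[OF j]] xi_unit[OF pop j] expansion[OF j] \<epsilon>])
        fix \<zeta> :: real assume \<zeta>: "\<zeta> > 0" and pert:
          "\<And>d w ph Mh l u v P xhat. spec d Mh l u \<Longrightarrow>
          (\<And>a b. a < d \<Longrightarrow> b < d \<Longrightarrow> Mh a b = (\<Sum>s\<in>{1..S}. ph s * w s a * w s b)) \<Longrightarrow> j \<le> d \<Longrightarrow>
          (\<And>s. s \<in> {1..S} \<Longrightarrow> ph s \<ge> 0) \<Longrightarrow> (\<And>s. s \<in> {1..S} \<Longrightarrow> \<bar>ph s - q s\<bar> \<le> \<zeta>) \<Longrightarrow>
          (\<And>s r. s \<in> {1..S} \<Longrightarrow> r \<in> {1..S} \<Longrightarrow> \<bar>dot d (w s) (w r) - l2_inner M (\<eta> s) (\<eta> r)\<bar> \<le> \<zeta>) \<Longrightarrow>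
          (\<And>a. a < d \<Longrightarrow> mv d Mh v a = l j * v a) \<Longrightarrow> dot d v v = 1 \<Longrightarrow>
          (\<And>s. s \<in> {1..S} \<Longrightarrow> P s \<in> L2 M) \<Longrightarrow> (\<And>s. s \<in> {1..S} \<Longrightarrow> l2_norm M (\<lambda>w. P s w - \<eta> s w) \<le> \<zeta>) \<Longrightarrow>
          (l j \<noteq> 0 \<Longrightarrow> xhat = (\<lambda>x. \<Sum>s\<in>{1..S}. (ph s * dot d (w s) v / l j) * P s x)) \<Longrightarrow>
          l2_inner M xhat (\<xi> j) \<ge> 0 \<Longrightarrow> l2_norm M (\<lambda>x. xhat x - \<xi> j x) \<le> \<epsilon>"
        \<comment> \<open>a tolerance for truncation, small enough for the perturbation bound\<close>
        have "((\<lambda>\<rho>. sqrt (33 * \<rho>) + sqrt (2 * \<rho>)) \<longlongrightarrow> sqrt (33 * 0) + sqrt (2 * 0)) (at_right 0)" by (intro tendsto_intros)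
        then have 1: "\<forall>\<^sub>F \<rho> in at_right 0. sqrt (33 * \<rho>) + sqrt (2 * \<rho>) < \<zeta>" using \<zeta> by (intro order_tendstoD(2)) auto
        have "((\<lambda>\<rho>. 5 * \<rho> + sqrt (2 * \<rho>) * (2 * C2 + sqrt (2 * \<rho>))) \<longlongrightarrow> 5 * 0 + sqrt (2 * 0) * (2 * C2 + sqrt (2 * 0))) (at_right 0)"
          by (intro tendsto_intros)
        then have 2: "\<forall>\<^sub>F \<rho> in at_right 0. 5 * \<rho> + sqrt (2 * \<rho>) * (2 * C2 + sqrt (2 * \<rho>)) < \<zeta>" using \<zeta> by (intro order_tendstoD(2)) auto
        have 3: "\<forall>\<^sub>F \<rho>::real in at_right 0. 0 < \<rho>" by (rule eventually_at_right_less)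
        have "\<forall>\<^sub>F \<rho> in at_right 0. sqrt (33 * \<rho>) + sqrt (2 * \<rho>) < \<zeta> \<and> 5 * \<rho> + sqrt (2 * \<rho>) * (2 * C2 + sqrt (2 * \<rho>)) < \<zeta> \<and> 0 < \<rho>"
          using 1 2 3 by eventually_elim simp
        then have "\<exists>\<rho>. sqrt (33 * \<rho>) + sqrt (2 * \<rho>) < \<zeta> \<and> 5 * \<rho> + sqrt (2 * \<rho>) * (2 * C2 + sqrt (2 * \<rho>)) < \<zeta> \<and> 0 < \<rho>"
          by (rule eventually_happens'[OF trivial_limit_at_right_real])
        then obtain \<rho> where \<rho>: "sqrt (33 * \<rho>) + sqrt (2 * \<rho>) < \<zeta>" "5 * \<rho> + sqrt (2 * \<rho>) * (2 * C2 + sqrt (2 * \<rho>)) < \<zeta>" "0 < \<rho>"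
          by (elim exE conjE)
        have "\<forall>\<^sub>F i in sequentially. (\<lambda>n. measure D {\<omega>\<in>space D. \<bar>l2_norm M (\<lambda>w. \<xi>hat n (kk i) j \<omega> w - \<xi> j w)\<bar> > \<epsilon>}) \<longlonglongrightarrow> 0"
          using defect_small[OF \<rho>(3)]
        proof eventually_elim
          case (elim i)
          define k where "k = kk i"
          have def: "\<forall>\<^sub>F n in sequentially. \<forall>u s. spec (J n) ?A (l (J n)) u \<longrightarrow> s \<in> {1..S} \<longrightarrow>
              defect (J n) k (l (J n)) u ((\<lambda>s a. l2_inner M (\<eta> s) (X (\<tau> (Suc a)))) s) \<le> \<rho>"
            using elim kJ[of i] by eventually_elim (simp add: k_def hv_rep)
          have kpos: "k > 0" by (simp add: k_def kk_pos)
          \<comment> \<open>The truncation index \<open>k\<close> is fixed from here on; only \<open>n\<close> tends to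
            infinity.\<close>
          have gap_k: "Liminf (towards Jinf) (\<lambda>i. eigengap k (?R i) / ereal (real i)) > 0"
            by (rule gap) (simp add: k_def)
          obtain c :: real where c: "c > 0" and gapc: "\<forall>\<^sub>F n in sequentially. \<forall>j\<in>{1..J n}. l (J n) j \<noteq> l (J n) k \<longrightarrow>
              \<bar>l (J n) j - l (J n) k\<bar> \<ge> c * J n"
            by (rule eigengap_bound[where R = ?R and k = k, OF J_lim J_pos gap_k kernel_mat_carrier]) (rule that[unfolded l_def])
          have dens: "\<forall>\<^sub>F n in sequentially. \<exists>b. (l2_norm M (\<lambda>w. proc X \<tau> (J n) b w - \<eta> s w))\<^sup>2 < \<rho>" if s: "s \<in> {1..S}" for s
          proof -
            have "\<forall>\<^sub>F n in sequentially. \<exists>b. l2_norm M (\<lambda>w. proc X \<tau> (J n) b w - \<eta> s w) < sqrt \<rho>"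
              by (rule sampled_span_dense[OF X_L2 J_lim J_finite T_cover[unfolded R_eq] \<eta>c[OF s]]) (assumption | simp add: \<rho>(3))+
            then show ?thesis
            proof eventually_elim
              case (elim n)
              then obtain b where "l2_norm M (\<lambda>w. proc X \<tau> (J n) b w - \<eta> s w) < sqrt \<rho>" by blast
              then have "(l2_norm M (\<lambda>w. proc X \<tau> (J n) b w - \<eta> s w))\<^sup>2 < (sqrt \<rho>)\<^sup>2" by (intro power_strict_mono) auto
              then show ?case using \<rho>(3) by auto
            qed
          qed
          note Jk = eventually_towards_le[OF J_lim kk_le[of i], folded k_def]
          obtain t n0 where t: "t > 0" "t \<le> \<rho>" and trunc:
            "\<forall>\<^sub>F n in sequentially. k \<le> J n \<and> J n0 \<le> J n \<and> (\<forall>B l' v H. spec (J n) B l' v \<longrightarrow>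
               close_sample ?A (l (J n)) (u (J n)) (\<lambda>s a. l2_inner M (\<eta> s) (X (\<tau> (Suc a)))) S (J n0) (J n) t B H \<longrightarrow>
             (\<forall>s\<in>{1..S}. l2_norm M (\<lambda>w. proc X \<tau> (J n) (mv (J n) (comb (J n) (tinv k l') v) (H s)) w - \<eta> s w) \<le> sqrt (33 * \<rho>) + sqrt (2 * \<rho>) \<and>
               (\<forall>r\<in>{1..S}. \<bar>dot (J n) (H r) (mv (J n) (comb (J n) (tinv k l') v) (H s)) - l2_inner M (\<eta> r) (\<eta> s)\<bar>
                 \<le> 5 * \<rho> + sqrt (2 * \<rho>) * (2 * C2 + sqrt (2 * \<rho>)))))"
            by (rule fixed_truncation[where M = M and X = X and \<tau> = \<tau> and \<eta> = \<eta> and S = S and C = C and ?C2.0 = C2 and l = l and u = u and J = J and k = k and c = c and \<rho> = \<rho>,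
                OF X_L2 XC \<eta>L \<eta>C A J_mono J_pos kpos Jk c gapc \<rho>(3) def dens]) (assumption | rule that)+
          \<comment> \<open>the accuracy \<open>t1\<close> of slice sums and frequencies yields accuracy \<open>t\<close> of slice means\<close>
          define t1 where "t1 = min (min t \<zeta>) (min (q0 / 2) (t * q0 / (2 * (1 + C1))))"
          have t1: "t1 > 0" "t1 \<le> t" "t1 \<le> \<zeta>" "t1 \<le> q0 / 2" "2 / q0 * (1 + C1) * t1 \<le> t"
          proof -
            show "t1 > 0" using t \<zeta> q0 C10 by (simp add: t1_def)
            show "t1 \<le> t" "t1 \<le> \<zeta>" "t1 \<le> q0 / 2" unfolding t1_def by linarith+
            have "t1 \<le> t * q0 / (2 * (1 + C1))" by (auto simp: t1_def)
            then have "2 / q0 * (1 + C1) * t1 \<le> 2 / q0 * (1 + C1) * (t * q0 / (2 * (1 + C1)))"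
              using q0 C10 by (intro mult_left_mono) auto
            also have "\<dots> = t" using q0(1) C10 by (simp add: divide_simps)
            finally show "2 / q0 * (1 + C1) * t1 \<le> t" .
          qed
          have qh: "q s * h s t = (\<integral>w. X t w * indicator (I s) (Y w) \<partial>M)" if s: "s \<in> {1..S}" for s t
          proof -
            have "q s * h s t = l2_inner M (indicator (?E s)) (X t)"
              using slice(3)[OF s s s, of "X t"] h_eq[OF s, of t] q_pos[OF s] by (simp add: field_simps)
            also have "\<dots> = (\<integral>w. X t w * indicator (I s) (Y w) \<partial>M)"
              unfolding l2_inner_def by (rule Bochner_Integration.integral_cong) (auto simp: indicator_def)
            finally show ?thesis .
          qed
          obtain bad where bad: "\<And>n. n \<ge> 1 \<Longrightarrow> bad n \<in> sets D" "(\<lambda>n. measure D (bad n)) \<longlonglongrightarrow> 0" and good: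
            "\<And>n \<omega>. n \<ge> 1 \<Longrightarrow> \<omega> \<in> space D - bad n \<Longrightarrow>
            (\<Sum>a<J n. \<Sum>b<J n. ((\<Sum>i\<in>{1..n}. Xd i (\<tau> (Suc a)) \<omega> * Xd i (\<tau> (Suc b)) \<omega>) / real n - ?A a b)\<^sup>2) \<le> t1\<^sup>2 * J n \<and>
            (\<Sum>a<J n0. \<Sum>b<J n0. ((\<Sum>i\<in>{1..n}. Xd i (\<tau> (Suc a)) \<omega> * Xd i (\<tau> (Suc b)) \<omega>) / real n - ?A a b)\<^sup>2) \<le> t1\<^sup>2 \<and>
            (\<forall>j\<in>{1..J n}. l (J n) j = 0 \<longrightarrow> (\<forall>i\<in>{1..n}. (\<Sum>a<J n. u (J n) j a * Xd i (\<tau> (Suc a)) \<omega>) = 0)) \<and>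
            (\<forall>s\<in>{1..S}. (\<Sum>a<J n. ((\<Sum>i\<in>{1..n}. Xd i (\<tau> (Suc a)) \<omega> * indicator (I s) (Yd i \<omega>)) / real n - q s * h s (\<tau> (Suc a)))\<^sup>2) \<le> t1\<^sup>2 \<and>
              ((\<Sum>i\<in>{1..n}. indicator (I s) (Yd i \<omega>)) / real n - q s)\<^sup>2 * J n \<le> t1\<^sup>2)"
            by (rule good_events[where M = M and X = X and N = N and Y = Y and D = D and Yd = Yd and Xd = Xd and \<tau> = \<tau> and J = J and I = I
                  and l = l and u = u and q = q and h = h and t = t1 and S = S and ?m0.0 = "J n0" and ?C4.0 = C4,
                  OF prob_M X_L2 Y_meas prob_D data_indep data_distr X4 X4C I_sets q_eq qh J_pos J_small A t1(1)]) (assumption | rule that)+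
          have "\<forall>\<^sub>F n in sequentially. measure D {\<omega>\<in>space D. \<bar>l2_norm M (\<lambda>w. \<xi>hat n (kk i) j \<omega> w - \<xi> j w)\<bar> > \<epsilon>} \<le> measure D (bad n)"
            using trunc pJ eventually_ge_at_top[of 1]
          proof eventually_elim
            case (elim n)
            have kn: "k \<le> J n" and jn: "j \<le> J n" and n1: "n \<ge> 1" using elim j by auto
            show ?case
            proof (rule D.finite_measure_mono[OF _ bad(1)[OF n1]], rule subsetI, rule ccontr)
              fix \<omega> assume \<omega>bad: "\<omega> \<in> {\<omega>\<in>space D. \<bar>l2_norm M (\<lambda>w. \<xi>hat n (kk i) j \<omega> w - \<xi> j w)\<bar> > \<epsilon>}" and "\<omega> \<notin> bad n"
              then have \<omega>: "\<omega> \<in> space D" and \<omega>': "\<omega> \<in> space D - bad n" by auto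
              note gd = good[OF n1 \<omega>']
              let ?C = "samp_cov Xd \<tau> n (J n) \<omega>"
              let ?ph = "\<lambda>s. samp_p Yd n (I s) \<omega>" and ?Hv = "\<lambda>s. samp_h Yd Xd \<tau> n (J n) (I s) \<omega>"
              let ?H = "\<lambda>s a. ?Hv s $ a"
              let ?Q = "samp_isqrt Xd \<tau> n (J n) (Phat n k \<omega>) \<omega>"
              let ?M = "samp_M Yd Xd \<tau> I S n (J n) (Phat n k \<omega>) \<omega>"
              have Cc: "?C \<in> carrier_mat (J n) (J n)" by (simp add: samp_cov_def)
              have Ce: "ent ?C a b = (\<Sum>i\<in>{1..n}. Xd i (\<tau> (Suc a)) \<omega> * Xd i (\<tau> (Suc b)) \<omega>) / real n" if "a < J n" "b < J n" for a b
                using that by (simp add: ent_def samp_cov_def)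
              have Cmv: "mv (J n) (ent ?C) x a = (\<Sum>i\<in>{1..n}. Xd i (\<tau> (Suc a)) \<omega> * (\<Sum>b<J n. x b * Xd i (\<tau> (Suc b)) \<omega>)) / real n" if a: "a < J n" for x a
              proof -
                have "mv (J n) (ent ?C) x a = (\<Sum>b<J n. \<Sum>i\<in>{1..n}. Xd i (\<tau> (Suc a)) \<omega> * Xd i (\<tau> (Suc b)) \<omega> * x b) / real n"
                  unfolding mv_def sum_divide_distrib using a by (intro sum.cong refl) (simp add: Ce sum_distrib_right sum_divide_distrib)
                also have "(\<Sum>b<J n. \<Sum>i\<in>{1..n}. Xd i (\<tau> (Suc a)) \<omega> * Xd i (\<tau> (Suc b)) \<omega> * x b) =
                    (\<Sum>i\<in>{1..n}. \<Sum>b<J n. Xd i (\<tau> (Suc a)) \<omega> * Xd i (\<tau> (Suc b)) \<omega> * x b)" by (rule sum.swap)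
                finally show ?thesis by (simp add: sum_distrib_left mult_ac)
              qed
              have psd: "dot (J n) x (mv (J n) (ent ?C) x) \<ge> 0" for x
              proof -
                have "dot (J n) x (mv (J n) (ent ?C) x) = (\<Sum>a<J n. \<Sum>i\<in>{1..n}. (x a * Xd i (\<tau> (Suc a)) \<omega>) * (\<Sum>b<J n. x b * Xd i (\<tau> (Suc b)) \<omega>)) / real n"
                  unfolding dot_def sum_divide_distrib by (intro sum.cong refl) (simp add: Cmv sum_distrib_left mult_ac sum_divide_distrib)
                also have "(\<Sum>a<J n. \<Sum>i\<in>{1..n}. (x a * Xd i (\<tau> (Suc a)) \<omega>) * (\<Sum>b<J n. x b * Xd i (\<tau> (Suc b)) \<omega>)) =
                    (\<Sum>i\<in>{1..n}. \<Sum>a<J n. (x a * Xd i (\<tau> (Suc a)) \<omega>) * (\<Sum>b<J n. x b * Xd i (\<tau> (Suc b)) \<omega>))" by (rule sum.swap)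
                also have "\<dots> = (\<Sum>i\<in>{1..n}. (\<Sum>b<J n. x b * Xd i (\<tau> (Suc b)) \<omega>) * (\<Sum>b<J n. x b * Xd i (\<tau> (Suc b)) \<omega>))"
                  unfolding sum_distrib_right ..
                finally show ?thesis by (simp add: sum_nonneg)
              qed
              obtain l' v' w u' where B: "spec (J n) (ent ?C) l' v'"
                and Me: "\<And>a b. a < J n \<Longrightarrow> b < J n \<Longrightarrow> ent ?M a b = (\<Sum>s\<in>{1..S}. ?ph s * w s a * w s b)"
                and ww: "\<And>s r. dot (J n) (w s) (w r) = dot (J n) (?H s) (mv (J n) (comb (J n) (tinv k l') v') (?H r))"
                and Ms: "spec (J n) (ent ?M) (eigval ?M) u'" and Mc: "?M \<in> carrier_mat (J n) (J n)"
                and rep: "\<And>x \<mu>. x \<in> carrier_vec (J n) \<Longrightarrow> ?M *\<^sub>v x = \<mu> \<cdot>\<^sub>v x \<Longrightarrow> \<mu> \<noteq> 0 \<Longrightarrow>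
                  lin_comb X \<tau> (?Q *\<^sub>v x) = (\<lambda>z. \<Sum>s\<in>{1..S}. (?ph s * dot (J n) (w s) (\<lambda>a. x $ a) / \<mu>) *
                  proc X \<tau> (J n) (mv (J n) (comb (J n) (tinv k l') v') (?H s)) z)"
                by (rule estimator_representation[where X = X and \<tau> = \<tau> and C = ?C and n = "J n" and k = k and P = "Phat n k \<omega>" and S = S and ph = ?ph and Hv = ?Hv
                      and Sl = "samp_slice Yd Xd \<tau> I S n (J n) \<omega>" and Q = ?Q and Mm = ?M,
                      OF Cc psd Phat[OF kn \<omega>] kn samp_slice_def samp_isqrt_def samp_M_def]) (assumption | rule that)+
              have ph_err: "\<bar>?ph s - q s\<bar> * sqrt (J n) \<le> t1" if s: "s \<in> {1..S}" for s
              proof (rule power2_le_imp_le)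
                show "(\<bar>?ph s - q s\<bar> * sqrt (J n))\<^sup>2 \<le> t1\<^sup>2"
                  using gd s by (simp add: samp_p_def power_mult_distrib)
              qed (use t1 in simp)
              define m where "m s a = (\<Sum>i\<in>{1..n}. Xd i (\<tau> (Suc a)) \<omega> * indicator (I s) (Yd i \<omega>)) / real n" for s a
              have m_err: "nrm (J n) (\<lambda>a. m s a - q s * hv s a) \<le> t1" if s: "s \<in> {1..S}" for s
              proof (rule power2_le_imp_le)
                show "(nrm (J n) (\<lambda>a. m s a - q s * hv s a))\<^sup>2 \<le> t1\<^sup>2"
                  using gd s unfolding nrm_sq dot_def m_def hv_def by (simp add: power2_eq_square)
              qed (use t1 in simp)
              have H_eq: "?H s a = m s a / ?ph s" if "a < J n" for s a
                using that n1 by (simp add: samp_h_def m_def samp_p_def)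
              have J1: "1 \<le> J n" using J_pos[of n] by simp
              have H_err: "nrm (J n) (\<lambda>a. ?H s a - hv s a) \<le> t" and p_err: "\<bar>?ph s - q s\<bar> \<le> \<zeta>" if s: "s \<in> {1..S}" for s
              proof -
                note e = slice_mean_error[OF q0(1) q0(2)[OF s] ph_err[OF s] J1 t1(4) m_err[OF s] hv_nrm[OF s] C10]
                have "nrm (J n) (\<lambda>a. ?H s a - hv s a) = nrm (J n) (\<lambda>a. m s a / ?ph s - hv s a)" by (rule nrm_cong) (simp add: H_eq)
                then show "nrm (J n) (\<lambda>a. ?H s a - hv s a) \<le> t" using e(1) t1(5) by linarith
                show "\<bar>?ph s - q s\<bar> \<le> \<zeta>" using e(2) t1(3) by linarith
              qed
              have close: "close_sample ?A (l (J n)) (u (J n)) (\<lambda>s a. l2_inner M (\<eta> s) (X (\<tau> (Suc a)))) S (J n0) (J n) t (ent ?C) ?H"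
                unfolding close_sample_def
              proof (intro conjI ballI impI allI)
                have "(frob (J n) (\<lambda>a b. ent ?C a b - ?A a b))\<^sup>2 \<le> t1\<^sup>2 * J n"
                  unfolding frob_sq using gd by (simp add: Ce cong: sum.cong_simp)
                also have "\<dots> = (t1 * sqrt (J n))\<^sup>2" by (simp add: power_mult_distrib)
                finally have "frob (J n) (\<lambda>a b. ent ?C a b - ?A a b) \<le> t1 * sqrt (J n)"
                  by (rule power2_le_imp_le) (use t1 in simp)
                also have "\<dots> \<le> t * sqrt (J n)" using t1(2) by (intro mult_right_mono) auto
                finally show "frob (J n) (\<lambda>a b. ent ?C a b - ?A a b) \<le> t * sqrt (J n)" .
                have J0: "J n0 \<le> J n" using elim by blast
                have "(frob (J n0) (\<lambda>a b. ent ?C a b - ?A a b))\<^sup>2 \<le> t1\<^sup>2"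
                  unfolding frob_sq using gd J0 by (simp add: Ce cong: sum.cong_simp)
                then have "frob (J n0) (\<lambda>a b. ent ?C a b - ?A a b) \<le> t1" by (rule power2_le_imp_le) (use t1 in simp)
                then show "frob (J n0) (\<lambda>a b. ent ?C a b - ?A a b) \<le> t" using t1(2) by linarith
                show "mv (J n) (ent ?C) (u (J n) j) a = 0" if "j \<in> {1..J n}" "l (J n) j = 0" "a < J n" for j a
                  unfolding Cmv[OF that(3)] using gd that by simp
                show "nrm (J n) (\<lambda>a. ?H s a - l2_inner M (\<eta> s) (X (\<tau> (Suc a)))) \<le> t" if "s \<in> {1..S}" for s
                  using H_err[OF that] by (simp add: hv_rep[OF that])
              qed
              have est: "l2_norm M (\<lambda>w. proc X \<tau> (J n) (mv (J n) (comb (J n) (tinv k l') v') (?H s)) w - \<eta> s w) \<le> \<zeta>"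
                and gr: "r \<in> {1..S} \<Longrightarrow> \<bar>dot (J n) (w r) (w s) - l2_inner M (\<eta> r) (\<eta> s)\<bar> \<le> \<zeta>" if s: "s \<in> {1..S}" for s r
              proof -
                have tr: "l2_norm M (\<lambda>w. proc X \<tau> (J n) (mv (J n) (comb (J n) (tinv k l') v') (?H s)) w - \<eta> s w) \<le> sqrt (33 * \<rho>) + sqrt (2 * \<rho>) \<and>
                  (\<forall>r\<in>{1..S}. \<bar>dot (J n) (?H r) (mv (J n) (comb (J n) (tinv k l') v') (?H s)) - l2_inner M (\<eta> r) (\<eta> s)\<bar>
                    \<le> 5 * \<rho> + sqrt (2 * \<rho>) * (2 * C2 + sqrt (2 * \<rho>)))"
                  using elim(1) B close s by blast
                then show "l2_norm M (\<lambda>w. proc X \<tau> (J n) (mv (J n) (comb (J n) (tinv k l') v') (?H s)) w - \<eta> s w) \<le> \<zeta>" using \<rho>(1) by linarith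
                assume "r \<in> {1..S}"
                then show "\<bar>dot (J n) (w r) (w s) - l2_inner M (\<eta> r) (\<eta> s)\<bar> \<le> \<zeta>" using tr \<rho>(2) unfolding ww by force
              qed
              let ?v = "v n k j \<omega>"
              have ev: "eigenvector ?M ?v (eigval ?M j)" by (rule v_eigen[OF kn j jn \<omega>])
              then have vc: "?v \<in> carrier_vec (J n)" and Mv: "?M *\<^sub>v ?v = eigval ?M j \<cdot>\<^sub>v ?v"
                using Mc by (auto simp: eigenvector_def)
              have v1: "dot (J n) (\<lambda>a. ?v $ a) (\<lambda>a. ?v $ a) = 1"
                using v_unit[OF kn j jn \<omega>] vc by (simp add: scalar_prod_def dot_def atLeast0LessThan)
              have "l2_norm M (\<lambda>x. \<xi>hat n k j \<omega> x - \<xi> j x) \<le> \<epsilon>"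
              proof (rule pert[of "J n" "ent ?M" "eigval ?M" u' ?ph w "\<lambda>a. ?v $ a"
                    "\<lambda>s. proc X \<tau> (J n) (mv (J n) (comb (J n) (tinv k l') v') (?H s))", OF Ms Me jn])
                show "?ph s \<ge> 0" for s by (simp add: samp_p_def sum_nonneg)
                show "\<bar>?ph s - q s\<bar> \<le> \<zeta>" if "s \<in> {1..S}" for s by (rule p_err[OF that])
                show "\<bar>dot (J n) (w s) (w r) - l2_inner M (\<eta> s) (\<eta> r)\<bar> \<le> \<zeta>" if "s \<in> {1..S}" "r \<in> {1..S}" for s r
                  by (rule gr[OF that(2,1)])
                show "mv (J n) (ent ?M) (\<lambda>a. ?v $ a) a = eigval ?M j * ?v $ a" if "a < J n" for a
                  using mv_ent[OF Mc vc that] Mv vc that by simp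
                show "dot (J n) (\<lambda>a. ?v $ a) (\<lambda>a. ?v $ a) = 1" by (rule v1)
                show "proc X \<tau> (J n) (mv (J n) (comb (J n) (tinv k l') v') (?H s)) \<in> L2 M" for s by (rule proc_L2[OF X_L2])
                show "l2_norm M (\<lambda>w. proc X \<tau> (J n) (mv (J n) (comb (J n) (tinv k l') v') (?H s)) w - \<eta> s w) \<le> \<zeta>" if "s \<in> {1..S}" for s
                  by (rule est[OF that])
                show "\<xi>hat n k j \<omega> = (\<lambda>x. \<Sum>s\<in>{1..S}. (?ph s * dot (J n) (w s) (\<lambda>a. ?v $ a) / eigval ?M j) *
                    proc X \<tau> (J n) (mv (J n) (comb (J n) (tinv k l') v') (?H s)) x)" if "eigval ?M j \<noteq> 0"
                  unfolding \<xi>hat_eq by (rule rep[OF vc Mv that])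
                show "l2_inner M (\<xi>hat n k j \<omega>) (\<xi> j) \<ge> 0" by (rule v_sign[OF kn j jn \<omega>])
              qed
              then show False using \<omega>bad by (simp add: k_def)
            qed
          qed
          then have "\<forall>\<^sub>F n in sequentially. norm (measure D {\<omega>\<in>space D. \<bar>l2_norm M (\<lambda>w. \<xi>hat n (kk i) j \<omega> w - \<xi> j w)\<bar> > \<epsilon>}) \<le> measure D (bad n)"
            by simp
          then show ?case by (rule Lim_null_comparison[OF _ bad(2)])
        qed
        then have "\<forall>\<^sub>F i in sequentially. limsup (\<lambda>n. ereal (measure D {\<omega>\<in>space D. \<bar>l2_norm M (\<lambda>w. \<xi>hat n (kk i) j \<omega> w - \<xi> j w)\<bar> > \<epsilon>})) = 0"
        proof eventually_elim
          case (elim i)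
          then have "(\<lambda>n. ereal (measure D {\<omega>\<in>space D. \<bar>l2_norm M (\<lambda>w. \<xi>hat n (kk i) j \<omega> w - \<xi> j w)\<bar> > \<epsilon>})) \<longlonglongrightarrow> ereal 0"
            by simp
          from lim_imp_Limsup[OF sequentially_bot this] show ?case by (simp add: zero_ereal_def)
        qed
        then show "(\<lambda>i. limsup (\<lambda>n. ereal (measure D {\<omega>\<in>space D. \<bar>l2_norm M (\<lambda>w. \<xi>hat n (kk i) j \<omega> w - \<xi> j w)\<bar> > \<epsilon>}))) \<longlonglongrightarrow> 0"
          by (rule tendsto_eventually)
      qed
    qed
  qed
qed

end
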